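(* Let $d_1,d_2\ge1$ be integers, $R>0$, $K>0$, $\alpha\in(0,1]$, let $B_R\subset\mathbb{R}^{d_2}$ be the open ball of radius $R$ centred at the origin, and let $\psi=\psi(v)\in C^1_c(B_R)$. Assume that $h,g_0\in L^2(\mathbb{R}_t\times\mathbb{R}^{d_1}_x\times B_R)$ and $g_1\in L^2(\mathbb{R}_t\times\mathbb{R}^{d_1}_x\times B_R,\mathbb{R}^{d_2})$ satisfy $$\left(\partial_t+b(v)\cdot\nabla_x\right)h(t,x,v)={\rm div}_v\,g_1(t,x,v)+g_0(t,x,v)$$ in the sense of distributions, where $b=b(v)\in L^\infty\cap H^1(B_R,\mathbb{R}^{d_1})$ satisfies $$\forall\mu\in\mathbb{R},\ \forall\nu\in\mathbb{S}^{d_1-1},\ \forall\epsilon>0,\quad\big|\{v\in B_R:|\mu+b(v)\cdot\nu|\le\epsilon\}\big|\le K\epsilon^\alpha.$$ Then the average $$h_\psi(t,x):=\int_{B_R}h(t,x,v)\psi(v)\,dv$$ belongs to $H^{\varsigma}(\mathbb{R}_t\times\mathbb{R}^{d_1}_x)$ with $\varsigma:=\frac{\alpha}{4+\alpha}$, and $$\|h_\psi\|_{H^\varsigma}\le C_b\|\psi\|_{W^{1,\infty}}\left(\|h\|_{L^2}+\|g_1\|_{L^2}+\|g_0\|_{L^2}\right),$$ where $C_b>0$ depends only on $d_1,d_2,K,R,\|b\|_{L^\infty}$, and $\|Db\|_{L^2}$.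
   Context: Norms without indicated domain are over $(t,x,v)\in\mathbb{R}_t\times\mathbb{R}^{d_1}_x\times B_R$, or over $v\in B_R$ for functions of $v$ only; the $H^\varsigma$ norm of $h_\psi$ is over $\mathbb{R}_t\times\mathbb{R}^{d_1}_x$. $|\cdot|$ of a set is Lebesgue measure. *)

theory Defs
  imports "HOL-Probability.Essential_Supremum"
begin

definition L2_on :: "'a::euclidean_space set \<Rightarrow> ('a \<Rightarrow> 'b::euclidean_space) \<Rightarrow> bool" where
  "L2_on S f \<longleftrightarrow> f \<in> borel_measurable (lebesgue_on S) \<and>
     integrable (lebesgue_on S) (\<lambda>x. (norm (f x))\<^sup>2)"

definition L2_norm :: "'a::euclidean_space set \<Rightarrow> ('a \<Rightarrow> 'b::euclidean_space) \<Rightarrow> real" where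
  "L2_norm S f = sqrt (LINT x|lebesgue_on S. (norm (f x))\<^sup>2)"

definition Linf_on :: "'a::euclidean_space set \<Rightarrow> ('a \<Rightarrow> 'b::euclidean_space) \<Rightarrow> bool" where
  "Linf_on S f \<longleftrightarrow> f \<in> borel_measurable (lebesgue_on S) \<and>
     esssup (lebesgue_on S) (\<lambda>x. ennreal (norm (f x))) < \<infinity>"

definition Linf_norm :: "'a::euclidean_space set \<Rightarrow> ('a \<Rightarrow> 'b::euclidean_space) \<Rightarrow> real" where
  "Linf_norm S f = enn2real (esssup (lebesgue_on S) (\<lambda>x. ennreal (norm (f x))))"

text \<open>\<open>Ck k f\<close>: \<open>f\<close> is of class \<open>C\<^sup>k\<close> on the whole space. The frechet derivative in a direction
  \<open>u\<close> is the directional derivative in that direction; asking for all directions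
  amounts to asking for all partial derivatives.\<close>

primrec Ck :: "nat \<Rightarrow> ('a::euclidean_space \<Rightarrow> real) \<Rightarrow> bool" where
  "Ck 0 f \<longleftrightarrow> continuous_on UNIV f"
| "Ck (Suc k) f \<longleftrightarrow> (\<forall>x. f differentiable (at x)) \<and>
     (\<forall>u. Ck k (\<lambda>x. frechet_derivative f (at x) u))"

text \<open>A function in \<open>C\<^sup>k\<^sub>c(U)\<close>, \<open>U\<close> open, is represented by its extension by zero to the whole space.\<close>

definition Ck_c :: "nat \<Rightarrow> 'a::euclidean_space set \<Rightarrow> ('a \<Rightarrow> real) \<Rightarrow> bool" where
  "Ck_c k U f \<longleftrightarrow> Ck k f \<and> compact (closure {x. f x \<noteq> 0}) \<and> closure {x. f x \<noteq> 0} \<subseteq> U"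

definition test_function :: "'a::euclidean_space set \<Rightarrow> ('a \<Rightarrow> real) \<Rightarrow> bool" where
  "test_function U \<phi> \<longleftrightarrow> (\<forall>k. Ck_c k U \<phi>)"

definition grad :: "('a::euclidean_space \<Rightarrow> real) \<Rightarrow> 'a \<Rightarrow> 'a" where
  "grad f x = (\<Sum>i\<in>Basis. frechet_derivative f (at x) i *\<^sub>R i)"

text \<open>The \<open>W\<^sup>1\<^sup>,\<^sup>\<infinity>(U)\<close> norm of a \<open>C\<^sup>1\<close> function, whose weak gradient is the classical one.\<close>

definition W1inf_norm :: "'a::euclidean_space set \<Rightarrow> ('a \<Rightarrow> real) \<Rightarrow> real" where
  "W1inf_norm U f = Linf_norm U f + Linf_norm U (grad f)"

text \<open>\<open>f \<in> H\<^sup>1(U)\<close>, with weak Jacobian matrix \<open>Df \<in> L\<^sup>2(U)\<close>, where \<open>Df x $ i $ j\<close> is the weak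
  derivative of \<open>f $ i\<close> in direction \<open>axis j 1\<close>. The library norm on \<open>real^'m^'n\<close>,
  used in \<open>L2_norm U Df\<close>, is the Frobenius norm.\<close>

definition H1_with_jacobian ::
  "(real^'m) set \<Rightarrow> (real^'m \<Rightarrow> real^'n) \<Rightarrow> (real^'m \<Rightarrow> real^'m^'n) \<Rightarrow> bool" where
  "H1_with_jacobian U f Df \<longleftrightarrow> L2_on U f \<and> L2_on U Df \<and>
     (\<forall>\<phi>. test_function U \<phi> \<longrightarrow> (\<forall>i j.
        (LINT x|lebesgue_on U. f x $ i * frechet_derivative \<phi> (at x) (axis j 1)) =
        - (LINT x|lebesgue_on U. Df x $ i $ j * \<phi> x)))"

text \<open>Unitary normalisation of the Fourier integral.\<close>

definition fourier_integral :: "('a::euclidean_space \<Rightarrow> complex) \<Rightarrow> 'a \<Rightarrow> complex" where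
  "fourier_integral f \<xi> =
     of_real ((2 * pi) powr (- (real DIM('a) / 2))) * (LINT x|lebesgue. cis (- (x \<bullet> \<xi>)) * f x)"

text \<open>The Fourier--Plancherel transform of \<open>f \<in> L\<^sup>2\<close>: the \<open>L\<^sup>2\<close> limit of the Fourier integrals over
  balls of growing radius. It exists by Plancherel's theorem and is unique almost
  everywhere, so the choice made in \<open>fourier_L2\<close> is irrelevant below.\<close>

definition is_fourier_L2 ::
  "('a::euclidean_space \<Rightarrow> complex) \<Rightarrow> ('a \<Rightarrow> complex) \<Rightarrow> bool" where
  "is_fourier_L2 f F \<longleftrightarrow> L2_on UNIV F \<and>
     (\<lambda>n. \<integral>\<^sup>+\<xi>. ennreal ((norm (F \<xi> -
          fourier_integral (\<lambda>x. if norm x \<le> real n then f x else 0) \<xi>))\<^sup>2) \<partial>lebesgue)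
       \<longlonglongrightarrow> 0"

definition fourier_L2 :: "('a::euclidean_space \<Rightarrow> complex) \<Rightarrow> 'a \<Rightarrow> complex" where
  "fourier_L2 f = (SOME F. is_fourier_L2 f F)"

definition bessel_weighted :: "real \<Rightarrow> ('a::euclidean_space \<Rightarrow> real) \<Rightarrow> 'a \<Rightarrow> complex" where
  "bessel_weighted s f \<xi> =
     of_real ((1 + (norm \<xi>)\<^sup>2) powr (s / 2)) * fourier_L2 (\<lambda>x. complex_of_real (f x)) \<xi>"

text \<open>Because \<open>f\<close> is required to be in \<open>L\<^sup>2\<close>, this is the usual \<open>H\<^sup>s\<close> only for \<open>s \<ge> 0\<close>.\<close>

definition Hs :: "real \<Rightarrow> ('a::euclidean_space \<Rightarrow> real) \<Rightarrow> bool" where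
  "Hs s f \<longleftrightarrow> L2_on UNIV f \<and> L2_on UNIV (bessel_weighted s f)"

definition Hs_norm :: "real \<Rightarrow> ('a::euclidean_space \<Rightarrow> real) \<Rightarrow> real" where
  "Hs_norm s f = L2_norm UNIV (bessel_weighted s f)"

text \<open>Points of phase space are triples \<open>(t, x, v)\<close>.\<close>

definition phase_space :: "real \<Rightarrow> (real \<times> (real^'n) \<times> (real^'m)) set" where
  "phase_space R = UNIV \<times> UNIV \<times> ball 0 R"

text \<open>\<open>(\<partial>\<^sub>t + b(v) \<cdot> \<nabla>\<^sub>x) h = div\<^sub>v g1 + g0\<close> in the sense of distributions. At \<open>z = (t, x, v)\<close>, the frechet
  derivative of \<open>\<phi>\<close> in direction \<open>(1, b v, 0)\<close> is \<open>(\<partial>\<^sub>t + b(v) \<cdot> \<nabla>\<^sub>x) \<phi>\<close>, and in direction \<open>(0, 0, g1 z)\<close>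
  it is \<open>g1 z \<cdot> \<nabla>\<^sub>v \<phi>\<close>.\<close>

definition transport_equation ::
  "real \<Rightarrow> (real^'m \<Rightarrow> real^'n) \<Rightarrow> (real \<times> (real^'n) \<times> (real^'m) \<Rightarrow> real) \<Rightarrow>
   (real \<times> (real^'n) \<times> (real^'m) \<Rightarrow> real^'m) \<Rightarrow> (real \<times> (real^'n) \<times> (real^'m) \<Rightarrow> real) \<Rightarrow> bool" where
  "transport_equation R b h g1 g0 \<longleftrightarrow>
     (\<forall>\<phi>. test_function (phase_space R) \<phi> \<longrightarrow>
        - (LINT z|lebesgue_on (phase_space R).
             h z * frechet_derivative \<phi> (at z) (1, b (snd (snd z)), 0)) =
        - (LINT z|lebesgue_on (phase_space R). frechet_derivative \<phi> (at z) (0, 0, g1 z))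
        + (LINT z|lebesgue_on (phase_space R). g0 z * \<phi> z))"

definition velocity_average ::
  "real \<Rightarrow> (real \<times> (real^'n) \<times> (real^'m) \<Rightarrow> real) \<Rightarrow> (real^'m \<Rightarrow> real) \<Rightarrow> real \<times> (real^'n) \<Rightarrow> real" where
  "velocity_average R h \<psi> = (\<lambda>(t, x). LINT v|lebesgue_on (ball 0 R). h (t, x, v) * \<psi> v)"

definition nondegenerate :: "real \<Rightarrow> real \<Rightarrow> real \<Rightarrow> (real^'m \<Rightarrow> real^'n) \<Rightarrow> bool" where
  "nondegenerate R K \<alpha> b \<longleftrightarrow>
     (\<forall>\<mu>. \<forall>\<nu>\<in>sphere 0 1. \<forall>\<epsilon>>0.
        measure lebesgue {v \<in> ball 0 R. \<bar>\<mu> + b v \<bullet> \<nu>\<bar> \<le> \<epsilon>} \<le> K * \<epsilon> powr \<alpha>)"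

end

theory Submission
  imports Defs "HOL-Probability.Probability"
begin

text \<open>
  The proof is the Fourier proof of velocity averaging. Write \<open>z = (t, x)\<close>, \<open>\<zeta>\<close> for the dual
  frequency, \<open>c v = (1, b v)\<close> and \<open>s v = c v \<bullet> \<zeta>\<close>. After Fourier transformation in \<open>z\<close> the transport
  equation reads \<open>\<i> s H = E + div G\<close> in the velocity variable alone. Let \<open>\<delta> > 0\<close>. Where \<open>|s| \<le> \<delta>\<close> one
  uses that the set of such \<open>v\<close> is small, of measure at most a multiple of \<open>(\<delta> / |\<zeta>|)\<^sup>\<alpha>\<close> by
  nondegeneracy (\<open>direction_nondegenerate\<close>), so that this part of the average costs
  \<open>(\<delta> / |\<zeta>|)\<close> to the power \<open>\<alpha> / 2\<close>. Where \<open>|s| > \<delta>\<close> one divides the equation by \<open>s\<close> and integrates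
  by parts in \<open>v\<close>; the derivative may fall on \<open>1 / s\<close>, which produces \<open>|\<zeta>| |Db| / \<delta>\<^sup>2\<close> and is the worst
  term. Equating the two costs gives \<open>\<delta> = |\<zeta>|\<close> to the power \<open>(2 + \<alpha>) / (4 + \<alpha>)\<close> and the decay
  \<open>|\<zeta>|\<close> to the power \<open>- \<alpha> / (4 + \<alpha>)\<close> of the transformed average. This is done for a single frequency in
  \<open>averaging_data.average_le\<close> and \<open>kinetic.frequency_estimate\<close>.

  Two points need care. First, \<open>\<psi> / s\<close> is not a test function: \<open>1 / s\<close> is replaced by a smooth
  function of \<open>s\<close> that agrees with it for \<open>|s| \<ge> \<delta>\<close>, and both \<open>\<psi>\<close> and \<open>s\<close> are mollified. Since the aim
  is an inequality, the derivatives of the mollified functions are merely bounded uniformly, that of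
  \<open>s\<close> in the mean square by \<open>|\<zeta>| |Db|\<close>; the mollified \<open>s\<close> converges to \<open>s\<close> in the mean. Secondly, the data are only square integrable in \<open>z\<close>. Multiplying them by a smooth cutoff
  in \<open>z\<close> changes the right hand side of the equation by a bounded multiple of \<open>h\<close>, makes all Fourier
  integrals absolutely convergent, and lets one test the equation with exponentials; the bound is
  uniform in the cutoff and passes to the limit by Fatou's lemma (\<open>fourier_L2_weighted\<close>).

  The tool from Fourier analysis is Bessel's inequality (\<open>Bessel_inequality\<close>). It gives the existence of the transform of a square integrable function,
  and it turns the pointwise frequency estimate into one by the norms of \<open>h\<close>, \<open>g1\<close> and \<open>g0\<close>.
\<close>

section \<open>Smooth functions\<close>

lemma Ck_SucI:
  assumes "\<And>x. (f has_derivative D x) (at x)" and "\<And>u. Ck k (\<lambda>x. D x u)"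
  shows "Ck (Suc k) f"
proof -
  have "frechet_derivative f (at x) = D x" for x
    using assms(1) frechet_derivative_at by metis
  then show ?thesis unfolding Ck.simps(2) using assms by (auto simp: differentiable_def)
qed

declare Ck.simps(2) [simp del]

lemma Ck_Suc_derivative: "Ck (Suc k) f \<Longrightarrow> Ck k (\<lambda>x. frechet_derivative f (at x) u)"
  unfolding Ck.simps(2) by blast

lemma Ck_Suc_has_derivative:
  assumes "Ck (Suc k) f"
  shows "(f has_derivative frechet_derivative f (at x)) (at x)"
  using assms frechet_derivative_works unfolding Ck.simps(2) by blast

lemma Ck_Suc_imp_Ck: "Ck (Suc k) f \<Longrightarrow> Ck k f"
proof (induction k arbitrary: f)
  case 0
  then show ?case
    unfolding Ck.simps by (auto intro!: continuous_at_imp_continuous_on differentiable_imp_continuous_within)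
next
  case (Suc k)
  then show ?case using Ck.simps(2) by blast
qed

lemma Ck_const: "Ck k (\<lambda>x. a)"
proof (induction k arbitrary: a)
  case (Suc k)
  show ?case by (rule Ck_SucI[where D="\<lambda>x u. 0"]) (use Suc in auto)
qed auto

lemma Ck_add:
  assumes "Ck k f" "Ck k g" shows "Ck k (\<lambda>x. f x + g x)"
  using assms
proof (induction k arbitrary: f g)
  case 0
  then show ?case by (simp add: continuous_on_add)
next
  case (Suc k)
  show ?case
  proof (rule Ck_SucI)
    show "((\<lambda>x. f x + g x) has_derivative
        (\<lambda>u. frechet_derivative f (at x) u + frechet_derivative g (at x) u)) (at x)" for x
      by (intro has_derivative_add Ck_Suc_has_derivative[OF Suc.prems(1)]
          Ck_Suc_has_derivative[OF Suc.prems(2)])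
    show "Ck k (\<lambda>x. frechet_derivative f (at x) u + frechet_derivative g (at x) u)" for u
      by (rule Suc.IH) (use Suc.prems Ck_Suc_derivative in blast)+
  qed
qed

lemma Ck_mult:
  assumes "Ck k f" "Ck k g" shows "Ck k (\<lambda>x. f x * g x)"
  using assms
proof (induction k arbitrary: f g)
  case 0
  then show ?case by (simp add: continuous_on_mult)
next
  case (Suc k)
  show ?case
  proof (rule Ck_SucI)
    show "((\<lambda>x. f x * g x) has_derivative
        (\<lambda>u. f x * frechet_derivative g (at x) u + frechet_derivative f (at x) u * g x)) (at x)" for x
      by (intro has_derivative_mult Ck_Suc_has_derivative[OF Suc.prems(1)]
          Ck_Suc_has_derivative[OF Suc.prems(2)])
    show "Ck k (\<lambda>x. f x * frechet_derivative g (at x) u + frechet_derivative f (at x) u * g x)" for u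
    proof -
      have f': "Ck k (\<lambda>x. f x * frechet_derivative g (at x) u)"
        using Suc.IH[OF Ck_Suc_imp_Ck[OF Suc.prems(1)] Ck_Suc_derivative[OF Suc.prems(2)]] .
      have g': "Ck k (\<lambda>x. frechet_derivative f (at x) u * g x)"
        using Suc.IH[OF Ck_Suc_derivative[OF Suc.prems(1)] Ck_Suc_imp_Ck[OF Suc.prems(2)]] .
      show ?thesis using Ck_add[OF f' g'] .
    qed
  qed
qed

lemma Ck_compose_affine:
  assumes "Ck k f" and L: "bounded_linear L" shows "Ck k (\<lambda>x. f (a + L x))"
  using assms(1)
proof (induction k arbitrary: f)
  case 0
  have "continuous_on UNIV (\<lambda>x. a + L x)"
    by (intro continuous_on_add continuous_on_const bounded_linear.continuous_on[OF L continuous_on_id])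
  with 0 show ?case
    using continuous_on_compose2[of UNIV f UNIV "\<lambda>x. a + L x"] by simp
next
  case (Suc k)
  show ?case
  proof (rule Ck_SucI[where D="\<lambda>x u. frechet_derivative f (at (a + L x)) (L u)"])
    fix x
    have "((\<lambda>x. a + L x) has_derivative (\<lambda>u. 0 + L u)) (at x)"
      by (rule has_derivative_add[OF has_derivative_const bounded_linear_imp_has_derivative[OF L]])
    then show "((\<lambda>x. f (a + L x)) has_derivative (\<lambda>u. frechet_derivative f (at (a + L x)) (L u))) (at x)"
      using has_derivative_compose[OF _ Ck_Suc_has_derivative[OF Suc.prems]] by simp
    fix u show "Ck k (\<lambda>x. frechet_derivative f (at (a + L x)) (L u))"
      by (rule Suc.IH[OF Ck_Suc_derivative[OF Suc.prems]])
  qed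
qed

lemma Ck_compose_linear: "Ck k f \<Longrightarrow> bounded_linear L \<Longrightarrow> Ck k (\<lambda>x. f (L x))"
  using Ck_compose_affine[of k f L 0] by simp

lemma Ck_inner: "Ck k (\<lambda>x. x \<bullet> a)"
proof (cases k)
  case (Suc j)
  show ?thesis unfolding Suc
    by (rule Ck_SucI[where D="\<lambda>x u. u \<bullet> a"])
       (rule bounded_linear_imp_has_derivative[OF bounded_linear_inner_left], rule Ck_const)
qed (simp add: continuous_on_inner)

lemma Ck_sum:
  assumes "\<And>i. i \<in> I \<Longrightarrow> Ck k (f i)" shows "Ck k (\<lambda>x. \<Sum>i\<in>I. f i x)"
  using assms by (induction I rule: infinite_finite_induct) (auto intro: Ck_const Ck_add)

lemma Ck_norm_square: "Ck k (\<lambda>x. (norm x)\<^sup>2)"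
proof -
  have "Ck k (\<lambda>x::'a. \<Sum>i\<in>Basis. (x \<bullet> i) * (x \<bullet> i))"
    by (rule Ck_sum[OF Ck_mult[OF Ck_inner Ck_inner]])
  then show ?thesis
    by (simp add: euclidean_inner[symmetric] power2_norm_eq_inner)
qed

lemma Ck_compose_real:
  fixes f :: "real \<Rightarrow> real"
  assumes "Ck k f" "Ck k q" shows "Ck k (\<lambda>x. f (q x))"
  using assms
proof (induction k arbitrary: f)
  case 0
  then show ?case using continuous_on_compose2[of UNIV f UNIV q] by simp
next
  case (Suc k)
  let ?f' = "\<lambda>t. frechet_derivative f (at t) 1"
  have f': "(f has_derivative (\<lambda>u. u * ?f' t)) (at t)" for t
  proof -
    interpret bounded_linear "frechet_derivative f (at t)"
      using Ck_Suc_has_derivative[OF Suc.prems(1)] has_derivative_bounded_linear by blast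
    have "frechet_derivative f (at t) = (\<lambda>u. u * ?f' t)"
    proof
      fix u show "frechet_derivative f (at t) u = u * ?f' t"
        using scaleR[of u 1] by simp
    qed
    then show ?thesis using Ck_Suc_has_derivative[OF Suc.prems(1), of t] by simp
  qed
  show ?case
  proof (rule Ck_SucI[where D="\<lambda>x u. frechet_derivative q (at x) u * ?f' (q x)"])
    fix x show "((\<lambda>x. f (q x)) has_derivative (\<lambda>u. frechet_derivative q (at x) u * ?f' (q x))) (at x)"
      by (rule has_derivative_compose[OF Ck_Suc_has_derivative[OF Suc.prems(2)] f'])
    fix u show "Ck k (\<lambda>x. frechet_derivative q (at x) u * ?f' (q x))"
      by (rule Ck_mult[OF Ck_Suc_derivative[OF Suc.prems(2)]
            Suc.IH[OF Ck_Suc_derivative[OF Suc.prems(1)] Ck_Suc_imp_Ck[OF Suc.prems(2)]]])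
  qed
qed

lemma Ck_inverse:
  assumes "Ck k f" "\<And>x. f x \<noteq> 0" shows "Ck k (\<lambda>x. inverse (f x))"
  using assms(1)
proof (induction k)
  case 0
  then show ?case using assms(2) by (simp add: continuous_on_inverse)
next
  case (Suc k)
  have i: "Ck k (\<lambda>x. inverse (f x))" using Suc Ck_Suc_imp_Ck by blast
  show ?case
  proof (rule Ck_SucI[where D="\<lambda>x u. (-1) * (inverse (f x) * frechet_derivative f (at x) u * inverse (f x))"])
    fix x show "((\<lambda>x. inverse (f x)) has_derivative
        (\<lambda>u. (-1) * (inverse (f x) * frechet_derivative f (at x) u * inverse (f x)))) (at x)"
      using Deriv.has_derivative_inverse[OF assms(2) Ck_Suc_has_derivative[OF Suc.prems]] by simp
    fix u show "Ck k (\<lambda>x. (-1) * (inverse (f x) * frechet_derivative f (at x) u * inverse (f x)))"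
      by (rule Ck_mult[OF Ck_const Ck_mult[OF Ck_mult[OF i Ck_Suc_derivative[OF Suc.prems]] i]])
  qed
qed

text \<open>The induction on the order of differentiability has to cover the derivatives as well, hence a
  family that is closed under differentiation.\<close>

lemma Ck_real_family:
  fixes F :: "(real \<Rightarrow> real) set"
  assumes "\<And>f. f \<in> F \<Longrightarrow> \<exists>f'\<in>F. \<forall>x. (f has_real_derivative f' x) (at x)" and "f \<in> F"
  shows "Ck k f"
  using assms(2)
proof (induction k arbitrary: f)
  case 0
  then obtain f' where "\<And>x. (f has_real_derivative f' x) (at x)" using assms(1) by blast
  then have "\<forall>x\<in>UNIV. isCont f x" using DERIV_isCont by blast
  then show ?case by (simp add: continuous_at_imp_continuous_on)
next
  case (Suc k)
  obtain f' where f': "f' \<in> F" "\<And>x. (f has_real_derivative f' x) (at x)"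
    using assms(1) Suc.prems by blast
  show ?case
  proof (rule Ck_SucI)
    show "(f has_derivative (\<lambda>u. f' x * u)) (at x)" for x
      using f'(2)[of x] by (simp add: has_field_derivative_def)
    show "Ck k (\<lambda>x. f' x * u)" for u
      by (rule Ck_mult[OF Suc.IH[OF f'(1)] Ck_const])
  qed
qed

lemma Ck_cos: "Ck k (cos :: real \<Rightarrow> real)" and Ck_sin: "Ck k (sin :: real \<Rightarrow> real)"
proof -
  let ?F = "{cos, sin, \<lambda>x. - sin x, \<lambda>x. - cos x} :: (real \<Rightarrow> real) set"
  have "\<exists>f'\<in>?F. \<forall>x. (f has_real_derivative f' x) (at x)" if "f \<in> ?F" for f
    using that by (auto intro!: derivative_eq_intros)
  from Ck_real_family[of ?F, OF this] show "Ck k (cos :: real \<Rightarrow> real)" "Ck k (sin :: real \<Rightarrow> real)"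
    by auto
qed

text \<open>The standard smooth function that is flat at the origin; all cutoffs below are built from it.\<close>

definition flat_exp :: "real \<Rightarrow> real" where
  "flat_exp x = (if x > 0 then exp (- (1 / x)) else 0)"

lemma flat_exp_pos: "x > 0 \<Longrightarrow> flat_exp x > 0"
  and flat_exp_zero: "x \<le> 0 \<Longrightarrow> flat_exp x = 0"
  and flat_exp_nonneg: "flat_exp x \<ge> 0"
  by (auto simp: flat_exp_def)

lemma poly_times_exp_minus_tendsto_0:
  fixes p :: "real poly"
  shows "((\<lambda>x. poly p x * exp (- x)) \<longlongrightarrow> 0) at_top"
proof -
  have "((\<lambda>x. \<Sum>i\<le>degree p. coeff p i * (x ^ i / exp x)) \<longlongrightarrow> (\<Sum>i\<le>degree p. coeff p i * 0)) at_top"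
    by (intro tendsto_sum tendsto_mult tendsto_const tendsto_power_div_exp_0)
  moreover have "(\<Sum>i\<le>degree p. coeff p i * (x ^ i / exp x)) = poly p x * exp (- x)" for x
    by (simp add: poly_altdef exp_minus divide_inverse sum_distrib_right mult.assoc)
  ultimately show ?thesis by simp
qed

text \<open>On the positive axis every derivative is a polynomial in \<open>1 / x\<close> times \<open>exp (- 1 / x)\<close>, and
  the exponential beats the polynomial at the origin.\<close>

lemma Ck_flat_exp: "Ck k flat_exp"
proof -
  define P where "P p x = (if x > 0 then poly p (1 / x) * exp (- (1 / x)) else (0::real))"
    for p :: "real poly" and x
  have d: "(P p has_real_derivative P ([:0, 0, 1:] * (p - pderiv p)) x) (at x)" for p x
  proof -
    consider "x > 0" | "x < 0" | "x = 0" by linarith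
    then show ?thesis
    proof cases
      case 1
      have "((\<lambda>x. poly p (1 / x) * exp (- (1 / x))) has_real_derivative
              P ([:0, 0, 1:] * (p - pderiv p)) x) (at x)"
      proof -
        have "((\<lambda>x. poly p (1 / x)) has_real_derivative poly (pderiv p) (1 / x) * (- (1 / (x * x)))) (at x)"
          by (rule DERIV_chain2[OF poly_DERIV])
             (use 1 in \<open>auto intro!: derivative_eq_intros\<close>)
        moreover have "((\<lambda>x. exp (- (1 / x))) has_real_derivative exp (- (1 / x)) * (1 / (x * x))) (at x)"
          by (rule DERIV_chain2[OF DERIV_exp]) (use 1 in \<open>auto intro!: derivative_eq_intros\<close>)
        ultimately have "((\<lambda>x. poly p (1 / x) * exp (- (1 / x))) has_real_derivative
            poly (pderiv p) (1 / x) * (- (1 / (x * x))) * exp (- (1 / x))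
            + exp (- (1 / x)) * (1 / (x * x)) * poly p (1 / x)) (at x)"
          by (rule DERIV_mult)
        moreover have "poly (pderiv p) (1 / x) * (- (1 / (x * x))) * exp (- (1 / x))
            + exp (- (1 / x)) * (1 / (x * x)) * poly p (1 / x) = P ([:0, 0, 1:] * (p - pderiv p)) x"
          using 1 by (simp add: P_def algebra_simps)
        ultimately show ?thesis by simp
      qed
      then show ?thesis
        by (rule has_field_derivative_transform_within_open[of _ _ _ "{0<..}"])
           (use 1 in \<open>auto simp: P_def\<close>)
    next
      case 2
      have "((\<lambda>x. 0) has_real_derivative P ([:0, 0, 1:] * (p - pderiv p)) x) (at x)"
        unfolding P_def using 2 by auto
      then show ?thesis
        by (rule has_field_derivative_transform_within_open[of _ _ _ "{..<0}"])
           (use 2 in \<open>auto simp: P_def\<close>)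
    next
      case 3
      have "((\<lambda>h. P p h / h) \<longlongrightarrow> 0) (at_right 0)"
      proof -
        have "((\<lambda>h. poly ([:0, 1:] * p) (inverse h) * exp (- inverse h)) \<longlongrightarrow> 0) (at_right 0)"
          by (rule filterlim_compose[OF poly_times_exp_minus_tendsto_0 filterlim_inverse_at_top_right])
        then show ?thesis
          by (rule Lim_transform_eventually)
             (auto simp: eventually_at_filter P_def field_simps)
      qed
      moreover have "((\<lambda>h. P p h / h) \<longlongrightarrow> 0) (at_left 0)"
        by (rule Lim_transform_eventually[where f="\<lambda>_. 0"]) (auto simp: eventually_at_filter P_def)
      ultimately have "((\<lambda>h. P p h / h) \<longlongrightarrow> 0) (at 0)"
        by (simp add: filterlim_split_at)
      then show ?thesis using 3 by (auto simp: DERIV_def P_def)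
    qed
  qed
  have "P 1 = flat_exp" by (auto simp: P_def flat_exp_def fun_eq_iff)
  then show ?thesis
    using Ck_real_family[of "range P" "P 1" k] d by (metis rangeE rangeI)
qed

definition bump :: "real \<Rightarrow> 'a::euclidean_space \<Rightarrow> real" where
  "bump e x = flat_exp (1 - (norm x)\<^sup>2 / e\<^sup>2)"

lemma Ck_bump: "Ck k (bump e)"
proof -
  have "Ck k (\<lambda>x::'a. flat_exp (1 + (- (1 / e\<^sup>2)) * (norm x)\<^sup>2))"
    by (rule Ck_compose_real[OF Ck_flat_exp Ck_add[OF Ck_const Ck_mult[OF Ck_const Ck_norm_square]]])
  then show ?thesis by (simp add: bump_def[abs_def])
qed

lemma bump_nonneg: "bump e x \<ge> 0"
  by (simp add: bump_def flat_exp_nonneg)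

lemma bump_pos_iff: "e > 0 \<Longrightarrow> bump e x > 0 \<longleftrightarrow> norm x < e"
proof -
  assume e: "e > 0"
  have "bump e x > 0 \<longleftrightarrow> (norm x)\<^sup>2 / e\<^sup>2 < 1"
    unfolding bump_def flat_exp_def by auto
  also have "\<dots> \<longleftrightarrow> norm x < e"
    using e power_strict_mono[of "norm x" e 2] power2_less_imp_less[of "norm x" e]
    by (auto simp: divide_less_eq)
  finally show ?thesis .
qed

lemma bump_eq_0_iff: "e > 0 \<Longrightarrow> bump e x = 0 \<longleftrightarrow> e \<le> norm x"
  using bump_pos_iff[of e x] bump_nonneg[of e x] by linarith

text \<open>The function is required to vanish on an open set, so that its derivatives vanish there as well.\<close>

definition smooth_in_ball :: "real \<Rightarrow> ('a::euclidean_space \<Rightarrow> real) \<Rightarrow> bool" where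
  "smooth_in_ball r f \<longleftrightarrow> (\<forall>k. Ck k f) \<and> (\<forall>x. norm x > r \<longrightarrow> f x = 0)"

lemma smooth_in_ball_bump: "e > 0 \<Longrightarrow> smooth_in_ball e (bump e)"
  by (simp add: smooth_in_ball_def Ck_bump bump_eq_0_iff)

lemma smooth_in_ballD:
  assumes "smooth_in_ball r f" shows "Ck k f" "norm x > r \<Longrightarrow> f x = 0"
  using assms unfolding smooth_in_ball_def by simp_all

lemma smooth_in_ball_has_derivative:
  "smooth_in_ball r f \<Longrightarrow> (f has_derivative frechet_derivative f (at x)) (at x)"
  by (rule Ck_Suc_has_derivative[OF smooth_in_ballD(1)[of r f "Suc 0"]])

lemma smooth_in_ball_derivative:
  assumes "smooth_in_ball r f"
  shows "smooth_in_ball r (\<lambda>x. frechet_derivative f (at x) u)"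
  unfolding smooth_in_ball_def
proof (intro conjI allI impI)
  fix k show "Ck k (\<lambda>x. frechet_derivative f (at x) u)"
    by (rule Ck_Suc_derivative[OF smooth_in_ballD(1)[OF assms]])
next
  fix x :: 'a assume x: "norm x > r"
  have "open {x :: 'a. norm x > r}" by (intro open_Collect_less continuous_intros)
  then have "(f has_derivative (\<lambda>_. 0)) (at x)"
    by (rule has_derivative_transform_within_open[OF has_derivative_const[of 0]])
       (use x smooth_in_ballD(2)[OF assms] in simp_all)
  then show "frechet_derivative f (at x) u = 0"
    using frechet_derivative_at by metis
qed

lemma smooth_in_ball_mult:
  "smooth_in_ball r f \<Longrightarrow> (\<And>k. Ck k g) \<Longrightarrow> smooth_in_ball r (\<lambda>x. f x * g x)"
  by (simp add: smooth_in_ball_def Ck_mult)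

lemma smooth_in_ball_continuous: "smooth_in_ball r f \<Longrightarrow> continuous_on UNIV f"
  using smooth_in_ballD(1)[of r f 0] by simp

lemma smooth_in_ball_borel [measurable_dest]: "smooth_in_ball r f \<Longrightarrow> f \<in> borel_measurable borel"
  by (rule borel_measurable_continuous_onI[OF smooth_in_ball_continuous])

lemma smooth_derivative_sum:
  assumes "smooth_in_ball \<rho> \<phi>"
  shows "frechet_derivative \<phi> (at x) u = (\<Sum>i\<in>Basis. (u \<bullet> i) * frechet_derivative \<phi> (at x) i)"
proof -
  note lin = bounded_linear.linear[OF has_derivative_bounded_linear[OF smooth_in_ball_has_derivative[OF assms, of x]]]
  show ?thesis
    by (subst euclidean_representation[of u, symmetric])
       (simp add: linear_sum[OF lin] linear_cmul[OF lin] del: euclidean_representation)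
qed

lemma smooth_derivative_borel:
  assumes \<phi>: "smooth_in_ball \<rho> \<phi>" and a: "a \<in> borel_measurable M" and u: "u \<in> borel_measurable M"
  shows "(\<lambda>p. frechet_derivative \<phi> (at (a p)) (u p)) \<in> borel_measurable M"
proof -
  have "(\<lambda>p. \<Sum>i\<in>Basis. (u p \<bullet> i) * frechet_derivative \<phi> (at (a p)) i) \<in> borel_measurable M"
    by (intro borel_measurable_sum borel_measurable_times borel_measurable_inner u borel_measurable_const
        measurable_compose[OF a smooth_in_ball_borel[OF smooth_in_ball_derivative[OF \<phi>]]])
  moreover have "(\<lambda>p. frechet_derivative \<phi> (at (a p)) (u p))
      = (\<lambda>p. \<Sum>i\<in>Basis. (u p \<bullet> i) * frechet_derivative \<phi> (at (a p)) i)"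
    by (rule ext) (rule smooth_derivative_sum[OF \<phi>])
  ultimately show ?thesis by (simp only:)
qed

lemma smooth_in_ball_bounded:
  assumes "smooth_in_ball r f" obtains C where "C \<ge> 0" "\<And>x. \<bar>f x\<bar> \<le> C"
proof -
  have "compact (f ` cball 0 r)"
    by (rule compact_continuous_image[OF continuous_on_subset[OF smooth_in_ball_continuous[OF assms]]]) auto
  then have "bounded (f ` cball 0 r)" by (rule compact_imp_bounded)
  then obtain C where C: "\<And>x. x \<in> cball 0 r \<Longrightarrow> \<bar>f x\<bar> \<le> C"
    unfolding bounded_iff by (auto simp del: mem_cball mem_cball_0)
  show thesis
  proof (rule that[of "max C 0"])
    fix x show "\<bar>f x\<bar> \<le> max C 0"
      using C[of x] smooth_in_ballD(2)[OF assms, of x] by (cases "norm x \<le> r") auto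
  qed simp
qed

lemma smooth_in_ball_test_function:
  assumes "smooth_in_ball r f" "cball 0 r \<subseteq> U" shows "test_function U f"
proof -
  have "{x. f x \<noteq> 0} \<subseteq> cball 0 r" using smooth_in_ballD(2)[OF assms(1)] by (auto simp: not_less[symmetric])
  then have cl: "closure {x. f x \<noteq> 0} \<subseteq> cball 0 r" and "bounded {x. f x \<noteq> 0}"
    using bounded_subset[OF bounded_cball] by (simp_all add: closure_minimal)
  then have "compact (closure {x. f x \<noteq> 0})" by (simp add: compact_closure)
  then show ?thesis
    using smooth_in_ballD(1)[OF assms(1)] subset_trans[OF cl assms(2)]
    unfolding test_function_def Ck_c_def by simp
qed

lemma test_function_smooth_in_ball:
  fixes f :: "'a::euclidean_space \<Rightarrow> real"
  assumes "test_function U f" obtains r where "smooth_in_ball r f"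
proof -
  have "bounded (closure {x. f x \<noteq> 0})"
    using assms by (auto simp: test_function_def Ck_c_def compact_imp_bounded)
  then obtain r where r: "\<forall>x\<in>closure {x. f x \<noteq> 0}. norm x \<le> r"
    unfolding bounded_iff by blast
  have "f x = 0" if "norm x > r" for x
    using r that closure_subset[of "{x. f x \<noteq> 0}"] by force
  moreover have "Ck k f" for k
    using assms unfolding test_function_def Ck_c_def by simp
  ultimately show thesis
    by (intro that[of r]) (simp add: smooth_in_ball_def)
qed

section \<open>Mollification\<close>

lemma lborel_distr_reflect: "distr lborel borel (\<lambda>y. v - y) = (lborel :: 'a::euclidean_space measure)"
proof -
  have "(lborel :: 'a measure) = density (distr lborel borel (\<lambda>x. v + (-1) *\<^sub>R x)) (\<lambda>_. ennreal (\<bar>-1 :: real\<bar>^DIM('a)))"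
    by (rule lborel_affine) simp
  then show ?thesis by (simp add: density_1)
qed

lemma nn_integral_lborel_reflect:
  fixes v :: "'a::euclidean_space"
  assumes [measurable]: "f \<in> borel_measurable borel"
  shows "(\<integral>\<^sup>+y. f (v - y) \<partial>lborel) = (\<integral>\<^sup>+y. f y \<partial>lborel)"
  by (subst (2) lborel_distr_reflect[of v, symmetric]) (simp add: nn_integral_distr)

lemma nn_integral_lborel_shift:
  fixes v :: "'a::euclidean_space"
  assumes [measurable]: "f \<in> borel_measurable borel"
  shows "(\<integral>\<^sup>+y. f (y - v) \<partial>lborel) = (\<integral>\<^sup>+y. f y \<partial>lborel)"
  by (subst (2) lborel_distr_plus[of "- v", symmetric]) (simp add: nn_integral_distr)

lemma integral_lborel_reflect:
  fixes v :: "'a::euclidean_space" and f :: "'a \<Rightarrow> real"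
  assumes [measurable]: "f \<in> borel_measurable borel"
  shows "(\<integral>y. f (v - y) \<partial>lborel) = (\<integral>y. f y \<partial>lborel)"
  by (subst (2) lborel_distr_reflect[of v, symmetric]) (simp add: integral_distr)

lemma integrable_lborel_reflect:
  fixes v :: "'a::euclidean_space" and f :: "'a \<Rightarrow> real"
  assumes "integrable lborel f"
  shows "integrable lborel (\<lambda>y. f (v - y))"
proof -
  have [measurable]: "f \<in> borel_measurable borel" using assms by simp
  have "integrable (distr lborel borel (\<lambda>y. v - y)) f"
    using assms by (simp add: lborel_distr_reflect)
  then show ?thesis by (simp add: integrable_distr_eq)
qed

lemma integrable_bounded_support:
  fixes f :: "'a::euclidean_space \<Rightarrow> real"
  assumes [measurable]: "f \<in> borel_measurable borel"
    and "\<And>x. \<bar>f x\<bar> \<le> C" and "\<And>x. norm x > r \<Longrightarrow> f x = 0"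
  shows "integrable lborel f"
proof (rule Bochner_Integration.integrable_bound)
  show "integrable lborel (\<lambda>x. C * indicator (cball 0 r :: 'a set) x :: real)"
    by (intro integrable_mult_right integrable_real_indicator emeasure_lborel_cball_finite) simp
  show "AE x in lborel. norm (f x) \<le> norm (C * indicator (cball 0 r :: 'a set) x :: real)"
  proof (intro AE_I2)
    fix x show "norm (f x) \<le> norm (C * indicator (cball 0 r :: 'a set) x :: real)"
      using assms(2)[of x] assms(3)[of x] by (cases "norm x \<le> r") auto
  qed
qed simp

lemma smooth_in_ball_integrable:
  assumes "smooth_in_ball r f" shows "integrable lborel f"
proof -
  obtain C where "\<And>x. \<bar>f x\<bar> \<le> C" using smooth_in_ball_bounded[OF assms] by blast
  then show ?thesis
    by (rule integrable_bounded_support[OF smooth_in_ball_borel[OF assms] _ smooth_in_ballD(2)[OF assms]])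
qed

lemma linear_functional_bound:
  fixes L :: "'a::euclidean_space \<Rightarrow> real"
  assumes "bounded_linear L" and "\<And>i. i \<in> Basis \<Longrightarrow> \<bar>L i\<bar> \<le> B i"
  shows "\<bar>L u\<bar> \<le> (\<Sum>i\<in>Basis. B i) * norm u"
proof -
  interpret bounded_linear L by fact
  have "L u = (\<Sum>i\<in>Basis. (u \<bullet> i) * L i)"
    by (subst euclidean_representation[of u, symmetric]) (simp add: sum scaleR)
  also have "\<bar>\<dots>\<bar> \<le> (\<Sum>i\<in>Basis. B i * norm u)"
  proof (rule order_trans[OF sum_abs sum_mono])
    fix i :: 'a assume i: "i \<in> Basis"
    have "\<bar>u \<bullet> i\<bar> * \<bar>L i\<bar> \<le> norm u * B i"
      by (rule mult_mono[OF Basis_le_norm[OF i] assms(2)[OF i]]) auto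
    then show "\<bar>u \<bullet> i * L i\<bar> \<le> B i * norm u" by (simp add: abs_mult mult.commute)
  qed
  finally show ?thesis by (simp add: sum_distrib_right)
qed

lemma smooth_in_ball_Lipschitz:
  assumes "smooth_in_ball r f"
  obtains L where "L \<ge> 0" "\<And>x y. \<bar>f x - f y\<bar> \<le> L * norm (x - y)"
    "\<And>x u. \<bar>frechet_derivative f (at x) u\<bar> \<le> L * norm u"
proof -
  have "\<forall>i. \<exists>B\<ge>0. \<forall>x. \<bar>frechet_derivative f (at x) i\<bar> \<le> B"
    using smooth_in_ball_bounded[OF smooth_in_ball_derivative[OF assms]] by metis
  then obtain B where B: "\<And>i. B i \<ge> 0" "\<And>i x. \<bar>frechet_derivative f (at x) i\<bar> \<le> B i"
    by metis
  define L where "L = (\<Sum>i\<in>Basis. B i)"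
  note der = smooth_in_ball_has_derivative[OF assms]
  have bd: "\<bar>frechet_derivative f (at x) u\<bar> \<le> L * norm u" for x u
    unfolding L_def by (rule linear_functional_bound[OF has_derivative_bounded_linear[OF der] B(2)])
  show thesis
  proof (rule that)
    show "L \<ge> 0" unfolding L_def by (rule sum_nonneg) (rule B(1))
    show "\<bar>frechet_derivative f (at x) u\<bar> \<le> L * norm u" for x u by (rule bd)
    show "\<bar>f x - f y\<bar> \<le> L * norm (x - y)" for x y
    proof -
      have "norm (f x - f y) \<le> L * norm (x - y)"
        by (rule differentiable_bound[OF convex_UNIV der])
           (auto intro!: onorm_le simp: bd)
      then show ?thesis by simp
    qed
  qed
qed

text \<open>The derivative is itself Lipschitz, so that the first order Taylor expansion is uniform in
  the base point; this is what allows one to differentiate a convolution under the integral.\<close>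

lemma smooth_in_ball_Taylor:
  assumes "smooth_in_ball r f"
  obtains M where "M \<ge> 0"
    "\<And>x u. \<bar>f (x + u) - f x - frechet_derivative f (at x) u\<bar> \<le> M * (norm u)\<^sup>2"
proof -
  let ?D = "\<lambda>x. frechet_derivative f (at x)"
  have "\<forall>i. \<exists>B\<ge>0. \<forall>x y. \<bar>?D x i - ?D y i\<bar> \<le> B * norm (x - y)"
    using smooth_in_ball_Lipschitz[OF smooth_in_ball_derivative[OF assms]] by metis
  then obtain B where B: "\<And>i. B i \<ge> 0" "\<And>i x y. \<bar>?D x i - ?D y i\<bar> \<le> B i * norm (x - y)"
    by metis
  define M where "M = (\<Sum>i\<in>Basis. B i)"
  have M: "M \<ge> 0" unfolding M_def by (rule sum_nonneg) (rule B(1))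
  note der = smooth_in_ball_has_derivative[OF assms]
  have bl: "bounded_linear (?D x)" for x by (rule has_derivative_bounded_linear[OF der])
  have bd: "\<bar>?D x u - ?D y u\<bar> \<le> M * norm (x - y) * norm u" for x y u
  proof -
    have "\<bar>(\<lambda>u. ?D x u - ?D y u) u\<bar> \<le> (\<Sum>i\<in>Basis. B i * norm (x - y)) * norm u"
      by (rule linear_functional_bound[OF bounded_linear_sub[OF bl bl] B(2)])
    then show ?thesis by (simp add: M_def sum_distrib_right)
  qed
  have "\<bar>f (x + u) - f x - ?D x u\<bar> \<le> M * (norm u)\<^sup>2" for x u
  proof -
    have "norm (f (x + u) - f x - ?D x (x + u - x)) \<le> norm (x + u - x) * (M * norm u)"
    proof (rule differentiable_bound_linearization[where S="cball x (norm u)"])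
      fix y assume y: "y \<in> cball x (norm u)"
      show "(f has_derivative ?D y) (at y within cball x (norm u))"
        by (rule has_derivative_at_withinI[OF der])
      show "onorm (?D y - ?D x) \<le> M * norm u"
      proof (rule onorm_le)
        fix w
        have "norm ((?D y - ?D x) w) \<le> M * norm (y - x) * norm w"
          using bd[of y w x] by simp
        also have "\<dots> \<le> M * norm u * norm w"
          using y M by (intro mult_right_mono mult_left_mono) (auto simp: dist_norm norm_minus_commute)
        finally show "norm ((?D y - ?D x) w) \<le> M * norm u * norm w" .
      qed
    next
      fix t :: real assume "t \<in> {0..1}"
      then have "\<bar>t\<bar> * norm u \<le> 1 * norm u" by (intro mult_right_mono) auto
      then show "x + t *\<^sub>R (x + u - x) \<in> cball x (norm u)" by (simp add: dist_norm)
    qed simp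
    then show ?thesis by (simp add: power2_eq_square algebra_simps)
  qed
  with M show thesis by (rule that)
qed

definition conv :: "('a::euclidean_space \<Rightarrow> real) \<Rightarrow> ('a \<Rightarrow> real) \<Rightarrow> 'a \<Rightarrow> real" where
  "conv \<rho> f v = (\<integral>y. \<rho> (v - y) * f y \<partial>lborel)"

lemma conv_integrable:
  fixes f :: "'a::euclidean_space \<Rightarrow> real"
  assumes \<rho>: "smooth_in_ball r \<rho>" and f: "integrable lborel f"
  shows "integrable lborel (\<lambda>y. \<rho> (v - y) * f y)"
proof -
  obtain C where C: "\<And>x. \<bar>\<rho> x\<bar> \<le> C" using smooth_in_ball_bounded[OF \<rho>] by blast
  have [measurable]: "f \<in> borel_measurable borel" "\<rho> \<in> borel_measurable borel"
    using f smooth_in_ball_borel[OF \<rho>] by auto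
  show ?thesis
  proof (rule Bochner_Integration.integrable_bound)
    show "integrable lborel (\<lambda>y. C * f y)" using f by simp
    have "\<bar>\<rho> (v - y)\<bar> * \<bar>f y\<bar> \<le> C * \<bar>f y\<bar>" for y using C by (rule mult_right_mono) simp
    moreover have "C \<ge> 0" using C[of 0] by linarith
    ultimately show "AE y in lborel. norm (\<rho> (v - y) * f y) \<le> norm (C * f y)"
      by (simp add: abs_mult)
  qed simp
qed

text \<open>The Taylor remainder under the integral is at most a constant times the square of the increment.\<close>

lemma conv_has_derivative:
  fixes f :: "'a::euclidean_space \<Rightarrow> real"
  assumes \<rho>: "smooth_in_ball r \<rho>" and f: "integrable lborel f"
  shows "(conv \<rho> f has_derivative (\<lambda>u. conv (\<lambda>x. frechet_derivative \<rho> (at x) u) f v)) (at v)"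
proof -
  let ?D = "\<lambda>x. frechet_derivative \<rho> (at x)"
  let ?I = "\<integral>y. \<bar>f y\<bar> \<partial>lborel"
  have [measurable]: "f \<in> borel_measurable borel" using f by simp
  note der = smooth_in_ball_has_derivative[OF \<rho>]
  have bl: "bounded_linear (?D x)" for x by (rule has_derivative_bounded_linear[OF der])
  have lin: "?D x (u + w) = ?D x u + ?D x w" "?D x (a *\<^sub>R u) = a * ?D x u" for x u w a
    using linear_add[OF bounded_linear.linear[OF bl]] linear_cmul[OF bounded_linear.linear[OF bl]]
    by auto
  have intD: "integrable lborel (\<lambda>y. ?D (v - y) u * f y)" for u
    by (rule conv_integrable[OF smooth_in_ball_derivative[OF \<rho>] f])
  obtain L where L: "L \<ge> 0" "\<And>x u. \<bar>?D x u\<bar> \<le> L * norm u"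
    using smooth_in_ball_Lipschitz[OF \<rho>] by metis
  obtain M where M: "M \<ge> 0" "\<And>x u. \<bar>\<rho> (x + u) - \<rho> x - ?D x u\<bar> \<le> M * (norm u)\<^sup>2"
    using smooth_in_ball_Taylor[OF \<rho>] by metis
  have "bounded_linear (\<lambda>u. conv (\<lambda>x. ?D x u) f v)"
  proof (rule bounded_linear_intro)
    show "conv (\<lambda>x. ?D x (u + w)) f v = conv (\<lambda>x. ?D x u) f v + conv (\<lambda>x. ?D x w) f v" for u w
      unfolding conv_def lin distrib_right by (rule Bochner_Integration.integral_add[OF intD intD])
    show "conv (\<lambda>x. ?D x (a *\<^sub>R u)) f v = a *\<^sub>R conv (\<lambda>x. ?D x u) f v" for a u
      unfolding conv_def lin by (simp add: mult.assoc)
    show "norm (conv (\<lambda>x. ?D x u) f v) \<le> norm u * (L * ?I)" for u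
    proof -
      have "norm (conv (\<lambda>x. ?D x u) f v) \<le> (\<integral>y. (L * norm u) * \<bar>f y\<bar> \<partial>lborel)"
        unfolding conv_def
        by (rule Bochner_Integration.integral_norm_bound_integral[OF intD])
           (use f in \<open>simp_all add: abs_mult mult_right_mono[OF L(2)]\<close>)
      then show ?thesis by (simp add: mult_ac)
    qed
  qed
  moreover have "((\<lambda>u. norm (conv \<rho> f (v + u) - conv \<rho> f v - conv (\<lambda>x. ?D x u) f v) / norm u)
      \<longlongrightarrow> 0) (at 0)"
  proof (rule tendsto_sandwich[where f="\<lambda>_. 0" and h="\<lambda>u. M * ?I * norm u"])
    have "norm (conv \<rho> f (v + u) - conv \<rho> f v - conv (\<lambda>x. ?D x u) f v) \<le> M * ?I * norm u * norm u" for u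
    proof -
      note int = conv_integrable[OF \<rho> f]
      have eq: "conv \<rho> f (v + u) - conv \<rho> f v - conv (\<lambda>x. ?D x u) f v =
          (\<integral>y. \<rho> (v + u - y) * f y - \<rho> (v - y) * f y - ?D (v - y) u * f y \<partial>lborel)"
        unfolding conv_def using int intD by simp
      have "norm (\<integral>y. \<rho> (v + u - y) * f y - \<rho> (v - y) * f y - ?D (v - y) u * f y \<partial>lborel)
          \<le> (\<integral>y. (M * (norm u)\<^sup>2) * \<bar>f y\<bar> \<partial>lborel)"
      proof (rule Bochner_Integration.integral_norm_bound_integral)
        show "integrable lborel (\<lambda>y. \<rho> (v + u - y) * f y - \<rho> (v - y) * f y - ?D (v - y) u * f y)"
          using int intD by simp
        show "integrable lborel (\<lambda>y. M * (norm u)\<^sup>2 * \<bar>f y\<bar>)" using f by simp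
        fix y
        have "\<bar>\<rho> (v - y + u) - \<rho> (v - y) - ?D (v - y) u\<bar> * \<bar>f y\<bar> \<le> M * (norm u)\<^sup>2 * \<bar>f y\<bar>"
          by (rule mult_right_mono[OF M(2)]) simp
        moreover have "\<rho> (v + u - y) * f y - \<rho> (v - y) * f y - ?D (v - y) u * f y
            = (\<rho> (v - y + u) - \<rho> (v - y) - ?D (v - y) u) * f y"
          by (simp add: algebra_simps)
        ultimately show "norm (\<rho> (v + u - y) * f y - \<rho> (v - y) * f y - ?D (v - y) u * f y)
            \<le> M * (norm u)\<^sup>2 * \<bar>f y\<bar>"
          by (simp add: abs_mult)
      qed
      then show ?thesis unfolding eq by (simp add: power2_eq_square mult_ac)
    qed
    then show "\<forall>\<^sub>F u in at 0. norm (conv \<rho> f (v + u) - conv \<rho> f v - conv (\<lambda>x. ?D x u) f v) / norm u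
        \<le> M * ?I * norm u"
      by (auto simp: eventually_at_filter divide_le_eq)
    have "((\<lambda>u::'a. M * ?I * norm u) \<longlongrightarrow> M * ?I * norm (0::'a)) (at 0)"
      by (intro tendsto_mult tendsto_const tendsto_norm tendsto_ident_at)
    then show "((\<lambda>u::'a. M * ?I * norm u) \<longlongrightarrow> 0) (at 0)" by simp
  qed auto
  ultimately show ?thesis by (simp add: has_derivative_at)
qed

lemma Ck_conv:
  fixes f :: "'a::euclidean_space \<Rightarrow> real"
  assumes "smooth_in_ball r \<rho>" and f: "integrable lborel f"
  shows "Ck k (conv \<rho> f)"
  using assms(1)
proof (induction k arbitrary: \<rho>)
  case 0
  have "isCont (conv \<rho> f) v" for v
    by (rule has_derivative_continuous[OF conv_has_derivative[OF 0 f]])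
  then show ?case by (simp add: continuous_at_imp_continuous_on)
next
  case (Suc k)
  show ?case
    by (rule Ck_SucI[OF conv_has_derivative[OF Suc.prems f] Suc.IH[OF smooth_in_ball_derivative[OF Suc.prems]]])
qed

lemma frechet_derivative_conv:
  fixes f :: "'a::euclidean_space \<Rightarrow> real"
  assumes "smooth_in_ball r \<rho>" and f: "integrable lborel f"
  shows "frechet_derivative (conv \<rho> f) (at v) u = conv (\<lambda>x. frechet_derivative \<rho> (at x) u) f v"
  using frechet_derivative_at[OF conv_has_derivative[OF assms, of v]] by metis

lemma smooth_in_ball_conv:
  fixes f :: "'a::euclidean_space \<Rightarrow> real"
  assumes \<rho>: "smooth_in_ball r \<rho>" and f: "integrable lborel f" and z: "\<And>x. norm x > R \<Longrightarrow> f x = 0"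
  shows "smooth_in_ball (R + r) (conv \<rho> f)"
  unfolding smooth_in_ball_def
proof (intro conjI allI impI Ck_conv[OF \<rho> f])
  fix v :: 'a assume v: "norm v > R + r"
  have "\<rho> (v - y) * f y = 0" for y
  proof (cases "norm y > R")
    case False
    then have "norm (v - y) > r" using v norm_triangle_ineq2[of v y] by linarith
    then show ?thesis by (simp add: smooth_in_ballD(2)[OF \<rho>])
  qed (simp add: z)
  then show "conv \<rho> f v = 0" unfolding conv_def by (simp only: integral_zero)
qed

definition mollifier :: "real \<Rightarrow> 'a::euclidean_space \<Rightarrow> real" where
  "mollifier e x = bump e x * (1 / (\<integral>x. bump e (x::'a) \<partial>lborel))"

lemma bump_integral_pos:
  assumes "e > 0" shows "(\<integral>x. bump e (x::'a::euclidean_space) \<partial>lborel) > 0"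
proof -
  have int: "integrable lborel (bump e :: 'a \<Rightarrow> real)"
    by (rule smooth_in_ball_integrable[OF smooth_in_ball_bump[OF assms]])
  have "(\<integral>x. bump e (x::'a) \<partial>lborel) \<noteq> 0"
  proof
    assume "(\<integral>x. bump e (x::'a) \<partial>lborel) = 0"
    then have "AE x in lborel. bump e (x::'a) = 0"
      using integral_nonneg_eq_0_iff_AE[OF int] bump_nonneg by auto
    then have "AE x in lborel. x \<notin> ball (0::'a) e"
      by eventually_elim (use assms in \<open>auto simp: bump_eq_0_iff\<close>)
    then have "ball (0::'a) e \<in> null_sets lborel"
      by (subst AE_iff_null_sets) auto
    then have "measure lborel (ball (0::'a) e) = 0"
      by (simp add: measure_eq_emeasure_eq_ennreal null_sets_def measure_def)
    then show False using content_ball_pos[OF assms, of "0::'a"] by simp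
  qed
  then show ?thesis
    using Bochner_Integration.integral_nonneg[OF bump_nonneg[of e, where 'a='a], of lborel]
    by (simp add: less_le)
qed

lemma mollifier_nonneg: "e > 0 \<Longrightarrow> mollifier e (x::'a::euclidean_space) \<ge> 0"
  unfolding mollifier_def using bump_integral_pos[of e, where 'a='a] bump_nonneg[of e x] by simp

lemma smooth_in_ball_mollifier: "e > 0 \<Longrightarrow> smooth_in_ball e (mollifier e)"
  unfolding mollifier_def[abs_def]
  by (rule smooth_in_ball_mult[OF smooth_in_ball_bump Ck_const])

lemma mollifier_borel [measurable]: "mollifier e \<in> borel_measurable borel"
  unfolding mollifier_def[abs_def]
  by (intro borel_measurable_times borel_measurable_const
      borel_measurable_continuous_onI[OF Ck_bump[of 0, unfolded Ck.simps]])

lemma integral_mollifier: "e > 0 \<Longrightarrow> (\<integral>x. mollifier e (x::'a::euclidean_space) \<partial>lborel) = 1"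
  unfolding mollifier_def[abs_def] using bump_integral_pos[of e, where 'a='a]
  by (subst integral_mult_left_zero) simp

lemma integrable_mollifier: "e > 0 \<Longrightarrow> integrable lborel (mollifier e)"
  by (rule smooth_in_ball_integrable[OF smooth_in_ball_mollifier])

lemma nn_integral_mollifier: "e > 0 \<Longrightarrow> (\<integral>\<^sup>+x. ennreal (mollifier e x) \<partial>lborel) = 1"
  by (subst nn_integral_eq_integral[OF integrable_mollifier])
     (simp_all add: mollifier_nonneg integral_mollifier)

lemma conv_mollifier_eq:
  fixes f :: "'a::euclidean_space \<Rightarrow> real"
  assumes [measurable]: "f \<in> borel_measurable borel"
  shows "conv (mollifier e) f v = (\<integral>y. mollifier e y * f (v - y) \<partial>lborel)"
  unfolding conv_def
  using integral_lborel_reflect[of "\<lambda>y. mollifier e y * f (v - y)" v] by simp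

lemma conv_mollifier_integrable:
  fixes f :: "'a::euclidean_space \<Rightarrow> real"
  assumes "e > 0" and f: "integrable lborel f"
  shows "integrable lborel (\<lambda>y. mollifier e y * f (v - y))"
  using integrable_lborel_reflect[OF conv_integrable[OF smooth_in_ball_mollifier[OF assms(1)] f, of v], of v]
  by simp

lemma conv_mollifier_le:
  fixes f :: "'a::euclidean_space \<Rightarrow> real"
  assumes e: "e > 0" and f: "integrable lborel f"
    and le: "\<And>y. norm y \<le> e \<Longrightarrow> \<bar>f (v - y) - a\<bar> \<le> C"
  shows "\<bar>conv (mollifier e) f v - a\<bar> \<le> C"
proof -
  have [measurable]: "f \<in> borel_measurable borel" using f by simp
  note i = conv_mollifier_integrable[OF e f] integrable_mollifier[OF e, where 'a='a]
  have "conv (mollifier e) f v - a = (\<integral>y. mollifier e y * f (v - y) - mollifier e y * a \<partial>lborel)"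
    using i by (simp add: conv_mollifier_eq integral_mollifier[OF e])
  also have "\<bar>\<dots>\<bar> \<le> (\<integral>y. mollifier e (y::'a) * C \<partial>lborel)"
  proof -
    have "norm (\<integral>y. mollifier e y * f (v - y) - mollifier e y * a \<partial>lborel)
        \<le> (\<integral>y. mollifier e (y::'a) * C \<partial>lborel)"
    proof (rule Bochner_Integration.integral_norm_bound_integral)
      fix y
      show "norm (mollifier e y * f (v - y) - mollifier e y * a) \<le> mollifier e y * C"
      proof (cases "norm y \<le> e")
        case True
        have "mollifier e y * \<bar>f (v - y) - a\<bar> \<le> mollifier e y * C"
          by (rule mult_left_mono[OF le[OF True] mollifier_nonneg[OF e]])
        then show ?thesis
          using mollifier_nonneg[OF e, of y] by (simp add: right_diff_distrib[symmetric] abs_mult)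
      next
        case False
        then show ?thesis using smooth_in_ballD(2)[OF smooth_in_ball_mollifier[OF e], of y] by simp
      qed
    qed (use i in simp_all)
    then show ?thesis by simp
  qed
  finally show ?thesis by (simp add: integral_mollifier[OF e])
qed

lemma conv_mollifier_Lipschitz:
  fixes f :: "'a::euclidean_space \<Rightarrow> real"
  assumes e: "e > 0" and f: "integrable lborel f"
    and L: "\<And>x y. \<bar>f x - f y\<bar> \<le> L * norm (x - y)"
  shows "\<bar>conv (mollifier e) f v - conv (mollifier e) f w\<bar> \<le> L * norm (v - w)"
proof -
  have [measurable]: "f \<in> borel_measurable borel" using f by simp
  note i = conv_mollifier_integrable[OF e f] integrable_mollifier[OF e, where 'a='a]
  have "norm (\<integral>y. mollifier e y * f (v - y) - mollifier e y * f (w - y) \<partial>lborel)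
      \<le> (\<integral>y. mollifier e (y::'a) * (L * norm (v - w)) \<partial>lborel)"
  proof (rule Bochner_Integration.integral_norm_bound_integral)
    fix y
    have "mollifier e y * \<bar>f (v - y) - f (w - y)\<bar> \<le> mollifier e y * (L * norm (v - w))"
      using L[of "v - y" "w - y"] by (intro mult_left_mono mollifier_nonneg[OF e]) simp
    then show "norm (mollifier e y * f (v - y) - mollifier e y * f (w - y)) \<le> mollifier e y * (L * norm (v - w))"
      using mollifier_nonneg[OF e, of y] by (simp add: right_diff_distrib[symmetric] abs_mult)
  qed (use i in simp_all)
  then show ?thesis using i by (simp add: conv_mollifier_eq integral_mollifier[OF e])
qed

lemma nn_conv_mollifier:
  fixes F :: "'a::euclidean_space \<Rightarrow> ennreal"
  assumes e: "e > 0" and [measurable]: "F \<in> borel_measurable borel"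
  shows "(\<integral>\<^sup>+v. \<integral>\<^sup>+y. ennreal (mollifier e (v - y)) * F y \<partial>lborel \<partial>lborel) = (\<integral>\<^sup>+y. F y \<partial>lborel)"
proof -
  have "(\<integral>\<^sup>+v. \<integral>\<^sup>+y. ennreal (mollifier e (v - y)) * F y \<partial>lborel \<partial>lborel)
      = (\<integral>\<^sup>+y. \<integral>\<^sup>+v. ennreal (mollifier e (v - y)) * F y \<partial>lborel \<partial>lborel)"
    by (rule lborel_pair.Fubini'[symmetric]) simp
  also have "\<dots> = (\<integral>\<^sup>+y. F y \<partial>lborel)"
    using nn_integral_lborel_shift[of "\<lambda>v. ennreal (mollifier e (v::'a))"]
    by (simp add: nn_integral_multc nn_integral_mollifier[OF e])
  finally show ?thesis .
qed

lemma conv_mollifier_L1: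
  fixes f :: "'a::euclidean_space \<Rightarrow> real"
  assumes e: "e > 0" and f: "integrable lborel f"
  shows "(\<integral>\<^sup>+v. ennreal \<bar>conv (mollifier e) f v\<bar> \<partial>lborel) \<le> (\<integral>\<^sup>+y. ennreal \<bar>f y\<bar> \<partial>lborel)"
proof -
  have [measurable]: "f \<in> borel_measurable borel" using f by simp
  have "ennreal \<bar>conv (mollifier e) f v\<bar> \<le> (\<integral>\<^sup>+y. ennreal (mollifier e (v - y)) * ennreal \<bar>f y\<bar> \<partial>lborel)" for v
    using integral_norm_bound_ennreal[OF conv_integrable[OF smooth_in_ball_mollifier[OF e] f, of v]]
    by (simp add: conv_def abs_mult ennreal_mult' mollifier_nonneg[OF e])
  then have "(\<integral>\<^sup>+v. ennreal \<bar>conv (mollifier e) f v\<bar> \<partial>lborel)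
      \<le> (\<integral>\<^sup>+v. \<integral>\<^sup>+y. ennreal (mollifier e (v - y)) * ennreal \<bar>f y\<bar> \<partial>lborel \<partial>lborel)"
    by (intro nn_integral_mono) simp
  then show ?thesis by (simp add: nn_conv_mollifier[OF e])
qed

text \<open>Pointwise this is the Cauchy--Schwarz inequality for the probability density
  \<open>mollifier e (v - y)\<close>; integrating in \<open>v\<close> the density disappears.\<close>

lemma conv_mollifier_L2:
  fixes f :: "'a::euclidean_space \<Rightarrow> real"
  assumes e: "e > 0" and f: "integrable lborel f"
  shows "(\<integral>\<^sup>+v. ennreal ((conv (mollifier e) f v)\<^sup>2) \<partial>lborel) \<le> (\<integral>\<^sup>+y. ennreal ((f y)\<^sup>2) \<partial>lborel)"
proof -
  have [measurable]: "f \<in> borel_measurable borel" using f by simp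
  have "ennreal ((conv (mollifier e) f v)\<^sup>2)
      \<le> (\<integral>\<^sup>+y. ennreal (mollifier e (v - y)) * ennreal ((f y)\<^sup>2) \<partial>lborel)" for v
  proof -
    let ?r = "\<lambda>y. ennreal (sqrt (mollifier e (v - y)))"
    have sq: "(?r y)\<^sup>2 = ennreal (mollifier e (v - y))" for y
      by (simp add: ennreal_power mollifier_nonneg[OF e])
    have "ennreal \<bar>conv (mollifier e) f v\<bar> \<le> (\<integral>\<^sup>+y. ennreal (mollifier e (v - y)) * ennreal \<bar>f y\<bar> \<partial>lborel)"
      using integral_norm_bound_ennreal[OF conv_integrable[OF smooth_in_ball_mollifier[OF e] f, of v]]
      by (simp add: conv_def abs_mult ennreal_mult' mollifier_nonneg[OF e])
    also have "\<dots> = (\<integral>\<^sup>+y. ?r y * (?r y * ennreal \<bar>f y\<bar>) \<partial>lborel)"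
      by (simp add: sq[symmetric] power2_eq_square mult.assoc)
    finally have "(ennreal \<bar>conv (mollifier e) f v\<bar>)\<^sup>2 \<le> (\<integral>\<^sup>+y. ?r y * (?r y * ennreal \<bar>f y\<bar>) \<partial>lborel)\<^sup>2"
      by (rule power_mono) simp
    also have "\<dots> \<le> (\<integral>\<^sup>+y. (?r y)\<^sup>2 \<partial>lborel) * (\<integral>\<^sup>+y. (?r y * ennreal \<bar>f y\<bar>)\<^sup>2 \<partial>lborel)"
      by (rule Cauchy_Schwarz_nn_integral) simp_all
    also have "(\<integral>\<^sup>+y. (?r y)\<^sup>2 \<partial>lborel) = 1"
      unfolding sq using nn_integral_lborel_reflect[of "\<lambda>y. ennreal (mollifier e y)" v]
      by (simp add: nn_integral_mollifier[OF e])
    also have "(\<integral>\<^sup>+y. (?r y * ennreal \<bar>f y\<bar>)\<^sup>2 \<partial>lborel)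
        = (\<integral>\<^sup>+y. ennreal (mollifier e (v - y)) * ennreal ((f y)\<^sup>2) \<partial>lborel)"
      by (simp add: power_mult_distrib sq ennreal_power)
    finally show ?thesis by (simp add: ennreal_power)
  qed
  then have "(\<integral>\<^sup>+v. ennreal ((conv (mollifier e) f v)\<^sup>2) \<partial>lborel)
      \<le> (\<integral>\<^sup>+v. \<integral>\<^sup>+y. ennreal (mollifier e (v - y)) * ennreal ((f y)\<^sup>2) \<partial>lborel \<partial>lborel)"
    by (intro nn_integral_mono) simp
  then show ?thesis by (simp add: nn_conv_mollifier[OF e])
qed

section \<open>Approximation in the mean\<close>

text \<open>A set of finite measure is nearly an open set \<open>U\<close>, and the indicator of \<open>U\<close> is the limit of
  the Lipschitz functions \<open>min 1 (n * infdist x (- U))\<close>.\<close>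

lemma Lipschitz_L1_dense:
  fixes f :: "'a::euclidean_space \<Rightarrow> real"
  assumes "integrable lborel f" and "\<eta> > 0"
  shows "\<exists>g L. integrable lborel g \<and> L \<ge> 0 \<and> (\<forall>x y. \<bar>g x - g y\<bar> \<le> L * norm (x - y)) \<and>
    (\<integral>x. \<bar>f x - g x\<bar> \<partial>lborel) < \<eta>"
  using assms
proof (induction f arbitrary: \<eta> rule: integrable_induct)
  case (base A c)
  have A: "A \<in> sets borel" "emeasure lborel A < \<infinity>" using base by auto
  define \<delta> where "\<delta> = \<eta> / (2 * (\<bar>c\<bar> + 1))"
  have \<delta>: "\<delta> > 0" "\<bar>c\<bar> * (2 * \<delta>) < \<eta>" using base by (simp_all add: \<delta>_def field_simps)
  obtain U where U: "open U" "A \<subseteq> U" "emeasure lborel (U - A) < ennreal \<delta>"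
    using outer_regular_lborel[OF A(1) \<delta>(1)] by blast
  have [measurable]: "U \<in> sets borel" "A \<in> sets borel" using U(1) A(1) by auto
  have finUA: "emeasure lborel (U - A) < \<infinity>" using U(3) by (rule less_trans) simp
  have "emeasure lborel U = emeasure lborel A + emeasure lborel (U - A)"
    using U(2) by (subst plus_emeasure) (auto simp: Un_absorb1 Un_Diff_cancel)
  then have finU: "emeasure lborel U < \<infinity>" using A(2) finUA by simp
  then have "U \<noteq> UNIV" by auto
  then have ne: "- U \<noteq> {}" by auto
  have iU: "integrable lborel (indicator U :: 'a \<Rightarrow> real)" and iA: "integrable lborel (indicator A :: 'a \<Rightarrow> real)"
    using finU A(2) by (auto intro!: integrable_real_indicator)
  define g where "g n x = min 1 (real n * infdist x (- U))" for n and x :: 'a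
  have g01: "0 \<le> g n x" "g n x \<le> 1" for n x
    by (auto simp: g_def infdist_nonneg)
  have gU: "g n x = 0" if "x \<notin> U" for n x
    using that by (simp add: g_def)
  have g_le: "g n x \<le> indicator U x" for n x
    using g01[of n x] gU[of x n] by (cases "x \<in> U") auto
  have gL: "\<bar>g n x - g n y\<bar> \<le> real n * norm (x - y)" for n x y
  proof -
    have "\<bar>g n x - g n y\<bar> \<le> \<bar>real n * infdist x (- U) - real n * infdist y (- U)\<bar>"
      unfolding g_def by linarith
    also have "\<dots> = real n * \<bar>infdist x (- U) - infdist y (- U)\<bar>"
      by (simp add: right_diff_distrib[symmetric] abs_mult)
    also have "\<dots> \<le> real n * norm (x - y)"
      using infdist_triangle_abs[of x "- U" y] by (intro mult_left_mono) (auto simp: dist_norm)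
    finally show ?thesis .
  qed
  have [measurable]: "g n \<in> borel_measurable borel" for n
    unfolding g_def[abs_def]
    by (intro borel_measurable_continuous_onI continuous_on_min continuous_on_const continuous_on_mult
        continuous_on_infdist continuous_on_id)
  have ig: "integrable lborel (g n)" for n
    by (rule Bochner_Integration.integrable_bound[OF iU]) (use g01 g_le in auto)
  have lim: "(\<lambda>n. \<integral>x. indicator U x - g n x \<partial>lborel) \<longlonglongrightarrow> (\<integral>x. 0 \<partial>(lborel :: 'a measure))"
  proof (rule integral_dominated_convergence[OF _ _ iU])
    show "AE x in lborel. (\<lambda>n. indicator U x - g n x) \<longlonglongrightarrow> 0"
    proof (rule AE_I2)
      fix x
      show "(\<lambda>n. indicator U x - g n x) \<longlonglongrightarrow> 0"
      proof (cases "x \<in> U")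
        case True
        have "infdist x (- U) \<noteq> 0"
          using True U(1) ne in_closed_iff_infdist_zero[of "- U" x] by (simp add: closed_Compl)
        then have pos: "infdist x (- U) > 0" using infdist_nonneg[of x "- U"] by linarith
        obtain N :: nat where N: "1 / infdist x (- U) < real N" using reals_Archimedean2 by blast
        have "indicator U x - g n x = 0" if "n \<ge> N" for n
        proof -
          have "1 < real N * infdist x (- U)" using N pos by (simp add: divide_less_eq)
          also have "\<dots> \<le> real n * infdist x (- U)"
            using that pos by (intro mult_right_mono) auto
          finally show ?thesis using True by (simp add: g_def)
        qed
        then show ?thesis
          by (intro tendsto_eventually) (auto simp: eventually_sequentially)
      next
        case False
        then show ?thesis by (simp add: gU)
      qed
    qed
    show "AE x in lborel. norm (indicator U x - g n x) \<le> indicator U x" for n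
      using g01 g_le by (intro AE_I2) (auto simp: abs_of_nonneg)
  qed simp_all
  then have "eventually (\<lambda>n. (\<integral>x. indicator U x - g n x \<partial>lborel) < \<delta>) sequentially"
    using \<delta>(1) by (intro order_tendstoD(2)[where y=0]) auto
  then obtain n where n: "(\<integral>x. indicator U x - g n x \<partial>lborel) < \<delta>"
    by (auto simp: eventually_sequentially)
  have UA: "(\<integral>x. indicator U x - indicator A x \<partial>lborel) < \<delta>"
  proof -
    have "(\<integral>x. indicator U x - indicator A x \<partial>lborel) = (\<integral>x. indicator (U - A) x \<partial>lborel)"
      using U(2) by (intro Bochner_Integration.integral_cong) (auto split: split_indicator)
    also have "\<dots> = measure lborel (U - A)" by simp
    also have "\<dots> < \<delta>"
      using U(3) finUA \<delta>(1) by (simp add: emeasure_eq_ennreal_measure ennreal_less_iff)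
    finally show ?thesis .
  qed
  have "(\<integral>x. \<bar>indicator A x *\<^sub>R c - c * g n x\<bar> \<partial>lborel)
      \<le> (\<integral>x. \<bar>c\<bar> * ((indicator U x - indicator A x) + (indicator U x - g n x)) \<partial>lborel)"
  proof (rule integral_mono)
    show "integrable lborel (\<lambda>x. \<bar>indicator A x *\<^sub>R c - c * g n x\<bar>)"
      using iA ig by simp
    show "integrable lborel (\<lambda>x. \<bar>c\<bar> * ((indicator U x - indicator A x) + (indicator U x - g n x)))"
      using iA ig iU by simp
    fix x
    have "\<bar>indicator A x - g n x\<bar> \<le> (indicator U x - indicator A x) + (indicator U x - g n x)"
      using U(2) g01[of n x] gU[of x n] by (auto split: split_indicator)
    from mult_left_mono[OF this, of "\<bar>c\<bar>"]
    show "\<bar>indicator A x *\<^sub>R c - c * g n x\<bar> \<le> \<bar>c\<bar> * ((indicator U x - indicator A x) + (indicator U x - g n x))"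
      by (simp add: abs_mult[symmetric] right_diff_distrib mult.commute)
  qed
  also have "\<dots> = \<bar>c\<bar> * ((\<integral>x. indicator U x - indicator A x \<partial>lborel) + (\<integral>x. indicator U x - g n x \<partial>lborel))"
    using iA ig iU by simp
  also have "\<dots> \<le> \<bar>c\<bar> * (2 * \<delta>)"
    using UA n by (intro mult_left_mono) auto
  finally have "(\<integral>x. \<bar>indicator A x *\<^sub>R c - c * g n x\<bar> \<partial>lborel) < \<eta>" using \<delta>(2) by linarith
  moreover have "\<bar>c * g n x - c * g n y\<bar> \<le> \<bar>c\<bar> * real n * norm (x - y)" for x y
    using mult_left_mono[OF gL[of n x y], of "\<bar>c\<bar>"]
    by (simp add: right_diff_distrib[symmetric] abs_mult mult.assoc)
  ultimately show ?case
    using ig[of n] by (intro exI[of _ "\<lambda>x. c * g n x"] exI[of _ "\<bar>c\<bar> * real n"]) simp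
next
  case (add f1 f2)
  obtain g1 L1 where g1: "integrable lborel g1" "L1 \<ge> 0" "\<And>x y. \<bar>g1 x - g1 y\<bar> \<le> L1 * norm (x - y)"
    "(\<integral>x. \<bar>f1 x - g1 x\<bar> \<partial>lborel) < \<eta> / 2"
    using add.IH(1)[of "\<eta> / 2"] add.prems by auto
  obtain g2 L2 where g2: "integrable lborel g2" "L2 \<ge> 0" "\<And>x y. \<bar>g2 x - g2 y\<bar> \<le> L2 * norm (x - y)"
    "(\<integral>x. \<bar>f2 x - g2 x\<bar> \<partial>lborel) < \<eta> / 2"
    using add.IH(2)[of "\<eta> / 2"] add.prems by auto
  have "(\<integral>x. \<bar>(f1 x + f2 x) - (g1 x + g2 x)\<bar> \<partial>lborel) \<le> (\<integral>x. \<bar>f1 x - g1 x\<bar> + \<bar>f2 x - g2 x\<bar> \<partial>lborel)"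
    by (rule integral_mono) (use add.hyps g1(1) g2(1) in auto)
  also have "\<dots> < \<eta>" using add.hyps g1 g2 by simp
  finally have "(\<integral>x. \<bar>(f1 x + f2 x) - (g1 x + g2 x)\<bar> \<partial>lborel) < \<eta>" .
  moreover have "\<bar>(g1 x + g2 x) - (g1 y + g2 y)\<bar> \<le> (L1 + L2) * norm (x - y)" for x y
    using g1(3)[of x y] g2(3)[of x y] unfolding distrib_right by linarith
  ultimately show ?case
    using g1(1,2) g2(1,2) by (intro exI[of _ "\<lambda>x. g1 x + g2 x"] exI[of _ "L1 + L2"]) simp
next
  case (lim f s)
  have "(\<lambda>i. \<integral>x. \<bar>f x - s i x\<bar> \<partial>lborel) \<longlonglongrightarrow> (\<integral>x. 0 \<partial>(lborel :: 'a measure))"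
  proof (rule integral_dominated_convergence[where w="\<lambda>x. 3 * \<bar>f x\<bar>"])
    show "AE x in lborel. (\<lambda>i. \<bar>f x - s i x\<bar>) \<longlonglongrightarrow> 0"
    proof (rule AE_I2)
      fix x
      have "(\<lambda>i. \<bar>f x - s i x\<bar>) \<longlonglongrightarrow> \<bar>f x - f x\<bar>"
        using lim.hyps(2)[of x] by (intro tendsto_rabs tendsto_diff tendsto_const) simp
      then show "(\<lambda>i. \<bar>f x - s i x\<bar>) \<longlonglongrightarrow> 0" by simp
    qed
    show "AE x in lborel. norm \<bar>f x - s i x\<bar> \<le> 3 * \<bar>f x\<bar>" for i
    proof (rule AE_I2)
      fix x show "norm \<bar>f x - s i x\<bar> \<le> 3 * \<bar>f x\<bar>"
        using lim.hyps(3)[of x i] by (auto simp: abs_real_def split: if_splits)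
    qed
  qed (use lim.hyps(1,4) in auto)
  then have "eventually (\<lambda>i. (\<integral>x. \<bar>f x - s i x\<bar> \<partial>lborel) < \<eta> / 2) sequentially"
    using lim.prems by (intro order_tendstoD(2)[where y=0]) auto
  then obtain i where i: "(\<integral>x. \<bar>f x - s i x\<bar> \<partial>lborel) < \<eta> / 2"
    by (auto simp: eventually_sequentially)
  obtain g L where g: "integrable lborel g" "L \<ge> 0" "\<forall>x y. \<bar>g x - g y\<bar> \<le> L * norm (x - y)"
    "(\<integral>x. \<bar>s i x - g x\<bar> \<partial>lborel) < \<eta> / 2"
    using lim.IH[of "\<eta> / 2" i] lim.prems by auto
  have "(\<integral>x. \<bar>f x - g x\<bar> \<partial>lborel) \<le> (\<integral>x. \<bar>f x - s i x\<bar> + \<bar>s i x - g x\<bar> \<partial>lborel)"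
    by (rule integral_mono) (use lim.hyps(1)[of i] lim.hyps(4) g(1) in auto)
  also have "\<dots> < \<eta>" using lim.hyps(1)[of i] lim.hyps(4) g i by simp
  finally show ?case using g by blast
qed

lemma conv_borel:
  assumes "e > 0" and "integrable lborel f" shows "conv (mollifier e) f \<in> borel_measurable borel"
  by (rule borel_measurable_continuous_onI[OF Ck_conv[of _ _ _ 0, unfolded Ck.simps, OF smooth_in_ball_mollifier[OF assms(1)] assms(2)]])

lemma conv_mollifier_integrable_L1:
  assumes e: "e > 0" and f: "integrable lborel f" shows "integrable lborel (conv (mollifier e) f)"
proof (rule integrableI_bounded)
  show "conv (mollifier e) f \<in> borel_measurable lborel" using conv_borel[OF e f] by simp
  have "(\<integral>\<^sup>+ x. ennreal (norm (conv (mollifier e) f x)) \<partial>lborel) \<le> (\<integral>\<^sup>+ x. ennreal (norm (f x)) \<partial>lborel)"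
    using conv_mollifier_L1[OF e f] by simp
  also have "\<dots> < \<infinity>" using f by (simp add: integrable_iff_bounded)
  finally show "(\<integral>\<^sup>+ x. ennreal (norm (conv (mollifier e) f x)) \<partial>lborel) < \<infinity>" .
qed

lemma conv_mollifier_L1_integral:
  assumes e: "e > 0" and f: "integrable lborel f"
  shows "(\<integral>x. \<bar>conv (mollifier e) f x\<bar> \<partial>lborel) \<le> (\<integral>x. \<bar>f x\<bar> \<partial>lborel)"
proof -
  have "ennreal (\<integral>x. \<bar>conv (mollifier e) f x\<bar> \<partial>lborel) \<le> ennreal (\<integral>x. \<bar>f x\<bar> \<partial>lborel)"
    using conv_mollifier_L1[OF e f] conv_mollifier_integrable_L1[OF e f] f
    by (simp add: nn_integral_eq_integral)
  then show ?thesis by (simp add: Bochner_Integration.integral_nonneg)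
qed

lemma conv_diff:
  assumes e: "e > 0" and f: "integrable lborel f" and g: "integrable lborel g"
  shows "conv (mollifier e) (\<lambda>x. f x - g x) v = conv (mollifier e) f v - conv (mollifier e) g v"
  unfolding conv_def right_diff_distrib
  by (rule Bochner_Integration.integral_diff[OF conv_integrable[OF smooth_in_ball_mollifier[OF e] f]
        conv_integrable[OF smooth_in_ball_mollifier[OF e] g]])

text \<open>For Lipschitz functions the convergence is uniform, which controls the mean only on sets of
  finite measure; hence the restriction to a ball.\<close>

lemma conv_mollifier_tendsto_L1:
  fixes f :: "'a::euclidean_space \<Rightarrow> real"
  assumes f: "integrable lborel f"
  shows "((\<lambda>e. \<integral>x. indicator (ball 0 r) x * \<bar>conv (mollifier e) f x - f x\<bar> \<partial>lborel) \<longlongrightarrow> 0) (at_right 0)"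
proof (rule tendstoI)
  fix \<eta> :: real assume \<eta>: "\<eta> > 0"
  obtain g L where g: "integrable lborel g" "L \<ge> 0" "\<And>x y. \<bar>g x - g y\<bar> \<le> L * norm (x - y)"
    "(\<integral>x. \<bar>f x - g x\<bar> \<partial>lborel) < \<eta> / 4"
    using Lipschitz_L1_dense[OF f, of "\<eta> / 4"] \<eta> by auto
  define V where "V = measure lborel (ball (0::'a) r)"
  define d where "d = \<eta> / (4 * (L * V + 1))"
  have V: "V \<ge> 0" by (simp add: V_def)
  have pos: "L * V + 1 > 0" using g(2) V mult_nonneg_nonneg[of L V] by linarith
  have d: "d > 0" "L * d * V < \<eta> / 2"
  proof -
    show "d > 0" using \<eta> pos by (simp add: d_def)
    have "L * d * V = \<eta> / 4 * (L * V / (L * V + 1))" by (simp add: d_def)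
    also have "\<dots> \<le> \<eta> / 4 * 1" using \<eta> pos by (intro mult_left_mono) (auto simp: divide_le_eq_1)
    finally show "L * d * V < \<eta> / 2" using \<eta> by linarith
  qed
  have ball: "integrable lborel (indicator (ball (0::'a) r) :: 'a \<Rightarrow> real)"
    by (intro integrable_real_indicator emeasure_lborel_ball_finite) simp
  have main: "(\<integral>x. indicator (ball 0 r) x * \<bar>conv (mollifier e) f x - f x\<bar> \<partial>lborel) < \<eta>"
    if e: "0 < e" "e < d" for e
  proof -
    have fg: "integrable lborel (\<lambda>x. f x - g x)" using f g by simp
    note i = conv_mollifier_integrable_L1[OF e(1) fg] conv_mollifier_integrable_L1[OF e(1) f]
    have gb: "\<bar>conv (mollifier e) g x - g x\<bar> \<le> L * e" for x
    proof (rule conv_mollifier_le[OF e(1) g(1)])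
      fix y :: 'a assume "norm y \<le> e"
      then show "\<bar>g (x - y) - g x\<bar> \<le> L * e"
        using g(3)[of "x - y" x] mult_left_mono[of "norm y" e L] g(2) by simp
    qed
    have "(\<integral>x. indicator (ball 0 r) x * \<bar>conv (mollifier e) f x - f x\<bar> \<partial>lborel)
       \<le> (\<integral>x. \<bar>conv (mollifier e) (\<lambda>x. f x - g x) x\<bar> + \<bar>f x - g x\<bar> + L * e * indicator (ball 0 r) x \<partial>lborel)"
    proof (rule integral_mono)
      have "integrable lborel (\<lambda>x. indicator (ball 0 r) x *\<^sub>R \<bar>conv (mollifier e) f x - f x\<bar>)"
        using i f by (intro integrable_mult_indicator) auto
      then show "integrable lborel (\<lambda>x. indicator (ball 0 r) x * \<bar>conv (mollifier e) f x - f x\<bar>)" by simp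
      show "integrable lborel (\<lambda>x. \<bar>conv (mollifier e) (\<lambda>x. f x - g x) x\<bar> + \<bar>f x - g x\<bar>
          + L * e * indicator (ball 0 r) x)"
        using i fg ball by simp
      fix x
      have "conv (mollifier e) f x - f x = conv (mollifier e) (\<lambda>x. f x - g x) x - (f x - g x)
          + (conv (mollifier e) g x - g x)"
        by (simp add: conv_diff[OF e(1) f g(1)])
      then show "indicator (ball 0 r) x * \<bar>conv (mollifier e) f x - f x\<bar>
          \<le> \<bar>conv (mollifier e) (\<lambda>x. f x - g x) x\<bar> + \<bar>f x - g x\<bar> + L * e * indicator (ball 0 r) x"
        using gb[of x] by (auto split: split_indicator)
    qed
    also have "\<dots> = (\<integral>x. \<bar>conv (mollifier e) (\<lambda>x. f x - g x) x\<bar> \<partial>lborel) + (\<integral>x. \<bar>f x - g x\<bar> \<partial>lborel) + L * e * V"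
      using i fg ball by (simp add: V_def)
    also have "\<dots> \<le> \<eta> / 4 + \<eta> / 4 + L * d * V"
    proof -
      have "(\<integral>x. \<bar>conv (mollifier e) (\<lambda>x. f x - g x) x\<bar> \<partial>lborel) \<le> \<eta> / 4"
        using conv_mollifier_L1_integral[OF e(1) fg] g(4) by linarith
      moreover have "L * e * V \<le> L * d * V"
        using e g(2) V by (intro mult_right_mono mult_left_mono) auto
      ultimately show ?thesis using g(4) by linarith
    qed
    finally show ?thesis using d(2) by linarith
  qed
  have "eventually (\<lambda>e. 0 < e \<and> e < d) (at_right (0::real))"
    using d(1) by (auto simp: eventually_at_right_field)
  then show "\<forall>\<^sub>F e in at_right 0. dist (\<integral>x. indicator (ball 0 r) x * \<bar>conv (mollifier e) f x - f x\<bar> \<partial>lborel) 0 < \<eta>"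
  proof eventually_elim
    case (elim e)
    have "0 \<le> (\<integral>x. indicator (ball 0 r) x * \<bar>conv (mollifier e) f x - f x\<bar> \<partial>lborel)"
      by (intro Bochner_Integration.integral_nonneg) simp
    then show ?case using main[of e] elim by (simp add: dist_real_def)
  qed
qed

section \<open>Square integrable functions\<close>

text \<open>The estimates are carried out for Borel functions and the Borel--Lebesgue measure; the completed
  measure enters only when the results are transferred to the original data.\<close>

definition square_integrable :: "('a::euclidean_space \<Rightarrow> 'b::euclidean_space) \<Rightarrow> bool" where
  "square_integrable f \<longleftrightarrow> f \<in> borel_measurable borel \<and> integrable lborel (\<lambda>x. (norm (f x))\<^sup>2)"

definition l2 :: "('a::euclidean_space \<Rightarrow> 'b::euclidean_space) \<Rightarrow> real" where
  "l2 f = sqrt (\<integral>x. (norm (f x))\<^sup>2 \<partial>lborel)"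

lemma l2_nonneg: "l2 f \<ge> 0"
  by (simp add: l2_def)

lemma l2_square: "(l2 f)\<^sup>2 = (\<integral>x. (norm (f x))\<^sup>2 \<partial>lborel)"
  by (simp add: l2_def Bochner_Integration.integral_nonneg)

lemma square_integrable_borel: "square_integrable f \<Longrightarrow> f \<in> borel_measurable borel"
  by (simp add: square_integrable_def)

lemma l2_nn_integral:
  assumes "square_integrable f"
  shows "(\<integral>\<^sup>+x. ennreal ((norm (f x))\<^sup>2) \<partial>lborel) = ennreal ((l2 f)\<^sup>2)"
  unfolding l2_square using assms
  by (subst nn_integral_eq_integral) (auto simp: square_integrable_def)

lemma square_integrable_iff_nn:
  assumes "f \<in> borel_measurable borel"
  shows "square_integrable f \<longleftrightarrow> (\<integral>\<^sup>+x. ennreal ((norm (f x))\<^sup>2) \<partial>lborel) < \<infinity>"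
  using assms unfolding square_integrable_def by (auto simp: integrable_iff_bounded)

lemma l2_leI:
  assumes "f \<in> borel_measurable borel" "C \<ge> 0"
    "(\<integral>\<^sup>+x. ennreal ((norm (f x))\<^sup>2) \<partial>lborel) \<le> ennreal (C\<^sup>2)"
  shows "square_integrable f" "l2 f \<le> C"
proof -
  show sq: "square_integrable f"
    unfolding square_integrable_iff_nn[OF assms(1)] using assms(3) by (rule le_less_trans) simp
  have "(l2 f)\<^sup>2 \<le> C\<^sup>2" using assms(3) unfolding l2_nn_integral[OF sq] by simp
  then show "l2 f \<le> C" using assms(2) by (rule power2_le_imp_le)
qed

lemma Cauchy_Schwarz_l2:
  assumes f: "square_integrable f" and g: "square_integrable g"
  shows "integrable lborel (\<lambda>x. norm (f x) * norm (g x))"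
    and "(\<integral>x. norm (f x) * norm (g x) \<partial>lborel) \<le> l2 f * l2 g"
proof -
  have [measurable]: "f \<in> borel_measurable borel" "g \<in> borel_measurable borel"
    using f g by (auto simp: square_integrable_def)
  have "(\<integral>\<^sup>+x. ennreal (norm (f x)) * ennreal (norm (g x)) \<partial>lborel)\<^sup>2
      \<le> (\<integral>\<^sup>+x. (ennreal (norm (f x)))\<^sup>2 \<partial>lborel) * (\<integral>\<^sup>+x. (ennreal (norm (g x)))\<^sup>2 \<partial>lborel)"
    by (rule Cauchy_Schwarz_nn_integral) simp_all
  also have "\<dots> = ennreal ((l2 f * l2 g)\<^sup>2)"
    by (simp add: ennreal_power l2_nn_integral[OF f] l2_nn_integral[OF g] ennreal_mult[symmetric] power_mult_distrib)
  finally have le2: "(\<integral>\<^sup>+x. ennreal (norm (f x) * norm (g x)) \<partial>lborel)\<^sup>2 \<le> ennreal ((l2 f * l2 g)\<^sup>2)"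
    by (simp add: ennreal_mult)
  have le: "(\<integral>\<^sup>+x. ennreal (norm (f x) * norm (g x)) \<partial>lborel) \<le> ennreal (l2 f * l2 g)"
  proof (cases "\<integral>\<^sup>+x. ennreal (norm (f x) * norm (g x)) \<partial>lborel")
    case (real x)
    then have "x\<^sup>2 \<le> (l2 f * l2 g)\<^sup>2" using le2 by (simp add: ennreal_power)
    then have "x \<le> l2 f * l2 g" by (rule power2_le_imp_le) (simp add: l2_nonneg)
    then show ?thesis unfolding real(2) by (rule ennreal_leI)
  next
    case top
    then show ?thesis using le2 by (simp add: top_unique)
  qed
  then show int: "integrable lborel (\<lambda>x. norm (f x) * norm (g x))"
    by (intro integrableI_bounded) (auto simp: le_less_trans)
  show "(\<integral>x. norm (f x) * norm (g x) \<partial>lborel) \<le> l2 f * l2 g"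
    using le by (subst (asm) nn_integral_eq_integral[OF int]) (auto simp: l2_nonneg)
qed

lemma square_integrable_bound:
  assumes f: "square_integrable f" and "g \<in> borel_measurable borel" and "\<And>x. norm (g x) \<le> norm (f x)"
  shows "square_integrable g" "l2 g \<le> l2 f"
proof -
  have "(\<integral>\<^sup>+x. ennreal ((norm (g x))\<^sup>2) \<partial>lborel) \<le> (\<integral>\<^sup>+x. ennreal ((norm (f x))\<^sup>2) \<partial>lborel)"
    using assms(3) by (intro nn_integral_mono ennreal_leI power_mono) auto
  then have "(\<integral>\<^sup>+x. ennreal ((norm (g x))\<^sup>2) \<partial>lborel) \<le> ennreal ((l2 f)\<^sup>2)"
    by (simp add: l2_nn_integral[OF f])
  then show "square_integrable g" "l2 g \<le> l2 f"
    using l2_leI[OF assms(2) l2_nonneg] by blast+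
qed

lemma l2_indicator:
  assumes [measurable]: "A \<in> sets borel" and "emeasure lborel A < \<infinity>"
  shows "square_integrable (indicator A :: 'a::euclidean_space \<Rightarrow> real)"
    and "l2 (indicator A :: 'a::euclidean_space \<Rightarrow> real) = sqrt (measure lborel A)"
proof -
  have eq: "(\<lambda>x. (norm (indicator A x :: real))\<^sup>2) = indicator A"
    by (auto split: split_indicator)
  show "square_integrable (indicator A :: 'a \<Rightarrow> real)"
    unfolding square_integrable_def eq using assms by (auto intro!: integrable_real_indicator)
  show "l2 (indicator A :: 'a \<Rightarrow> real) = sqrt (measure lborel A)"
    unfolding l2_def eq by simp
qed

section \<open>The velocity averaging estimate at a fixed frequency\<close>

text \<open>A smooth replacement for \<open>1 / x\<close>: the two agree for \<open>\<bar>x\<bar> \<ge> 1\<close>, and inside this interval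
  the flat function keeps the denominator positive.\<close>

definition profile :: "real \<Rightarrow> real" where
  "profile x = x * inverse (x\<^sup>2 + flat_exp (1 - x\<^sup>2))"

lemma profile_denominator_pos: "x\<^sup>2 + flat_exp (1 - x\<^sup>2) > 0"
proof (cases "x\<^sup>2 < 1")
  case True
  then show ?thesis using flat_exp_pos[of "1 - x\<^sup>2"] by (simp add: add_nonneg_pos)
next
  case False
  then show ?thesis using flat_exp_nonneg[of "1 - x\<^sup>2"] by linarith
qed

lemma Ck_profile: "Ck k profile"
proof -
  have sq: "Ck k (\<lambda>x::real. x\<^sup>2)"
    using Ck_norm_square[of k, where 'a=real] by simp
  have "Ck k (\<lambda>x::real. flat_exp (1 + (-1) * x\<^sup>2))"
    by (rule Ck_compose_real[OF Ck_flat_exp Ck_add[OF Ck_const Ck_mult[OF Ck_const sq]]])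
  then have fl: "Ck k (\<lambda>x::real. flat_exp (1 - x\<^sup>2))" by simp
  have id: "Ck k (\<lambda>x::real. x)" using Ck_inner[of k "1::real"] by simp
  have "Ck k (\<lambda>x. inverse (x\<^sup>2 + flat_exp (1 - x\<^sup>2)))"
    by (rule Ck_inverse[OF Ck_add[OF sq fl]]) (simp add: profile_denominator_pos[THEN less_imp_neq, symmetric])
  from Ck_mult[OF id this] show ?thesis by (simp add: profile_def[abs_def])
qed

lemma profile_outside: "\<bar>x\<bar> \<ge> 1 \<Longrightarrow> profile x = 1 / x"
proof -
  assume x: "\<bar>x\<bar> \<ge> 1"
  then have "x\<^sup>2 \<ge> 1" using abs_le_square_iff[of 1 x] by simp
  then have "flat_exp (1 - x\<^sup>2) = 0" by (simp add: flat_exp_zero)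
  moreover have "x \<noteq> 0" using x by auto
  ultimately show ?thesis by (simp add: profile_def power2_eq_square field_simps)
qed

lemma one_minus_profile:
  "0 \<le> 1 - x * profile x" "1 - x * profile x \<le> 1" "\<bar>x\<bar> \<ge> 1 \<Longrightarrow> 1 - x * profile x = 0"
proof -
  have d: "x\<^sup>2 + flat_exp (1 - x\<^sup>2) > 0" by (rule profile_denominator_pos)
  have "1 - x * profile x = flat_exp (1 - x\<^sup>2) / (x\<^sup>2 + flat_exp (1 - x\<^sup>2))"
    using d by (simp add: profile_def field_simps power2_eq_square)
  then show "0 \<le> 1 - x * profile x" "1 - x * profile x \<le> 1"
    using d flat_exp_nonneg[of "1 - x\<^sup>2"] by simp_all
  assume "\<bar>x\<bar> \<ge> 1"
  then show "1 - x * profile x = 0" by (subst profile_outside) auto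
qed

text \<open>On \<open>[-1, 1]\<close> by compactness, elsewhere because the function is \<open>1 / x\<close> there.\<close>

lemma profile_bounds:
  obtains A where "A \<ge> 1" "\<And>x. \<bar>profile x\<bar> \<le> A" "\<And>x y. \<bar>profile x - profile y\<bar> \<le> A * \<bar>x - y\<bar>"
proof -
  have c: "continuous_on UNIV profile" using Ck_profile[of 0] by simp
  have c': "continuous_on UNIV (\<lambda>x. frechet_derivative profile (at x) 1)"
    using Ck_Suc_derivative[OF Ck_profile[of "Suc 0"], of 1] by simp
  have "bounded (profile ` cball 0 1)" "bounded ((\<lambda>x. frechet_derivative profile (at x) 1) ` cball 0 1)"
    by (intro compact_imp_bounded compact_continuous_image continuous_on_subset[OF c] compact_cball subset_UNIV
        continuous_on_subset[OF c'])+
  then obtain A1 A2 where "\<forall>x\<in>cball 0 1. norm (profile x) \<le> A1"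
    "\<forall>x\<in>cball 0 1. norm (frechet_derivative profile (at x) 1) \<le> A2"
    unfolding bounded_iff by blast
  then have A: "\<And>x. \<bar>x\<bar> \<le> 1 \<Longrightarrow> \<bar>profile x\<bar> \<le> A1"
    "\<And>x. \<bar>x\<bar> \<le> 1 \<Longrightarrow> \<bar>frechet_derivative profile (at x) 1\<bar> \<le> A2"
    by simp_all
  define A where "A = max 1 (max A1 A2)"
  have b1: "\<bar>profile x\<bar> \<le> A" for x
  proof (cases "\<bar>x\<bar> \<le> 1")
    case True then show ?thesis using A(1)[of x] by (simp add: A_def)
  next
    case False
    then have "\<bar>profile x\<bar> \<le> 1" by (simp add: profile_outside divide_le_eq_1)
    then show ?thesis by (simp add: A_def)
  qed
  have b2: "\<bar>frechet_derivative profile (at x) 1\<bar> \<le> A" for x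
  proof (cases "\<bar>x\<bar> \<le> 1")
    case True then show ?thesis using A(2)[of x] by (simp add: A_def)
  next
    case False
    then have x0: "x \<noteq> 0" by auto
    have "((\<lambda>x. 1 / x) has_real_derivative - (1 / x\<^sup>2)) (at x)"
      using x0 by (auto intro!: derivative_eq_intros simp: power2_eq_square)
    then have "((\<lambda>x. 1 / x) has_derivative (\<lambda>u. - (1 / x\<^sup>2) * u)) (at x)"
      unfolding has_field_derivative_def .
    moreover have "open {x::real. \<bar>x\<bar> > 1}" by (intro open_Collect_less continuous_intros)
    ultimately have "(profile has_derivative (\<lambda>u. - (1 / x\<^sup>2) * u)) (at x)"
      by (rule has_derivative_transform_within_open) (use False in \<open>auto simp: profile_outside\<close>)
    then have "frechet_derivative profile (at x) = (\<lambda>u. - (1 / x\<^sup>2) * u)"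
      by (rule frechet_derivative_at[symmetric])
    moreover have "1 \<le> x\<^sup>2" using False abs_le_square_iff[of 1 x] by simp
    then have "1 / x\<^sup>2 \<le> 1" by (simp add: divide_le_eq_1)
    ultimately show ?thesis by (simp add: A_def le_max_iff_disj)
  qed
  show thesis
  proof (rule that[of A])
    show "A \<ge> 1" by (simp add: A_def)
    show "\<bar>profile x\<bar> \<le> A" for x by (rule b1)
    have der: "(profile has_derivative frechet_derivative profile (at x)) (at x)" for x
      by (rule Ck_Suc_has_derivative[OF Ck_profile[of "Suc 0"]])
    have "norm (profile x - profile y) \<le> A * norm (x - y)" for x y
    proof (rule differentiable_bound[OF convex_UNIV der])
      fix z show "onorm (frechet_derivative profile (at z)) \<le> A"
      proof (rule onorm_le)
        fix u
        have "frechet_derivative profile (at z) u = u * frechet_derivative profile (at z) 1"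
          using linear_cmul[OF bounded_linear.linear[OF has_derivative_bounded_linear[OF der]], of z u 1] by simp
        then show "norm (frechet_derivative profile (at z) u) \<le> A * norm u"
          using mult_left_mono[OF b2[of z], of "\<bar>u\<bar>"] by (simp add: abs_mult mult.commute)
      qed
    qed simp_all
    then show "\<bar>profile x - profile y\<bar> \<le> A * \<bar>x - y\<bar>" for x y by simp
  qed
qed

lemma derivative_le_Lipschitz:
  fixes f :: "'a::euclidean_space \<Rightarrow> real"
  assumes D: "(f has_derivative D) (at x)" and L: "\<And>x y. \<bar>f x - f y\<bar> \<le> L * norm (x - y)"
  shows "\<bar>D u\<bar> \<le> L * norm u"
proof -
  have "((\<lambda>t. x + t *\<^sub>R u) has_derivative (\<lambda>t. 0 + t *\<^sub>R u)) (at 0)"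
    by (intro has_derivative_add has_derivative_const bounded_linear_imp_has_derivative bounded_linear_scaleR_left)
  moreover have "(f has_derivative D) (at (x + 0 *\<^sub>R u))" using D by simp
  ultimately have "((\<lambda>t. f (x + t *\<^sub>R u)) has_derivative (\<lambda>t. D (0 + t *\<^sub>R u))) (at 0)"
    by (rule has_derivative_compose)
  moreover have "(\<lambda>t. D (0 + t *\<^sub>R u)) = (\<lambda>t. D u * t)"
    using linear_cmul[OF bounded_linear.linear[OF has_derivative_bounded_linear[OF D]]] by (auto simp: mult.commute)
  ultimately have "((\<lambda>t. f (x + t *\<^sub>R u)) has_real_derivative D u) (at 0)"
    by (simp add: has_field_derivative_def)
  then have "((\<lambda>t. (f (x + t *\<^sub>R u) - f x) / t) \<longlongrightarrow> D u) (at 0)"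
    by (simp add: DERIV_def)
  then have lim: "((\<lambda>t. \<bar>(f (x + t *\<^sub>R u) - f x) / t\<bar>) \<longlongrightarrow> \<bar>D u\<bar>) (at 0)" by (rule tendsto_rabs)
  show ?thesis
  proof (rule tendsto_upperbound[OF lim])
    show "\<forall>\<^sub>F t in at 0. \<bar>(f (x + t *\<^sub>R u) - f x) / t\<bar> \<le> L * norm u"
      unfolding eventually_at_filter
    proof (intro always_eventually allI impI)
      fix t :: real assume "t \<noteq> 0"
      then show "\<bar>(f (x + t *\<^sub>R u) - f x) / t\<bar> \<le> L * norm u"
        using L[of "x + t *\<^sub>R u" x] by (simp add: divide_le_eq mult_ac)
    qed
  qed simp
qed

text \<open>If the ball of radius \<open>e\<close> around \<open>v\<close> lies in the domain, then \<open>\<lambda>y. mollifier e (v - y)\<close> is a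
  test function there.\<close>

lemma conv_weak_derivative:
  fixes s :: "'v::euclidean_space \<Rightarrow> real"
  assumes e: "e > 0" and v: "norm v + e < R"
    and weak: "\<And>\<phi>. test_function (ball 0 R) \<phi> \<Longrightarrow>
      (\<integral>y. s y * frechet_derivative \<phi> (at y) j \<partial>lborel) = - (\<integral>y. d y * \<phi> y \<partial>lborel)"
  shows "conv (\<lambda>x. frechet_derivative (mollifier e) (at x) j) s v = conv (mollifier e) d v"
proof -
  let ?\<rho> = "mollifier e :: 'v \<Rightarrow> real"
  let ?\<phi> = "\<lambda>y. ?\<rho> (v + - y)"
  note sm = smooth_in_ball_mollifier[OF e, where 'a='v]
  have bl: "bounded_linear (\<lambda>y::'v. - y)" by (rule bounded_linear_minus[OF bounded_linear_ident])
  have "smooth_in_ball (norm v + e) ?\<phi>"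
    unfolding smooth_in_ball_def
  proof (intro conjI allI impI)
    show "Ck k ?\<phi>" for k by (rule Ck_compose_affine[OF smooth_in_ballD(1)[OF sm] bl])
    fix y :: 'v assume "norm y > norm v + e"
    then have "norm (v - y) > e" using norm_triangle_ineq2[of y v] by (simp add: norm_minus_commute)
    then show "?\<phi> y = 0" using smooth_in_ballD(2)[OF sm] by simp
  qed
  then have "test_function (ball 0 R) ?\<phi>"
    by (rule smooth_in_ball_test_function) (use v in auto)
  from weak[OF this]
  have w: "(\<integral>y. s y * frechet_derivative ?\<phi> (at y) j \<partial>lborel) = - (\<integral>y. d y * ?\<phi> y \<partial>lborel)" .
  have fd: "frechet_derivative ?\<phi> (at y) j = - frechet_derivative ?\<rho> (at (v - y)) j" for y
  proof -
    have "((\<lambda>y. v + - y) has_derivative (\<lambda>u. 0 + - u)) (at y)"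
      by (rule has_derivative_add[OF has_derivative_const bounded_linear_imp_has_derivative[OF bl]])
    then have "(?\<phi> has_derivative (\<lambda>u. frechet_derivative ?\<rho> (at (v + - y)) (0 + - u))) (at y)"
      by (rule has_derivative_compose) (rule smooth_in_ball_has_derivative[OF sm])
    then have "frechet_derivative ?\<phi> (at y) = (\<lambda>u. frechet_derivative ?\<rho> (at (v + - y)) (0 + - u))"
      by (rule frechet_derivative_at[symmetric])
    then show ?thesis
      using linear_neg[OF bounded_linear.linear[OF has_derivative_bounded_linear[OF smooth_in_ball_has_derivative[OF sm]]]]
      by simp
  qed
  show ?thesis using w unfolding fd conv_def by (simp add: mult.commute)
qed

lemma norm_integral_le_l2:
  fixes f :: "'v::euclidean_space \<Rightarrow> complex"
  assumes f: "square_integrable f" and g: "square_integrable (g :: 'v \<Rightarrow> real)"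
    and F: "(F :: 'v \<Rightarrow> complex) \<in> borel_measurable borel" "\<And>v. norm (F v) \<le> norm (f v) * norm (g v)"
  shows "integrable lborel F" "norm (\<integral>v. F v \<partial>lborel) \<le> l2 f * l2 g"
proof -
  note i = Cauchy_Schwarz_l2(1)[OF f g]
  show int: "integrable lborel F"
    by (rule Bochner_Integration.integrable_bound[OF i]) (use F in auto)
  have "norm (\<integral>v. F v \<partial>lborel) \<le> (\<integral>v. norm (f v) * norm (g v) \<partial>lborel)"
    by (rule Bochner_Integration.integral_norm_bound_integral[OF int i]) (use F in auto)
  then show "norm (\<integral>v. F v \<partial>lborel) \<le> l2 f * l2 g"
    using Cauchy_Schwarz_l2(2)[OF f g] by linarith
qed

lemma l2_scale:
  fixes f :: "'v::euclidean_space \<Rightarrow> real"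
  assumes f: "square_integrable f" and c: "c \<ge> 0"
  shows "square_integrable (\<lambda>v. c * f v)" "l2 (\<lambda>v. c * f v) = c * l2 f"
proof -
  show "square_integrable (\<lambda>v. c * f v)"
    using f by (auto simp: square_integrable_def power_mult_distrib)
  show "l2 (\<lambda>v. c * f v) = c * l2 f"
    using c by (simp add: l2_def power_mult_distrib real_sqrt_mult)
qed

text \<open>The situation at one frequency \<open>\<zeta>\<close>: \<open>s v\<close> is the symbol of the transport operator divided by
  \<open>\<i>\<close>, with weak derivatives \<open>ds\<close>, and \<open>H\<close>, \<open>E\<close> and \<open>g\<close> are the transforms of the solution and of the
  right hand side, which satisfy \<open>\<i> s H = E + div g\<close> weakly. The resonant layer \<open>\<bar>s v\<bar> \<le> \<delta>\<close> is
  treated separately.\<close>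

locale averaging_data =
  fixes R r S P D A \<delta> :: real
    and s :: "'v::euclidean_space \<Rightarrow> real" and ds :: "'v \<Rightarrow> 'v \<Rightarrow> real"
    and H E :: "'v \<Rightarrow> complex" and g :: "'v \<Rightarrow> 'v \<Rightarrow> complex" and \<psi> :: "'v \<Rightarrow> real"
  assumes r: "0 \<le> r" "r < R" and S: "S \<ge> 0" and P: "P \<ge> 0" and lam: "\<delta> > 0"
    and A: "A \<ge> 1" "\<And>x. \<bar>profile x\<bar> \<le> A"
      "\<And>x y. \<bar>profile x - profile y\<bar> \<le> A * \<bar>x - y\<bar>"
    and s: "s \<in> borel_measurable borel" "\<And>v. \<bar>s v\<bar> \<le> S" "\<And>v. norm v \<ge> R \<Longrightarrow> s v = 0"
    and ds: "\<And>j. j \<in> Basis \<Longrightarrow> square_integrable (ds j)" "\<And>j. j \<in> Basis \<Longrightarrow> l2 (ds j) \<le> D"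
      "\<And>j v. j \<in> Basis \<Longrightarrow> norm v \<ge> R \<Longrightarrow> ds j v = 0"
    and weak: "\<And>j \<phi>. j \<in> Basis \<Longrightarrow> test_function (ball 0 R) \<phi> \<Longrightarrow>
      (\<integral>y. s y * frechet_derivative \<phi> (at y) j \<partial>lborel) = - (\<integral>y. ds j y * \<phi> y \<partial>lborel)"
    and H: "square_integrable H" and E: "square_integrable E"
    and g: "\<And>j. j \<in> Basis \<Longrightarrow> square_integrable (g j)"
    and supp: "\<And>v. norm v \<ge> R \<Longrightarrow> H v = 0"
    and eq: "\<And>w. test_function (ball 0 R) w \<Longrightarrow>
      \<i> * (\<integral>v. complex_of_real (s v) * H v * complex_of_real (w v) \<partial>lborel) =
      (\<integral>v. E v * complex_of_real (w v) \<partial>lborel)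
      - (\<Sum>j\<in>Basis. \<integral>v. g j v * complex_of_real (frechet_derivative w (at v) j) \<partial>lborel)"
    and \<psi>: "integrable lborel \<psi>" "\<And>v. norm v > r \<Longrightarrow> \<psi> v = 0" "\<And>v. \<bar>\<psi> v\<bar> \<le> P"
      "\<And>v w. \<bar>\<psi> v - \<psi> w\<bar> \<le> P * norm (v - w)"
begin

abbreviation "B \<equiv> ball (0::'v) R"
abbreviation "thin \<equiv> sqrt (measure lborel {v \<in> ball (0::'v) R. \<bar>s v\<bar> \<le> \<delta>})"
definition "s_e e = conv (mollifier e) s"
definition "psi_e e = conv (mollifier e) \<psi>"
definition "G x = profile (x / \<delta>) / \<delta>"
text \<open>The regularised version of \<open>\<psi> / s\<close>.\<close>

definition "w_e e v = psi_e e v * G (s_e e v)"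
definition "kap e = (\<integral>v. indicator (ball 0 R) v * \<bar>s_e e v - s v\<bar> \<partial>lborel)"

lemma s_integrable: "integrable lborel s"
  by (rule integrable_bounded_support[OF s(1,2), where r=R]) (use s(3) in simp)

lemma ds_integrable: assumes j: "j \<in> Basis" shows "integrable lborel (ds j)"
proof -
  have "integrable lborel (\<lambda>v. norm (ds j v) * norm (indicator B v :: real))"
    by (rule Cauchy_Schwarz_l2(1)[OF ds(1)[OF j] l2_indicator(1)[OF _ emeasure_lborel_ball_finite]]) simp
  then show ?thesis
  proof (rule Bochner_Integration.integrable_bound)
    show "ds j \<in> borel_measurable lborel" using square_integrable_borel[OF ds(1)[OF j]] by simp
    show "AE v in lborel. norm (ds j v) \<le> norm (norm (ds j v) * norm (indicator B v :: real))"
      using ds(3)[OF j] by (intro AE_I2) (auto split: split_indicator simp: not_less)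
  qed
qed

lemma l2B: "square_integrable (indicator B :: 'v \<Rightarrow> real)" "l2 (indicator B :: 'v \<Rightarrow> real) = sqrt (measure lborel B)"
  by (rule l2_indicator[OF _ emeasure_lborel_ball_finite], simp)+

lemma s_e_le: assumes "e > 0" shows "\<bar>s_e e v\<bar> \<le> S"
  using conv_mollifier_le[OF assms s_integrable, of v 0 S] s(2) by (simp add: s_e_def)

lemma psi_e_le: assumes "e > 0" shows "\<bar>psi_e e v\<bar> \<le> P"
  using conv_mollifier_le[OF assms \<psi>(1), of v 0 P] \<psi>(3) by (simp add: psi_e_def)

lemma psi_e_near: assumes "e > 0" shows "\<bar>psi_e e v - \<psi> v\<bar> \<le> P * e"
  unfolding psi_e_def
proof (rule conv_mollifier_le[OF assms \<psi>(1)])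
  fix y :: 'v assume "norm y \<le> e"
  then show "\<bar>\<psi> (v - y) - \<psi> v\<bar> \<le> P * e"
    using \<psi>(4)[of "v - y" v] mult_left_mono[of "norm y" e P] P by simp
qed

lemma psi_e_smooth: assumes "e > 0" shows "smooth_in_ball (r + e) (psi_e e)"
  unfolding psi_e_def by (rule smooth_in_ball_conv[OF smooth_in_ball_mollifier[OF assms] \<psi>(1,2)])

lemma s_e_smooth: assumes "e > 0" shows "Ck k (s_e e)"
  unfolding s_e_def by (rule Ck_conv[OF smooth_in_ball_mollifier[OF assms] s_integrable])

lemma G_le: "\<bar>G x\<bar> \<le> A / \<delta>"
  using A(2)[of "x / \<delta>"] lam by (simp add: G_def divide_right_mono)

lemma G_Lipschitz: "\<bar>G x - G y\<bar> \<le> A / \<delta>\<^sup>2 * \<bar>x - y\<bar>"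
proof -
  have "\<bar>G x - G y\<bar> = \<bar>profile (x / \<delta>) - profile (y / \<delta>)\<bar> / \<delta>"
    using lam by (simp add: G_def diff_divide_distrib[symmetric])
  also have "\<dots> \<le> A * \<bar>x / \<delta> - y / \<delta>\<bar> / \<delta>"
    using A(3)[of "x / \<delta>" "y / \<delta>"] lam by (intro divide_right_mono) auto
  also have "\<dots> = A / \<delta>\<^sup>2 * \<bar>x - y\<bar>"
    using lam by (simp add: diff_divide_distrib[symmetric] power2_eq_square)
  finally show ?thesis .
qed

lemma Ck_G: "Ck k G"
proof -
  have "Ck k (\<lambda>x::real. profile (0 + x *\<^sub>R (1 / \<delta>)) * (1 / \<delta>))"
    by (rule Ck_mult[OF Ck_compose_affine[OF Ck_profile bounded_linear_scaleR_left] Ck_const])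
  then show ?thesis by (simp add: G_def[abs_def])
qed

lemma G_derivative: "\<bar>frechet_derivative G (at x) u\<bar> \<le> A / \<delta>\<^sup>2 * \<bar>u\<bar>"
  using derivative_le_Lipschitz[OF Ck_Suc_has_derivative[OF Ck_G[of "Suc 0"]], of "A / \<delta>\<^sup>2" x u] G_Lipschitz
  by simp

lemma w_e_smooth: assumes "e > 0" shows "smooth_in_ball (r + e) (w_e e)"
  unfolding w_e_def[abs_def]
  by (rule smooth_in_ball_mult[OF psi_e_smooth[OF assms] Ck_compose_real[OF Ck_G s_e_smooth[OF assms]]])

lemma w_e_le: assumes "e > 0" "r + e < R" shows "\<bar>w_e e v\<bar> \<le> P * A / \<delta> * indicator B v"
proof (cases "norm v < R")
  case True
  have "\<bar>psi_e e v\<bar> * \<bar>G (s_e e v)\<bar> \<le> P * (A / \<delta>)"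
    by (rule mult_mono[OF psi_e_le[OF assms(1)] G_le P]) simp
  then show ?thesis using True by (simp add: w_e_def abs_mult)
next
  case False
  then show ?thesis using smooth_in_ballD(2)[OF w_e_smooth[OF assms(1)], of v] assms(2) by simp
qed

lemma w_e_derivative_le:
  assumes e: "e > 0" "r + 2 * e < R" and j: "j \<in> Basis"
  shows "\<bar>frechet_derivative (w_e e) (at v) j\<bar>
    \<le> P * A / \<delta> * indicator B v + P * A / \<delta>\<^sup>2 * \<bar>conv (mollifier e) (ds j) v\<bar>"
proof (cases "norm v \<le> r + e")
  case True
  have ds: "(s_e e has_derivative frechet_derivative (s_e e) (at v)) (at v)"
    by (rule Ck_Suc_has_derivative[OF s_e_smooth[OF e(1), of "Suc 0"]])
  have dp: "(psi_e e has_derivative frechet_derivative (psi_e e) (at v)) (at v)"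
    by (rule smooth_in_ball_has_derivative[OF psi_e_smooth[OF e(1)]])
  have dG: "(G has_derivative frechet_derivative G (at x)) (at x)" for x
    by (rule Ck_Suc_has_derivative[OF Ck_G[of "Suc 0"]])
  have "((\<lambda>v. psi_e e v * G (s_e e v)) has_derivative
     (\<lambda>u. psi_e e v * frechet_derivative G (at (s_e e v)) (frechet_derivative (s_e e) (at v) u)
        + frechet_derivative (psi_e e) (at v) u * G (s_e e v))) (at v)"
    by (rule has_derivative_mult[OF dp has_derivative_compose[OF ds dG]])
  then have fd: "frechet_derivative (w_e e) (at v) =
     (\<lambda>u. psi_e e v * frechet_derivative G (at (s_e e v)) (frechet_derivative (s_e e) (at v) u)
        + frechet_derivative (psi_e e) (at v) u * G (s_e e v))"
    unfolding w_e_def[abs_def] by (rule frechet_derivative_at[symmetric])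
  have ss: "frechet_derivative (s_e e) (at v) j = conv (mollifier e) (ds j) v"
    unfolding s_e_def frechet_derivative_conv[OF smooth_in_ball_mollifier[OF e(1)] s_integrable]
    by (rule conv_weak_derivative[OF e(1) _ weak[OF j]]) (use True e in auto)
  have pp: "\<bar>frechet_derivative (psi_e e) (at v) j\<bar> \<le> P"
    using derivative_le_Lipschitz[OF dp, of P j] conv_mollifier_Lipschitz[OF e(1) \<psi>(1,4)] j
    by (simp add: psi_e_def)
  have "\<bar>psi_e e v\<bar> * \<bar>frechet_derivative G (at (s_e e v)) (frechet_derivative (s_e e) (at v) j)\<bar>
      \<le> P * (A / \<delta>\<^sup>2 * \<bar>conv (mollifier e) (ds j) v\<bar>)"
    using G_derivative[of "s_e e v" "frechet_derivative (s_e e) (at v) j"]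
    by (intro mult_mono psi_e_le[OF e(1)] P) (auto simp: ss)
  moreover have "\<bar>frechet_derivative (psi_e e) (at v) j\<bar> * \<bar>G (s_e e v)\<bar> \<le> P * (A / \<delta>)"
    by (rule mult_mono[OF pp G_le P]) simp
  moreover have "v \<in> B" using True e by simp
  ultimately show ?thesis unfolding fd by (simp add: abs_mult[symmetric] abs_le_iff)
next
  case False
  have "frechet_derivative (w_e e) (at v) j = 0"
    using smooth_in_ballD(2)[OF smooth_in_ball_derivative[OF w_e_smooth[OF e(1)]], of v j] False by simp
  then show ?thesis using P A(1) lam by simp
qed

lemma conv_ds_l2:
  assumes e: "e > 0" and j: "j \<in> Basis"
  shows "square_integrable (conv (mollifier e) (ds j))" "l2 (conv (mollifier e) (ds j)) \<le> D"
proof -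
  have D: "0 \<le> D" using ds(2)[OF j] l2_nonneg[of "ds j"] by linarith
  have "(\<integral>\<^sup>+ x. ennreal ((norm (conv (mollifier e) (ds j) x))\<^sup>2) \<partial>lborel) \<le> (\<integral>\<^sup>+y. ennreal ((norm (ds j y))\<^sup>2) \<partial>lborel)"
    using conv_mollifier_L2[OF e ds_integrable[OF j]] by simp
  also have "\<dots> = ennreal ((l2 (ds j))\<^sup>2)" by (rule l2_nn_integral[OF ds(1)[OF j]])
  also have "\<dots> \<le> ennreal (D\<^sup>2)"
    by (intro ennreal_leI power_mono ds(2)[OF j] l2_nonneg)
  finally show "square_integrable (conv (mollifier e) (ds j))" "l2 (conv (mollifier e) (ds j)) \<le> D"
    using l2_leI[OF conv_borel[OF e ds_integrable[OF j]] D] by blast+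
qed

text \<open>Here the equation is used, with \<open>w_e\<close> as test function.\<close>

lemma transported_part:
  assumes e: "e > 0" "r + 2 * e < R"
  shows "norm (\<integral>v. complex_of_real (s v) * H v * complex_of_real (w_e e v) \<partial>lborel)
    \<le> P * A * ((l2 E + (\<Sum>j\<in>Basis. l2 (g j))) * sqrt (measure lborel B) / \<delta> + (\<Sum>j\<in>Basis. l2 (g j)) * D / \<delta>\<^sup>2)"
proof -
  have e': "r + e < R" using e by simp
  have c: "P * A / \<delta> \<ge> 0" "P * A / \<delta>\<^sup>2 \<ge> 0" using P A(1) lam by auto
  have [measurable]: "w_e e \<in> borel_measurable borel" "E \<in> borel_measurable borel"
    "H \<in> borel_measurable borel" "s \<in> borel_measurable borel"
    using smooth_in_ball_borel[OF w_e_smooth[OF e(1)]] square_integrable_borel[OF E]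
      square_integrable_borel[OF H] s(1) by auto
  have "test_function (ball 0 R) (w_e e)"
    by (rule smooth_in_ball_test_function[OF w_e_smooth[OF e(1)]]) (use e' in auto)
  note eqw = eq[OF this]
  have "norm (\<integral>v. complex_of_real (s v) * H v * complex_of_real (w_e e v) \<partial>lborel)
      = norm (\<i> * (\<integral>v. complex_of_real (s v) * H v * complex_of_real (w_e e v) \<partial>lborel))"
    by (simp add: norm_mult)
  also have "\<dots> \<le> norm (\<integral>v. E v * complex_of_real (w_e e v) \<partial>lborel)
      + (\<Sum>j\<in>Basis. norm (\<integral>v. g j v * complex_of_real (frechet_derivative (w_e e) (at v) j) \<partial>lborel))"
    unfolding eqw by (rule order_trans[OF norm_triangle_ineq4 add_left_mono[OF norm_sum]])
  also have "\<dots> \<le> l2 E * (P * A / \<delta> * sqrt (measure lborel B))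
      + (\<Sum>j\<in>Basis. l2 (g j) * (P * A / \<delta> * sqrt (measure lborel B)) + l2 (g j) * (P * A / \<delta>\<^sup>2 * D))"
  proof (intro add_mono sum_mono)
    have "norm (\<integral>v. E v * complex_of_real (w_e e v) \<partial>lborel) \<le> l2 E * l2 (\<lambda>v. P * A / \<delta> * indicator B v :: real)"
    proof (rule norm_integral_le_l2(2)[OF E l2_scale(1)[OF l2B(1) c(1)]])
      show "norm (E v * complex_of_real (w_e e v)) \<le> norm (E v) * norm (P * A / \<delta> * indicator B v :: real)" for v
        using mult_left_mono[OF w_e_le[OF e(1) e', of v], of "norm (E v)"]
        unfolding norm_mult[of "E v"] real_norm_def abs_mult[of "P * A / \<delta>"] abs_of_nonneg[OF c(1)] by simp
    qed simp
    then show "norm (\<integral>v. E v * complex_of_real (w_e e v) \<partial>lborel) \<le> l2 E * (P * A / \<delta> * sqrt (measure lborel B))"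
      unfolding l2_scale(2)[OF l2B(1) c(1)] l2B(2) .
  next
    fix j :: 'v assume j: "j \<in> Basis"
    let ?d = "\<lambda>v. frechet_derivative (w_e e) (at v) j"
    let ?c = "conv (mollifier e) (ds j)"
    have [measurable]: "g j \<in> borel_measurable borel" "?d \<in> borel_measurable borel" "?c \<in> borel_measurable borel"
      using square_integrable_borel[OF g[OF j]] smooth_in_ball_borel[OF smooth_in_ball_derivative[OF w_e_smooth[OF e(1)]]]
        conv_borel[OF e(1) ds_integrable[OF j]] by auto
    have i1: "integrable lborel (\<lambda>v. norm (g j v) * norm (P * A / \<delta> * indicator B v :: real))"
      and b1: "(\<integral>v. norm (g j v) * norm (P * A / \<delta> * indicator B v :: real) \<partial>lborel) \<le> l2 (g j) * (P * A / \<delta> * sqrt (measure lborel B))"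
      using Cauchy_Schwarz_l2[OF g[OF j] l2_scale(1)[OF l2B(1) c(1)]]
      unfolding l2_scale(2)[OF l2B(1) c(1)] l2B(2) by blast+
    have i2: "integrable lborel (\<lambda>v. norm (g j v) * norm (P * A / \<delta>\<^sup>2 * ?c v))"
      and b2: "(\<integral>v. norm (g j v) * norm (P * A / \<delta>\<^sup>2 * ?c v) \<partial>lborel) \<le> l2 (g j) * (P * A / \<delta>\<^sup>2 * l2 ?c)"
      using Cauchy_Schwarz_l2[OF g[OF j] l2_scale(1)[OF conv_ds_l2(1)[OF e(1) j] c(2)]]
      unfolding l2_scale(2)[OF conv_ds_l2(1)[OF e(1) j] c(2)] by blast+
    have pt: "norm (g j v * complex_of_real (?d v))
        \<le> norm (g j v) * norm (P * A / \<delta> * indicator B v :: real) + norm (g j v) * norm (P * A / \<delta>\<^sup>2 * ?c v)" for v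
    proof -
      have "norm (g j v * complex_of_real (?d v)) = norm (g j v) * \<bar>?d v\<bar>" by (simp add: norm_mult)
      also have "\<dots> \<le> norm (g j v) * (P * A / \<delta> * indicator B v + P * A / \<delta>\<^sup>2 * \<bar>?c v\<bar>)"
        by (intro mult_left_mono w_e_derivative_le[OF e j]) simp
      also have "\<dots> = norm (g j v) * norm (P * A / \<delta> * indicator B v :: real) + norm (g j v) * norm (P * A / \<delta>\<^sup>2 * ?c v)"
        unfolding distrib_left real_norm_def abs_mult[of "P * A / \<delta>"] abs_mult[of "P * A / \<delta>\<^sup>2"]
          abs_of_nonneg[OF c(1)] abs_of_nonneg[OF c(2)] by simp
      finally show ?thesis .
    qed
    have "integrable lborel (\<lambda>v. g j v * complex_of_real (?d v))"
    proof (rule Bochner_Integration.integrable_bound[OF Bochner_Integration.integrable_add[OF i1 i2]])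
      show "AE v in lborel. norm (g j v * complex_of_real (?d v)) \<le>
         norm (norm (g j v) * norm (P * A / \<delta> * indicator B v :: real) + norm (g j v) * norm (P * A / \<delta>\<^sup>2 * ?c v))"
        by (intro AE_I2 order_trans[OF pt]) simp
    qed simp
    then have "norm (\<integral>v. g j v * complex_of_real (?d v) \<partial>lborel)
        \<le> (\<integral>v. norm (g j v) * norm (P * A / \<delta> * indicator B v :: real) + norm (g j v) * norm (P * A / \<delta>\<^sup>2 * ?c v) \<partial>lborel)"
      using i1 i2 pt by (intro Bochner_Integration.integral_norm_bound_integral Bochner_Integration.integrable_add)
    also have "\<dots> \<le> l2 (g j) * (P * A / \<delta> * sqrt (measure lborel B)) + l2 (g j) * (P * A / \<delta>\<^sup>2 * l2 ?c)"
      using b1 b2 i1 i2 by simp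
    also have "\<dots> \<le> l2 (g j) * (P * A / \<delta> * sqrt (measure lborel B)) + l2 (g j) * (P * A / \<delta>\<^sup>2 * D)"
      by (intro add_left_mono mult_left_mono conv_ds_l2(2)[OF e(1) j] c l2_nonneg)
    finally show "norm (\<integral>v. g j v * complex_of_real (?d v) \<partial>lborel)
      \<le> l2 (g j) * (P * A / \<delta> * sqrt (measure lborel B)) + l2 (g j) * (P * A / \<delta>\<^sup>2 * D)" .
  qed
  also have "\<dots> = P * A * ((l2 E + (\<Sum>j\<in>Basis. l2 (g j))) * sqrt (measure lborel B) / \<delta> + (\<Sum>j\<in>Basis. l2 (g j)) * D / \<delta>\<^sup>2)"
    unfolding sum.distrib sum_distrib_right[symmetric] by (simp add: algebra_simps add_divide_distrib)
  finally show ?thesis .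
qed

lemma thin_measurable: "{v \<in> B. \<bar>s v\<bar> \<le> \<delta>} \<in> sets borel"
proof -
  have [measurable]: "s \<in> borel_measurable borel" by (rule s(1))
  have "{v \<in> space borel. \<bar>s v\<bar> \<le> \<delta>} \<in> sets borel" by measurable
  then have "{v. \<bar>s v\<bar> \<le> \<delta>} \<inter> B \<in> sets borel" by (intro sets.Int) auto
  then show ?thesis by (simp add: Int_def conj_commute)
qed

lemma thin_l2:
  shows "square_integrable (indicator {v \<in> B. \<bar>s v\<bar> \<le> \<delta>} :: 'v \<Rightarrow> real)"
    and "l2 (indicator {v \<in> B. \<bar>s v\<bar> \<le> \<delta>} :: 'v \<Rightarrow> real) = thin"
proof -
  have "emeasure lborel {v \<in> B. \<bar>s v\<bar> \<le> \<delta>} \<le> emeasure lborel B"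
    by (rule emeasure_mono) auto
  also have "\<dots> < \<infinity>" by (rule emeasure_lborel_ball_finite)
  finally have fin: "emeasure lborel {v \<in> B. \<bar>s v\<bar> \<le> \<delta>} < \<infinity>" .
  show "square_integrable (indicator {v \<in> B. \<bar>s v\<bar> \<le> \<delta>} :: 'v \<Rightarrow> real)"
    "l2 (indicator {v \<in> B. \<bar>s v\<bar> \<le> \<delta>} :: 'v \<Rightarrow> real) = thin"
    by (rule l2_indicator[OF thin_measurable fin])+
qed

text \<open>As both functions are bounded by \<open>S\<close>, convergence in the mean entails convergence in the mean
  square.\<close>

lemma diff_l2:
  assumes e: "e > 0"
  shows "square_integrable (\<lambda>v. indicator B v * (s v - s_e e v))"
    and "l2 (\<lambda>v. indicator B v * (s v - s_e e v)) \<le> sqrt (2 * S * kap e)"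
proof -
  have [measurable]: "s \<in> borel_measurable borel" "s_e e \<in> borel_measurable borel"
    using s(1) conv_borel[OF e s_integrable] by (auto simp: s_e_def)
  have i0: "integrable lborel (s_e e)"
    unfolding s_e_def by (rule conv_mollifier_integrable_L1[OF e s_integrable])
  have "integrable lborel (\<lambda>v. indicator B v *\<^sub>R \<bar>s_e e v - s v\<bar>)"
    using i0 s_integrable by (intro integrable_mult_indicator) auto
  then have i1: "integrable lborel (\<lambda>v. indicator B v * \<bar>s_e e v - s v\<bar>)" by simp
  have pt: "(norm (indicator B v * (s v - s_e e v)))\<^sup>2 \<le> 2 * S * (indicator B v * \<bar>s_e e v - s v\<bar>)" for v
  proof -
    have "\<bar>s v - s_e e v\<bar> * \<bar>s v - s_e e v\<bar> \<le> (2 * S) * \<bar>s v - s_e e v\<bar>"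
      using s(2)[of v] s_e_le[OF e, of v] by (intro mult_right_mono) auto
    then show ?thesis
      by (auto simp: power2_eq_square abs_minus_commute split: split_indicator)
  qed
  have mU: "(\<lambda>v. indicator B v * (s v - s_e e v)) \<in> borel_measurable borel"
    by (intro borel_measurable_times borel_measurable_indicator borel_measurable_diff) (simp_all add: s(1))
  then have mU2: "(\<lambda>v. (norm (indicator B v * (s v - s_e e v)))\<^sup>2) \<in> borel_measurable borel"
    by (rule borel_measurable_power[OF measurable_compose[OF _ borel_measurable_norm]])
  show sq: "square_integrable (\<lambda>v. indicator B v * (s v - s_e e v))"
    unfolding square_integrable_def
  proof
    show "integrable lborel (\<lambda>v. (norm (indicator B v * (s v - s_e e v)))\<^sup>2)"
    proof (rule Bochner_Integration.integrable_bound[OF integrable_mult_right[OF i1, of "2 * S"]])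
      show "AE v in lborel. norm ((norm (indicator B v * (s v - s_e e v)))\<^sup>2) \<le>
        norm (2 * S * (indicator B v * \<bar>s_e e v - s v\<bar>))"
      proof (rule AE_I2)
        fix v
        have "norm ((norm (indicator B v * (s v - s_e e v)))\<^sup>2) = (norm (indicator B v * (s v - s_e e v)))\<^sup>2"
          by simp
        also note pt
        also have "2 * S * (indicator B v * \<bar>s_e e v - s v\<bar>) \<le> norm (2 * S * (indicator B v * \<bar>s_e e v - s v\<bar>))"
          unfolding real_norm_def by (rule abs_ge_self)
        finally show "norm ((norm (indicator B v * (s v - s_e e v)))\<^sup>2) \<le>
          norm (2 * S * (indicator B v * \<bar>s_e e v - s v\<bar>))" .
      qed
    qed (use mU2 in simp)
  qed (rule mU)
  have "(\<integral>v. (norm (indicator B v * (s v - s_e e v)))\<^sup>2 \<partial>lborel) \<le> (\<integral>v. 2 * S * (indicator B v * \<bar>s_e e v - s v\<bar>) \<partial>lborel)"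
    using sq i1 pt by (intro integral_mono) (auto simp: square_integrable_def)
  then show "l2 (\<lambda>v. indicator B v * (s v - s_e e v)) \<le> sqrt (2 * S * kap e)"
    by (simp add: l2_def kap_def)
qed

text \<open>Decompose \<open>\<psi> = (\<psi> - psi_e) + psi_e (1 - s G (s_e)) + s w_e\<close>. The first term is small with \<open>e\<close>,
  the third is \<open>transported_part\<close>. In the second, \<open>1 - s G (s)\<close> is at most one and lives on the
  resonant layer, while \<open>s (G (s) - G (s_e))\<close> is small with \<open>e\<close>.\<close>

lemma average_le_mollified:
  assumes e: "e > 0" "r + 2 * e < R"
  shows "norm (\<integral>v. H v * complex_of_real (\<psi> v) \<partial>lborel)
    \<le> l2 H * (P * e * sqrt (measure lborel B)) + (l2 H * (P * thin) + l2 H * (P * S * A / \<delta>\<^sup>2 * sqrt (2 * S * kap e)))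
      + P * A * ((l2 E + (\<Sum>j\<in>Basis. l2 (g j))) * sqrt (measure lborel B) / \<delta> + (\<Sum>j\<in>Basis. l2 (g j)) * D / \<delta>\<^sup>2)"
proof -
  have [measurable]: "s \<in> borel_measurable borel" "s_e e \<in> borel_measurable borel"
    "H \<in> borel_measurable borel" "\<psi> \<in> borel_measurable borel" "psi_e e \<in> borel_measurable borel"
    "w_e e \<in> borel_measurable borel"
    using s(1) conv_borel[OF e(1) s_integrable] square_integrable_borel[OF H] \<psi>(1)
      smooth_in_ball_borel[OF psi_e_smooth[OF e(1)]] smooth_in_ball_borel[OF w_e_smooth[OF e(1)]]
    by (auto simp: s_e_def)
  let ?X1 = "\<lambda>v. H v * complex_of_real (\<psi> v - psi_e e v)"
  let ?X2 = "\<lambda>v. H v * complex_of_real (psi_e e v * (1 - s v * G (s_e e v)))"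
  let ?X3 = "\<lambda>v. complex_of_real (s v) * H v * complex_of_real (w_e e v)"
  have cP: "P * e \<ge> 0" "P * S * A / \<delta>\<^sup>2 \<ge> 0" using P e S A(1) by auto
  have gm: "G \<in> borel_measurable borel"
    using Ck_G[of 0] by (auto intro: borel_measurable_continuous_onI)
  have [measurable]: "(\<lambda>v. G (s_e e v)) \<in> borel_measurable borel"
    by (rule measurable_compose[OF _ gm]) measurable
  have x1: "integrable lborel ?X1" "norm (\<integral>v. ?X1 v \<partial>lborel) \<le> l2 H * (P * e * sqrt (measure lborel B))"
  proof -
    have m1: "?X1 \<in> borel_measurable borel" by measurable
    have b1: "norm (?X1 v) \<le> norm (H v) * norm (P * e * indicator B v :: real)" for v
    proof (cases "norm v < R")
      case True
      then show ?thesis using psi_e_near[OF e(1), of v] cP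
        by (auto simp: norm_mult abs_minus_commute intro!: mult_left_mono simp del: of_real_diff)
    next
      case False
      then show ?thesis using supp[of v] by simp
    qed
    show "integrable lborel ?X1" "norm (\<integral>v. ?X1 v \<partial>lborel) \<le> l2 H * (P * e * sqrt (measure lborel B))"
      using norm_integral_le_l2[OF H l2_scale(1)[OF l2B(1) cP(1)] m1 b1]
      unfolding l2_scale(2)[OF l2B(1) cP(1)] l2B(2) by blast+
  qed
  let ?T = "\<lambda>v. indicator {v \<in> B. \<bar>s v\<bar> \<le> \<delta>} v :: real"
  let ?U = "\<lambda>v. indicator B v * (s v - s_e e v)"
  have x2: "integrable lborel ?X2"
    "norm (\<integral>v. ?X2 v \<partial>lborel) \<le> l2 H * (P * thin) + l2 H * (P * S * A / \<delta>\<^sup>2 * sqrt (2 * S * kap e))"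
  proof -
    note i1 = Cauchy_Schwarz_l2[OF H l2_scale(1)[OF thin_l2(1) P], unfolded l2_scale(2)[OF thin_l2(1) P] thin_l2(2)]
    note i2 = Cauchy_Schwarz_l2[OF H l2_scale(1)[OF diff_l2(1)[OF e(1)] cP(2)], unfolded l2_scale(2)[OF diff_l2(1)[OF e(1)] cP(2)]]
    have pt: "norm (?X2 v) \<le> norm (H v) * norm (P * ?T v) + norm (H v) * norm (P * S * A / \<delta>\<^sup>2 * ?U v)" for v
    proof (cases "norm v < R")
      case False
      then show ?thesis using supp[of v] by simp
    next
      case True
      have sG: "s v * G (s v) = (s v / \<delta>) * profile (s v / \<delta>)"
        by (simp add: G_def)
      have a: "\<bar>1 - s v * G (s v)\<bar> \<le> ?T v"
        using one_minus_profile[of "s v / \<delta>"] lam True unfolding sG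
        by (auto split: split_indicator simp: abs_of_nonneg le_divide_eq_1 not_le)
      have "\<bar>s v\<bar> * \<bar>G (s v) - G (s_e e v)\<bar> \<le> S * (A / \<delta>\<^sup>2 * \<bar>s v - s_e e v\<bar>)"
        by (rule mult_mono[OF s(2) G_Lipschitz S]) simp
      then have b: "\<bar>s v * (G (s v) - G (s_e e v))\<bar> \<le> S * (A / \<delta>\<^sup>2 * \<bar>s v - s_e e v\<bar>)"
        by (simp add: abs_mult)
      have "1 - s v * G (s_e e v) = (1 - s v * G (s v)) + s v * (G (s v) - G (s_e e v))"
        by (simp add: algebra_simps)
      then have "\<bar>1 - s v * G (s_e e v)\<bar> \<le> ?T v + S * (A / \<delta>\<^sup>2 * \<bar>s v - s_e e v\<bar>)"
        using a b by linarith
      then have "\<bar>psi_e e v\<bar> * \<bar>1 - s v * G (s_e e v)\<bar> \<le> P * (?T v + S * (A / \<delta>\<^sup>2 * \<bar>s v - s_e e v\<bar>))"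
        by (intro mult_mono psi_e_le[OF e(1)] P) auto
      also have "\<dots> = norm (P * ?T v) + norm (P * S * A / \<delta>\<^sup>2 * ?U v)"
        using True P S A(1) by (simp add: abs_mult distrib_left)
      finally have "norm (H v) * (\<bar>psi_e e v\<bar> * \<bar>1 - s v * G (s_e e v)\<bar>)
          \<le> norm (H v) * (norm (P * ?T v) + norm (P * S * A / \<delta>\<^sup>2 * ?U v))"
        by (rule mult_left_mono) simp
      then show ?thesis by (simp add: norm_mult abs_mult distrib_left del: of_real_diff of_real_mult)
    qed
    show int: "integrable lborel ?X2"
    proof (rule Bochner_Integration.integrable_bound[OF Bochner_Integration.integrable_add[OF i1(1) i2(1)]])
      show "AE v in lborel. norm (?X2 v) \<le> norm (norm (H v) * norm (P * ?T v) + norm (H v) * norm (P * S * A / \<delta>\<^sup>2 * ?U v))"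
        by (intro AE_I2 order_trans[OF pt]) simp
    qed measurable
    have "norm (\<integral>v. ?X2 v \<partial>lborel) \<le> (\<integral>v. norm (H v) * norm (P * ?T v) + norm (H v) * norm (P * S * A / \<delta>\<^sup>2 * ?U v) \<partial>lborel)"
      by (rule Bochner_Integration.integral_norm_bound_integral[OF int Bochner_Integration.integrable_add[OF i1(1) i2(1)] pt])
    also have "\<dots> \<le> l2 H * (P * thin) + l2 H * (P * S * A / \<delta>\<^sup>2 * l2 ?U)"
      using i1 i2 by simp
    also have "\<dots> \<le> l2 H * (P * thin) + l2 H * (P * S * A / \<delta>\<^sup>2 * sqrt (2 * S * kap e))"
      by (intro add_left_mono mult_left_mono diff_l2(2)[OF e(1)] cP l2_nonneg)
    finally show "norm (\<integral>v. ?X2 v \<partial>lborel) \<le> l2 H * (P * thin) + l2 H * (P * S * A / \<delta>\<^sup>2 * sqrt (2 * S * kap e))" .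
  qed
  have x3: "integrable lborel ?X3"
  proof -
    have c: "S * (P * A / \<delta>) \<ge> 0" using P S A(1) lam by auto
    show ?thesis
    proof (rule norm_integral_le_l2(1)[OF H l2_scale(1)[OF l2B(1) c]])
      show "norm (?X3 v) \<le> norm (H v) * norm (S * (P * A / \<delta>) * indicator B v :: real)" for v
      proof -
        have "\<bar>s v\<bar> * \<bar>w_e e v\<bar> \<le> S * (P * A / \<delta> * indicator B v)"
          by (rule mult_mono[OF s(2) w_e_le[OF e(1)] S]) (use e in auto)
        also have "\<dots> = norm (S * (P * A / \<delta>) * indicator B v :: real)"
          unfolding real_norm_def abs_mult[of "S * (P * A / \<delta>)"] abs_of_nonneg[OF c] by simp
        finally have "norm (H v) * (\<bar>s v\<bar> * \<bar>w_e e v\<bar>) \<le> norm (H v) * norm (S * (P * A / \<delta>) * indicator B v :: real)"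
          by (rule mult_left_mono) simp
        then show ?thesis by (simp add: norm_mult mult_ac)
      qed
    qed measurable
  qed
  have "H v * complex_of_real (\<psi> v) = ?X1 v + ?X2 v + ?X3 v" for v
    by (simp add: w_e_def algebra_simps)
  then have "(\<integral>v. H v * complex_of_real (\<psi> v) \<partial>lborel) = (\<integral>v. ?X1 v + ?X2 v + ?X3 v \<partial>lborel)"
    by (simp only:)
  also have "\<dots> = (\<integral>v. ?X1 v + ?X2 v \<partial>lborel) + (\<integral>v. ?X3 v \<partial>lborel)"
    by (rule Bochner_Integration.integral_add[OF Bochner_Integration.integrable_add[OF x1(1) x2(1)] x3])
  also have "(\<integral>v. ?X1 v + ?X2 v \<partial>lborel) = (\<integral>v. ?X1 v \<partial>lborel) + (\<integral>v. ?X2 v \<partial>lborel)"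
    by (rule Bochner_Integration.integral_add[OF x1(1) x2(1)])
  finally have "norm (\<integral>v. H v * complex_of_real (\<psi> v) \<partial>lborel)
      \<le> norm (\<integral>v. ?X1 v \<partial>lborel) + norm (\<integral>v. ?X2 v \<partial>lborel) + norm (\<integral>v. ?X3 v \<partial>lborel)"
    by (simp only: norm_triangle_le[OF add_right_mono[OF norm_triangle_ineq]])
  also have "\<dots> \<le> l2 H * (P * e * sqrt (measure lborel B)) + (l2 H * (P * thin) + l2 H * (P * S * A / \<delta>\<^sup>2 * sqrt (2 * S * kap e)))
      + P * A * ((l2 E + (\<Sum>j\<in>Basis. l2 (g j))) * sqrt (measure lborel B) / \<delta> + (\<Sum>j\<in>Basis. l2 (g j)) * D / \<delta>\<^sup>2)"
    by (rule add_mono[OF add_mono[OF x1(2) x2(2)] transported_part[OF e]])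
  finally show ?thesis .
qed

theorem average_le:
  "norm (\<integral>v. H v * complex_of_real (\<psi> v) \<partial>lborel)
    \<le> P * A * (l2 H * thin + (l2 E + (\<Sum>j\<in>Basis. l2 (g j))) * sqrt (measure lborel B) / \<delta> + (\<Sum>j\<in>Basis. l2 (g j)) * D / \<delta>\<^sup>2)"
proof -
  let ?Y = "P * A * ((l2 E + (\<Sum>j\<in>Basis. l2 (g j))) * sqrt (measure lborel B) / \<delta> + (\<Sum>j\<in>Basis. l2 (g j)) * D / \<delta>\<^sup>2)"
  let ?F = "\<lambda>e. l2 H * (P * e * sqrt (measure lborel B)) + (l2 H * (P * thin) + l2 H * (P * S * A / \<delta>\<^sup>2 * sqrt (2 * S * kap e))) + ?Y"
  have k: "(kap \<longlongrightarrow> 0) (at_right 0)"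
    unfolding kap_def[abs_def] s_e_def by (rule conv_mollifier_tendsto_L1[OF s_integrable])
  have "(?F \<longlongrightarrow> l2 H * (P * 0 * sqrt (measure lborel B)) + (l2 H * (P * thin) + l2 H * (P * S * A / \<delta>\<^sup>2 * sqrt (2 * S * 0))) + ?Y) (at_right 0)"
    by (intro tendsto_add tendsto_mult tendsto_const tendsto_real_sqrt k tendsto_ident_at)
  then have lim: "(?F \<longlongrightarrow> l2 H * (P * thin) + ?Y) (at_right 0)" by simp
  have "eventually (\<lambda>e. 0 < e \<and> e < (R - r) / 2) (at_right (0::real))"
    using r by (auto simp: eventually_at_right_field intro!: exI[of _ "(R - r) / 2"])
  then have ev: "\<forall>\<^sub>F e in at_right 0. norm (\<integral>v. H v * complex_of_real (\<psi> v) \<partial>lborel) \<le> ?F e"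
    proof eventually_elim
    case (elim e)
    then show ?case by (intro average_le_mollified) auto
  qed
  have "norm (\<integral>v. H v * complex_of_real (\<psi> v) \<partial>lborel) \<le> l2 H * (P * thin) + ?Y"
    by (rule tendsto_lowerbound[OF lim ev]) simp
  also have "l2 H * (P * thin) \<le> P * A * (l2 H * thin)"
    using mult_right_mono[of 1 A "P * (l2 H * thin)"] A(1) P l2_nonneg[of H] by (simp add: mult_ac)
  finally show ?thesis by (simp add: distrib_left add.assoc)
qed

end

section \<open>The Fourier transform on square integrable functions\<close>

definition ft :: "('a::euclidean_space \<Rightarrow> complex) \<Rightarrow> 'a \<Rightarrow> complex" where
  "ft f \<zeta> = (\<integral>x. cis (- (x \<bullet> \<zeta>)) * f x \<partial>lborel)"

lemma cis_borel [measurable]: "cis \<in> borel_measurable borel"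
  by (intro borel_measurable_continuous_onI continuous_on_cis continuous_on_id)

lemma cnj_borel [measurable]: "cnj \<in> borel_measurable borel"
  by (intro borel_measurable_continuous_onI continuous_on_cnj continuous_on_id)

lemma ft_borel [measurable]:
  assumes [measurable]: "f \<in> borel_measurable borel"
  shows "ft f \<in> borel_measurable borel"
  unfolding ft_def[abs_def] by measurable

lemma ft_integrand_integrable:
  assumes f: "integrable lborel f"
  shows "integrable lborel (\<lambda>x. cis (- (x \<bullet> \<zeta>)) * f x)"
proof -
  have [measurable]: "f \<in> borel_measurable borel" using f by simp
  show ?thesis
    by (rule Bochner_Integration.integrable_bound[OF f]) (auto simp: norm_mult)
qed

lemma ft_diff:
  assumes "integrable lborel f" "integrable lborel g"
  shows "ft (\<lambda>x. f x - g x) \<zeta> = ft f \<zeta> - ft g \<zeta>"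
  unfolding ft_def right_diff_distrib
  by (rule Bochner_Integration.integral_diff[OF ft_integrand_integrable[OF assms(1)] ft_integrand_integrable[OF assms(2)]])

lemma ft_norm_le:
  assumes "integrable lborel f" shows "norm (ft f \<zeta>) \<le> (\<integral>x. norm (f x) \<partial>lborel)"
proof -
  have "norm (ft f \<zeta>) \<le> (\<integral>x. norm (cis (- (x \<bullet> \<zeta>)) * f x) \<partial>lborel)"
    unfolding ft_def by (rule integral_norm_bound)
  then show ?thesis by (simp add: norm_mult)
qed

lemma norm_integral_le_nn:
  fixes f :: "'a \<Rightarrow> complex"
  shows "ennreal (norm (\<integral>x. f x \<partial>M)) \<le> (\<integral>\<^sup>+x. ennreal (norm (f x)) \<partial>M)"
proof (cases "integrable M f")
  case True then show ?thesis by (rule integral_norm_bound_ennreal)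
next
  case False then show ?thesis by (simp add: not_integrable_integral_eq)
qed

text \<open>A Gaussian of width \<open>1 / \<epsilon>\<close> and its Fourier integral (\<open>gaussian_fourier\<close>).\<close>

definition gauss :: "real \<Rightarrow> 'a::euclidean_space \<Rightarrow> real" where
  "gauss \<epsilon> \<zeta> = (\<Prod>b\<in>Basis. exp (- (\<epsilon> * (\<zeta> \<bullet> b))\<^sup>2 / 2))"

definition gauss_dual :: "real \<Rightarrow> 'a::euclidean_space \<Rightarrow> real" where
  "gauss_dual \<epsilon> y = (\<Prod>b\<in>Basis. sqrt (2 * pi) / \<epsilon> * exp (- ((y \<bullet> b) / \<epsilon>)\<^sup>2 / 2))"

lemma gauss_bounds: "0 < gauss \<epsilon> \<zeta>" "gauss \<epsilon> \<zeta> \<le> 1"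
  unfolding gauss_def by (auto intro!: prod_pos prod_le_1)

lemma gauss_dual_nonneg: "\<epsilon> > 0 \<Longrightarrow> 0 \<le> gauss_dual \<epsilon> y"
  unfolding gauss_dual_def by (auto intro!: prod_nonneg)

lemma gauss_borel [measurable]: "gauss \<epsilon> \<in> borel_measurable borel"
  unfolding gauss_def[abs_def] by measurable

lemma gauss_dual_borel [measurable]: "gauss_dual \<epsilon> \<in> borel_measurable borel"
  unfolding gauss_dual_def[abs_def] by measurable

text \<open>Rescaling of the characteristic function of the standard normal distribution.\<close>

lemma gaussian_fourier_real:
  fixes \<epsilon> y :: real
  assumes \<epsilon>: "\<epsilon> > 0"
  shows "integrable lborel (\<lambda>t. cis (- (y * t)) * complex_of_real (exp (- (\<epsilon> * t)\<^sup>2 / 2)))"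
    and "(\<integral>t. cis (- (y * t)) * complex_of_real (exp (- (\<epsilon> * t)\<^sup>2 / 2)) \<partial>lborel)
      = complex_of_real (sqrt (2 * pi) / \<epsilon> * exp (- (y / \<epsilon>)\<^sup>2 / 2))"
proof -
  let ?s = "- y / \<epsilon>"
  let ?f = "\<lambda>x. complex_of_real (std_normal_density x) * iexp (?s * x)"
  have int0: "integrable lborel (\<lambda>x. std_normal_density x *\<^sub>R iexp (?s * x))"
  proof (rule Bochner_Integration.integrable_bound)
    show "integrable lborel (\<lambda>x. std_normal_density x)" by (rule integrable_normal_density) simp
    show "AE x in lborel. norm (std_normal_density x *\<^sub>R iexp (?s * x)) \<le> norm (std_normal_density x)"
      by (intro AE_I2) (simp add: norm_exp_i_times)
  qed simp
  then have int: "integrable lborel ?f" by (simp add: scaleR_conv_of_real)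
  have "char std_normal_distribution ?s = (\<integral>x. std_normal_density x *\<^sub>R iexp (?s * x) \<partial>lborel)"
    unfolding char_def by (subst integral_density) (auto simp: normal_density_nonneg)
  then have val: "(\<integral>x. ?f x \<partial>lborel) = complex_of_real (exp (- ?s\<^sup>2 / 2))"
    by (simp add: char_std_normal_distribution scaleR_conv_of_real)
  have f: "?f (0 + \<epsilon> * t) = complex_of_real (1 / sqrt (2 * pi)) *
      (cis (- (y * t)) * complex_of_real (exp (- (\<epsilon> * t)\<^sup>2 / 2)))" for t
    using \<epsilon> by (simp add: normal_density_def cis_conv_exp field_simps)
  have "integrable lborel (\<lambda>t. ?f (0 + \<epsilon> * t))"
    using lborel_integrable_real_affine[OF int, of \<epsilon> 0] \<epsilon> by simp
  then have "integrable lborel (\<lambda>t. complex_of_real (sqrt (2 * pi)) * ?f (0 + \<epsilon> * t))"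
    by (rule integrable_mult_right)
  moreover have "complex_of_real (sqrt (2 * pi)) * ?f (0 + \<epsilon> * t)
      = cis (- (y * t)) * complex_of_real (exp (- (\<epsilon> * t)\<^sup>2 / 2))" for t
    unfolding f by (simp flip: mult.assoc of_real_mult)
  ultimately show "integrable lborel (\<lambda>t. cis (- (y * t)) * complex_of_real (exp (- (\<epsilon> * t)\<^sup>2 / 2)))"
    by (simp only:)
  have "(\<integral>x. ?f x \<partial>lborel) = \<bar>\<epsilon>\<bar> *\<^sub>R (\<integral>t. ?f (0 + \<epsilon> * t) \<partial>lborel)"
    by (rule lborel_integral_real_affine) (use \<epsilon> in simp)
  then have "complex_of_real (exp (- ?s\<^sup>2 / 2)) = complex_of_real (\<epsilon> / sqrt (2 * pi)) *
      (\<integral>t. cis (- (y * t)) * complex_of_real (exp (- (\<epsilon> * t)\<^sup>2 / 2)) \<partial>lborel)"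
    unfolding val f using \<epsilon> by (simp add: scaleR_conv_of_real)
  then show "(\<integral>t. cis (- (y * t)) * complex_of_real (exp (- (\<epsilon> * t)\<^sup>2 / 2)) \<partial>lborel)
      = complex_of_real (sqrt (2 * pi) / \<epsilon> * exp (- (y / \<epsilon>)\<^sup>2 / 2))"
    using \<epsilon> by (simp add: field_simps power2_eq_square)
qed

lemma cis_sum: "finite I \<Longrightarrow> cis (\<Sum>i\<in>I. f i) = (\<Prod>i\<in>I. cis (f i))"
  by (induction I rule: finite_induct) (auto simp: cis_mult[symmetric])

lemma gaussian_fourier:
  fixes y :: "'a::euclidean_space"
  assumes \<epsilon>: "\<epsilon> > 0"
  shows "(\<integral>\<zeta>. cis (- (y \<bullet> \<zeta>)) * complex_of_real (gauss \<epsilon> \<zeta>) \<partial>lborel) = complex_of_real (gauss_dual \<epsilon> y)"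
proof -
  interpret product_sigma_finite "\<lambda>_::'a. lborel :: real measure" ..
  let ?f = "\<lambda>b t. cis (- ((y \<bullet> b) * t)) * complex_of_real (exp (- (\<epsilon> * t)\<^sup>2 / 2))"
  have eq: "cis (- (y \<bullet> \<zeta>)) * complex_of_real (gauss \<epsilon> \<zeta>) = (\<Prod>b\<in>Basis. ?f b (\<zeta> \<bullet> b))" for \<zeta>
  proof -
    have "- (y \<bullet> \<zeta>) = (\<Sum>b\<in>Basis. - ((y \<bullet> b) * (\<zeta> \<bullet> b)))"
      by (subst euclidean_inner) (simp add: sum_negf)
    then show ?thesis by (simp add: gauss_def cis_sum prod.distrib)
  qed
  have "(\<integral>\<zeta>. (\<Prod>b\<in>Basis. ?f b (\<zeta> \<bullet> b)) \<partial>lborel)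
      = (\<integral>x. (\<Prod>b\<in>Basis. ?f b ((\<Sum>i\<in>Basis. x i *\<^sub>R i) \<bullet> b)) \<partial>(\<Pi>\<^sub>M b\<in>Basis. lborel))"
    by (subst lborel_eq) (subst integral_distr; measurable)
  also have "\<dots> = (\<integral>x. (\<Prod>b\<in>Basis. ?f b (x b)) \<partial>(\<Pi>\<^sub>M b\<in>Basis. lborel))"
    by (simp add: inner_sum_left_Basis)
  also have "\<dots> = (\<Prod>b\<in>Basis. \<integral>t. ?f b t \<partial>lborel)"
    by (rule product_integral_prod[OF finite_Basis gaussian_fourier_real(1)[OF \<epsilon>]])
  also have "\<dots> = complex_of_real (gauss_dual \<epsilon> y)"
    unfolding gaussian_fourier_real(2)[OF \<epsilon>] gauss_dual_def by (simp add: of_real_prod)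
  finally show ?thesis unfolding eq .
qed

lemma nn_gaussian_real:
  fixes \<epsilon> :: real assumes \<epsilon>: "\<epsilon> > 0"
  shows "(\<integral>\<^sup>+t. ennreal (exp (- (\<epsilon> * t)\<^sup>2 / 2)) \<partial>lborel) = ennreal (sqrt (2 * pi) / \<epsilon>)"
proof -
  let ?g = "\<lambda>t. exp (- (\<epsilon> * t)\<^sup>2 / 2) :: real"
  have int: "integrable lborel ?g"
    using integrable_norm[OF gaussian_fourier_real(1)[OF \<epsilon>, of 0]] by (simp add: norm_mult)
  have "complex_of_real (\<integral>t. ?g t \<partial>lborel) = (\<integral>t. complex_of_real (?g t) \<partial>lborel)"
    by (rule integral_complex_of_real[symmetric])
  also have "\<dots> = complex_of_real (sqrt (2 * pi) / \<epsilon>)"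
    using gaussian_fourier_real(2)[OF \<epsilon>, of 0] by simp
  finally have "(\<integral>t. ?g t \<partial>lborel) = sqrt (2 * pi) / \<epsilon>" by (simp only: of_real_eq_iff)
  then show ?thesis by (subst nn_integral_eq_integral[OF int]) auto
qed

lemma gauss_integrable:
  assumes \<epsilon>: "\<epsilon> > 0" shows "integrable lborel (gauss \<epsilon> :: 'a::euclidean_space \<Rightarrow> real)"
proof (rule integrableI_bounded)
  have "(\<integral>\<^sup>+\<zeta>. ennreal (norm (gauss \<epsilon> (\<zeta>::'a))) \<partial>lborel)
      = (\<integral>\<^sup>+\<zeta>. (\<Prod>b\<in>Basis. ennreal (exp (- (\<epsilon> * ((\<zeta>::'a) \<bullet> b))\<^sup>2 / 2))) \<partial>lborel)"
    using gauss_bounds(1)[of \<epsilon>] by (intro nn_integral_cong) (simp add: gauss_def prod_ennreal abs_prod)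
  also have "\<dots> = (\<Prod>b\<in>(Basis::'a set). \<integral>\<^sup>+t. ennreal (exp (- (\<epsilon> * t)\<^sup>2 / 2)) \<partial>lborel)"
    by (rule nn_integral_lborel_prod) auto
  also have "\<dots> < \<infinity>"
    unfolding nn_gaussian_real[OF \<epsilon>] by (simp add: ennreal_power[symmetric] less_top[symmetric] ennreal_prod_eq_top power_eq_top_ennreal)
  finally show "(\<integral>\<^sup>+\<zeta>. ennreal (norm (gauss \<epsilon> (\<zeta>::'a))) \<partial>lborel) < \<infinity>" .
qed simp

lemma nn_gauss_dual:
  assumes \<epsilon>: "\<epsilon> > 0"
  shows "(\<integral>\<^sup>+y. ennreal (gauss_dual \<epsilon> (y::'a::euclidean_space)) \<partial>lborel) = ennreal ((2 * pi) ^ DIM('a))"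
proof -
  have "(\<integral>\<^sup>+y. ennreal (gauss_dual \<epsilon> (y::'a)) \<partial>lborel)
      = (\<integral>\<^sup>+y. (\<Prod>b\<in>Basis. ennreal (sqrt (2 * pi) / \<epsilon> * exp (- (((y::'a) \<bullet> b) / \<epsilon>)\<^sup>2 / 2))) \<partial>lborel)"
    unfolding gauss_dual_def using \<epsilon> by (subst prod_ennreal) auto
  also have "\<dots> = (\<Prod>b\<in>(Basis::'a set). \<integral>\<^sup>+t. ennreal (sqrt (2 * pi) / \<epsilon> * exp (- (t / \<epsilon>)\<^sup>2 / 2)) \<partial>lborel)"
    by (rule nn_integral_lborel_prod) (use \<epsilon> in auto)
  also have "(\<integral>\<^sup>+t. ennreal (sqrt (2 * pi) / \<epsilon> * exp (- (t / \<epsilon>)\<^sup>2 / 2)) \<partial>lborel) = ennreal (2 * pi)"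
  proof -
    have "(\<integral>\<^sup>+t. ennreal (sqrt (2 * pi) / \<epsilon> * exp (- (t / \<epsilon>)\<^sup>2 / 2)) \<partial>lborel)
        = (\<integral>\<^sup>+t. ennreal (sqrt (2 * pi) / \<epsilon>) * ennreal (exp (- ((1 / \<epsilon>) * t)\<^sup>2 / 2)) \<partial>lborel)"
    proof (rule nn_integral_cong)
      fix t
      have "t / \<epsilon> = (1 / \<epsilon>) * t" by simp
      then show "ennreal (sqrt (2 * pi) / \<epsilon> * exp (- (t / \<epsilon>)\<^sup>2 / 2))
          = ennreal (sqrt (2 * pi) / \<epsilon>) * ennreal (exp (- ((1 / \<epsilon>) * t)\<^sup>2 / 2))"
        using \<epsilon> by (simp only: ennreal_mult[symmetric]) (subst ennreal_mult[symmetric], simp_all)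
    qed
    also have "\<dots> = ennreal (sqrt (2 * pi) / \<epsilon>) * (\<integral>\<^sup>+t. ennreal (exp (- ((1 / \<epsilon>) * t)\<^sup>2 / 2)) \<partial>lborel)"
      by (rule nn_integral_cmult) measurable
    also have "\<dots> = ennreal (sqrt (2 * pi) / \<epsilon>) * ennreal (sqrt (2 * pi) / (1 / \<epsilon>))"
      by (subst nn_gaussian_real) (use \<epsilon> in simp, rule refl)
    also have "\<dots> = ennreal (sqrt (2 * pi) / \<epsilon> * (sqrt (2 * pi) / (1 / \<epsilon>)))"
      by (rule ennreal_mult[symmetric]) (use \<epsilon> in simp_all)
    also have "sqrt (2 * pi) / \<epsilon> * (sqrt (2 * pi) / (1 / \<epsilon>)) = 2 * pi"
      using \<epsilon> by (simp add: field_simps)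
    finally show ?thesis .
  qed
  finally show ?thesis by (simp add: ennreal_power)
qed

lemma pair_integrable_mult:
  fixes a :: "'a::euclidean_space \<Rightarrow> real" and b :: "'b::euclidean_space \<Rightarrow> real"
    and F :: "'a \<times> 'b \<Rightarrow> complex"
  assumes a: "integrable lborel a" and b: "integrable lborel b"
    and F: "F \<in> borel_measurable (lborel \<Otimes>\<^sub>M lborel)" "\<And>x y. norm (F (x, y)) \<le> \<bar>a x\<bar> * \<bar>b y\<bar>"
  shows "integrable (lborel \<Otimes>\<^sub>M lborel) F"
proof (rule integrableI_bounded[OF F(1)])
  have [measurable]: "a \<in> borel_measurable borel" "b \<in> borel_measurable borel" using a b by auto
  have "(\<integral>\<^sup>+p. ennreal (norm (F p)) \<partial>(lborel \<Otimes>\<^sub>M lborel))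
      \<le> (\<integral>\<^sup>+p. ennreal \<bar>a (fst p)\<bar> * ennreal \<bar>b (snd p)\<bar> \<partial>(lborel \<Otimes>\<^sub>M lborel))"
    using F(2) by (intro nn_integral_mono) (auto simp: ennreal_mult[symmetric] split: prod.splits)
  also have "\<dots> = (\<integral>\<^sup>+x. \<integral>\<^sup>+y. ennreal \<bar>a x\<bar> * ennreal \<bar>b y\<bar> \<partial>lborel \<partial>lborel)"
    by (subst lborel.nn_integral_fst[symmetric]) auto
  also have "\<dots> = (\<integral>\<^sup>+x. ennreal \<bar>a x\<bar> \<partial>lborel) * (\<integral>\<^sup>+y. ennreal \<bar>b y\<bar> \<partial>lborel)"
    by (simp add: nn_integral_cmult nn_integral_multc)
  also have "\<dots> < \<infinity>"
    using a b by (simp add: integrable_iff_bounded ennreal_mult_less_top)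
  finally show "(\<integral>\<^sup>+p. ennreal (norm (F p)) \<partial>(lborel \<Otimes>\<^sub>M lborel)) < \<infinity>" .
qed

text \<open>Against a Gaussian weight the square of the transform is a convolution square, with a
  nonnegative kernel of total mass \<open>(2 \<pi>)\<^sup>d\<close>, whatever the width.\<close>

lemma gauss_weighted_Bessel:
  fixes f :: "'a::euclidean_space \<Rightarrow> complex"
  assumes f: "integrable lborel f" and \<epsilon>: "\<epsilon> > 0"
  shows "(\<integral>\<^sup>+\<zeta>. ennreal (gauss \<epsilon> \<zeta> * (norm (ft f \<zeta>))\<^sup>2) \<partial>lborel)
    \<le> ennreal ((2 * pi) ^ DIM('a)) * (\<integral>\<^sup>+x. ennreal ((norm (f x))\<^sup>2) \<partial>lborel)"
proof -
  have [measurable]: "f \<in> borel_measurable borel" using f by simp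
  let ?I = "\<integral>x. norm (f x) \<partial>lborel"
  let ?g = "\<lambda>\<zeta>. complex_of_real (gauss \<epsilon> \<zeta>)"
  note fn = integrable_norm[OF f] and gi = gauss_integrable[OF \<epsilon>, where 'a='a]
  have g0: "gauss \<epsilon> \<zeta> \<ge> 0" for \<zeta> :: 'a using gauss_bounds(1)[of \<epsilon> \<zeta>] by simp
  have inner: "(\<integral>\<zeta>. ?g \<zeta> * cnj (ft f \<zeta>) * cis (- (x \<bullet> \<zeta>)) \<partial>lborel)
      = (\<integral>y. cnj (f y) * complex_of_real (gauss_dual \<epsilon> (x - y)) \<partial>lborel)" for x
  proof -
    let ?F = "\<lambda>(\<zeta>, y). ?g \<zeta> * cis (- ((x - y) \<bullet> \<zeta>)) * cnj (f y)"
    have shift: "cis (- ((x - y) \<bullet> \<zeta>)) = cis (y \<bullet> \<zeta>) * cis (- (x \<bullet> \<zeta>))" for y \<zeta>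
      by (simp add: cis_mult inner_diff_left)
    have F: "integrable (lborel \<Otimes>\<^sub>M lborel) ?F"
      by (rule pair_integrable_mult[OF gi fn]) (auto simp: norm_mult g0)
    have "?g \<zeta> * cnj (ft f \<zeta>) * cis (- (x \<bullet> \<zeta>)) = (\<integral>y. ?F (\<zeta>, y) \<partial>lborel)" for \<zeta>
    proof -
      have "cnj (ft f \<zeta>) = (\<integral>y. cnj (cis (- (y \<bullet> \<zeta>)) * f y) \<partial>lborel)"
        unfolding ft_def by (rule Bochner_Integration.integral_cnj[symmetric])
      then have "?g \<zeta> * cnj (ft f \<zeta>) * cis (- (x \<bullet> \<zeta>))
          = (\<integral>y. ?g \<zeta> * cnj (cis (- (y \<bullet> \<zeta>)) * f y) * cis (- (x \<bullet> \<zeta>)) \<partial>lborel)"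
        by simp
      also have "\<dots> = (\<integral>y. ?F (\<zeta>, y) \<partial>lborel)"
        by (intro Bochner_Integration.integral_cong refl)
           (unfold split_conv shift, simp add: cis_cnj mult_ac)
      finally show ?thesis .
    qed
    then have "(\<integral>\<zeta>. ?g \<zeta> * cnj (ft f \<zeta>) * cis (- (x \<bullet> \<zeta>)) \<partial>lborel) = (\<integral>\<zeta>. \<integral>y. ?F (\<zeta>, y) \<partial>lborel \<partial>lborel)"
      by simp
    also have "\<dots> = (\<integral>y. \<integral>\<zeta>. ?F (\<zeta>, y) \<partial>lborel \<partial>lborel)"
      using lborel_pair.Fubini_integral[of "\<lambda>\<zeta> y. ?F (\<zeta>, y)"] F by (simp add: case_prod_unfold)
    also have "\<dots> = (\<integral>y. cnj (f y) * complex_of_real (gauss_dual \<epsilon> (x - y)) \<partial>lborel)"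
    proof (intro Bochner_Integration.integral_cong refl)
      fix y
      have "(\<integral>\<zeta>. ?F (\<zeta>, y) \<partial>lborel) = (\<integral>\<zeta>. cnj (f y) * (cis (- ((x - y) \<bullet> \<zeta>)) * ?g \<zeta>) \<partial>lborel)"
        by (intro Bochner_Integration.integral_cong refl) (simp add: mult_ac)
      then show "(\<integral>\<zeta>. ?F (\<zeta>, y) \<partial>lborel) = cnj (f y) * complex_of_real (gauss_dual \<epsilon> (x - y))"
        by (simp add: gaussian_fourier[OF \<epsilon>])
    qed
    finally show ?thesis .
  qed
  let ?G = "\<lambda>(\<zeta>, x). ?g \<zeta> * cnj (ft f \<zeta>) * cis (- (x \<bullet> \<zeta>)) * f x"
  have bG: "norm (?g \<zeta> * cnj (ft f \<zeta>)) \<le> \<bar>gauss \<epsilon> \<zeta> * ?I\<bar>" for \<zeta>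
    using mult_left_mono[OF ft_norm_le[OF f, of \<zeta>] g0[of \<zeta>]] g0[of \<zeta>]
    by (simp add: norm_mult abs_mult)
  have G: "integrable (lborel \<Otimes>\<^sub>M lborel) ?G"
  proof (rule pair_integrable_mult[OF integrable_mult_left[OF gi, of ?I] fn])
    show "norm (?G (\<zeta>, x)) \<le> \<bar>gauss \<epsilon> \<zeta> * ?I\<bar> * \<bar>norm (f x)\<bar>" for \<zeta> x
      using mult_right_mono[OF bG[of \<zeta>], of "norm (f x)"] by (simp add: norm_mult)
  qed measurable
  have sq: "complex_of_real (gauss \<epsilon> \<zeta> * (norm (ft f \<zeta>))\<^sup>2) = (\<integral>x. ?G (\<zeta>, x) \<partial>lborel)" for \<zeta>
  proof -
    have "(\<integral>x. ?G (\<zeta>, x) \<partial>lborel) = (\<integral>x. (?g \<zeta> * cnj (ft f \<zeta>)) * (cis (- (x \<bullet> \<zeta>)) * f x) \<partial>lborel)"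
      by (simp add: mult.assoc)
    also have "\<dots> = ?g \<zeta> * cnj (ft f \<zeta>) * ft f \<zeta>"
      unfolding ft_def by simp
    also have "\<dots> = complex_of_real (gauss \<epsilon> \<zeta> * (norm (ft f \<zeta>))\<^sup>2)"
      by (simp only: of_real_mult complex_norm_square mult_ac)
    finally show ?thesis by (rule sym)
  qed
  have int: "integrable lborel (\<lambda>\<zeta>. gauss \<epsilon> \<zeta> * (norm (ft f \<zeta>))\<^sup>2)"
  proof (rule Bochner_Integration.integrable_bound[OF integrable_mult_left[OF gi, of "?I\<^sup>2"]])
    show "AE \<zeta> in lborel. norm (gauss \<epsilon> \<zeta> * (norm (ft f \<zeta>))\<^sup>2) \<le> norm (gauss \<epsilon> \<zeta> * ?I\<^sup>2)"
      using ft_norm_le[OF f] g0 by (intro AE_I2) (simp add: mult_left_mono power_mono)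
  qed simp
  have "complex_of_real (\<integral>\<zeta>. gauss \<epsilon> \<zeta> * (norm (ft f \<zeta>))\<^sup>2 \<partial>lborel)
      = (\<integral>\<zeta>. \<integral>x. ?G (\<zeta>, x) \<partial>lborel \<partial>lborel)"
    unfolding sq[symmetric] by (rule integral_complex_of_real[symmetric])
  also have "\<dots> = (\<integral>x. \<integral>\<zeta>. ?G (\<zeta>, x) \<partial>lborel \<partial>lborel)"
    using lborel_pair.Fubini_integral[of "\<lambda>\<zeta> x. ?G (\<zeta>, x)"] G by (simp add: case_prod_unfold)
  also have "\<dots> = (\<integral>x. f x * (\<integral>y. cnj (f y) * complex_of_real (gauss_dual \<epsilon> (x - y)) \<partial>lborel) \<partial>lborel)"
    unfolding inner[symmetric] by (simp add: mult.commute)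
  finally have eq: "complex_of_real (\<integral>\<zeta>. gauss \<epsilon> \<zeta> * (norm (ft f \<zeta>))\<^sup>2 \<partial>lborel)
      = (\<integral>x. f x * (\<integral>y. cnj (f y) * complex_of_real (gauss_dual \<epsilon> (x - y)) \<partial>lborel) \<partial>lborel)" .
  let ?k = "\<lambda>x y. ennreal (gauss_dual \<epsilon> (x - y))"
  have mass: "(\<integral>\<^sup>+y. ?k x y \<partial>lborel) = ennreal ((2 * pi) ^ DIM('a))"
    "(\<integral>\<^sup>+x. ?k x y \<partial>lborel) = ennreal ((2 * pi) ^ DIM('a))" for x y :: 'a
    using nn_integral_lborel_reflect[of "\<lambda>y. ennreal (gauss_dual \<epsilon> y)" x]
      nn_integral_lborel_shift[of "\<lambda>y. ennreal (gauss_dual \<epsilon> y)" y]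
    by (simp_all add: nn_gauss_dual[OF \<epsilon>])
  have "(\<integral>\<^sup>+\<zeta>. ennreal (gauss \<epsilon> \<zeta> * (norm (ft f \<zeta>))\<^sup>2) \<partial>lborel)
      = ennreal (\<integral>\<zeta>. gauss \<epsilon> \<zeta> * (norm (ft f \<zeta>))\<^sup>2 \<partial>lborel)"
    by (rule nn_integral_eq_integral[OF int]) (simp add: g0)
  also have "\<dots> = ennreal (norm (\<integral>x. f x * (\<integral>y. cnj (f y) * complex_of_real (gauss_dual \<epsilon> (x - y)) \<partial>lborel) \<partial>lborel))"
    unfolding eq[symmetric] norm_of_real by (simp add: g0 Bochner_Integration.integral_nonneg)
  also have "\<dots> \<le> (\<integral>\<^sup>+x. ennreal (norm (f x * (\<integral>y. cnj (f y) * complex_of_real (gauss_dual \<epsilon> (x - y)) \<partial>lborel))) \<partial>lborel)"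
    by (rule norm_integral_le_nn)
  also have "\<dots> \<le> (\<integral>\<^sup>+x. \<integral>\<^sup>+y. (ennreal ((norm (f x))\<^sup>2 / 2) * ?k x y + ennreal ((norm (f y))\<^sup>2 / 2) * ?k x y) \<partial>lborel \<partial>lborel)"
  proof (rule nn_integral_mono)
    fix x
    have "ennreal (norm (f x * (\<integral>y. cnj (f y) * complex_of_real (gauss_dual \<epsilon> (x - y)) \<partial>lborel)))
        \<le> ennreal (norm (f x)) * (\<integral>\<^sup>+y. ennreal (norm (cnj (f y) * complex_of_real (gauss_dual \<epsilon> (x - y)))) \<partial>lborel)"
      unfolding norm_mult[of "f x"] by (simp add: ennreal_mult mult_left_mono[OF norm_integral_le_nn])
    also have "\<dots> = (\<integral>\<^sup>+y. ennreal (norm (f x) * norm (f y)) * ?k x y \<partial>lborel)"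
      by (subst nn_integral_cmult[symmetric])
         (auto simp: norm_mult gauss_dual_nonneg[OF \<epsilon>] ennreal_mult mult.assoc)
    also have "\<dots> \<le> (\<integral>\<^sup>+y. (ennreal ((norm (f x))\<^sup>2 / 2) * ?k x y + ennreal ((norm (f y))\<^sup>2 / 2) * ?k x y) \<partial>lborel)"
    proof (rule nn_integral_mono)
      fix y
      have "norm (f x) * norm (f y) \<le> (norm (f x))\<^sup>2 / 2 + (norm (f y))\<^sup>2 / 2"
        using sum_squares_bound[of "norm (f x)" "norm (f y)"] by simp
      from ennreal_leI[OF this]
      have "ennreal (norm (f x) * norm (f y)) \<le> ennreal ((norm (f x))\<^sup>2 / 2) + ennreal ((norm (f y))\<^sup>2 / 2)"
        by (subst (asm) ennreal_plus) simp_all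
      then show "ennreal (norm (f x) * norm (f y)) * ?k x y
          \<le> ennreal ((norm (f x))\<^sup>2 / 2) * ?k x y + ennreal ((norm (f y))\<^sup>2 / 2) * ?k x y"
        unfolding distrib_right[symmetric] by (rule mult_right_mono) simp
    qed
    finally show "ennreal (norm (f x * (\<integral>y. cnj (f y) * complex_of_real (gauss_dual \<epsilon> (x - y)) \<partial>lborel)))
      \<le> (\<integral>\<^sup>+y. (ennreal ((norm (f x))\<^sup>2 / 2) * ?k x y + ennreal ((norm (f y))\<^sup>2 / 2) * ?k x y) \<partial>lborel)" .
  qed
  also have "\<dots> = (\<integral>\<^sup>+x. \<integral>\<^sup>+y. ennreal ((norm (f x))\<^sup>2 / 2) * ?k x y \<partial>lborel \<partial>lborel)
      + (\<integral>\<^sup>+x. \<integral>\<^sup>+y. ennreal ((norm (f y))\<^sup>2 / 2) * ?k x y \<partial>lborel \<partial>lborel)"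
    by (simp add: nn_integral_add)
  also have "(\<integral>\<^sup>+x. \<integral>\<^sup>+y. ennreal ((norm (f y))\<^sup>2 / 2) * ?k x y \<partial>lborel \<partial>lborel)
      = (\<integral>\<^sup>+y. \<integral>\<^sup>+x. ennreal ((norm (f y))\<^sup>2 / 2) * ?k x y \<partial>lborel \<partial>lborel)"
    by (rule lborel_pair.Fubini'[symmetric]) measurable
  also have "(\<integral>\<^sup>+x. \<integral>\<^sup>+y. ennreal ((norm (f x))\<^sup>2 / 2) * ?k x y \<partial>lborel \<partial>lborel)
      + (\<integral>\<^sup>+y. \<integral>\<^sup>+x. ennreal ((norm (f y))\<^sup>2 / 2) * ?k x y \<partial>lborel \<partial>lborel)
      = (\<integral>\<^sup>+x. ennreal ((norm (f x))\<^sup>2 / 2) \<partial>lborel) * ennreal ((2 * pi) ^ DIM('a))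
      + (\<integral>\<^sup>+x. ennreal ((norm (f x))\<^sup>2 / 2) \<partial>lborel) * ennreal ((2 * pi) ^ DIM('a))"
    by (simp add: nn_integral_cmult mass nn_integral_multc)
  also have "\<dots> = (\<integral>\<^sup>+x. ennreal ((norm (f x))\<^sup>2 / 2) + ennreal ((norm (f x))\<^sup>2 / 2) \<partial>lborel) * ennreal ((2 * pi) ^ DIM('a))"
    by (simp add: nn_integral_add distrib_right)
  also have "(\<lambda>x. ennreal ((norm (f x))\<^sup>2 / 2) + ennreal ((norm (f x))\<^sup>2 / 2)) = (\<lambda>x. ennreal ((norm (f x))\<^sup>2))"
    by (simp add: ennreal_plus[symmetric] del: ennreal_plus)
  finally show ?thesis by (simp add: mult.commute)
qed

text \<open>The weight tends to one as \<open>\<epsilon>\<close> tends to zero, and Fatou's lemma applies.\<close>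

theorem Bessel_inequality:
  fixes f :: "'a::euclidean_space \<Rightarrow> complex"
  assumes f: "integrable lborel f"
  shows "(\<integral>\<^sup>+\<zeta>. ennreal ((norm (ft f \<zeta>))\<^sup>2) \<partial>lborel)
    \<le> ennreal ((2 * pi) ^ DIM('a)) * (\<integral>\<^sup>+x. ennreal ((norm (f x))\<^sup>2) \<partial>lborel)"
proof -
  have [measurable]: "f \<in> borel_measurable borel" using f by simp
  let ?g = "\<lambda>n \<zeta>. ennreal (gauss (1 / real (Suc n)) \<zeta> * (norm (ft f \<zeta>))\<^sup>2)"
  have lim: "(\<lambda>n. ?g n \<zeta>) \<longlonglongrightarrow> ennreal ((norm (ft f \<zeta>))\<^sup>2)" for \<zeta>
  proof -
    have "(\<lambda>n. gauss (1 / real (Suc n)) \<zeta>) \<longlonglongrightarrow> (\<Prod>b\<in>(Basis :: 'a set). exp (- (0 * (\<zeta> \<bullet> b))\<^sup>2 / 2))"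
      unfolding gauss_def
      by (intro tendsto_prod tendsto_exp tendsto_divide tendsto_const tendsto_minus tendsto_power tendsto_mult
          LIMSEQ_Suc[OF lim_1_over_n]) simp
    then have "(\<lambda>n. gauss (1 / real (Suc n)) \<zeta> * (norm (ft f \<zeta>))\<^sup>2) \<longlonglongrightarrow> 1 * (norm (ft f \<zeta>))\<^sup>2"
      by (intro tendsto_mult tendsto_const) simp
    then show ?thesis by (intro tendsto_ennrealI) simp
  qed
  have "(\<integral>\<^sup>+\<zeta>. ennreal ((norm (ft f \<zeta>))\<^sup>2) \<partial>lborel) = (\<integral>\<^sup>+\<zeta>. liminf (\<lambda>n. ?g n \<zeta>) \<partial>lborel)"
    using lim_imp_Liminf[OF _ lim] by simp
  also have "\<dots> \<le> liminf (\<lambda>n. \<integral>\<^sup>+\<zeta>. ?g n \<zeta> \<partial>lborel)"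
    by (rule nn_integral_liminf) simp
  also have "\<dots> \<le> liminf (\<lambda>n::nat. ennreal ((2 * pi) ^ DIM('a)) * (\<integral>\<^sup>+x. ennreal ((norm (f x))\<^sup>2) \<partial>lborel))"
    by (intro Liminf_mono always_eventually allI gauss_weighted_Bessel[OF f]) simp
  finally show ?thesis by (simp add: Liminf_const)
qed

text \<open>The unitary normalisation.\<close>

definition nft :: "('a::euclidean_space \<Rightarrow> complex) \<Rightarrow> 'a \<Rightarrow> complex" where
  "nft f \<zeta> = complex_of_real ((2 * pi) powr (- (real DIM('a) / 2))) * ft f \<zeta>"

lemma nft_borel [measurable]:
  "f \<in> borel_measurable borel \<Longrightarrow> nft f \<in> borel_measurable borel"
  unfolding nft_def[abs_def] by measurable

lemma nft_diff:
  assumes "integrable lborel f" "integrable lborel g"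
  shows "nft (\<lambda>x. f x - g x) \<zeta> = nft f \<zeta> - nft g \<zeta>"
  by (simp add: nft_def ft_diff[OF assms] right_diff_distrib)

lemma fourier_constant:
  "((2 * pi) powr (- (real DIM('a::euclidean_space) / 2)))\<^sup>2 * (2 * pi) ^ DIM('a) = 1"
proof -
  have "((2 * pi) powr (- (real DIM('a) / 2)))\<^sup>2 = (2 * pi) powr (- (real DIM('a) / 2) + - (real DIM('a) / 2))"
    by (simp only: power2_eq_square powr_add)
  also have "- (real DIM('a) / 2) + - (real DIM('a) / 2) = - real DIM('a)" by simp
  also have "(2 * pi) powr (- real DIM('a)) = inverse ((2 * pi) ^ DIM('a))"
    by (subst powr_minus) (simp add: powr_realpow)
  finally have "((2 * pi) powr (- (real DIM('a) / 2)))\<^sup>2 = inverse ((2 * pi) ^ DIM('a))" .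
  then show ?thesis by (simp only:) (rule left_inverse, simp)
qed

lemma nft_Bessel:
  fixes f :: "'a::euclidean_space \<Rightarrow> complex"
  assumes f: "integrable lborel f"
  shows "(\<integral>\<^sup>+\<zeta>. ennreal ((norm (nft f \<zeta>))\<^sup>2) \<partial>lborel) \<le> (\<integral>\<^sup>+x. ennreal ((norm (f x))\<^sup>2) \<partial>lborel)"
proof -
  have [measurable]: "f \<in> borel_measurable borel" using f by simp
  let ?c = "(2 * pi) powr (- (real DIM('a) / 2))"
  note c = fourier_constant[where 'a='a]
  have "(\<integral>\<^sup>+\<zeta>. ennreal ((norm (nft f \<zeta>))\<^sup>2) \<partial>lborel) = (\<integral>\<^sup>+\<zeta>. ennreal (?c\<^sup>2) * ennreal ((norm (ft f \<zeta>))\<^sup>2) \<partial>lborel)"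
    by (intro nn_integral_cong) (simp add: nft_def norm_mult power_mult_distrib ennreal_mult)
  also have "\<dots> = ennreal (?c\<^sup>2) * (\<integral>\<^sup>+\<zeta>. ennreal ((norm (ft f \<zeta>))\<^sup>2) \<partial>lborel)"
    by (rule nn_integral_cmult) measurable
  also have "\<dots> \<le> ennreal (?c\<^sup>2) * (ennreal ((2 * pi) ^ DIM('a)) * (\<integral>\<^sup>+x. ennreal ((norm (f x))\<^sup>2) \<partial>lborel))"
    by (rule mult_left_mono[OF Bessel_inequality[OF f]]) simp
  also have "\<dots> = ennreal (?c\<^sup>2 * (2 * pi) ^ DIM('a)) * (\<integral>\<^sup>+x. ennreal ((norm (f x))\<^sup>2) \<partial>lborel)"
    by (subst ennreal_mult) (auto simp: mult.assoc)
  finally show ?thesis unfolding c by simp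
qed

lemma square_integrable_diff:
  fixes f g :: "'a::euclidean_space \<Rightarrow> 'b::euclidean_space"
  assumes f: "square_integrable f" and g: "square_integrable g"
  shows "square_integrable (\<lambda>x. f x - g x)"
  unfolding square_integrable_def
proof
  have [measurable]: "f \<in> borel_measurable borel" "g \<in> borel_measurable borel"
    using f g by (auto simp: square_integrable_def)
  show "(\<lambda>x. f x - g x) \<in> borel_measurable borel" by measurable
  have i: "integrable lborel (\<lambda>x. 2 * (norm (f x))\<^sup>2 + 2 * (norm (g x))\<^sup>2)"
    using f g by (simp add: square_integrable_def)
  show "integrable lborel (\<lambda>x. (norm (f x - g x))\<^sup>2)"
  proof (rule Bochner_Integration.integrable_bound[OF i])
    show "AE x in lborel. norm ((norm (f x - g x))\<^sup>2) \<le> norm (2 * (norm (f x))\<^sup>2 + 2 * (norm (g x))\<^sup>2)"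
    proof (rule AE_I2)
      fix x
      have "(norm (f x - g x))\<^sup>2 \<le> (norm (f x) + norm (g x))\<^sup>2"
        by (intro power_mono norm_triangle_ineq4) simp
      also have "\<dots> \<le> 2 * (norm (f x))\<^sup>2 + 2 * (norm (g x))\<^sup>2"
        using sum_squares_bound[of "norm (f x)" "norm (g x)"] by (simp add: power2_sum)
      finally show "norm ((norm (f x - g x))\<^sup>2) \<le> norm (2 * (norm (f x))\<^sup>2 + 2 * (norm (g x))\<^sup>2)"
        by simp
    qed
  qed measurable
qed

lemma gauss_square_integrable: "square_integrable (gauss 1 :: 'a::euclidean_space \<Rightarrow> real)"
  unfolding square_integrable_def
proof
  show "integrable lborel (\<lambda>x::'a. (norm (gauss 1 x))\<^sup>2)"
  proof (rule Bochner_Integration.integrable_bound[OF gauss_integrable[of 1]])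
    show "AE x::'a in lborel. norm ((norm (gauss 1 x))\<^sup>2) \<le> norm (gauss 1 x)"
    proof (rule AE_I2)
      fix x :: 'a
      have "gauss 1 x * gauss 1 x \<le> 1 * gauss 1 x"
        using gauss_bounds[of 1 x] by (intro mult_right_mono) auto
      then show "norm ((norm (gauss 1 x))\<^sup>2) \<le> norm (gauss 1 x)"
        using gauss_bounds(1)[of 1 x] by (simp add: power2_eq_square)
    qed
  qed simp_all
qed measurable

text \<open>Almost everywhere convergent subsequences are available for sequences that converge in \<open>L\<^sup>1\<close>.
  Multiplication with a positive square integrable function, here a Gaussian, makes them available
  for convergence in \<open>L\<^sup>2\<close> as well.\<close>

lemma gauss_weighted_L1:
  fixes f :: "'a::euclidean_space \<Rightarrow> complex"
  assumes f: "square_integrable f"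
  shows "integrable lborel (\<lambda>x. f x * complex_of_real (gauss 1 x))"
    and "(\<integral>x. norm (f x * complex_of_real (gauss 1 x)) \<partial>lborel) \<le> l2 f * l2 (gauss 1 :: 'a \<Rightarrow> real)"
proof -
  have [measurable]: "f \<in> borel_measurable borel" using f by (rule square_integrable_borel)
  note cs = Cauchy_Schwarz_l2[OF f gauss_square_integrable]
  show "integrable lborel (\<lambda>x. f x * complex_of_real (gauss 1 x))"
    by (rule Bochner_Integration.integrable_bound[OF cs(1)]) (auto simp: norm_mult)
  show "(\<integral>x. norm (f x * complex_of_real (gauss 1 x)) \<partial>lborel) \<le> l2 f * l2 (gauss 1 :: 'a \<Rightarrow> real)"
    using cs(2) by (simp add: norm_mult)
qed

lemma l2_tendsto_0:
  assumes d: "\<And>n. square_integrable (d n)"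
    and lim: "(\<lambda>n. \<integral>\<^sup>+x. ennreal ((norm (d n x))\<^sup>2) \<partial>lborel) \<longlonglongrightarrow> 0"
  shows "(\<lambda>n. l2 (d n)) \<longlonglongrightarrow> 0"
proof -
  have "(\<lambda>n. ennreal ((l2 (d n))\<^sup>2)) \<longlonglongrightarrow> ennreal 0"
    using lim by (simp add: l2_nn_integral[OF d])
  then have "(\<lambda>n. (l2 (d n))\<^sup>2) \<longlonglongrightarrow> 0"
    by (subst (asm) tendsto_ennreal_iff) auto
  from tendsto_real_sqrt[OF this] show ?thesis by (simp add: l2_nonneg)
qed

lemma L2_null_AE_subseq:
  fixes d :: "nat \<Rightarrow> 'a::euclidean_space \<Rightarrow> complex"
  assumes d: "\<And>n. square_integrable (d n)"
    and lim: "(\<lambda>n. \<integral>\<^sup>+x. ennreal ((norm (d n x))\<^sup>2) \<partial>lborel) \<longlonglongrightarrow> 0"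
  obtains r where "strict_mono (r :: nat \<Rightarrow> nat)" "AE x in lborel. (\<lambda>k. d (r k) x) \<longlonglongrightarrow> 0"
proof -
  let ?p = "\<lambda>x::'a. complex_of_real (gauss 1 x)"
  have "(\<lambda>n. \<integral>x. norm (d n x * ?p x) \<partial>lborel) \<longlonglongrightarrow> 0"
  proof (rule tendsto_sandwich[where f="\<lambda>_. 0"])
    show "(\<lambda>n. l2 (d n) * l2 (gauss 1 :: 'a \<Rightarrow> real)) \<longlonglongrightarrow> 0"
      using tendsto_mult[OF l2_tendsto_0[OF d lim] tendsto_const] by simp
    show "\<forall>\<^sub>F n in sequentially. (\<integral>x. norm (d n x * ?p x) \<partial>lborel) \<le> l2 (d n) * l2 (gauss 1 :: 'a \<Rightarrow> real)"
      by (intro always_eventually allI gauss_weighted_L1(2)[OF d])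
  qed (auto intro!: always_eventually Bochner_Integration.integral_nonneg)
  from tendsto_L1_AE_subseq[OF gauss_weighted_L1(1)[OF d] this]
  obtain r where r: "strict_mono r" "AE x in lborel. (\<lambda>n. d (r n) x * ?p x) \<longlonglongrightarrow> 0" by blast
  from r(2) have "AE x in lborel. (\<lambda>k. d (r k) x) \<longlonglongrightarrow> 0"
  proof eventually_elim
    case (elim x)
    from tendsto_divide[OF elim tendsto_const[of "?p x"]] gauss_bounds(1)[of 1 x]
    show ?case by simp
  qed
  with r(1) show thesis by (rule that)
qed

lemma multiplier_tendsto_0:
  fixes u :: "'a::euclidean_space \<Rightarrow> complex" and m :: "nat \<Rightarrow> 'a \<Rightarrow> real"
  assumes u: "square_integrable u" and [measurable]: "\<And>n. m n \<in> borel_measurable borel"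
    and C: "\<And>n x. \<bar>m n x\<bar> \<le> C" and lim: "\<And>x. (\<lambda>n. m n x) \<longlonglongrightarrow> 0"
  shows "(\<lambda>n. \<integral>\<^sup>+x. ennreal ((norm (complex_of_real (m n x) * u x))\<^sup>2) \<partial>lborel) \<longlonglongrightarrow> 0"
proof -
  have [measurable]: "u \<in> borel_measurable borel" using u by (rule square_integrable_borel)
  have "(\<lambda>n. \<integral>\<^sup>+x. ennreal ((norm (complex_of_real (m n x) * u x))\<^sup>2) \<partial>lborel) \<longlonglongrightarrow> (\<integral>\<^sup>+x. 0 \<partial>(lborel :: 'a measure))"
  proof (rule nn_integral_dominated_convergence[where w="\<lambda>x. ennreal (C\<^sup>2) * ennreal ((norm (u x))\<^sup>2)"])
    show "AE x in lborel. ennreal ((norm (complex_of_real (m n x) * u x))\<^sup>2) \<le> ennreal (C\<^sup>2) * ennreal ((norm (u x))\<^sup>2)" for n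
    proof (rule AE_I2)
      fix x
      have "(norm (complex_of_real (m n x) * u x))\<^sup>2 = (m n x)\<^sup>2 * (norm (u x))\<^sup>2"
        by (simp add: norm_mult power_mult_distrib)
      also have "\<dots> \<le> C\<^sup>2 * (norm (u x))\<^sup>2"
        using C[of n x] by (intro mult_right_mono power2_le_iff_abs_le[THEN iffD2]) (auto intro: order_trans[OF abs_ge_zero])
      finally show "ennreal ((norm (complex_of_real (m n x) * u x))\<^sup>2) \<le> ennreal (C\<^sup>2) * ennreal ((norm (u x))\<^sup>2)"
        by (simp add: ennreal_mult[symmetric])
    qed
    show "(\<integral>\<^sup>+x. ennreal (C\<^sup>2) * ennreal ((norm (u x))\<^sup>2) \<partial>lborel) < \<infinity>"
      by (subst nn_integral_cmult) (auto simp: l2_nn_integral[OF u] ennreal_mult_less_top)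
    show "AE x in lborel. (\<lambda>n. ennreal ((norm (complex_of_real (m n x) * u x))\<^sup>2)) \<longlonglongrightarrow> 0"
    proof (rule AE_I2)
      fix x
      have "(\<lambda>n. (norm (complex_of_real (m n x) * u x))\<^sup>2) \<longlonglongrightarrow> (norm (complex_of_real 0 * u x))\<^sup>2"
        by (intro tendsto_power tendsto_norm tendsto_mult tendsto_const tendsto_of_real lim)
      from tendsto_ennrealI[OF this]
      show "(\<lambda>n. ennreal ((norm (complex_of_real (m n x) * u x))\<^sup>2)) \<longlonglongrightarrow> 0" by simp
    qed
  qed measurable
  then show ?thesis by simp
qed

lemma multiplier_integrable:
  fixes u :: "'a::euclidean_space \<Rightarrow> complex" and m :: "'a \<Rightarrow> real"
  assumes u: "square_integrable u" and [measurable]: "m \<in> borel_measurable borel"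
    and C: "\<And>x. \<bar>m x\<bar> \<le> C" and supp: "\<And>x. norm x > r \<Longrightarrow> m x = 0"
  shows "integrable lborel (\<lambda>x. complex_of_real (m x) * u x)"
    and "square_integrable (\<lambda>x. complex_of_real (m x) * u x)"
proof -
  have [measurable]: "u \<in> borel_measurable borel" using u by (rule square_integrable_borel)
  have C0: "C \<ge> 0" using C[of 0] by linarith
  have ic: "square_integrable (indicator (cball (0::'a) r) :: 'a \<Rightarrow> real)"
    by (rule l2_indicator(1)[OF _ emeasure_lborel_cball_finite]) simp
  have i: "integrable lborel (\<lambda>x. C * (norm (u x) * norm (indicator (cball 0 r) x :: real)))"
    by (rule integrable_mult_right[OF Cauchy_Schwarz_l2(1)[OF u ic]])
  show "integrable lborel (\<lambda>x. complex_of_real (m x) * u x)"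
  proof (rule Bochner_Integration.integrable_bound[OF i])
    show "AE x in lborel. norm (complex_of_real (m x) * u x) \<le> norm (C * (norm (u x) * norm (indicator (cball 0 r) x :: real)))"
    proof (rule AE_I2)
      fix x show "norm (complex_of_real (m x) * u x) \<le> norm (C * (norm (u x) * norm (indicator (cball 0 r) x :: real)))"
        using mult_right_mono[OF C[of x], of "norm (u x)"] supp[of x] C0
        by (cases "norm x \<le> r") (auto simp: norm_mult)
    qed
  qed measurable
  have i2: "integrable lborel (\<lambda>x. C\<^sup>2 * (norm (u x))\<^sup>2)"
    using u by (simp add: square_integrable_def)
  show "square_integrable (\<lambda>x. complex_of_real (m x) * u x)"
    unfolding square_integrable_def
  proof
    show "integrable lborel (\<lambda>x. (norm (complex_of_real (m x) * u x))\<^sup>2)"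
    proof (rule Bochner_Integration.integrable_bound[OF i2])
      have "(m x)\<^sup>2 \<le> C\<^sup>2" for x using C[of x] C0 by (simp add: abs_le_square_iff[symmetric])
      then show "AE x in lborel. norm ((norm (complex_of_real (m x) * u x))\<^sup>2) \<le> norm (C\<^sup>2 * (norm (u x))\<^sup>2)"
        by (intro AE_I2) (simp add: norm_mult power_mult_distrib mult_right_mono)
    qed measurable
  qed measurable
qed

definition cutoff :: "nat \<Rightarrow> ('a::euclidean_space \<Rightarrow> complex) \<Rightarrow> 'a \<Rightarrow> complex" where
  "cutoff n u x = complex_of_real (indicator (cball 0 (real n)) x) * u x"

lemma cutoff_integrable:
  assumes "square_integrable (u :: 'a::euclidean_space \<Rightarrow> complex)"
  shows "integrable lborel (cutoff n u)" "square_integrable (cutoff n u)"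
  unfolding cutoff_def[abs_def]
proof -
  have m: "(indicator (cball 0 (real n)) :: 'a \<Rightarrow> real) \<in> borel_measurable borel"
    by (intro borel_measurable_indicator) simp
  show "integrable lborel (\<lambda>x. complex_of_real (indicator (cball 0 (real n)) x) * u x)"
    by (rule multiplier_integrable(1)[OF assms m, where C=1 and r="real n"]) (simp_all split: split_indicator)
  show "square_integrable (\<lambda>x. complex_of_real (indicator (cball 0 (real n)) x) * u x)"
    by (rule multiplier_integrable(2)[OF assms m, where C=1 and r="real n"]) (simp_all split: split_indicator)
qed

lemma nft_square_integrable:
  assumes "integrable lborel f" "square_integrable f"
  shows "square_integrable (nft f)"
proof -
  have "f \<in> borel_measurable borel" using assms(2) by (rule square_integrable_borel)
  then have "nft f \<in> borel_measurable borel" by measurable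
  moreover have "(\<integral>\<^sup>+\<zeta>. ennreal ((norm (nft f \<zeta>))\<^sup>2) \<partial>lborel) < \<infinity>"
    by (rule le_less_trans[OF nft_Bessel[OF assms(1)]]) (simp add: l2_nn_integral[OF assms(2)])
  ultimately show ?thesis by (simp add: square_integrable_iff_nn)
qed

lemma indicator_cball_tendsto:
  "(\<lambda>n. indicator (cball 0 (real n)) (x::'a::euclidean_space) :: real) \<longlonglongrightarrow> 1"
proof -
  obtain N :: nat where "norm x \<le> real N" using real_arch_simple by blast
  then have "eventually (\<lambda>n. indicator (cball 0 (real n)) x = (1::real)) sequentially"
    unfolding eventually_sequentially by (intro exI[of _ N]) (auto split: split_indicator)
  then show ?thesis by (rule tendsto_eventually)
qed

text \<open>By Bessel's inequality the transforms of the truncations form a Cauchy sequence, at the rate of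
  the tails of \<open>u\<close>. A limit is constructed along an almost everywhere convergent subsequence, and
  Fatou's lemma shows that it is a limit in the mean square.\<close>

theorem fourier_L2_exists:
  fixes u :: "'a::euclidean_space \<Rightarrow> complex"
  assumes u: "square_integrable u"
  obtains F where "square_integrable F"
    "(\<lambda>n. \<integral>\<^sup>+\<xi>. ennreal ((norm (F \<xi> - nft (cutoff n u) \<xi>))\<^sup>2) \<partial>lborel) \<longlonglongrightarrow> 0"
proof -
  have [measurable]: "u \<in> borel_measurable borel" using u by (rule square_integrable_borel)
  define a where "a n = nft (cutoff n u)" for n
  define \<tau> where "\<tau> n = (\<integral>\<^sup>+x. ennreal ((norm (complex_of_real (1 - indicator (cball 0 (real n)) x) * u x))\<^sup>2) \<partial>lborel)" for n
  have a_sq: "square_integrable (a n)" for n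
    unfolding a_def by (rule nft_square_integrable[OF cutoff_integrable[OF u]])
  have [measurable]: "a n \<in> borel_measurable borel" for n
    by (rule square_integrable_borel[OF a_sq])
  have \<tau>: "\<tau> \<longlonglongrightarrow> 0"
    unfolding \<tau>_def[abs_def]
  proof (rule multiplier_tendsto_0[OF u, where C=1])
    show "(\<lambda>n. 1 - indicator (cball 0 (real n)) x :: real) \<longlonglongrightarrow> 0" for x :: 'a
      using tendsto_diff[OF tendsto_const[of 1] indicator_cball_tendsto[of x]] by simp
    show "(\<lambda>x::'a. 1 - indicator (cball 0 (real n)) x :: real) \<in> borel_measurable borel" for n
      by (intro borel_measurable_diff borel_measurable_const borel_measurable_indicator) simp
  qed (auto split: split_indicator)
  have diff: "(\<integral>\<^sup>+\<xi>. ennreal ((norm (a i \<xi> - a j \<xi>))\<^sup>2) \<partial>lborel) \<le> \<tau> N" if "i \<ge> N" "j \<ge> N" for i j N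
  proof -
    note ci = cutoff_integrable(1)[OF u]
    have "(\<integral>\<^sup>+\<xi>. ennreal ((norm (a i \<xi> - a j \<xi>))\<^sup>2) \<partial>lborel)
        = (\<integral>\<^sup>+\<xi>. ennreal ((norm (nft (\<lambda>x. cutoff i u x - cutoff j u x) \<xi>))\<^sup>2) \<partial>lborel)"
      by (simp add: a_def nft_diff[OF ci ci])
    also have "\<dots> \<le> (\<integral>\<^sup>+x. ennreal ((norm (cutoff i u x - cutoff j u x))\<^sup>2) \<partial>lborel)"
      by (rule nft_Bessel) (intro Bochner_Integration.integrable_diff ci)
    also have "\<dots> \<le> \<tau> N"
      unfolding \<tau>_def
    proof (intro nn_integral_mono ennreal_leI power_mono)
      fix x show "norm (cutoff i u x - cutoff j u x) \<le> norm (complex_of_real (1 - indicator (cball 0 (real N)) x) * u x)"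
        using that by (auto simp: cutoff_def split: split_indicator)
    qed simp
    finally show ?thesis .
  qed
  let ?p = "\<lambda>x::'a. complex_of_real (gauss 1 x)"
  let ?lp = "l2 (gauss 1 :: 'a \<Rightarrow> real)"
  have cau: "\<exists>N. \<forall>i\<ge>N. \<forall>j\<ge>N. (\<integral>x. norm (a i x * ?p x - a j x * ?p x) \<partial>lborel) < e" if e: "e > 0" for e
  proof -
    define \<delta> where "\<delta> = e / (?lp + 1)"
    have \<delta>: "\<delta> > 0" "\<delta> * ?lp < e"
    proof -
      have l: "?lp + 1 > 0" using l2_nonneg[of "gauss 1 :: 'a \<Rightarrow> real"] by linarith
      then show "\<delta> > 0" using e by (simp add: \<delta>_def)
      then have "\<delta> * ?lp < \<delta> * (?lp + 1)" by simp
      also have "\<dots> = e" using l by (simp add: \<delta>_def)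
      finally show "\<delta> * ?lp < e" .
    qed
    have "eventually (\<lambda>n. \<tau> n < ennreal (\<delta>\<^sup>2)) sequentially"
      by (rule order_tendstoD(2)[OF \<tau>]) (use \<delta> in simp)
    then obtain N where N: "\<tau> N < ennreal (\<delta>\<^sup>2)" by (auto simp: eventually_sequentially)
    have "(\<integral>x. norm (a i x * ?p x - a j x * ?p x) \<partial>lborel) < e" if ij: "i \<ge> N" "j \<ge> N" for i j
    proof -
      have "(\<integral>\<^sup>+\<xi>. ennreal ((norm (a i \<xi> - a j \<xi>))\<^sup>2) \<partial>lborel) \<le> ennreal (\<delta>\<^sup>2)"
        using diff[OF ij] N by (meson le_less_trans less_imp_le)
      then have d: "square_integrable (\<lambda>\<xi>. a i \<xi> - a j \<xi>)" "l2 (\<lambda>\<xi>. a i \<xi> - a j \<xi>) \<le> \<delta>"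
        using l2_leI[of "\<lambda>\<xi>. a i \<xi> - a j \<xi>" \<delta>] \<delta>(1) by auto
      have "(\<integral>x. norm ((a i x - a j x) * ?p x) \<partial>lborel) \<le> l2 (\<lambda>\<xi>. a i \<xi> - a j \<xi>) * ?lp"
        by (rule gauss_weighted_L1(2)[OF d(1)])
      also have "\<dots> \<le> \<delta> * ?lp" by (rule mult_right_mono[OF d(2) l2_nonneg])
      finally show ?thesis using \<delta>(2) by (simp add: left_diff_distrib)
    qed
    then show ?thesis by blast
  qed
  obtain r where r: "strict_mono r" "AE x in lborel. Cauchy (\<lambda>i. a (r i) x * ?p x)"
    using cauchy_L1_AE_cauchy_subseq[of lborel "\<lambda>n x. a n x * ?p x", OF gauss_weighted_L1(1)[OF a_sq] cau] by blast
  define F where "F x = lim (\<lambda>i. a (r i) x)" for x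
  have [measurable]: "F \<in> borel_measurable borel"
    unfolding F_def[abs_def] by measurable
  from r(2) have ae: "AE x in lborel. (\<lambda>i. a (r i) x) \<longlonglongrightarrow> F x"
  proof eventually_elim
    case (elim x)
    then obtain l where "(\<lambda>i. a (r i) x * ?p x) \<longlonglongrightarrow> l"
      by (auto simp: Cauchy_convergent_iff convergent_def)
    from tendsto_divide[OF this tendsto_const[of "?p x"]] gauss_bounds(1)[of 1 x]
    have "convergent (\<lambda>i. a (r i) x)" by (auto simp: convergent_def)
    then show ?case by (simp add: F_def convergent_LIMSEQ_iff)
  qed
  have Fa: "(\<integral>\<^sup>+\<xi>. ennreal ((norm (F \<xi> - a n \<xi>))\<^sup>2) \<partial>lborel) \<le> \<tau> n" for n
  proof -
    have "(\<integral>\<^sup>+\<xi>. ennreal ((norm (F \<xi> - a n \<xi>))\<^sup>2) \<partial>lborel)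
        = (\<integral>\<^sup>+\<xi>. liminf (\<lambda>k. ennreal ((norm (a (r k) \<xi> - a n \<xi>))\<^sup>2)) \<partial>lborel)"
    proof (rule nn_integral_cong_AE)
      show "AE \<xi> in lborel. ennreal ((norm (F \<xi> - a n \<xi>))\<^sup>2) = liminf (\<lambda>k. ennreal ((norm (a (r k) \<xi> - a n \<xi>))\<^sup>2))"
        using ae
      proof eventually_elim
        case (elim \<xi>)
        have "(\<lambda>k. ennreal ((norm (a (r k) \<xi> - a n \<xi>))\<^sup>2)) \<longlonglongrightarrow> ennreal ((norm (F \<xi> - a n \<xi>))\<^sup>2)"
          by (intro tendsto_ennrealI tendsto_power tendsto_norm tendsto_diff elim tendsto_const)
        from lim_imp_Liminf[OF _ this] show ?case by simp
      qed
    qed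
    also have "\<dots> \<le> liminf (\<lambda>k. \<integral>\<^sup>+\<xi>. ennreal ((norm (a (r k) \<xi> - a n \<xi>))\<^sup>2) \<partial>lborel)"
      by (rule nn_integral_liminf) measurable
    also have "\<dots> \<le> liminf (\<lambda>k::nat. \<tau> n)"
    proof (rule Liminf_mono)
      show "\<forall>\<^sub>F k in sequentially. (\<integral>\<^sup>+\<xi>. ennreal ((norm (a (r k) \<xi> - a n \<xi>))\<^sup>2) \<partial>lborel) \<le> \<tau> n"
        unfolding eventually_sequentially
        using seq_suble[OF r(1)] by (intro exI[of _ n] allI impI diff) (auto intro: order_trans)
    qed
    finally show ?thesis by (simp add: Liminf_const)
  qed
  have lim: "(\<lambda>n. \<integral>\<^sup>+\<xi>. ennreal ((norm (F \<xi> - a n \<xi>))\<^sup>2) \<partial>lborel) \<longlonglongrightarrow> 0"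
    by (rule tendsto_sandwich[OF _ _ tendsto_const \<tau>]) (auto simp: Fa)
  have "eventually (\<lambda>n. \<tau> n < 1) sequentially" by (rule order_tendstoD(2)[OF \<tau>]) simp
  then obtain N where N: "\<tau> N < 1" by (auto simp: eventually_sequentially)
  have "square_integrable (\<lambda>\<xi>. F \<xi> - a N \<xi>)"
  proof (subst square_integrable_iff_nn)
    show "(\<integral>\<^sup>+\<xi>. ennreal ((norm (F \<xi> - a N \<xi>))\<^sup>2) \<partial>lborel) < \<infinity>"
      using le_less_trans[OF Fa N] by (rule less_trans) simp
  qed measurable
  moreover have "square_integrable (\<lambda>\<xi>. - a N \<xi>)"
    using a_sq[of N] by (simp add: square_integrable_def)
  ultimately have "square_integrable (\<lambda>\<xi>. (F \<xi> - a N \<xi>) - (- a N \<xi>))"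
    by (rule square_integrable_diff)
  then have "square_integrable F" by simp
  then show thesis using lim unfolding a_def by (rule that)
qed

text \<open>A weighted bound on the transforms of truncations passes to the limit by Fatou's lemma. The
  truncations may be smooth, whereas the transform is defined by sharp ones: their difference tends
  to zero in the mean square, and so does its transform.\<close>

theorem fourier_L2_weighted:
  fixes u F :: "'a::euclidean_space \<Rightarrow> complex" and \<kappa> :: "nat \<Rightarrow> 'a \<Rightarrow> real" and W :: "'a \<Rightarrow> real"
  assumes u: "square_integrable u" and F: "square_integrable F"
    and lim: "(\<lambda>n. \<integral>\<^sup>+\<xi>. ennreal ((norm (F \<xi> - nft (cutoff n u) \<xi>))\<^sup>2) \<partial>lborel) \<longlonglongrightarrow> 0"
    and \<kappa>[measurable]: "\<And>n. \<kappa> n \<in> borel_measurable borel"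
    and \<kappa>_le: "\<And>n x. \<bar>\<kappa> n x\<bar> \<le> 1" and \<kappa>_supp: "\<And>n x. norm x > \<rho> n \<Longrightarrow> \<kappa> n x = 0"
    and \<kappa>_lim: "\<And>x. (\<lambda>n. \<kappa> n x) \<longlonglongrightarrow> 1"
    and W[measurable]: "W \<in> borel_measurable borel"
    and bound: "\<And>n. (\<integral>\<^sup>+\<xi>. ennreal (W \<xi> * (norm (nft (\<lambda>x. complex_of_real (\<kappa> n x) * u x) \<xi>))\<^sup>2) \<partial>lborel) \<le> M"
  shows "(\<integral>\<^sup>+\<xi>. ennreal (W \<xi> * (norm (F \<xi>))\<^sup>2) \<partial>lborel) \<le> M"
proof -
  have [measurable]: "u \<in> borel_measurable borel" "F \<in> borel_measurable borel"
    using u F by (auto intro: square_integrable_borel)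
  define b where "b n = nft (\<lambda>x. complex_of_real (\<kappa> n x) * u x)" for n
  note mi = multiplier_integrable[OF u \<kappa> \<kappa>_le \<kappa>_supp]
  note ci = cutoff_integrable[OF u]
  have b_sq: "square_integrable (b n)" for n
    unfolding b_def by (rule nft_square_integrable[OF mi])
  have a_sq: "square_integrable (nft (cutoff n u))" for n
    by (rule nft_square_integrable[OF ci])
  have [measurable]: "b n \<in> borel_measurable borel" "nft (cutoff n u) \<in> borel_measurable borel" for n
    using a_sq b_sq by (auto intro: square_integrable_borel)
  let ?m = "\<lambda>n x. indicator (cball 0 (real n)) x - \<kappa> n x"
  have d1: "(\<lambda>n. \<integral>\<^sup>+x. ennreal ((norm (complex_of_real (?m n x) * u x))\<^sup>2) \<partial>lborel) \<longlonglongrightarrow> 0"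
  proof (rule multiplier_tendsto_0[OF u, where C=2])
    show "\<bar>?m n x\<bar> \<le> 2" for n x using \<kappa>_le[of n x] by (auto split: split_indicator)
    show "(\<lambda>n. ?m n x) \<longlonglongrightarrow> 0" for x
      using tendsto_diff[OF indicator_cball_tendsto[of x] \<kappa>_lim[of x]] by simp
    show "?m n \<in> borel_measurable borel" for n
      by (intro borel_measurable_diff borel_measurable_indicator \<kappa>) simp
  qed
  have d1': "(\<lambda>n. \<integral>\<^sup>+\<xi>. ennreal ((norm (nft (cutoff n u) \<xi> - b n \<xi>))\<^sup>2) \<partial>lborel) \<longlonglongrightarrow> 0"
  proof (rule tendsto_sandwich[OF _ _ tendsto_const d1])
    have eq: "nft (cutoff n u) \<xi> - b n \<xi> = nft (\<lambda>x. cutoff n u x - complex_of_real (\<kappa> n x) * u x) \<xi>" for n \<xi>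
      unfolding b_def by (rule nft_diff[OF ci(1) mi(1), symmetric])
    have "(\<integral>\<^sup>+\<xi>. ennreal ((norm (nft (cutoff n u) \<xi> - b n \<xi>))\<^sup>2) \<partial>lborel)
        \<le> (\<integral>\<^sup>+x. ennreal ((norm (cutoff n u x - complex_of_real (\<kappa> n x) * u x))\<^sup>2) \<partial>lborel)" for n
      unfolding eq
      by (rule nft_Bessel) (intro Bochner_Integration.integrable_diff ci mi)
    then show "\<forall>\<^sub>F n in sequentially. (\<integral>\<^sup>+\<xi>. ennreal ((norm (nft (cutoff n u) \<xi> - b n \<xi>))\<^sup>2) \<partial>lborel)
        \<le> (\<integral>\<^sup>+x. ennreal ((norm (complex_of_real (?m n x) * u x))\<^sup>2) \<partial>lborel)"
      by (intro always_eventually allI) (simp add: cutoff_def left_diff_distrib)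
  qed simp
  obtain r where r: "strict_mono (r :: nat \<Rightarrow> nat)" "AE x in lborel. (\<lambda>k. F x - nft (cutoff (r k) u) x) \<longlonglongrightarrow> 0"
    using L2_null_AE_subseq[OF square_integrable_diff[OF F a_sq] lim] by blast
  have "(\<lambda>k. \<integral>\<^sup>+\<xi>. ennreal ((norm (nft (cutoff (r k) u) \<xi> - b (r k) \<xi>))\<^sup>2) \<partial>lborel) \<longlonglongrightarrow> 0"
    using LIMSEQ_subseq_LIMSEQ[OF d1' r(1)] by (simp add: comp_def)
  then obtain q where q: "strict_mono (q :: nat \<Rightarrow> nat)"
    "AE x in lborel. (\<lambda>k. nft (cutoff (r (q k)) u) x - b (r (q k)) x) \<longlonglongrightarrow> 0"
    using L2_null_AE_subseq[of "\<lambda>k \<xi>. nft (cutoff (r k) u) \<xi> - b (r k) \<xi>", OF square_integrable_diff[OF a_sq b_sq]]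
    by blast
  from r(2) q(2) have ae: "AE x in lborel. (\<lambda>k. b (r (q k)) x) \<longlonglongrightarrow> F x"
  proof eventually_elim
    case (elim x)
    have "(\<lambda>k. F x - nft (cutoff (r (q k)) u) x) \<longlonglongrightarrow> 0"
      using LIMSEQ_subseq_LIMSEQ[OF elim(1) q(1)] by (simp add: comp_def)
    from tendsto_diff[OF tendsto_const[of "F x"] tendsto_add[OF this elim(2)]]
    show ?case by simp
  qed
  have "(\<integral>\<^sup>+\<xi>. ennreal (W \<xi> * (norm (F \<xi>))\<^sup>2) \<partial>lborel)
      = (\<integral>\<^sup>+\<xi>. liminf (\<lambda>k. ennreal (W \<xi> * (norm (b (r (q k)) \<xi>))\<^sup>2)) \<partial>lborel)"
  proof (rule nn_integral_cong_AE)
    show "AE \<xi> in lborel. ennreal (W \<xi> * (norm (F \<xi>))\<^sup>2) = liminf (\<lambda>k. ennreal (W \<xi> * (norm (b (r (q k)) \<xi>))\<^sup>2))"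
      using ae
    proof eventually_elim
      case (elim \<xi>)
      have "(\<lambda>k. ennreal (W \<xi> * (norm (b (r (q k)) \<xi>))\<^sup>2)) \<longlonglongrightarrow> ennreal (W \<xi> * (norm (F \<xi>))\<^sup>2)"
        by (intro tendsto_ennrealI tendsto_mult tendsto_power tendsto_norm elim tendsto_const)
      from lim_imp_Liminf[OF _ this] show ?case by simp
    qed
  qed
  also have "\<dots> \<le> liminf (\<lambda>k. \<integral>\<^sup>+\<xi>. ennreal (W \<xi> * (norm (b (r (q k)) \<xi>))\<^sup>2) \<partial>lborel)"
    by (rule nn_integral_liminf) measurable
  also have "\<dots> \<le> liminf (\<lambda>k::nat. M)"
    by (intro Liminf_mono always_eventually allI) (simp add: b_def bound)
  finally show ?thesis by (simp add: Liminf_const)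
qed

section \<open>Partial Fourier transform of the transport equation\<close>

lemma bounded_mult_square_integrable:
  fixes f m :: "'a::euclidean_space \<Rightarrow> real"
  assumes f: "square_integrable f" and m: "m \<in> borel_measurable borel" and C: "\<And>x. \<bar>m x\<bar> \<le> C"
  shows "square_integrable (\<lambda>x. m x * f x)" "l2 (\<lambda>x. m x * f x) \<le> C * l2 f"
proof -
  have [measurable]: "f \<in> borel_measurable borel" "m \<in> borel_measurable borel"
    using square_integrable_borel[OF f] m by auto
  have C0: "C \<ge> 0" using C[of 0] by linarith
  have b: "norm (m x * f x) \<le> norm (C * f x)" for x
    using mult_right_mono[OF C[of x], of "\<bar>f x\<bar>"] C0 by (simp add: abs_mult)
  have "(\<lambda>x. m x * f x) \<in> borel_measurable borel" by measurable
  from square_integrable_bound[OF l2_scale(1)[OF f C0] this b]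
  show "square_integrable (\<lambda>x. m x * f x)" "l2 (\<lambda>x. m x * f x) \<le> C * l2 f"
    unfolding l2_scale(2)[OF f C0] by blast+
qed

lemma compact_support_integrable:
  fixes f :: "'a::euclidean_space \<Rightarrow> real"
  assumes f: "square_integrable f" and supp: "\<And>x. norm x > \<rho> \<Longrightarrow> f x = 0"
  shows "integrable lborel f"
proof -
  have [measurable]: "f \<in> borel_measurable borel" by (rule square_integrable_borel[OF f])
  have ic: "square_integrable (indicator (cball (0::'a) \<rho>) :: 'a \<Rightarrow> real)"
    by (rule l2_indicator(1)[OF _ emeasure_lborel_cball_finite]) simp
  show ?thesis
  proof (rule Bochner_Integration.integrable_bound[OF Cauchy_Schwarz_l2(1)[OF f ic]])
    show "AE x in lborel. norm (f x) \<le> norm (norm (f x) * norm (indicator (cball 0 \<rho>) x :: real))"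
    proof (rule AE_I2)
      fix x show "norm (f x) \<le> norm (norm (f x) * norm (indicator (cball 0 \<rho>) x :: real))"
        using supp[of x] by (cases "norm x \<le> \<rho>") auto
    qed
  qed simp
qed

lemma borel_pair_measurable:
  fixes f :: "'a::euclidean_space \<times> 'b::euclidean_space \<Rightarrow> 'c::topological_space"
  shows "f \<in> borel_measurable borel \<longleftrightarrow> f \<in> borel_measurable (borel \<Otimes>\<^sub>M borel)"
  by (simp add: borel_prod)

lemma l2_add_square:
  fixes f1 f2 :: "'a::euclidean_space \<Rightarrow> real"
  assumes f1: "square_integrable f1" and f2: "square_integrable f2"
  shows "square_integrable (\<lambda>x. f1 x + f2 x)" "(l2 (\<lambda>x. f1 x + f2 x))\<^sup>2 \<le> 2 * (l2 f1)\<^sup>2 + 2 * (l2 f2)\<^sup>2"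
proof -
  have "square_integrable (\<lambda>x. - f2 x)" using f2 by (simp add: square_integrable_def)
  from square_integrable_diff[OF f1 this] show sq: "square_integrable (\<lambda>x. f1 x + f2 x)" by simp
  have "(l2 (\<lambda>x. f1 x + f2 x))\<^sup>2 = (\<integral>x. (norm (f1 x + f2 x))\<^sup>2 \<partial>lborel)" by (rule l2_square)
  also have "\<dots> \<le> (\<integral>x. 2 * (norm (f1 x))\<^sup>2 + 2 * (norm (f2 x))\<^sup>2 \<partial>lborel)"
  proof (rule integral_mono)
    fix x show "(norm (f1 x + f2 x))\<^sup>2 \<le> 2 * (norm (f1 x))\<^sup>2 + 2 * (norm (f2 x))\<^sup>2"
      using sum_squares_bound[of "f1 x" "f2 x"] by (simp add: power2_sum)
  qed (use sq f1 f2 in \<open>auto simp: square_integrable_def\<close>)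
  also have "\<dots> = 2 * (l2 f1)\<^sup>2 + 2 * (l2 f2)\<^sup>2"
    using f1 f2 by (simp add: l2_square square_integrable_def)
  finally show "(l2 (\<lambda>x. f1 x + f2 x))\<^sup>2 \<le> 2 * (l2 f1)\<^sup>2 + 2 * (l2 f2)\<^sup>2" .
qed

text \<open>The Fourier transform in the first variable, the second one being a parameter.\<close>

definition pft :: "('z::euclidean_space \<times> 'v::euclidean_space \<Rightarrow> real) \<Rightarrow> 'z \<Rightarrow> 'v \<Rightarrow> complex" where
  "pft f \<zeta> v = ft (\<lambda>z. complex_of_real (f (z, v))) \<zeta>"

lemma pft_borel:
  fixes f :: "'z::euclidean_space \<times> 'v::euclidean_space \<Rightarrow> real"
  assumes "f \<in> borel_measurable borel"
  shows "(\<lambda>(\<zeta>, v). pft f \<zeta> v) \<in> borel_measurable (borel \<Otimes>\<^sub>M borel)" "pft f \<zeta> \<in> borel_measurable borel"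
proof -
  have [measurable]: "f \<in> borel_measurable (borel \<Otimes>\<^sub>M borel)"
    using assms by (simp add: borel_pair_measurable)
  show *: "(\<lambda>(\<zeta>, v). pft f \<zeta> v) \<in> borel_measurable (borel \<Otimes>\<^sub>M borel)"
    unfolding pft_def ft_def by measurable
  show "pft f \<zeta> \<in> borel_measurable borel"
    unfolding pft_def ft_def by measurable
qed

lemma pft_Fubini:
  fixes f :: "'z::euclidean_space \<times> 'v::euclidean_space \<Rightarrow> real" and w :: "'v \<Rightarrow> real"
  assumes f: "integrable lborel (\<lambda>p. f p * w (snd p))"
  shows "(\<integral>v. pft f \<zeta> v * complex_of_real (w v) \<partial>lborel)
    = (\<integral>p. cis (- (fst p \<bullet> \<zeta>)) * complex_of_real (f p * w (snd p)) \<partial>lborel)"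
proof -
  let ?F = "\<lambda>(z, v). cis (- (z \<bullet> \<zeta>)) * complex_of_real (f (z, v) * w v)"
  have m: "(\<lambda>p. f p * w (snd p)) \<in> borel_measurable (borel \<Otimes>\<^sub>M borel)"
    using f by (simp add: borel_prod)
  have F: "integrable (lborel \<Otimes>\<^sub>M lborel) ?F"
  proof (rule Bochner_Integration.integrable_bound)
    show "integrable (lborel \<Otimes>\<^sub>M lborel) (\<lambda>p. f p * w (snd p))"
      using f by (simp add: lborel_prod)
    show "AE p in lborel \<Otimes>\<^sub>M lborel. norm (?F p) \<le> norm (f p * w (snd p))"
      by (intro AE_I2) (auto simp: norm_mult)
    have "(\<lambda>p. cis (- (fst p \<bullet> \<zeta>)) * complex_of_real (f p * w (snd p))) \<in> borel_measurable (lborel \<Otimes>\<^sub>M lborel)"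
      using m by measurable
    then show "?F \<in> borel_measurable (lborel \<Otimes>\<^sub>M lborel)" by (simp add: case_prod_unfold)
  qed
  have "(\<integral>v. pft f \<zeta> v * complex_of_real (w v) \<partial>lborel) = (\<integral>v. \<integral>z. ?F (z, v) \<partial>lborel \<partial>lborel)"
    by (simp add: pft_def ft_def mult.assoc[symmetric])
  also have "\<dots> = (\<integral>p. ?F p \<partial>(lborel \<Otimes>\<^sub>M lborel))"
    using lborel_pair.integral_snd[of "\<lambda>z v. ?F (z, v)"] F by (simp add: case_prod_unfold)
  finally show ?thesis by (simp add: lborel_prod case_prod_unfold)
qed

text \<open>Bessel's inequality for almost every \<open>v\<close>, integrated in \<open>v\<close>.\<close>

lemma pft_Bessel:
  fixes f :: "'z::euclidean_space \<times> 'v::euclidean_space \<Rightarrow> real"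
  assumes f: "square_integrable f" and i: "integrable lborel f"
  shows "(\<integral>\<^sup>+\<zeta>. \<integral>\<^sup>+v. ennreal ((norm (pft f \<zeta> v))\<^sup>2) \<partial>lborel \<partial>lborel)
    \<le> ennreal ((2 * pi) ^ DIM('z)) * ennreal ((l2 f)\<^sup>2)"
proof -
  have fb: "f \<in> borel_measurable borel" by (rule square_integrable_borel[OF f])
  then have [measurable]: "f \<in> borel_measurable (borel \<Otimes>\<^sub>M borel)" by (simp add: borel_pair_measurable)
  have [measurable]: "(\<lambda>(\<zeta>, v). pft f \<zeta> v) \<in> borel_measurable (borel \<Otimes>\<^sub>M borel)" by (rule pft_borel(1)[OF fb])
  have "(\<integral>\<^sup>+\<zeta>. \<integral>\<^sup>+v. ennreal ((norm (pft f \<zeta> v))\<^sup>2) \<partial>lborel \<partial>lborel)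
      = (\<integral>\<^sup>+v. \<integral>\<^sup>+\<zeta>. ennreal ((norm (pft f \<zeta> v))\<^sup>2) \<partial>lborel \<partial>lborel)"
    by (rule lborel_pair.Fubini'[symmetric]) measurable
  also have "\<dots> \<le> (\<integral>\<^sup>+v. ennreal ((2 * pi) ^ DIM('z)) * (\<integral>\<^sup>+z. ennreal ((f (z, v))\<^sup>2) \<partial>lborel) \<partial>lborel)"
  proof (rule nn_integral_mono_AE)
    have "integrable (lborel \<Otimes>\<^sub>M lborel) f" using i by (simp add: lborel_prod)
    then have "AE v in lborel. integrable lborel (\<lambda>z. f (z, v))"
      using lborel_pair.AE_integrable_snd[of "\<lambda>z v. f (z, v)"] by (simp add: case_prod_unfold)
    then show "AE v in lborel. (\<integral>\<^sup>+\<zeta>. ennreal ((norm (pft f \<zeta> v))\<^sup>2) \<partial>lborel)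
        \<le> ennreal ((2 * pi) ^ DIM('z)) * (\<integral>\<^sup>+z. ennreal ((f (z, v))\<^sup>2) \<partial>lborel)"
    proof eventually_elim
      case (elim v)
      then have "integrable lborel (\<lambda>z. complex_of_real (f (z, v)))" by simp
      from Bessel_inequality[OF this] show ?case by (simp add: pft_def)
    qed
  qed
  also have "\<dots> = ennreal ((2 * pi) ^ DIM('z)) * (\<integral>\<^sup>+v. \<integral>\<^sup>+z. ennreal ((f (z, v))\<^sup>2) \<partial>lborel \<partial>lborel)"
    by (rule nn_integral_cmult) measurable
  also have "(\<integral>\<^sup>+v. \<integral>\<^sup>+z. ennreal ((f (z, v))\<^sup>2) \<partial>lborel \<partial>lborel) = (\<integral>\<^sup>+p. ennreal ((f p)\<^sup>2) \<partial>(lborel \<Otimes>\<^sub>M lborel))"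
    by (rule lborel_pair.nn_integral_snd) measurable
  also have "\<dots> = ennreal ((l2 f)\<^sup>2)"
    using l2_nn_integral[OF f] by (simp add: lborel_prod)
  finally show ?thesis .
qed

lemma integral_cis_split:
  fixes F :: "'z::euclidean_space \<times> 'v::euclidean_space \<Rightarrow> real"
  assumes F: "integrable lborel F"
  shows "(\<integral>p. cis (- (fst p \<bullet> \<zeta>)) * complex_of_real (F p) \<partial>lborel)
    = complex_of_real (\<integral>p. cos (fst p \<bullet> \<zeta>) * F p \<partial>lborel) - \<i> * complex_of_real (\<integral>p. sin (fst p \<bullet> \<zeta>) * F p \<partial>lborel)"
    and "integrable lborel (\<lambda>p. cos (fst p \<bullet> \<zeta>) * F p)" "integrable lborel (\<lambda>p. sin (fst p \<bullet> \<zeta>) * F p)"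
    and "integrable lborel (\<lambda>p. cis (- (fst p \<bullet> \<zeta>)) * complex_of_real (F p))"
proof -
  have [measurable]: "F \<in> borel_measurable borel" using F by simp
  have [measurable]: "(\<lambda>p::'z \<times> 'v. fst p \<bullet> \<zeta>) \<in> borel_measurable borel"
    by (intro borel_measurable_continuous_onI continuous_on_inner continuous_on_fst continuous_on_id continuous_on_const)
  show c: "integrable lborel (\<lambda>p. cos (fst p \<bullet> \<zeta>) * F p)"
    by (rule Bochner_Integration.integrable_bound[OF F])
       (auto simp: abs_mult intro!: AE_I2 mult_left_le_one_le abs_cos_le_one)
  show s: "integrable lborel (\<lambda>p. sin (fst p \<bullet> \<zeta>) * F p)"
    by (rule Bochner_Integration.integrable_bound[OF F])
       (auto simp: abs_mult intro!: AE_I2 mult_left_le_one_le abs_sin_le_one)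
  have eq: "cis (- (fst p \<bullet> \<zeta>)) * complex_of_real (F p)
      = complex_of_real (cos (fst p \<bullet> \<zeta>) * F p) - \<i> * complex_of_real (sin (fst p \<bullet> \<zeta>) * F p)" for p
    by (simp add: complex_eq_iff)
  have ic: "integrable lborel (\<lambda>p. complex_of_real (cos (fst p \<bullet> \<zeta>) * F p))"
    "integrable lborel (\<lambda>p. complex_of_real (sin (fst p \<bullet> \<zeta>) * F p))"
    by (intro integrable_of_real c s)+
  show "integrable lborel (\<lambda>p. cis (- (fst p \<bullet> \<zeta>)) * complex_of_real (F p))"
    unfolding eq by (intro Bochner_Integration.integrable_diff integrable_mult_right ic)
  have "(\<integral>p. complex_of_real (cos (fst p \<bullet> \<zeta>) * F p) - \<i> * complex_of_real (sin (fst p \<bullet> \<zeta>) * F p) \<partial>lborel)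
      = (\<integral>p. complex_of_real (cos (fst p \<bullet> \<zeta>) * F p) \<partial>lborel) - (\<integral>p. \<i> * complex_of_real (sin (fst p \<bullet> \<zeta>) * F p) \<partial>lborel)"
    by (intro Bochner_Integration.integral_diff integrable_mult_right ic)
  also have "\<dots> = complex_of_real (\<integral>p. cos (fst p \<bullet> \<zeta>) * F p \<partial>lborel) - \<i> * complex_of_real (\<integral>p. sin (fst p \<bullet> \<zeta>) * F p \<partial>lborel)"
    by (simp only: integral_mult_right_zero integral_complex_of_real)
  finally show "(\<integral>p. cis (- (fst p \<bullet> \<zeta>)) * complex_of_real (F p) \<partial>lborel)
    = complex_of_real (\<integral>p. cos (fst p \<bullet> \<zeta>) * F p \<partial>lborel) - \<i> * complex_of_real (\<integral>p. sin (fst p \<bullet> \<zeta>) * F p \<partial>lborel)"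
    unfolding eq .
qed

text \<open>Smooth cutoffs of growing radius that tend to one, with uniformly bounded gradients, since all of them
  are rescalings of the first one.\<close>

definition plateau :: "nat \<Rightarrow> 'a::euclidean_space \<Rightarrow> real" where
  "plateau n z = bump (real (Suc n)) z * (1 / flat_exp 1)"

lemma flat_exp_mono: "x \<le> y \<Longrightarrow> flat_exp x \<le> flat_exp y"
  by (auto simp: flat_exp_def divide_left_mono intro: frac_le)

lemma smooth_in_ball_plateau: "smooth_in_ball (real (Suc n)) (plateau n)"
  unfolding plateau_def[abs_def] by (rule smooth_in_ball_mult[OF smooth_in_ball_bump Ck_const]) simp

lemma plateau_le: "\<bar>plateau n z\<bar> \<le> 1"
proof -
  have "bump (real (Suc n)) z \<le> flat_exp 1"
    unfolding bump_def by (rule flat_exp_mono) simp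
  then show ?thesis
    using flat_exp_pos[of 1] bump_nonneg[of "real (Suc n)" z] by (simp add: plateau_def)
qed

lemma plateau_tendsto: "(\<lambda>n. plateau n z) \<longlonglongrightarrow> 1"
proof -
  have c: "isCont flat_exp 1" using Ck_flat_exp[of 0] by (simp add: continuous_on_eq_continuous_at)
  have "(\<lambda>n. 1 - (norm z)\<^sup>2 * (inverse (real (Suc n)) * inverse (real (Suc n)))) \<longlonglongrightarrow> 1 - (norm z)\<^sup>2 * (0 * 0)"
    by (intro tendsto_diff tendsto_mult tendsto_const LIMSEQ_inverse_real_of_nat)
  then have "(\<lambda>n. 1 - (norm z)\<^sup>2 / (real (Suc n))\<^sup>2) \<longlonglongrightarrow> 1"
    by (simp add: power2_eq_square divide_inverse)
  from isCont_tendsto_compose[OF c this]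
  have "(\<lambda>n. bump (real (Suc n)) z * (1 / flat_exp 1)) \<longlonglongrightarrow> flat_exp 1 * (1 / flat_exp 1)"
    unfolding bump_def by (intro tendsto_mult tendsto_const)
  then show ?thesis using flat_exp_pos[of 1] by (simp add: plateau_def)
qed

lemma plateau_scale: "plateau n z = plateau 0 ((1 / real (Suc n)) *\<^sub>R z)"
  by (simp add: plateau_def bump_def power_divide)

lemma plateau_Lipschitz:
  obtains L where "L \<ge> 0" "\<And>n x y. \<bar>plateau n (x::'a::euclidean_space) - plateau n y\<bar> \<le> L * norm (x - y)"
proof -
  obtain L where L: "L \<ge> 0" "\<And>x y. \<bar>plateau 0 (x::'a) - plateau 0 y\<bar> \<le> L * norm (x - y)"
    using smooth_in_ball_Lipschitz[OF smooth_in_ball_plateau[of 0]] by metis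
  have "\<bar>plateau n x - plateau n y\<bar> \<le> L * norm (x - y)" for n and x y :: 'a
  proof -
    have "\<bar>plateau n x - plateau n y\<bar> \<le> L * norm ((1 / real (Suc n)) *\<^sub>R x - (1 / real (Suc n)) *\<^sub>R y)"
      unfolding plateau_scale[of n] by (rule L(2))
    also have "norm ((1 / real (Suc n)) *\<^sub>R x - (1 / real (Suc n)) *\<^sub>R y) = (1 / real (Suc n)) * norm (x - y)"
      by (simp add: scaleR_diff_right[symmetric] del: of_nat_Suc)
    also have "L * ((1 / real (Suc n)) * norm (x - y)) \<le> L * (1 * norm (x - y))"
      by (intro mult_left_mono mult_right_mono L) auto
    finally show ?thesis by simp
  qed
  with L(1) show thesis by (rule that)
qed

text \<open>The transport equation \<open>(c \<bullet> \<nabla>\<^sub>z) h = div\<^sub>v g + g0\<close> for Borel data on the product of the space of \<open>z\<close> and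
  the space of \<open>v\<close>, tested with products of a function of \<open>z\<close> and a function of \<open>v\<close> only; here \<open>g j\<close> are
  the components of \<open>g\<close>. The number \<open>L\<close> bounds the gradients of all the cutoffs.\<close>

locale kinetic =
  fixes R r S P A N Q L \<alpha> :: real
    and c :: "'v::euclidean_space \<Rightarrow> 'z::euclidean_space" and dc :: "'v \<Rightarrow> 'v \<Rightarrow> 'z"
    and h g0 :: "'z \<times> 'v \<Rightarrow> real" and g :: "'v \<Rightarrow> 'z \<times> 'v \<Rightarrow> real" and \<psi> :: "'v \<Rightarrow> real"
  assumes r: "0 \<le> r" "r < R" and S: "S \<ge> 0" and P: "P \<ge> 0" and N: "N \<ge> 0" and Q: "Q \<ge> 0"
    and \<alpha>: "0 < \<alpha>" "\<alpha> \<le> 1"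
    and L: "L \<ge> 0" "\<And>n x y. \<bar>plateau n (x::'z) - plateau n y\<bar> \<le> L * norm (x - y)"
    and A: "A \<ge> 1" "\<And>x. \<bar>profile x\<bar> \<le> A"
      "\<And>x y. \<bar>profile x - profile y\<bar> \<le> A * \<bar>x - y\<bar>"
    and c: "c \<in> borel_measurable borel" "\<And>v. norm (c v) \<le> S" "\<And>v. norm v \<ge> R \<Longrightarrow> c v = 0"
    and dc: "\<And>j. j \<in> Basis \<Longrightarrow> square_integrable (dc j)" "\<And>j. j \<in> Basis \<Longrightarrow> l2 (dc j) \<le> N"
      "\<And>j v. j \<in> Basis \<Longrightarrow> norm v \<ge> R \<Longrightarrow> dc j v = 0"
    and weak: "\<And>j \<phi> \<zeta>. j \<in> Basis \<Longrightarrow> test_function (ball 0 R) \<phi> \<Longrightarrow>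
      (\<integral>y. (c y \<bullet> \<zeta>) * frechet_derivative \<phi> (at y) j \<partial>lborel) = - (\<integral>y. (dc j y \<bullet> \<zeta>) * \<phi> y \<partial>lborel)"
    and h: "square_integrable h" and g0: "square_integrable g0"
    and g: "\<And>j. j \<in> Basis \<Longrightarrow> square_integrable (g j)"
    and supp: "\<And>z v. norm v \<ge> R \<Longrightarrow> h (z, v) = 0" "\<And>z v. norm v \<ge> R \<Longrightarrow> g0 (z, v) = 0"
      "\<And>j z v. j \<in> Basis \<Longrightarrow> norm v \<ge> R \<Longrightarrow> g j (z, v) = 0"
    and transport: "\<And>\<rho> \<phi> w. smooth_in_ball \<rho> \<phi> \<Longrightarrow> test_function (ball 0 R) w \<Longrightarrow>
      (\<integral>p. h p * (frechet_derivative \<phi> (at (fst p)) (c (snd p)) * w (snd p)) \<partial>lborel)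
      = (\<Sum>j\<in>Basis. \<integral>p. g j p * (\<phi> (fst p) * frechet_derivative w (at (snd p)) j) \<partial>lborel)
        - (\<integral>p. g0 p * (\<phi> (fst p) * w (snd p)) \<partial>lborel)"
    and nondeg: "\<And>\<zeta> \<delta>. \<zeta> \<noteq> 0 \<Longrightarrow> \<delta> > 0 \<Longrightarrow>
      measure lborel {v \<in> ball 0 R. \<bar>c v \<bullet> \<zeta>\<bar> \<le> \<delta>} \<le> Q * (\<delta> / norm \<zeta>) powr \<alpha>"
    and \<psi>: "integrable lborel \<psi>" "\<And>v. norm v > r \<Longrightarrow> \<psi> v = 0" "\<And>v. \<bar>\<psi> v\<bar> \<le> P"
      "\<And>v w. \<bar>\<psi> v - \<psi> w\<bar> \<le> P * norm (v - w)"
begin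

text \<open>The equation satisfied by \<open>plateau n * h\<close> has the same form, with a source \<open>en\<close> that contains the
  derivative of the cutoff.\<close>

definition "hn n p = plateau n (fst p) * h p"
definition "gn n j p = plateau n (fst p) * g j p"
definition "en n p = plateau n (fst p) * g0 p + frechet_derivative (plateau n) (at (fst p)) (c (snd p)) * h p"

lemma fst_borel: "(fst :: 'z \<times> 'v \<Rightarrow> 'z) \<in> borel_measurable borel"
  and snd_borel: "(snd :: 'z \<times> 'v \<Rightarrow> 'v) \<in> borel_measurable borel"
  by (intro borel_measurable_continuous_onI continuous_on_fst continuous_on_snd continuous_on_id)+

lemma plateau_fst_borel: "(\<lambda>p::'z \<times> 'v. plateau n (fst p)) \<in> borel_measurable borel"
  by (rule measurable_compose[OF fst_borel smooth_in_ball_borel[OF smooth_in_ball_plateau]])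

lemma plateau_derivative_le: "\<bar>frechet_derivative (plateau n) (at (z::'z)) u\<bar> \<le> L * norm u"
  by (rule derivative_le_Lipschitz[OF smooth_in_ball_has_derivative[OF smooth_in_ball_plateau] L(2)])

lemma plateau_derivative_borel:
  "(\<lambda>p::'z \<times> 'v. frechet_derivative (plateau n) (at (fst p)) (c (snd p))) \<in> borel_measurable borel"
  by (rule smooth_derivative_borel[OF smooth_in_ball_plateau fst_borel measurable_compose[OF snd_borel c(1)]])

lemma plateau_derivative_bound:
  "\<bar>frechet_derivative (plateau n) (at (fst p)) (c (snd p))\<bar> \<le> L * S"
  using plateau_derivative_le[of n "fst p" "c (snd p)"] mult_left_mono[OF c(2)[of "snd p"] L(1)] by linarith

lemma compact_support_pair_integrable:
  fixes f :: "'z \<times> 'v \<Rightarrow> real"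
  assumes f: "square_integrable f"
    and z: "\<And>z v. norm z > real (Suc n) \<Longrightarrow> f (z, v) = 0" and v: "\<And>z v. norm v \<ge> R \<Longrightarrow> f (z, v) = 0"
  shows "integrable lborel f"
proof (rule compact_support_integrable[OF f])
  fix p :: "'z \<times> 'v" assume p: "norm p > real (Suc n) + R"
  have "norm p \<le> norm (fst p) + norm (snd p)"
    using norm_Pair_le[of "fst p" "snd p"] by simp
  then have "norm (fst p) > real (Suc n) \<or> norm (snd p) \<ge> R" using p by linarith
  then show "f p = 0" using z[of "fst p" "snd p"] v[of "snd p" "fst p"] by auto
qed

lemma plateau_zero: "norm z > real (Suc n) \<Longrightarrow> plateau n z = 0"
  "norm z > real (Suc n) \<Longrightarrow> frechet_derivative (plateau n) (at z) u = 0"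
  using smooth_in_ballD(2)[OF smooth_in_ball_plateau[of n]]
    smooth_in_ballD(2)[OF smooth_in_ball_derivative[OF smooth_in_ball_plateau[of n]]] by blast+

lemma hn_sq: "square_integrable (hn n)" "l2 (hn n) \<le> l2 h" "integrable lborel (hn n)"
proof -
  show sq: "square_integrable (hn n)" and "l2 (hn n) \<le> l2 h"
    using bounded_mult_square_integrable[OF h plateau_fst_borel plateau_le] by (simp_all add: hn_def[abs_def])
  show "integrable lborel (hn n)"
    by (rule compact_support_pair_integrable[OF sq, where n=n])
       (simp_all add: hn_def plateau_zero supp del: of_nat_Suc)
qed

lemma gn_sq:
  assumes j: "j \<in> Basis"
  shows "square_integrable (gn n j)" "l2 (gn n j) \<le> l2 (g j)" "integrable lborel (gn n j)"
proof -
  show sq: "square_integrable (gn n j)" and "l2 (gn n j) \<le> l2 (g j)"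
    using bounded_mult_square_integrable[OF g[OF j] plateau_fst_borel plateau_le] by (simp_all add: gn_def[abs_def])
  show "integrable lborel (gn n j)"
    by (rule compact_support_pair_integrable[OF sq, where n=n])
       (simp_all add: gn_def plateau_zero supp j del: of_nat_Suc)
qed

lemma en_sq:
  "square_integrable (en n)" "(l2 (en n))\<^sup>2 \<le> 2 * (l2 g0)\<^sup>2 + 2 * (L * S * l2 h)\<^sup>2" "integrable lborel (en n)"
proof -
  note a = bounded_mult_square_integrable[OF g0 plateau_fst_borel[of n] plateau_le]
  note b = bounded_mult_square_integrable[OF h plateau_derivative_borel[of n] plateau_derivative_bound]
  note ab = l2_add_square[OF a(1) b(1)]
  show sq: "square_integrable (en n)" using ab(1) by (simp add: en_def[abs_def])
  have "(l2 (\<lambda>p. plateau n (fst p) * g0 p))\<^sup>2 \<le> (l2 g0)\<^sup>2"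
    using a(2) by (intro power_mono l2_nonneg) simp
  moreover have "(l2 (\<lambda>p. frechet_derivative (plateau n) (at (fst p)) (c (snd p)) * h p))\<^sup>2 \<le> (L * S * l2 h)\<^sup>2"
    using b(2) by (intro power_mono l2_nonneg)
  ultimately show "(l2 (en n))\<^sup>2 \<le> 2 * (l2 g0)\<^sup>2 + 2 * (L * S * l2 h)\<^sup>2"
    using ab(2) unfolding en_def[abs_def] by linarith
  show "integrable lborel (en n)"
    by (rule compact_support_pair_integrable[OF sq, where n=n])
       (simp_all add: en_def plateau_zero supp del: of_nat_Suc)
qed

lemma integrable_times_snd:
  fixes f :: "'z \<times> 'v \<Rightarrow> real"
  assumes f: "integrable lborel f" and w: "w \<in> borel_measurable borel" "\<And>v. \<bar>w v\<bar> \<le> C"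
  shows "integrable lborel (\<lambda>p. f p * w (snd p))"
proof (rule Bochner_Integration.integrable_bound[OF integrable_mult_right[OF f, of C]])
  have "(\<lambda>p::'z \<times> 'v. w (snd p)) \<in> borel_measurable borel"
    by (rule measurable_compose[OF snd_borel w(1)])
  then show "(\<lambda>p. f p * w (snd p)) \<in> borel_measurable lborel" using f by simp
  have C: "C \<ge> 0" using w(2)[of 0] by linarith
  show "AE p in lborel. norm (f p * w (snd p)) \<le> norm (C * f p)"
  proof (rule AE_I2)
    fix p show "norm (f p * w (snd p)) \<le> norm (C * f p)"
      using mult_right_mono[OF w(2)[of "snd p"], of "\<bar>f p\<bar>"] C by (simp add: abs_mult mult.commute)
  qed
qed

text \<open>The transport equation is tested with the real and the imaginary part of
  \<open>plateau n z * cis (- z \<bullet> \<zeta>) * w v\<close>. Because of the cutoff these are test functions, and the result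
  holds for each single frequency.\<close>

lemma velocity_equation:
  assumes w: "test_function (ball 0 R) w"
  shows "\<i> * (\<integral>v. complex_of_real (c v \<bullet> \<zeta>) * pft (hn n) \<zeta> v * complex_of_real (w v) \<partial>lborel)
    = (\<integral>v. pft (en n) \<zeta> v * complex_of_real (w v) \<partial>lborel)
      - (\<Sum>j\<in>Basis. \<integral>v. pft (gn n j) \<zeta> v * complex_of_real (frechet_derivative w (at v) j) \<partial>lborel)"
proof -
  let ?D = "\<lambda>p::'z \<times> 'v. frechet_derivative (plateau n) (at (fst p)) (c (snd p))"
  obtain \<rho> where ws: "smooth_in_ball \<rho> w" using test_function_smooth_in_ball[OF w] .
  obtain C where C: "\<And>v. \<bar>w v\<bar> \<le> C" using smooth_in_ball_bounded[OF ws] by blast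
  have Cd: "\<exists>C. \<forall>v. \<bar>frechet_derivative w (at v) j\<bar> \<le> C" for j
    using smooth_in_ball_bounded[OF smooth_in_ball_derivative[OF ws]] by metis
  have wb: "w \<in> borel_measurable borel" "\<And>j. (\<lambda>v. frechet_derivative w (at v) j) \<in> borel_measurable borel"
    using smooth_in_ball_borel[OF ws] smooth_in_ball_borel[OF smooth_in_ball_derivative[OF ws]] by auto
  have sw: "(\<lambda>v. (c v \<bullet> \<zeta>) * w v) \<in> borel_measurable borel"
    by (intro borel_measurable_times borel_measurable_inner c(1) borel_measurable_const wb)
  have swb: "\<bar>(c v \<bullet> \<zeta>) * w v\<bar> \<le> S * norm \<zeta> * C" for v
  proof -
    have "\<bar>c v \<bullet> \<zeta>\<bar> \<le> S * norm \<zeta>"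
      using Cauchy_Schwarz_ineq2[of "c v" \<zeta>] mult_right_mono[OF c(2)[of v], of "norm \<zeta>"] by simp
    then show ?thesis unfolding abs_mult
      by (rule mult_mono[OF _ C]) (use S in auto)
  qed
  \<comment> \<open>Writing each complex integral as cosine minus \<open>\<i>\<close> times sine, the claim is the cosine equation
    minus \<open>\<i>\<close> times the sine equation; \<open>F1\<close> and \<open>F4\<close> are the two parts of the source \<open>en\<close>.\<close>
  define F2 where "F2 p = hn n p * ((c (snd p) \<bullet> \<zeta>) * w (snd p))" for p
  define F14 where "F14 p = en n p * w (snd p)" for p
  define F3 where "F3 j p = gn n j p * frechet_derivative w (at (snd p)) j" for j p
  define F1 where "F1 p = ?D p * h p * w (snd p)" for p
  define F4 where "F4 p = plateau n (fst p) * g0 p * w (snd p)" for p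
  have i2: "integrable lborel F2" unfolding F2_def by (rule integrable_times_snd[OF hn_sq(3) sw swb])
  have i14: "integrable lborel F14" unfolding F14_def by (rule integrable_times_snd[OF en_sq(3) wb(1) C])
  have i3: "integrable lborel (F3 j)" if "j \<in> Basis" for j
  proof -
    obtain C' where "\<And>v. \<bar>frechet_derivative w (at v) j\<bar> \<le> C'" using Cd by blast
    then show ?thesis unfolding F3_def by (rule integrable_times_snd[OF gn_sq(3)[OF that] wb(2)])
  qed
  have sqD: "square_integrable (\<lambda>p. ?D p * h p)" 
    by (rule bounded_mult_square_integrable(1)[OF h plateau_derivative_borel[of n] plateau_derivative_bound])
  have iD: "integrable lborel (\<lambda>p. ?D p * h p)"
    by (rule compact_support_pair_integrable[OF sqD, where n=n])
       (simp_all add: plateau_zero supp del: of_nat_Suc)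
  have i1: "integrable lborel F1" unfolding F1_def by (rule integrable_times_snd[OF iD wb(1) C])
  have F14: "F14 p = F4 p + F1 p" for p
    by (simp add: F14_def F4_def F1_def en_def algebra_simps)
  have "integrable lborel (\<lambda>p. F14 p - F1 p)" by (rule Bochner_Integration.integrable_diff[OF i14 i1])
  then have i4: "integrable lborel F4" by (simp add: F14)
  let ?c = "\<lambda>F. \<integral>p. cos (fst p \<bullet> \<zeta>) * F p \<partial>(lborel :: ('z \<times> 'v) measure)"
  let ?s = "\<lambda>F. \<integral>p. sin (fst p \<bullet> \<zeta>) * F p \<partial>(lborel :: ('z \<times> 'v) measure)"
  let ?I = "\<lambda>F. \<integral>p. cis (- (fst p \<bullet> \<zeta>)) * complex_of_real (F p) \<partial>(lborel :: ('z \<times> 'v) measure)"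
  note split = integral_cis_split[where \<zeta>=\<zeta>]
  have inner: "Ck k (\<lambda>z::'z. z \<bullet> \<zeta>)" for k by (rule Ck_inner)
  have inner_d: "((\<lambda>z::'z. z \<bullet> \<zeta>) has_derivative (\<lambda>u. u \<bullet> \<zeta>)) (at z)" for z
    by (rule bounded_linear_imp_has_derivative[OF bounded_linear_inner_left])
  note pd = smooth_in_ball_has_derivative[OF smooth_in_ball_plateau[of n, where 'a='z]]
  have cos_d: "(cos has_derivative (\<lambda>u. - sin t * u)) (at t)" for t :: real
    using DERIV_cos[of t] unfolding has_field_derivative_def .
  have sin_d: "(sin has_derivative (\<lambda>u. cos t * u)) (at t)" for t :: real
    using DERIV_sin[of t] unfolding has_field_derivative_def .
  have cos_eq: "?c F1 - ?s F2 = (\<Sum>j\<in>Basis. ?c (F3 j)) - ?c F4"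
  proof -
    let ?\<phi> = "\<lambda>z. plateau n z * cos (z \<bullet> \<zeta>)"
    have sm: "smooth_in_ball (real (Suc n)) ?\<phi>"
      by (rule smooth_in_ball_mult[OF smooth_in_ball_plateau Ck_compose_real[OF Ck_cos inner]])
    have "(?\<phi> has_derivative (\<lambda>u. plateau n z * (- sin (z \<bullet> \<zeta>) * (u \<bullet> \<zeta>))
        + frechet_derivative (plateau n) (at z) u * cos (z \<bullet> \<zeta>))) (at z)" for z
      by (rule has_derivative_mult[OF pd has_derivative_compose[OF inner_d cos_d]])
    from frechet_derivative_at[OF this]
    have fd: "frechet_derivative ?\<phi> (at z) u = plateau n z * (- sin (z \<bullet> \<zeta>) * (u \<bullet> \<zeta>))
        + frechet_derivative (plateau n) (at z) u * cos (z \<bullet> \<zeta>)" for z u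
      by (rule fun_cong[symmetric])
    have "(\<integral>p. h p * (frechet_derivative ?\<phi> (at (fst p)) (c (snd p)) * w (snd p)) \<partial>lborel)
        = (\<integral>p. cos (fst p \<bullet> \<zeta>) * F1 p - sin (fst p \<bullet> \<zeta>) * F2 p \<partial>lborel)"
      by (intro Bochner_Integration.integral_cong refl) (simp add: fd F1_def F2_def hn_def algebra_simps)
    also have "\<dots> = ?c F1 - ?s F2"
      by (rule Bochner_Integration.integral_diff[OF split(2)[OF i1] split(3)[OF i2]])
    finally have l: "(\<integral>p. h p * (frechet_derivative ?\<phi> (at (fst p)) (c (snd p)) * w (snd p)) \<partial>lborel) = ?c F1 - ?s F2" .
    have r1: "(\<integral>p. g j p * (?\<phi> (fst p) * frechet_derivative w (at (snd p)) j) \<partial>lborel) = ?c (F3 j)" for j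
      by (intro Bochner_Integration.integral_cong refl) (simp add: F3_def gn_def mult_ac)
    have r2: "(\<integral>p. g0 p * (?\<phi> (fst p) * w (snd p)) \<partial>lborel) = ?c F4"
      by (intro Bochner_Integration.integral_cong refl) (simp add: F4_def mult_ac)
    from transport[OF sm w] show ?thesis unfolding l r1 r2 .
  qed
  have sin_eq: "?s F1 + ?c F2 = (\<Sum>j\<in>Basis. ?s (F3 j)) - ?s F4"
  proof -
    let ?\<phi> = "\<lambda>z. plateau n z * sin (z \<bullet> \<zeta>)"
    have sm: "smooth_in_ball (real (Suc n)) ?\<phi>"
      by (rule smooth_in_ball_mult[OF smooth_in_ball_plateau Ck_compose_real[OF Ck_sin inner]])
    have "(?\<phi> has_derivative (\<lambda>u. plateau n z * (cos (z \<bullet> \<zeta>) * (u \<bullet> \<zeta>))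
        + frechet_derivative (plateau n) (at z) u * sin (z \<bullet> \<zeta>))) (at z)" for z
      by (rule has_derivative_mult[OF pd has_derivative_compose[OF inner_d sin_d]])
    from frechet_derivative_at[OF this]
    have fd: "frechet_derivative ?\<phi> (at z) u = plateau n z * (cos (z \<bullet> \<zeta>) * (u \<bullet> \<zeta>))
        + frechet_derivative (plateau n) (at z) u * sin (z \<bullet> \<zeta>)" for z u
      by (rule fun_cong[symmetric])
    have "(\<integral>p. h p * (frechet_derivative ?\<phi> (at (fst p)) (c (snd p)) * w (snd p)) \<partial>lborel)
        = (\<integral>p. sin (fst p \<bullet> \<zeta>) * F1 p + cos (fst p \<bullet> \<zeta>) * F2 p \<partial>lborel)"
      by (intro Bochner_Integration.integral_cong refl) (simp add: fd F1_def F2_def hn_def algebra_simps)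
    also have "\<dots> = ?s F1 + ?c F2"
      by (rule Bochner_Integration.integral_add[OF split(3)[OF i1] split(2)[OF i2]])
    finally have l: "(\<integral>p. h p * (frechet_derivative ?\<phi> (at (fst p)) (c (snd p)) * w (snd p)) \<partial>lborel) = ?s F1 + ?c F2" .
    have r1: "(\<integral>p. g j p * (?\<phi> (fst p) * frechet_derivative w (at (snd p)) j) \<partial>lborel) = ?s (F3 j)" for j
      by (intro Bochner_Integration.integral_cong refl) (simp add: F3_def gn_def mult_ac)
    have r2: "(\<integral>p. g0 p * (?\<phi> (fst p) * w (snd p)) \<partial>lborel) = ?s F4"
      by (intro Bochner_Integration.integral_cong refl) (simp add: F4_def mult_ac)
    from transport[OF sm w] show ?thesis unfolding l r1 r2 .
  qed
  have f2: "(\<integral>v. complex_of_real (c v \<bullet> \<zeta>) * pft (hn n) \<zeta> v * complex_of_real (w v) \<partial>lborel) = ?I F2"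
    using pft_Fubini[OF i2[unfolded F2_def], of \<zeta>] by (simp add: F2_def mult_ac)
  have f14: "(\<integral>v. pft (en n) \<zeta> v * complex_of_real (w v) \<partial>lborel) = ?I F14"
    using pft_Fubini[OF i14[unfolded F14_def], of \<zeta>] by (simp add: F14_def)
  have f3: "(\<integral>v. pft (gn n j) \<zeta> v * complex_of_real (frechet_derivative w (at v) j) \<partial>lborel) = ?I (F3 j)"
    if "j \<in> Basis" for j
    using pft_Fubini[OF i3[OF that, unfolded F3_def], of \<zeta>] by (simp add: F3_def)
  have c14: "?c F14 = ?c F4 + ?c F1" "?s F14 = ?s F4 + ?s F1"
    unfolding F14 distrib_left
    by (rule Bochner_Integration.integral_add[OF split(2)[OF i4] split(2)[OF i1]],
        rule Bochner_Integration.integral_add[OF split(3)[OF i4] split(3)[OF i1]])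
  have sum3: "(\<Sum>j\<in>Basis. ?I (F3 j)) = complex_of_real (\<Sum>j\<in>Basis. ?c (F3 j)) - \<i> * complex_of_real (\<Sum>j\<in>Basis. ?s (F3 j))"
    by (simp add: split(1)[OF i3] sum_subtractf sum_distrib_left)
  have C3: "(\<Sum>j\<in>Basis. ?c (F3 j)) = ?c F1 - ?s F2 + ?c F4" and S3: "(\<Sum>j\<in>Basis. ?s (F3 j)) = ?s F1 + ?c F2 + ?s F4"
    using cos_eq sin_eq by linarith+
  have "\<i> * ?I F2 = ?I F14 - (\<Sum>j\<in>Basis. ?I (F3 j))"
    unfolding sum3 C3 S3 split(1)[OF i2] split(1)[OF i14] c14 by (simp add: complex_eq_iff)
  then show ?thesis unfolding f2 f14 using f3 by simp
qed

section \<open>The regularity estimate\<close>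

definition "\<sigma> = \<alpha> / (4 + \<alpha>)"
definition "M = P * A * (sqrt Q + sqrt (measure lborel (ball (0::'v) R)) + N)"
definition "avg z = (\<integral>v. h (z, v) * \<psi> v \<partial>lborel)"

lemma \<psi>_borel: "\<psi> \<in> borel_measurable borel"
  using \<psi>(1) by simp

lemma \<psi>_le_ball: "\<bar>\<psi> v\<bar> \<le> P * indicator (ball 0 R) v"
  using \<psi>(3)[of v] \<psi>(2)[of v] r by (cases "norm v \<le> r") auto

lemma ball_l2: "square_integrable (indicator (ball 0 R) :: 'v \<Rightarrow> real)"
  "l2 (indicator (ball 0 R) :: 'v \<Rightarrow> real) = sqrt (measure lborel (ball (0::'v) R))"
  by (rule l2_indicator[OF _ emeasure_lborel_ball_finite], simp)+

lemma \<psi>_l2: "square_integrable \<psi>" "l2 \<psi> \<le> P * sqrt (measure lborel (ball (0::'v) R))"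
proof -
  have le: "norm (\<psi> v) \<le> norm (P * indicator (ball 0 R) v :: real)" for v
    using \<psi>_le_ball[of v] by simp
  show "square_integrable \<psi>" "l2 \<psi> \<le> P * sqrt (measure lborel (ball (0::'v) R))"
    using square_integrable_bound[OF l2_scale(1)[OF ball_l2(1) P] \<psi>_borel le]
    unfolding l2_scale(2)[OF ball_l2(1) P] ball_l2(2) by blast+
qed

lemma h_pair_borel: "h \<in> borel_measurable (borel \<Otimes>\<^sub>M borel)"
  using square_integrable_borel[OF h] by (simp add: borel_pair_measurable)

lemma avg_square_integrable: "square_integrable avg"
proof -
  have [measurable]: "h \<in> borel_measurable (borel \<Otimes>\<^sub>M borel)" "\<psi> \<in> borel_measurable borel"
    by (rule h_pair_borel, rule \<psi>_borel)
  have [measurable]: "avg \<in> borel_measurable borel"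
    unfolding avg_def[abs_def] by measurable
  have "ennreal ((norm (avg z))\<^sup>2) \<le> ennreal ((l2 \<psi>)\<^sup>2) * (\<integral>\<^sup>+v. ennreal ((h (z, v))\<^sup>2) \<partial>lborel)" for z
  proof -
    have "ennreal (norm (avg z)) \<le> (\<integral>\<^sup>+v. ennreal (norm (h (z, v) * \<psi> v)) \<partial>lborel)"
    proof (cases "integrable lborel (\<lambda>v. h (z, v) * \<psi> v)")
      case True
      then show ?thesis unfolding avg_def by (rule integral_norm_bound_ennreal)
    next
      case False
      then show ?thesis by (simp add: avg_def not_integrable_integral_eq)
    qed
    also have "\<dots> = (\<integral>\<^sup>+v. ennreal \<bar>h (z, v)\<bar> * ennreal \<bar>\<psi> v\<bar> \<partial>lborel)"
      by (simp add: abs_mult ennreal_mult)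
    finally have "(ennreal (norm (avg z)))\<^sup>2 \<le> (\<integral>\<^sup>+v. ennreal \<bar>h (z, v)\<bar> * ennreal \<bar>\<psi> v\<bar> \<partial>lborel)\<^sup>2"
      by (rule power_mono) simp
    also have "\<dots> \<le> (\<integral>\<^sup>+v. (ennreal \<bar>h (z, v)\<bar>)\<^sup>2 \<partial>lborel) * (\<integral>\<^sup>+v. (ennreal \<bar>\<psi> v\<bar>)\<^sup>2 \<partial>lborel)"
      by (rule Cauchy_Schwarz_nn_integral) measurable
    also have "(\<integral>\<^sup>+v. (ennreal \<bar>\<psi> v\<bar>)\<^sup>2 \<partial>lborel) = ennreal ((l2 \<psi>)\<^sup>2)"
      using l2_nn_integral[OF \<psi>_l2(1)] by (simp add: ennreal_power)
    finally show ?thesis by (simp add: ennreal_power mult.commute)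
  qed
  then have "(\<integral>\<^sup>+z. ennreal ((norm (avg z))\<^sup>2) \<partial>lborel)
      \<le> (\<integral>\<^sup>+z. ennreal ((l2 \<psi>)\<^sup>2) * (\<integral>\<^sup>+v. ennreal ((h (z, v))\<^sup>2) \<partial>lborel) \<partial>lborel)"
    by (intro nn_integral_mono)
  also have "\<dots> = ennreal ((l2 \<psi>)\<^sup>2) * (\<integral>\<^sup>+z. \<integral>\<^sup>+v. ennreal ((h (z, v))\<^sup>2) \<partial>lborel \<partial>lborel)"
    by (rule nn_integral_cmult) measurable
  also have "(\<integral>\<^sup>+z. \<integral>\<^sup>+v. ennreal ((h (z, v))\<^sup>2) \<partial>lborel \<partial>lborel) = (\<integral>\<^sup>+p. ennreal ((h p)\<^sup>2) \<partial>(lborel \<Otimes>\<^sub>M lborel))"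
    by (rule lborel.nn_integral_fst) measurable
  also have "\<dots> = ennreal ((l2 h)\<^sup>2)"
    using l2_nn_integral[OF h] by (simp add: lborel_prod)
  also have "ennreal ((l2 \<psi>)\<^sup>2) * ennreal ((l2 h)\<^sup>2) < \<infinity>"
    by (simp add: ennreal_mult_less_top)
  finally show ?thesis by (simp add: square_integrable_iff_nn)
qed

lemma ft_average:
  "ft (\<lambda>z. complex_of_real (plateau n z) * complex_of_real (avg z)) \<zeta>
    = (\<integral>v. pft (hn n) \<zeta> v * complex_of_real (\<psi> v) \<partial>lborel)"
proof -
  let ?F = "\<lambda>(z, v). cis (- (z \<bullet> \<zeta>)) * complex_of_real (hn n (z, v) * \<psi> v)"
  note i = integrable_times_snd[OF hn_sq(3) \<psi>_borel \<psi>(3), of n]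
  have F: "integrable (lborel \<Otimes>\<^sub>M lborel) ?F"
    using integral_cis_split(4)[OF i, of \<zeta>] by (simp add: lborel_prod case_prod_unfold)
  have "(\<integral>v. pft (hn n) \<zeta> v * complex_of_real (\<psi> v) \<partial>lborel) = (\<integral>p. ?F p \<partial>(lborel \<Otimes>\<^sub>M lborel))"
    using pft_Fubini[OF i, of \<zeta>] by (simp add: lborel_prod case_prod_unfold)
  also have "\<dots> = (\<integral>z. \<integral>v. ?F (z, v) \<partial>lborel \<partial>lborel)"
    using lborel_pair.integral_fst[of "\<lambda>z v. ?F (z, v)"] F by (simp add: case_prod_unfold)
  also have "(\<lambda>z. \<integral>v. ?F (z, v) \<partial>lborel)
      = (\<lambda>z. cis (- (z \<bullet> \<zeta>)) * (complex_of_real (plateau n z) * complex_of_real (avg z)))"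
  proof
    fix z
    have "(\<integral>v. ?F (z, v) \<partial>lborel) = (\<integral>v. cis (- (z \<bullet> \<zeta>)) * complex_of_real (plateau n z) * complex_of_real (h (z, v) * \<psi> v) \<partial>lborel)"
      by (intro Bochner_Integration.integral_cong refl) (simp add: hn_def)
    also have "\<dots> = cis (- (z \<bullet> \<zeta>)) * complex_of_real (plateau n z) * complex_of_real (avg z)"
      unfolding avg_def by (simp only: integral_mult_right_zero integral_complex_of_real)
    finally show "(\<integral>v. ?F (z, v) \<partial>lborel) = cis (- (z \<bullet> \<zeta>)) * (complex_of_real (plateau n z) * complex_of_real (avg z))"
      by (simp add: mult.assoc)
  qed
  finally show ?thesis by (simp add: ft_def)
qed

text \<open>For \<open>|\<zeta>| \<ge> 1\<close> the resonant layer has width \<open>\<delta> = |\<zeta>|\<close> to the power \<open>(2 + \<alpha>) / (4 + \<alpha>)\<close>, which balances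
  its contribution against that of the derivative of the velocity field; both then decay like \<open>|\<zeta>|\<close>
  to the power \<open>- \<sigma>\<close>. For \<open>|\<zeta>| < 1\<close> the Cauchy--Schwarz inequality in \<open>v\<close> suffices.\<close>

lemma frequency_estimate:
  assumes Hs: "square_integrable (pft (hn n) \<zeta>)" and Es: "square_integrable (pft (en n) \<zeta>)"
    and gs: "\<And>j. j \<in> Basis \<Longrightarrow> square_integrable (pft (gn n j) \<zeta>)"
  shows "(1 + (norm \<zeta>)\<^sup>2) powr \<sigma> * (norm (\<integral>v. pft (hn n) \<zeta> v * complex_of_real (\<psi> v) \<partial>lborel))\<^sup>2
    \<le> 2 * (M * (l2 (pft (hn n) \<zeta>) + l2 (pft (en n) \<zeta>) + (\<Sum>j\<in>Basis. l2 (pft (gn n j) \<zeta>))))\<^sup>2"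
proof -
  let ?X = "norm (\<integral>v. pft (hn n) \<zeta> v * complex_of_real (\<psi> v) \<partial>lborel)"
  let ?H = "l2 (pft (hn n) \<zeta>)" and ?E = "l2 (pft (en n) \<zeta>)" and ?G = "\<Sum>j\<in>Basis. l2 (pft (gn n j) \<zeta>)"
  let ?V = "sqrt (measure lborel (ball (0::'v) R))"
  let ?x = "norm \<zeta>"
  have nn: "?H \<ge> 0" "?E \<ge> 0" "?G \<ge> 0" "?V \<ge> 0" "sqrt Q \<ge> 0"
    using Q by (auto intro: l2_nonneg sum_nonneg)
  have PA: "P * A \<ge> 0" "P \<le> P * A" using P A(1) mult_left_mono[of 1 A P] by auto
  have M0: "M \<ge> 0" unfolding M_def by (rule mult_nonneg_nonneg[OF PA(1)]) (use nn N in simp)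
  have \<sigma>: "0 < \<sigma>" "\<sigma> \<le> 1" using \<alpha> by (auto simp: \<sigma>_def divide_le_eq_1)
  show ?thesis
  proof (cases "?x \<ge> 1")
    case True
    define \<theta> where "\<theta> = (2 + \<alpha>) / (4 + \<alpha>)"
    have e1: "(\<theta> - 1) * \<alpha> = (- \<sigma>) + (- \<sigma>)" and e2: "1 - (\<theta> + \<theta>) = - \<sigma>" and e3: "\<sigma> \<le> \<theta>"
    proof -
      have t: "\<theta> = 1 - 2 / (4 + \<alpha>)" and s: "\<sigma> = 1 - 4 / (4 + \<alpha>)" and q: "0 < 1 / (4 + \<alpha>)"
        using \<alpha> by (simp_all add: \<theta>_def \<sigma>_def diff_divide_eq_iff)
      show "(\<theta> - 1) * \<alpha> = (- \<sigma>) + (- \<sigma>)" unfolding t by (simp add: \<sigma>_def)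
      show "1 - (\<theta> + \<theta>) = - \<sigma>" unfolding t s by simp
      show "\<sigma> \<le> \<theta>" unfolding t s using q by (simp add: divide_right_mono)
    qed
    define \<delta> where "\<delta> = ?x powr \<theta>"
    have x0: "?x > 0" "\<zeta> \<noteq> 0" using True by auto
    then have \<delta>: "\<delta> > 0" by (simp add: \<delta>_def)
    interpret A: averaging_data R r "S * ?x" P "N * ?x" A \<delta> "\<lambda>v. c v \<bullet> \<zeta>" "\<lambda>j v. dc j v \<bullet> \<zeta>"
      "pft (hn n) \<zeta>" "pft (en n) \<zeta>" "\<lambda>j. pft (gn n j) \<zeta>" \<psi>
    proof
      show "0 \<le> r" "r < R" "0 \<le> S * ?x" "0 \<le> P" "0 < \<delta>" by (use r S P \<delta> in simp_all)
      show "1 \<le> A" "\<bar>profile x\<bar> \<le> A" "\<bar>profile x - profile y\<bar> \<le> A * \<bar>x - y\<bar>" for x y by (rule A)+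
      show "(\<lambda>v. c v \<bullet> \<zeta>) \<in> borel_measurable borel"
        by (intro borel_measurable_inner c(1) borel_measurable_const)
      show "\<bar>c v \<bullet> \<zeta>\<bar> \<le> S * ?x" for v
        using Cauchy_Schwarz_ineq2[of "c v" \<zeta>] mult_right_mono[OF c(2)[of v], of ?x] by simp
      show "c v \<bullet> \<zeta> = 0" if "R \<le> norm v" for v using c(3)[OF that] by simp
      fix j :: 'v assume j: "j \<in> Basis"
      have sn: "square_integrable (\<lambda>v. norm (dc j v))" "l2 (\<lambda>v. norm (dc j v)) = l2 (dc j)"
        using dc(1)[OF j] by (auto simp: square_integrable_def l2_def)
      have m: "(\<lambda>v. dc j v \<bullet> \<zeta>) \<in> borel_measurable borel"
        by (intro borel_measurable_inner square_integrable_borel[OF dc(1)[OF j]] borel_measurable_const)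
      have le: "norm (dc j v \<bullet> \<zeta>) \<le> norm (?x * norm (dc j v))" for v
        using Cauchy_Schwarz_ineq2[of "dc j v" \<zeta>] by (simp add: mult.commute)
      note b = square_integrable_bound[OF l2_scale(1)[OF sn(1) norm_ge_zero] m le]
      show "square_integrable (\<lambda>v. dc j v \<bullet> \<zeta>)" by (rule b(1))
      have "l2 (\<lambda>v. dc j v \<bullet> \<zeta>) \<le> ?x * l2 (dc j)"
        using b(2) unfolding l2_scale(2)[OF sn(1) norm_ge_zero] sn(2) .
      also have "\<dots> \<le> ?x * N" by (rule mult_left_mono[OF dc(2)[OF j] norm_ge_zero])
      finally show "l2 (\<lambda>v. dc j v \<bullet> \<zeta>) \<le> N * ?x" by (simp add: mult.commute)
      show "dc j v \<bullet> \<zeta> = 0" if "R \<le> norm v" for v using dc(3)[OF j that] by simp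
      show "(\<integral>y. (c y \<bullet> \<zeta>) * frechet_derivative \<phi> (at y) j \<partial>lborel) = - (\<integral>y. (dc j y \<bullet> \<zeta>) * \<phi> y \<partial>lborel)"
        if "test_function (ball 0 R) \<phi>" for \<phi> by (rule weak[OF j that])
      show "square_integrable (pft (gn n j) \<zeta>)" by (rule gs[OF j])
    next
      show "square_integrable (pft (hn n) \<zeta>)" "square_integrable (pft (en n) \<zeta>)" by (rule Hs, rule Es)
      show "pft (hn n) \<zeta> v = 0" if "R \<le> norm v" for v
        using supp(1)[OF that] by (simp add: pft_def ft_def hn_def)
      show "\<i> * (\<integral>v. complex_of_real (c v \<bullet> \<zeta>) * pft (hn n) \<zeta> v * complex_of_real (w v) \<partial>lborel)
        = (\<integral>v. pft (en n) \<zeta> v * complex_of_real (w v) \<partial>lborel)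
          - (\<Sum>j\<in>Basis. \<integral>v. pft (gn n j) \<zeta> v * complex_of_real (frechet_derivative w (at v) j) \<partial>lborel)"
        if "test_function (ball 0 R) w" for w by (rule velocity_equation[OF that])
      show "integrable lborel \<psi>" "r < norm v \<Longrightarrow> \<psi> v = 0" "\<bar>\<psi> v\<bar> \<le> P" "\<bar>\<psi> v - \<psi> w\<bar> \<le> P * norm (v - w)" for v w
        by (rule \<psi>, assumption?)+
    qed
    have thin: "sqrt (measure lborel {v \<in> ball 0 R. \<bar>c v \<bullet> \<zeta>\<bar> \<le> \<delta>}) \<le> sqrt Q * ?x powr (- \<sigma>)"
    proof -
      have "measure lborel {v \<in> ball 0 R. \<bar>c v \<bullet> \<zeta>\<bar> \<le> \<delta>} \<le> Q * (\<delta> / ?x) powr \<alpha>"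
        by (rule nondeg[OF x0(2) \<delta>])
      also have "\<delta> / ?x = ?x powr (\<theta> - 1)" using x0 by (simp add: \<delta>_def powr_diff)
      also have "(?x powr (\<theta> - 1)) powr \<alpha> = ?x powr (- \<sigma>) * ?x powr (- \<sigma>)"
        unfolding powr_powr e1 powr_add ..
      finally have "sqrt (measure lborel {v \<in> ball 0 R. \<bar>c v \<bullet> \<zeta>\<bar> \<le> \<delta>}) \<le> sqrt (Q * (?x powr (- \<sigma>) * ?x powr (- \<sigma>)))"
        by (rule real_sqrt_le_mono)
      then show ?thesis by (simp add: real_sqrt_mult)
    qed
    have inv1: "1 / \<delta> \<le> ?x powr (- \<sigma>)"
    proof -
      have "1 / \<delta> = ?x powr (- \<theta>)" by (simp add: \<delta>_def powr_minus inverse_eq_divide)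
      also have "\<dots> \<le> ?x powr (- \<sigma>)" using e3 True by (intro powr_mono) auto
      finally show ?thesis .
    qed
    have inv2: "?x / \<delta>\<^sup>2 = ?x powr (- \<sigma>)"
    proof -
      have "\<delta>\<^sup>2 = ?x powr (\<theta> + \<theta>)" by (simp only: \<delta>_def power2_eq_square powr_add)
      then have "?x / \<delta>\<^sup>2 = ?x powr (1 - (\<theta> + \<theta>))" using x0 by (simp only: powr_diff) simp
      then show ?thesis unfolding e2 .
    qed
    have "?X \<le> P * A * (?H * sqrt (measure lborel {v \<in> ball 0 R. \<bar>c v \<bullet> \<zeta>\<bar> \<le> \<delta>})
        + (?E + ?G) * ?V / \<delta> + ?G * (N * ?x) / \<delta>\<^sup>2)"
      by (rule A.average_le)
    also have "(?E + ?G) * ?V / \<delta> = (?E + ?G) * ?V * (1 / \<delta>)" by simp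
    also have "?G * (N * ?x) / \<delta>\<^sup>2 = ?G * N * (?x / \<delta>\<^sup>2)" by simp
    also have "P * A * (?H * sqrt (measure lborel {v \<in> ball 0 R. \<bar>c v \<bullet> \<zeta>\<bar> \<le> \<delta>})
        + (?E + ?G) * ?V * (1 / \<delta>) + ?G * N * (?x / \<delta>\<^sup>2))
      \<le> P * A * (?H * (sqrt Q * ?x powr (- \<sigma>)) + (?E + ?G) * ?V * ?x powr (- \<sigma>) + ?G * N * ?x powr (- \<sigma>))"
      unfolding inv2 using nn thin inv1 mult_nonneg_nonneg[OF nn(3) N]
      by (intro mult_left_mono[OF _ PA(1)] add_mono mult_left_mono) auto
    also have "\<dots> = P * A * (sqrt Q * ?H + ?V * (?E + ?G) + N * ?G) * ?x powr (- \<sigma>)"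
      by (simp add: algebra_simps)
    also have "\<dots> \<le> P * A * ((sqrt Q + ?V + N) * (?H + ?E + ?G)) * ?x powr (- \<sigma>)"
    proof (intro mult_right_mono mult_left_mono[OF _ PA(1)])
      have "0 \<le> sqrt Q * ?E + sqrt Q * ?G + ?V * ?H + N * ?H + N * ?E"
        using nn N by (intro add_nonneg_nonneg mult_nonneg_nonneg)
      then show "sqrt Q * ?H + ?V * (?E + ?G) + N * ?G \<le> (sqrt Q + ?V + N) * (?H + ?E + ?G)"
        by (simp add: algebra_simps)
    qed simp
    finally have X: "?X \<le> M * (?H + ?E + ?G) * ?x powr (- \<sigma>)" by (simp add: M_def mult.assoc)
    have "1 \<le> ?x\<^sup>2" using True by simp
    then have "(1 + ?x\<^sup>2) powr \<sigma> \<le> (2 * ?x\<^sup>2) powr \<sigma>" using \<sigma> by (intro powr_mono2) auto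
    also have "\<dots> = 2 powr \<sigma> * (?x powr \<sigma> * ?x powr \<sigma>)"
      by (simp add: powr_mult power2_eq_square)
    also have "\<dots> \<le> 2 * (?x powr \<sigma> * ?x powr \<sigma>)"
      using \<sigma> powr_mono[of \<sigma> 1 "2::real"] by (intro mult_right_mono) auto
    finally have W: "(1 + ?x\<^sup>2) powr \<sigma> \<le> 2 * (?x powr \<sigma>)\<^sup>2" by (simp add: power2_eq_square)
    have "(1 + ?x\<^sup>2) powr \<sigma> * ?X\<^sup>2 \<le> (2 * (?x powr \<sigma>)\<^sup>2) * (M * (?H + ?E + ?G) * ?x powr (- \<sigma>))\<^sup>2"
      using W X by (intro mult_mono power_mono) auto
    also have "\<dots> = 2 * (M * (?H + ?E + ?G))\<^sup>2 * (?x powr \<sigma> * ?x powr (- \<sigma>))\<^sup>2"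
      by (simp add: power_mult_distrib mult_ac)
    also have "?x powr \<sigma> * ?x powr (- \<sigma>) = 1" using x0 by (simp add: powr_minus)
    finally show ?thesis by simp
  next
    case False
    have "?X \<le> ?H * l2 \<psi>"
    proof (rule norm_integral_le_l2(2)[OF Hs \<psi>_l2(1)])
      show "(\<lambda>v. pft (hn n) \<zeta> v * complex_of_real (\<psi> v)) \<in> borel_measurable borel"
        using square_integrable_borel[OF Hs] \<psi>_borel by measurable
    qed (simp add: norm_mult)
    also have "\<dots> \<le> ?H * (P * A * ?V)"
      using \<psi>_l2(2) mult_right_mono[OF PA(2) nn(4)] nn(1) by (intro mult_left_mono) auto
    also have "\<dots> \<le> M * (?H + ?E + ?G)"
    proof -
      have "0 \<le> P * A * (sqrt Q * (?H + ?E + ?G) + N * (?H + ?E + ?G) + ?V * (?E + ?G))"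
        by (rule mult_nonneg_nonneg[OF PA(1)]) (use nn N in \<open>intro add_nonneg_nonneg mult_nonneg_nonneg; simp\<close>)
      then show ?thesis by (simp add: M_def algebra_simps)
    qed
    finally have X: "?X \<le> M * (?H + ?E + ?G)" .
    have "?x\<^sup>2 \<le> 1" using False by (simp add: abs_square_le_1)
    then have "(1 + ?x\<^sup>2) powr \<sigma> \<le> 2 powr \<sigma>" using \<sigma> by (intro powr_mono2) auto
    also have "\<dots> \<le> 2" using \<sigma> powr_mono[of \<sigma> 1 "2::real"] by simp
    finally have W: "(1 + ?x\<^sup>2) powr \<sigma> \<le> 2" .
    show ?thesis using W X by (intro mult_mono power_mono) auto
  qed
qed

lemma sum_square_le:
  fixes a b :: real and f :: "'v \<Rightarrow> real"
  shows "(a + b + (\<Sum>j\<in>Basis. f j))\<^sup>2 \<le> 3 * real (DIM('v)) * (a\<^sup>2 + b\<^sup>2 + (\<Sum>j\<in>Basis. (f j)\<^sup>2))"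
proof -
  let ?G = "\<Sum>j\<in>(Basis :: 'v set). f j" and ?S = "\<Sum>j\<in>(Basis :: 'v set). (f j)\<^sup>2"
  have d: "1 \<le> real (DIM('v))" using DIM_positive[where 'a='v] by simp
  have "(a + b + ?G)\<^sup>2 \<le> 3 * (a\<^sup>2 + b\<^sup>2 + ?G\<^sup>2)"
    using sum_squares_bound[of a b] sum_squares_bound[of a ?G] sum_squares_bound[of b ?G]
    by (simp add: power2_eq_square algebra_simps)
  also have "?G\<^sup>2 \<le> real (DIM('v)) * ?S"
    using Cauchy_Schwarz_ineq_sum[of f "\<lambda>_. 1" "Basis :: 'v set"] by (simp add: mult.commute)
  also have "a\<^sup>2 \<le> real (DIM('v)) * a\<^sup>2" using mult_right_mono[OF d, of "a\<^sup>2"] by simp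
  also have "b\<^sup>2 \<le> real (DIM('v)) * b\<^sup>2" using mult_right_mono[OF d, of "b\<^sup>2"] by simp
  finally show ?thesis by (simp add: algebra_simps)
qed

definition "C1 = 2 * M\<^sup>2 * (3 * real (DIM('v)))"

text \<open>Stated with nonnegative integrals, so that it can be integrated in \<open>\<zeta>\<close>.\<close>

lemma frequency_estimate_nn:
  assumes "(\<integral>\<^sup>+v. ennreal ((norm (pft (hn n) \<zeta> v))\<^sup>2) \<partial>lborel) < \<infinity>"
    and "(\<integral>\<^sup>+v. ennreal ((norm (pft (en n) \<zeta> v))\<^sup>2) \<partial>lborel) < \<infinity>"
    and "\<And>j. j \<in> Basis \<Longrightarrow> (\<integral>\<^sup>+v. ennreal ((norm (pft (gn n j) \<zeta> v))\<^sup>2) \<partial>lborel) < \<infinity>"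
  shows "ennreal ((1 + (norm \<zeta>)\<^sup>2) powr \<sigma> * (norm (\<integral>v. pft (hn n) \<zeta> v * complex_of_real (\<psi> v) \<partial>lborel))\<^sup>2)
    \<le> ennreal C1 * ((\<integral>\<^sup>+v. ennreal ((norm (pft (hn n) \<zeta> v))\<^sup>2) \<partial>lborel)
      + (\<integral>\<^sup>+v. ennreal ((norm (pft (en n) \<zeta> v))\<^sup>2) \<partial>lborel)
      + (\<Sum>j\<in>Basis. \<integral>\<^sup>+v. ennreal ((norm (pft (gn n j) \<zeta> v))\<^sup>2) \<partial>lborel))"
proof -
  have Hs: "square_integrable (pft (hn n) \<zeta>)"
    using assms(1) square_integrable_iff_nn[OF pft_borel(2)[OF square_integrable_borel[OF hn_sq(1)]]] by blast
  have Es: "square_integrable (pft (en n) \<zeta>)"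
    using assms(2) square_integrable_iff_nn[OF pft_borel(2)[OF square_integrable_borel[OF en_sq(1)]]] by blast
  have gs: "square_integrable (pft (gn n j) \<zeta>)" if "j \<in> Basis" for j
    using assms(3)[OF that] square_integrable_iff_nn[OF pft_borel(2)[OF square_integrable_borel[OF gn_sq(1)[OF that]]]]
    by blast
  let ?T = "(l2 (pft (hn n) \<zeta>))\<^sup>2 + (l2 (pft (en n) \<zeta>))\<^sup>2 + (\<Sum>j\<in>Basis. (l2 (pft (gn n j) \<zeta>))\<^sup>2)"
  have T0: "?T \<ge> 0" by (intro add_nonneg_nonneg sum_nonneg) auto
  have C1: "C1 \<ge> 0" by (simp add: C1_def)
  have "(1 + (norm \<zeta>)\<^sup>2) powr \<sigma> * (norm (\<integral>v. pft (hn n) \<zeta> v * complex_of_real (\<psi> v) \<partial>lborel))\<^sup>2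
    \<le> 2 * (M * (l2 (pft (hn n) \<zeta>) + l2 (pft (en n) \<zeta>) + (\<Sum>j\<in>Basis. l2 (pft (gn n j) \<zeta>))))\<^sup>2"
    by (rule frequency_estimate[OF Hs Es gs])
  also have "\<dots> = 2 * M\<^sup>2 * (l2 (pft (hn n) \<zeta>) + l2 (pft (en n) \<zeta>) + (\<Sum>j\<in>Basis. l2 (pft (gn n j) \<zeta>)))\<^sup>2"
    by (simp add: power_mult_distrib)
  also have "\<dots> \<le> 2 * M\<^sup>2 * (3 * real (DIM('v)) * ?T)"
    by (rule mult_left_mono[OF sum_square_le]) simp
  finally have "(1 + (norm \<zeta>)\<^sup>2) powr \<sigma> * (norm (\<integral>v. pft (hn n) \<zeta> v * complex_of_real (\<psi> v) \<partial>lborel))\<^sup>2 \<le> C1 * ?T"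
    by (simp add: C1_def mult.assoc)
  then have "ennreal ((1 + (norm \<zeta>)\<^sup>2) powr \<sigma> * (norm (\<integral>v. pft (hn n) \<zeta> v * complex_of_real (\<psi> v) \<partial>lborel))\<^sup>2)
      \<le> ennreal C1 * ennreal ?T"
    unfolding ennreal_mult[OF C1 T0, symmetric] by (rule ennreal_leI)
  also have "ennreal ?T = (\<integral>\<^sup>+v. ennreal ((norm (pft (hn n) \<zeta> v))\<^sup>2) \<partial>lborel)
      + (\<integral>\<^sup>+v. ennreal ((norm (pft (en n) \<zeta> v))\<^sup>2) \<partial>lborel)
      + (\<Sum>j\<in>Basis. \<integral>\<^sup>+v. ennreal ((norm (pft (gn n j) \<zeta> v))\<^sup>2) \<partial>lborel)"
    using gs by (simp add: l2_nn_integral[OF Hs] l2_nn_integral[OF Es] l2_nn_integral sum_nonneg flip: sum_ennreal)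
  finally show ?thesis .
qed

definition "C2 = C1 * (2 + 2 * (L * S)\<^sup>2)"

text \<open>Integrate \<open>frequency_estimate_nn\<close> in \<open>\<zeta>\<close> and apply \<open>pft_Bessel\<close> to each term. The bound does not depend
  on \<open>n\<close>.\<close>

lemma plateau_average_bound:
  "(\<integral>\<^sup>+\<zeta>. ennreal ((1 + (norm \<zeta>)\<^sup>2) powr \<sigma> *
      (norm (nft (\<lambda>z. complex_of_real (plateau n z) * complex_of_real (avg z)) \<zeta>))\<^sup>2) \<partial>lborel)
    \<le> ennreal (C2 * ((l2 h)\<^sup>2 + (l2 g0)\<^sup>2 + (\<Sum>j\<in>Basis. (l2 (g j))\<^sup>2)))"
proof -
  let ?d = "(2 * pi) ^ DIM('z)"
  let ?k = "(2 * pi) powr (- (real DIM('z) / 2))"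
  let ?n = "\<lambda>f \<zeta>. \<integral>\<^sup>+v. ennreal ((norm (pft f \<zeta> v))\<^sup>2) \<partial>(lborel :: 'v measure)"
  have C1: "C1 \<ge> 0" by (simp add: C1_def)
  have kd: "?k\<^sup>2 * ?d = 1"
    by (rule fourier_constant)
  have meas: "?n f \<in> borel_measurable lborel" if "f \<in> borel_measurable borel" for f :: "'z \<times> 'v \<Rightarrow> real"
  proof -
    have [measurable]: "(\<lambda>(\<zeta>, v). pft f \<zeta> v) \<in> borel_measurable (borel \<Otimes>\<^sub>M borel)" by (rule pft_borel(1)[OF that])
    show ?thesis by measurable
  qed
  have fin: "AE \<zeta> in lborel. ?n f \<zeta> < \<infinity>" if "square_integrable f" "integrable lborel f"
    for f :: "'z \<times> 'v \<Rightarrow> real"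
  proof -
    have "(\<integral>\<^sup>+\<zeta>. ?n f \<zeta> \<partial>lborel) \<le> ennreal ?d * ennreal ((l2 f)\<^sup>2)" by (rule pft_Bessel[OF that])
    also have "\<dots> < \<infinity>" by (simp add: ennreal_mult_less_top)
    finally have "AE \<zeta> in lborel. ?n f \<zeta> \<noteq> \<infinity>"
      by (intro nn_integral_PInf_AE meas square_integrable_borel[OF that(1)]) auto
    then show ?thesis by eventually_elim (simp add: less_top)
  qed
  have fing: "AE \<zeta> in lborel. \<forall>j\<in>Basis. ?n (gn n j) \<zeta> < \<infinity>"
    by (rule AE_finite_allI[OF finite_Basis fin[OF gn_sq(1) gn_sq(3)]])
  have "(\<integral>\<^sup>+\<zeta>. ennreal ((1 + (norm \<zeta>)\<^sup>2) powr \<sigma> *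
      (norm (nft (\<lambda>z. complex_of_real (plateau n z) * complex_of_real (avg z)) \<zeta>))\<^sup>2) \<partial>lborel)
    \<le> (\<integral>\<^sup>+\<zeta>. ennreal (?k\<^sup>2 * C1) * (?n (hn n) \<zeta> + ?n (en n) \<zeta> + (\<Sum>j\<in>Basis. ?n (gn n j) \<zeta>)) \<partial>lborel)"
  proof (rule nn_integral_mono_AE)
    show "AE \<zeta> in lborel. ennreal ((1 + (norm \<zeta>)\<^sup>2) powr \<sigma> *
      (norm (nft (\<lambda>z. complex_of_real (plateau n z) * complex_of_real (avg z)) \<zeta>))\<^sup>2)
      \<le> ennreal (?k\<^sup>2 * C1) * (?n (hn n) \<zeta> + ?n (en n) \<zeta> + (\<Sum>j\<in>Basis. ?n (gn n j) \<zeta>))"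
      using fin[OF hn_sq(1,3)[of n]] fin[OF en_sq(1,3)[of n]] fing
    proof eventually_elim
      case (elim \<zeta>)
      let ?X = "norm (\<integral>v. pft (hn n) \<zeta> v * complex_of_real (\<psi> v) \<partial>lborel)"
      have "ennreal ((1 + (norm \<zeta>)\<^sup>2) powr \<sigma> *
          (norm (nft (\<lambda>z. complex_of_real (plateau n z) * complex_of_real (avg z)) \<zeta>))\<^sup>2)
        = ennreal (?k\<^sup>2) * ennreal ((1 + (norm \<zeta>)\<^sup>2) powr \<sigma> * ?X\<^sup>2)"
        unfolding nft_def ft_average
        by (subst ennreal_mult[symmetric]) (auto simp: norm_mult power_mult_distrib mult_ac)
      also have "\<dots> \<le> ennreal (?k\<^sup>2) * (ennreal C1 * (?n (hn n) \<zeta> + ?n (en n) \<zeta> + (\<Sum>j\<in>Basis. ?n (gn n j) \<zeta>)))"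
        using elim by (intro mult_left_mono frequency_estimate_nn) auto
      finally show ?case using C1 by (simp add: ennreal_mult mult.assoc)
    qed
  qed
  also have "\<dots> = ennreal (?k\<^sup>2 * C1) * ((\<integral>\<^sup>+\<zeta>. ?n (hn n) \<zeta> \<partial>lborel) + (\<integral>\<^sup>+\<zeta>. ?n (en n) \<zeta> \<partial>lborel)
      + (\<Sum>j\<in>Basis. \<integral>\<^sup>+\<zeta>. ?n (gn n j) \<zeta> \<partial>lborel))"
  proof -
    note mh = meas[OF square_integrable_borel[OF hn_sq(1)[of n]]] and me = meas[OF square_integrable_borel[OF en_sq(1)[of n]]]
      and mg = meas[OF square_integrable_borel[OF gn_sq(1)[of _ n]]]
    have ms: "(\<lambda>\<zeta>. \<Sum>j\<in>Basis. ?n (gn n j) \<zeta>) \<in> borel_measurable lborel"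
      by (rule borel_measurable_sum[OF mg])
    have "(\<integral>\<^sup>+\<zeta>. ?n (hn n) \<zeta> + ?n (en n) \<zeta> + (\<Sum>j\<in>Basis. ?n (gn n j) \<zeta>) \<partial>lborel)
        = (\<integral>\<^sup>+\<zeta>. ?n (hn n) \<zeta> + ?n (en n) \<zeta> \<partial>lborel) + (\<integral>\<^sup>+\<zeta>. (\<Sum>j\<in>Basis. ?n (gn n j) \<zeta>) \<partial>lborel)"
      by (rule nn_integral_add[OF borel_measurable_add[OF mh me] ms])
    also have "(\<integral>\<^sup>+\<zeta>. ?n (hn n) \<zeta> + ?n (en n) \<zeta> \<partial>lborel) = (\<integral>\<^sup>+\<zeta>. ?n (hn n) \<zeta> \<partial>lborel) + (\<integral>\<^sup>+\<zeta>. ?n (en n) \<zeta> \<partial>lborel)"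
      by (rule nn_integral_add[OF mh me])
    also have "(\<integral>\<^sup>+\<zeta>. (\<Sum>j\<in>Basis. ?n (gn n j) \<zeta>) \<partial>lborel) = (\<Sum>j\<in>Basis. \<integral>\<^sup>+\<zeta>. ?n (gn n j) \<zeta> \<partial>lborel)"
      by (rule nn_integral_sum[OF mg])
    finally show ?thesis
      by (subst nn_integral_cmult[OF borel_measurable_add[OF borel_measurable_add[OF mh me] ms]]) simp
  qed
  also have "\<dots> \<le> ennreal (?k\<^sup>2 * C1) * (ennreal ?d * ennreal ((l2 (hn n))\<^sup>2) + ennreal ?d * ennreal ((l2 (en n))\<^sup>2)
      + (\<Sum>j\<in>Basis. ennreal ?d * ennreal ((l2 (gn n j))\<^sup>2)))"
    by (intro mult_left_mono add_mono sum_mono pft_Bessel hn_sq en_sq gn_sq) auto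
  also have "\<dots> = ennreal (C1 * ((l2 (hn n))\<^sup>2 + (l2 (en n))\<^sup>2 + (\<Sum>j\<in>Basis. (l2 (gn n j))\<^sup>2)))"
  proof -
    have "ennreal (?k\<^sup>2 * C1) * (ennreal ?d * ennreal ((l2 (hn n))\<^sup>2) + ennreal ?d * ennreal ((l2 (en n))\<^sup>2)
        + (\<Sum>j\<in>Basis. ennreal ?d * ennreal ((l2 (gn n j))\<^sup>2)))
      = ennreal ((?k\<^sup>2 * C1) * (?d * (l2 (hn n))\<^sup>2 + ?d * (l2 (en n))\<^sup>2 + (\<Sum>j\<in>Basis. ?d * (l2 (gn n j))\<^sup>2)))"
      using C1 by (simp add: ennreal_mult sum_nonneg flip: sum_ennreal)
    also have "(?k\<^sup>2 * C1) * (?d * (l2 (hn n))\<^sup>2 + ?d * (l2 (en n))\<^sup>2 + (\<Sum>j\<in>Basis. ?d * (l2 (gn n j))\<^sup>2))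
        = (?k\<^sup>2 * ?d) * (C1 * ((l2 (hn n))\<^sup>2 + (l2 (en n))\<^sup>2 + (\<Sum>j\<in>Basis. (l2 (gn n j))\<^sup>2)))"
      unfolding sum_distrib_left[symmetric] distrib_left[symmetric] by (simp only: mult_ac)
    finally show ?thesis unfolding kd by simp
  qed
  also have "\<dots> \<le> ennreal (C2 * ((l2 h)\<^sup>2 + (l2 g0)\<^sup>2 + (\<Sum>j\<in>Basis. (l2 (g j))\<^sup>2)))"
  proof (rule ennreal_leI)
    have b1: "(l2 (hn n))\<^sup>2 \<le> (l2 h)\<^sup>2" by (rule power_mono[OF hn_sq(2) l2_nonneg])
    have b3: "(\<Sum>j\<in>Basis. (l2 (gn n j))\<^sup>2) \<le> (\<Sum>j\<in>Basis. (l2 (g j))\<^sup>2)"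
      by (intro sum_mono power_mono gn_sq(2) l2_nonneg)
    have p: "0 \<le> (L * S)\<^sup>2 * (l2 g0)\<^sup>2" "0 \<le> (L * S)\<^sup>2 * (\<Sum>j\<in>Basis. (l2 (g j))\<^sup>2)"
      "0 \<le> (\<Sum>j\<in>Basis. (l2 (g j))\<^sup>2)" "0 \<le> (l2 h)\<^sup>2"
      by (auto intro!: mult_nonneg_nonneg sum_nonneg)
    have "(l2 (hn n))\<^sup>2 + (l2 (en n))\<^sup>2 + (\<Sum>j\<in>Basis. (l2 (gn n j))\<^sup>2)
        \<le> (l2 h)\<^sup>2 + (2 * (l2 g0)\<^sup>2 + 2 * (L * S)\<^sup>2 * (l2 h)\<^sup>2) + (\<Sum>j\<in>Basis. (l2 (g j))\<^sup>2)"
      using b1 b3 en_sq(2)[of n] by (simp add: power_mult_distrib)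
    also have "\<dots> \<le> (2 + 2 * (L * S)\<^sup>2) * ((l2 h)\<^sup>2 + (l2 g0)\<^sup>2 + (\<Sum>j\<in>Basis. (l2 (g j))\<^sup>2))"
      using p by (simp add: algebra_simps)
    finally show "C1 * ((l2 (hn n))\<^sup>2 + (l2 (en n))\<^sup>2 + (\<Sum>j\<in>Basis. (l2 (gn n j))\<^sup>2))
        \<le> C2 * ((l2 h)\<^sup>2 + (l2 g0)\<^sup>2 + (\<Sum>j\<in>Basis. (l2 (g j))\<^sup>2))"
      unfolding C2_def mult.assoc by (rule mult_left_mono[OF _ C1])
  qed
  finally show ?thesis .
qed

theorem average_regularity:
  assumes F: "square_integrable F"
    and lim: "(\<lambda>n. \<integral>\<^sup>+\<xi>. ennreal ((norm (F \<xi> - nft (cutoff n (\<lambda>z. complex_of_real (avg z))) \<xi>))\<^sup>2) \<partial>lborel) \<longlonglongrightarrow> 0"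
  shows "(\<integral>\<^sup>+\<xi>. ennreal ((1 + (norm \<xi>)\<^sup>2) powr \<sigma> * (norm (F \<xi>))\<^sup>2) \<partial>lborel)
    \<le> ennreal (C2 * ((l2 h)\<^sup>2 + (l2 g0)\<^sup>2 + (\<Sum>j\<in>Basis. (l2 (g j))\<^sup>2)))"
proof (rule fourier_L2_weighted[OF _ F lim smooth_in_ball_borel[OF smooth_in_ball_plateau] plateau_le
      plateau_zero(1) plateau_tendsto _ plateau_average_bound])
  show "square_integrable (\<lambda>z. complex_of_real (avg z))"
    using avg_square_integrable by (auto simp: square_integrable_def)
  show "(\<lambda>\<xi>::'z. (1 + (norm \<xi>)\<^sup>2) powr \<sigma>) \<in> borel_measurable borel" by measurable
qed

end

section \<open>Borel representatives\<close>

text \<open>A Borel function that represents \<open>f\<close> on \<open>X\<close>, extended by zero, so that integrals over \<open>X\<close> become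
  integrals over the whole space.\<close>

definition borel_rep :: "'a::euclidean_space set \<Rightarrow> ('a \<Rightarrow> 'b::euclidean_space) \<Rightarrow> ('a \<Rightarrow> 'b) \<Rightarrow> bool" where
  "borel_rep X f f' \<longleftrightarrow> f' \<in> borel_measurable borel \<and> (\<forall>x. x \<notin> X \<longrightarrow> f' x = 0) \<and>
     (AE x in lborel. x \<in> X \<longrightarrow> f x = f' x)"

lemma borel_rep_exists:
  fixes f :: "'a::euclidean_space \<Rightarrow> 'b::euclidean_space"
  assumes f: "f \<in> borel_measurable (lebesgue_on X)" and X: "X \<in> sets borel"
  obtains f' where "borel_rep X f f'"
proof -
  let ?g = "\<lambda>x. if x \<in> X then f x else 0"
  have XL: "X \<in> sets lebesgue" using X by auto
  have g: "?g \<in> borel_measurable lebesgue"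
    using borel_measurable_if_lebesgue_on[OF XL, of UNIV f] f by (simp add: lebesgue_on_UNIV_eq)
  have "\<exists>k\<in>borel_measurable lborel. AE x in lborel. ?g x \<bullet> i = k x" for i
    by (rule completion_ex_borel_measurable_real) (intro borel_measurable_inner g borel_measurable_const)
  then obtain k where k: "\<And>i. k i \<in> borel_measurable lborel" "\<And>i. AE x in lborel. ?g x \<bullet> i = k i x"
    by metis
  define f' where "f' x = indicator X x *\<^sub>R (\<Sum>i\<in>Basis. k i x *\<^sub>R i)" for x
  have "AE x in lborel. \<forall>i\<in>Basis. ?g x \<bullet> i = k i x"
    by (rule AE_finite_allI[OF finite_Basis k(2)])
  then have ae: "AE x in lborel. x \<in> X \<longrightarrow> f x = f' x"
  proof eventually_elim
    case (elim x)
    show ?case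
    proof
      assume x: "x \<in> X"
      have "f x = (\<Sum>i\<in>Basis. (f x \<bullet> i) *\<^sub>R i)" by (rule euclidean_representation[symmetric])
      also have "\<dots> = (\<Sum>i\<in>Basis. k i x *\<^sub>R i)"
        using elim x by (intro sum.cong) auto
      finally show "f x = f' x" using x by (simp add: f'_def)
    qed
  qed
  have "f' \<in> borel_measurable borel"
    unfolding f'_def[abs_def] using X k(1)
    by (intro borel_measurable_scaleR borel_measurable_indicator borel_measurable_sum borel_measurable_const) auto
  then have "borel_rep X f f'" using ae by (auto simp: borel_rep_def f'_def)
  then show thesis by (rule that)
qed

lemma borel_repD:
  assumes "borel_rep X f f'"
  shows "f' \<in> borel_measurable borel" "\<And>x. x \<notin> X \<Longrightarrow> f' x = 0" "AE x in lborel. x \<in> X \<longrightarrow> f x = f' x"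
  using assms by (auto simp: borel_rep_def)

lemma lebesgue_measurable_AE:
  fixes F G :: "'a::euclidean_space \<Rightarrow> 'b::euclidean_space"
  assumes G: "G \<in> borel_measurable borel" and ae: "AE x in lborel. F x = G x"
  shows "F \<in> borel_measurable lebesgue"
proof (rule measurableI)
  fix S :: "'b set" assume S: "S \<in> sets borel"
  have "G -` S \<inter> space borel \<in> sets borel" by (rule measurable_sets[OF G S])
  then have GS: "G -` S \<in> sets lebesgue" by auto
  have "AE x in lebesgue. F x = G x" using ae by (rule AE_completion)
  then have "AE x in lebesgue. (x \<in> G -` S) \<longleftrightarrow> (x \<in> F -` S)" by eventually_elim simp
  then show "F -` S \<inter> space lebesgue \<in> sets lebesgue"
    using completion.in_sets_AE[OF _ GS, of "F -` S"] by simp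
qed simp

text \<open>Lebesgue measure is complete, so a function that agrees almost everywhere with a Borel function is
  measurable.\<close>

lemma lebesgue_on_integral_eq:
  fixes F G :: "'a::euclidean_space \<Rightarrow> 'b::euclidean_space"
  assumes X: "X \<in> sets borel" and rep: "borel_rep X F G"
  shows "(LINT x|lebesgue_on X. F x) = (\<integral>x. G x \<partial>lborel)"
    and "integrable (lebesgue_on X) F \<longleftrightarrow> integrable lborel G"
    and "F \<in> borel_measurable (lebesgue_on X)"
proof -
  note G = borel_repD[OF rep]
  let ?F = "\<lambda>x. if x \<in> X then F x else 0"
  have XL: "X \<in> sets lebesgue" using X by auto
  have ae: "AE x in lborel. ?F x = G x" using G(3) by eventually_elim (use G(2) in auto)
  have F: "?F \<in> borel_measurable lebesgue" by (rule lebesgue_measurable_AE[OF G(1) ae])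
  then show FX: "F \<in> borel_measurable (lebesgue_on X)"
    using borel_measurable_if_lebesgue_on[OF XL, of UNIV F] by (simp add: lebesgue_on_UNIV_eq)
  have GL: "G \<in> borel_measurable lebesgue" using G(1) by (simp add: measurable_completion)
  have aeL: "AE x in lebesgue. ?F x = G x" using ae by (rule AE_completion)
  have Xs: "X \<inter> space lebesgue \<in> sets lebesgue" using XL by simp
  have i: "(\<lambda>x. indicator X x *\<^sub>R F x) = ?F" by (auto split: split_indicator)
  have "(LINT x|lebesgue_on X. F x) = (\<integral>x. ?F x \<partial>lebesgue)"
    using integral_restrict_space[OF Xs, of F] unfolding i .
  also have "\<dots> = (\<integral>x. G x \<partial>lebesgue)" by (rule integral_cong_AE[OF F GL aeL])
  also have "\<dots> = (\<integral>x. G x \<partial>lborel)" by (rule integral_completion) (use G(1) in simp)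
  finally show "(LINT x|lebesgue_on X. F x) = (\<integral>x. G x \<partial>lborel)" .
  have "integrable (lebesgue_on X) F \<longleftrightarrow> integrable lebesgue ?F"
    using integrable_restrict_space[OF Xs, of F] unfolding i .
  also have "\<dots> \<longleftrightarrow> integrable lebesgue G" by (rule integrable_cong_AE[OF F GL aeL])
  also have "\<dots> \<longleftrightarrow> integrable lborel G" by (rule integrable_completion) (use G(1) in simp)
  finally show "integrable (lebesgue_on X) F \<longleftrightarrow> integrable lborel G" .
qed

lemma borel_rep_compose:
  fixes F :: "'a::euclidean_space \<Rightarrow> 'b::euclidean_space" and T :: "'a \<Rightarrow> 'b \<Rightarrow> 'c::euclidean_space"
  assumes rep: "borel_rep X F G" and T: "(\<lambda>x. T x (G x)) \<in> borel_measurable borel" "\<And>x. x \<notin> X \<Longrightarrow> T x 0 = 0"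
  shows "borel_rep X (\<lambda>x. T x (F x)) (\<lambda>x. T x (G x))"
  unfolding borel_rep_def
proof (intro conjI allI impI T(1))
  show "T x (G x) = 0" if "x \<notin> X" for x using T(2) borel_repD(2)[OF rep] that by simp
  show "AE x in lborel. x \<in> X \<longrightarrow> T x (F x) = T x (G x)"
    using borel_repD(3)[OF rep] by eventually_elim simp
qed

lemma L2_on_borel_rep:
  fixes F :: "'a::euclidean_space \<Rightarrow> 'b::euclidean_space"
  assumes X: "X \<in> sets borel" and rep: "borel_rep X F G"
  shows "L2_on X F \<longleftrightarrow> square_integrable G" "L2_norm X F = l2 G"
proof -
  have m: "(\<lambda>x. (norm (G x))\<^sup>2) \<in> borel_measurable borel"
    using borel_repD(1)[OF rep] by (intro borel_measurable_power measurable_compose[OF _ borel_measurable_norm])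
  have rep2: "borel_rep X (\<lambda>x. (norm (F x))\<^sup>2) (\<lambda>x. (norm (G x))\<^sup>2)"
    by (rule borel_rep_compose[OF rep, where T="\<lambda>x y. (norm y)\<^sup>2"]) (use m in simp_all)
  show "L2_on X F \<longleftrightarrow> square_integrable G"
    unfolding L2_on_def square_integrable_def
    using lebesgue_on_integral_eq(3)[OF X rep] lebesgue_on_integral_eq(2)[OF X rep2] borel_repD(1)[OF rep] by simp
  show "L2_norm X F = l2 G"
    unfolding L2_norm_def l2_def lebesgue_on_integral_eq(1)[OF X rep2] ..
qed

lemma L2_on_rep_obtain:
  fixes F :: "'a::euclidean_space \<Rightarrow> 'b::euclidean_space"
  assumes F: "L2_on X F" and X: "X \<in> sets borel"
  obtains G where "borel_rep X F G" "square_integrable G" "L2_norm X F = l2 G"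
proof -
  obtain G where G: "borel_rep X F G"
    using borel_rep_exists[OF _ X] F unfolding L2_on_def by blast
  then show thesis using that L2_on_borel_rep[OF X G] F by blast
qed

section \<open>Suprema of continuous functions\<close>

lemma Linf_norm_AE:
  assumes "Linf_on X f"
  shows "AE x in lebesgue_on X. norm (f x) \<le> Linf_norm X f"
proof -
  have fin: "esssup (lebesgue_on X) (\<lambda>x. ennreal (norm (f x))) < \<infinity>"
    using assms by (simp add: Linf_on_def)
  have "AE x in lebesgue_on X. ennreal (norm (f x)) \<le> esssup (lebesgue_on X) (\<lambda>x. ennreal (norm (f x)))"
    by (rule esssup_AE)
  then show ?thesis
  proof eventually_elim
    case (elim x)
    then have "enn2real (ennreal (norm (f x))) \<le> Linf_norm X f"
      unfolding Linf_norm_def by (rule enn2real_mono) (use fin in simp)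
    then show ?case by simp
  qed
qed

lemma AE_lebesgue_on_iff:
  assumes "X \<in> sets borel"
  shows "(AE x in lebesgue_on X. Q x) \<longleftrightarrow> (AE x in lebesgue. x \<in> X \<longrightarrow> Q x)"
  using assms by (subst AE_restrict_space_iff) auto

lemma AE_lebesgue_imp_lborel:
  assumes "AE x in lebesgue. Q x" shows "AE x in lborel. Q x"
  using assms by (simp add: AE_completion_iff)

text \<open>The set where a continuous function exceeds its essential supremum is open and null.\<close>

lemma Linf_norm_continuous:
  fixes f :: "'a::euclidean_space \<Rightarrow> 'b::euclidean_space"
  assumes c: "continuous_on UNIV f" and b: "\<And>x. norm (f x) \<le> C" and x: "x \<in> ball 0 R"
  shows "norm (f x) \<le> Linf_norm (ball 0 R) f"
proof (rule ccontr)
  let ?X = "ball (0::'a) R" and ?c = "Linf_norm (ball 0 R) f"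
  assume not: "\<not> norm (f x) \<le> ?c"
  have fb: "f \<in> borel_measurable borel" by (rule borel_measurable_continuous_onI[OF c])
  then have "f \<in> borel_measurable lebesgue" by (simp add: measurable_completion)
  then have fm: "f \<in> borel_measurable (lebesgue_on ?X)"
    by (rule measurable_restrict_space1)
  have "(\<lambda>x. ennreal (norm (f x))) \<in> borel_measurable (lebesgue_on ?X)"
    by (rule measurable_compose[OF fm, of "\<lambda>y. ennreal (norm y)"]) measurable
  then have "esssup (lebesgue_on ?X) (\<lambda>x. ennreal (norm (f x))) \<le> ennreal C"
    by (rule esssup_I) (intro AE_I2 ennreal_leI b)
  then have "esssup (lebesgue_on ?X) (\<lambda>x. ennreal (norm (f x))) < \<infinity>"
    by (rule le_less_trans) simp
  with fm have "Linf_on ?X f" by (simp add: Linf_on_def)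
  from Linf_norm_AE[OF this]
  have ae: "AE y in lborel. y \<in> ?X \<longrightarrow> norm (f y) \<le> ?c"
    by (intro AE_lebesgue_imp_lborel) (simp add: AE_lebesgue_on_iff)
  have "open (?X \<inter> {y. ?c < norm (f y)})"
    by (intro open_Int open_ball open_Collect_less continuous_on_const continuous_on_norm c)
  moreover have "x \<in> ?X \<inter> {y. ?c < norm (f y)}" using x not by simp
  ultimately obtain e where e: "e > 0" "ball x e \<subseteq> ?X \<inter> {y. ?c < norm (f y)}"
    using openE by blast
  from ae have "AE y in lborel. y \<notin> ball x e"
    by eventually_elim (use e(2) in force)
  then have "ball x e \<in> null_sets lborel" by (subst AE_iff_null_sets) auto
  then have "measure lborel (ball x e) = 0"
    by (simp add: null_sets_def measure_def)
  then show False using content_ball_pos[OF e(1), of x] by simp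
qed

text \<open>The form in which \<open>\<psi>\<close> enters the estimate: a compact support inside the ball, and one number that serves
  as a bound and as a Lipschitz constant.\<close>

lemma Ck_c_bounds:
  fixes \<psi> :: "'a::euclidean_space \<Rightarrow> real"
  assumes \<psi>: "Ck_c 1 (ball 0 R) \<psi>" and R: "R > 0"
  obtains r where "0 \<le> r" "r < R" "\<And>v. norm v > r \<Longrightarrow> \<psi> v = 0" "0 \<le> W1inf_norm (ball 0 R) \<psi>"
    "\<And>v. \<bar>\<psi> v\<bar> \<le> W1inf_norm (ball 0 R) \<psi>"
    "\<And>v w. \<bar>\<psi> v - \<psi> w\<bar> \<le> W1inf_norm (ball 0 R) \<psi> * norm (v - w)" "integrable lborel \<psi>"
proof -
  let ?K = "closure {x. \<psi> x \<noteq> 0}" and ?P = "W1inf_norm (ball 0 R) \<psi>"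
  have C1: "Ck (Suc 0) \<psi>" and K: "compact ?K" "?K \<subseteq> ball 0 R"
    using \<psi> by (auto simp: Ck_c_def)
  have z: "\<psi> v = 0" if "v \<notin> ?K" for v
    using that closure_subset[of "{x. \<psi> x \<noteq> 0}"] by blast
  obtain r where r: "0 \<le> r" "r < R" "\<And>v. v \<in> ?K \<Longrightarrow> norm v \<le> r"
  proof (cases "?K = {}")
    case True
    then show thesis using that[of 0] R by simp
  next
    case False
    obtain x where x: "x \<in> ?K" "\<forall>y\<in>?K. norm y \<le> norm x"
      using continuous_attains_sup[OF K(1) False, of norm] continuous_on_norm_id by blast
    then show thesis using that[of "norm x"] K(2) by auto
  qed
  have zr: "\<psi> v = 0" if "norm v > r" for v
    using that r(3)[of v] z[of v] by linarith
  have c0: "continuous_on UNIV \<psi>" using Ck_Suc_imp_Ck[OF C1] by simp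
  have cd: "continuous_on UNIV (\<lambda>x. frechet_derivative \<psi> (at x) u)" for u
    using Ck_Suc_derivative[OF C1, of u] by simp
  have cg: "continuous_on UNIV (grad \<psi>)"
    unfolding grad_def[abs_def] by (intro continuous_on_sum continuous_on_scaleR cd continuous_on_const)
  have dz: "frechet_derivative \<psi> (at v) = (\<lambda>_. 0)" if "norm v > r" for v
  proof -
    have "open {x :: 'a. norm x > r}" by (intro open_Collect_less continuous_on_const continuous_on_norm_id)
    then have "(\<psi> has_derivative (\<lambda>_. 0)) (at v)"
      by (rule has_derivative_transform_within_open[OF has_derivative_const[of 0]])
         (use that zr in simp_all)
    then show ?thesis by (rule frechet_derivative_at[symmetric])
  qed
  have gz: "grad \<psi> v = 0" if "norm v > r" for v by (simp add: grad_def dz[OF that])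
  have bounded: "\<exists>C. \<forall>x. norm (f x) \<le> C" if "continuous_on UNIV f" "\<And>v. norm v > r \<Longrightarrow> f v = 0"
    for f :: "'a \<Rightarrow> 'b::euclidean_space"
  proof -
    have "bounded (f ` cball 0 r)"
      by (intro compact_imp_bounded compact_continuous_image continuous_on_subset[OF that(1)] compact_cball subset_UNIV)
    then obtain C where C: "\<forall>x\<in>cball 0 r. norm (f x) \<le> C" unfolding bounded_iff by blast
    have "norm (f x) \<le> max C 0" for x
    proof (cases "norm x \<le> r")
      case True
      then have "norm (f x) \<le> C" using C by simp
      then show ?thesis by simp
    next
      case False
      then show ?thesis using that(2)[of x] by simp
    qed
    then show ?thesis by blast
  qed
  obtain B0 B1 where B: "\<And>x. norm (\<psi> x) \<le> B0" "\<And>x. norm (grad \<psi> x) \<le> B1"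
    using bounded[OF c0 zr] bounded[OF cg gz] by blast
  have n0: "0 \<le> Linf_norm (ball 0 R) \<psi>" "0 \<le> Linf_norm (ball 0 R) (grad \<psi>)"
    by (simp_all add: Linf_norm_def)
  have p0: "\<bar>\<psi> v\<bar> \<le> Linf_norm (ball 0 R) \<psi>" for v
    using Linf_norm_continuous[OF c0 B(1), of v R] zr[of v] r(2) n0(1) by (cases "norm v \<le> r") auto
  have p1: "norm (grad \<psi> v) \<le> Linf_norm (ball 0 R) (grad \<psi>)" for v
    using Linf_norm_continuous[OF cg B(2), of v R] gz[of v] r(2) n0(2) by (cases "norm v \<le> r") auto
  have der: "(\<psi> has_derivative frechet_derivative \<psi> (at v)) (at v)" for v
    by (rule Ck_Suc_has_derivative[OF C1])
  have gr: "frechet_derivative \<psi> (at v) u = grad \<psi> v \<bullet> u" for v u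
  proof -
    note lin = bounded_linear.linear[OF has_derivative_bounded_linear[OF der[of v]]]
    have "frechet_derivative \<psi> (at v) u = (\<Sum>i\<in>Basis. (u \<bullet> i) * frechet_derivative \<psi> (at v) i)"
      by (subst euclidean_representation[of u, symmetric])
         (simp add: linear_sum[OF lin] linear_cmul[OF lin] del: euclidean_representation)
    then show ?thesis
      unfolding grad_def inner_sum_left inner_scaleR_left by (simp add: inner_commute mult.commute)
  qed
  have lip: "\<bar>\<psi> v - \<psi> w\<bar> \<le> Linf_norm (ball 0 R) (grad \<psi>) * norm (v - w)" for v w
  proof -
    have "norm (\<psi> v - \<psi> w) \<le> Linf_norm (ball 0 R) (grad \<psi>) * norm (v - w)"
    proof (rule differentiable_bound[OF convex_UNIV der])
      fix y show "onorm (frechet_derivative \<psi> (at y)) \<le> Linf_norm (ball 0 R) (grad \<psi>)"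
      proof (rule onorm_le)
        fix u show "norm (frechet_derivative \<psi> (at y) u) \<le> Linf_norm (ball 0 R) (grad \<psi>) * norm u"
          unfolding gr real_norm_def
          by (rule order_trans[OF Cauchy_Schwarz_ineq2 mult_right_mono[OF p1 norm_ge_zero]])
      qed
    qed simp_all
    then show ?thesis by simp
  qed
  show thesis
  proof (rule that[OF r(1,2)])
    show "\<psi> v = 0" if "r < norm v" for v by (rule zr[OF that])
    show "0 \<le> ?P" using n0 by (simp add: W1inf_norm_def)
    show "\<bar>\<psi> v\<bar> \<le> ?P" for v using p0[of v] n0 by (simp add: W1inf_norm_def)
    show "\<bar>\<psi> v - \<psi> w\<bar> \<le> ?P * norm (v - w)" for v w
      using lip[of v w] mult_right_mono[of "Linf_norm (ball 0 R) (grad \<psi>)" ?P "norm (v - w)"] n0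
      by (simp add: W1inf_norm_def)
    have "\<psi> \<in> borel_measurable borel" by (rule borel_measurable_continuous_onI[OF c0])
    then show "integrable lborel \<psi>"
      by (rule integrable_bounded_support[OF _ _ zr]) (use B(1) in simp)
  qed
qed

section \<open>Integrals of derivatives\<close>

text \<open>The convolution of \<open>\<phi>\<close> with the indicator of a large ball is constant near the origin, where its
  value is the integral of \<open>\<phi>\<close>; and the derivative of the convolution is computed in the same way from
  the derivative of \<open>\<phi>\<close>.\<close>

lemma integral_derivative_eq_0:
  fixes \<phi> :: "'a::euclidean_space \<Rightarrow> real"
  assumes \<phi>: "smooth_in_ball r \<phi>"
  shows "(\<integral>y. frechet_derivative \<phi> (at y) u \<partial>lborel) = 0"
proof -
  define f :: "'a \<Rightarrow> real" where "f = indicator (ball 0 (\<bar>r\<bar> + 1))"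
  have f: "integrable lborel f"
    unfolding f_def by (intro integrable_real_indicator emeasure_lborel_ball_finite) simp
  have eq: "conv \<rho> f v = (\<integral>y. \<rho> y \<partial>lborel)" if \<rho>: "smooth_in_ball r \<rho>" and v: "norm v < 1" for \<rho> v
  proof -
    have "\<rho> (v - y) * f y = \<rho> (v - y)" for y
    proof (cases "norm y < \<bar>r\<bar> + 1")
      case False
      then have "norm (v - y) > r"
        using v norm_triangle_ineq2[of y v] by (simp add: norm_minus_commute)
      then show ?thesis by (simp add: smooth_in_ballD(2)[OF \<rho>])
    qed (simp add: f_def)
    then have "conv \<rho> f v = (\<integral>y. \<rho> (v - y) \<partial>lborel)" by (simp only: conv_def)
    then show ?thesis using integral_lborel_reflect[OF smooth_in_ball_borel[OF \<rho>], of v] by simp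
  qed
  have "open {v::'a. norm v < 1}" by (intro open_Collect_less continuous_on_const continuous_on_norm_id)
  then have "(conv \<phi> f has_derivative (\<lambda>_. 0)) (at 0)"
    by (rule has_derivative_transform_within_open[OF has_derivative_const[of "\<integral>y. \<phi> y \<partial>lborel"]])
       (use eq[OF \<phi>] in simp_all)
  then have "frechet_derivative (conv \<phi> f) (at 0) = (\<lambda>_. 0)" by (rule frechet_derivative_at[symmetric])
  then have "conv (\<lambda>x. frechet_derivative \<phi> (at x) u) f 0 = 0"
    using frechet_derivative_conv[OF \<phi> f, of 0 u] by simp
  then show ?thesis using eq[OF smooth_in_ball_derivative[OF \<phi>], of 0] by simp
qed

section \<open>From the frequency bound to the Sobolev norm\<close>

lemma fourier_integral_cutoff:
  fixes u a :: "'a::euclidean_space \<Rightarrow> real"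
  assumes rep: "borel_rep UNIV u a"
  shows "fourier_integral (\<lambda>x. if norm x \<le> real n then complex_of_real (u x) else 0) \<xi>
    = nft (cutoff n (\<lambda>x. complex_of_real (a x))) \<xi>"
proof -
  let ?T = "\<lambda>x y. cis (- (x \<bullet> \<xi>)) * (complex_of_real (indicator (cball 0 (real n)) x) * complex_of_real y)"
  note a = borel_repD(1)[OF rep]
  have m: "(\<lambda>x. ?T x (a x)) \<in> borel_measurable borel"
  proof -
    have [measurable]: "a \<in> borel_measurable borel" by (rule a)
    have [measurable]: "(indicator (cball 0 (real n)) :: 'a \<Rightarrow> real) \<in> borel_measurable borel"
      by (intro borel_measurable_indicator) simp
    show ?thesis by measurable
  qed
  have "borel_rep UNIV (\<lambda>x. ?T x (u x)) (\<lambda>x. ?T x (a x))"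
    by (rule borel_rep_compose[where T="?T", OF rep m]) simp
  from lebesgue_on_integral_eq(1)[OF _ this]
  have "(LINT x|lebesgue. ?T x (u x)) = (\<integral>x. ?T x (a x) \<partial>lborel)"
    by (simp add: lebesgue_on_UNIV_eq)
  moreover have "(\<lambda>x. cis (- (x \<bullet> \<xi>)) * (if norm x \<le> real n then complex_of_real (u x) else 0)) = (\<lambda>x. ?T x (u x))"
    by (auto split: split_indicator)
  ultimately show ?thesis
    unfolding fourier_integral_def nft_def ft_def cutoff_def by simp
qed

text \<open>The bound is required of every function that qualifies as the transform, since \<open>fourier_L2\<close>
  is one of them by choice.\<close>

lemma Hs_from_transform_bound:
  fixes u a :: "'a::euclidean_space \<Rightarrow> real"
  assumes rep: "borel_rep UNIV u a" and a: "square_integrable a" and B: "B \<ge> 0"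
    and bound: "\<And>F. square_integrable F \<Longrightarrow>
      (\<lambda>n. \<integral>\<^sup>+\<xi>. ennreal ((norm (F \<xi> - nft (cutoff n (\<lambda>x. complex_of_real (a x))) \<xi>))\<^sup>2) \<partial>lborel) \<longlonglongrightarrow> 0 \<Longrightarrow>
      (\<integral>\<^sup>+\<xi>. ennreal ((1 + (norm \<xi>)\<^sup>2) powr s * (norm (F \<xi>))\<^sup>2) \<partial>lborel) \<le> ennreal (B\<^sup>2)"
  shows "Hs s u" "Hs_norm s u \<le> B"
proof -
  let ?u = "\<lambda>x. complex_of_real (u x)" and ?a = "\<lambda>x. complex_of_real (a x)"
  have ac: "square_integrable ?a" using a by (auto simp: square_integrable_def)
  have is_iff: "is_fourier_L2 ?u F \<longleftrightarrow> L2_on UNIV F \<and>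
      (\<lambda>n. \<integral>\<^sup>+\<xi>. ennreal ((norm (F \<xi> - nft (cutoff n ?a) \<xi>))\<^sup>2) \<partial>lborel) \<longlonglongrightarrow> 0" for F
    unfolding is_fourier_L2_def fourier_integral_cutoff[OF rep] nn_integral_completion ..
  obtain F0 where F0: "square_integrable F0"
    "(\<lambda>n. \<integral>\<^sup>+\<xi>. ennreal ((norm (F0 \<xi> - nft (cutoff n ?a) \<xi>))\<^sup>2) \<partial>lborel) \<longlonglongrightarrow> 0"
    using fourier_L2_exists[OF ac] by blast
  have "borel_rep UNIV F0 F0" using square_integrable_borel[OF F0(1)] by (simp add: borel_rep_def)
  then have "L2_on UNIV F0" using L2_on_borel_rep(1)[of UNIV F0 F0] F0(1) by simp
  with F0(2) have "is_fourier_L2 ?u F0" by (simp add: is_iff)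
  then have F: "is_fourier_L2 ?u (fourier_L2 ?u)"
    unfolding fourier_L2_def by (rule someI[of "is_fourier_L2 ?u"])
  let ?F = "fourier_L2 ?u"
  have L2F: "L2_on UNIV ?F" using F by (simp add: is_iff)
  obtain G where G: "borel_rep UNIV ?F G" "square_integrable G"
    using L2_on_rep_obtain[OF L2F] by auto
  note Gb = borel_repD(1)[OF G(1)]
  have ae: "AE \<xi> in lborel. ?F \<xi> = G \<xi>" using borel_repD(3)[OF G(1)] by simp
  have "(\<integral>\<^sup>+\<xi>. ennreal ((norm (?F \<xi> - nft (cutoff n ?a) \<xi>))\<^sup>2) \<partial>lborel)
      = (\<integral>\<^sup>+\<xi>. ennreal ((norm (G \<xi> - nft (cutoff n ?a) \<xi>))\<^sup>2) \<partial>lborel)" for n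
    by (rule nn_integral_cong_AE) (use ae in \<open>eventually_elim, simp\<close>)
  then have "(\<lambda>n. \<integral>\<^sup>+\<xi>. ennreal ((norm (G \<xi> - nft (cutoff n ?a) \<xi>))\<^sup>2) \<partial>lborel) \<longlonglongrightarrow> 0"
    using F by (simp add: is_iff)
  from bound[OF G(2) this]
  have le: "(\<integral>\<^sup>+\<xi>. ennreal ((1 + (norm \<xi>)\<^sup>2) powr s * (norm (G \<xi>))\<^sup>2) \<partial>lborel) \<le> ennreal (B\<^sup>2)" .
  define W where "W \<xi> = complex_of_real ((1 + (norm \<xi>)\<^sup>2) powr (s / 2)) * G \<xi>" for \<xi>
  have Wm: "W \<in> borel_measurable borel"
  proof -
    have [measurable]: "G \<in> borel_measurable borel" by (rule Gb)
    show ?thesis unfolding W_def[abs_def] by measurable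
  qed
  have "(norm (W \<xi>))\<^sup>2 = (1 + (norm \<xi>)\<^sup>2) powr s * (norm (G \<xi>))\<^sup>2" for \<xi>
  proof -
    have "((1 + (norm \<xi>)\<^sup>2) powr (s / 2))\<^sup>2 = (1 + (norm \<xi>)\<^sup>2) powr (s / 2 + s / 2)"
      by (simp only: power2_eq_square powr_add)
    then show ?thesis by (simp add: W_def norm_mult power_mult_distrib)
  qed
  then have "(\<integral>\<^sup>+\<xi>. ennreal ((norm (W \<xi>))\<^sup>2) \<partial>lborel) \<le> ennreal (B\<^sup>2)" using le by simp
  note W = l2_leI[OF Wm B this]
  have "borel_rep UNIV (bessel_weighted s u) W"
    unfolding bessel_weighted_def[abs_def] W_def[abs_def]
    by (rule borel_rep_compose[OF G(1), where T="\<lambda>\<xi> y. complex_of_real ((1 + (norm \<xi>)\<^sup>2) powr (s / 2)) * y"])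
       (use Wm in \<open>simp_all add: W_def[abs_def]\<close>)
  note wrep = L2_on_borel_rep[OF _ this]
  show "Hs s u"
    unfolding Hs_def using L2_on_borel_rep(1)[OF _ rep] a wrep(1) W(1) by simp
  show "Hs_norm s u \<le> B"
    unfolding Hs_norm_def using wrep(2) W(2) by simp
qed

section \<open>Phase space\<close>

text \<open>Fourier transformation acts on \<open>(t, x)\<close>, whereas in the triples \<open>(t, x, v)\<close> the last two components
  are grouped together.\<close>

definition reassoc :: "('a \<times> 'b) \<times> 'c \<Rightarrow> 'a \<times> 'b \<times> 'c" where
  "reassoc p = (fst (fst p), snd (fst p), snd p)"

lemma reassoc_borel [measurable]:
  "reassoc \<in> (borel :: (('a::euclidean_space \<times> 'b::euclidean_space) \<times> 'c::euclidean_space) measure) \<rightarrow>\<^sub>M borel"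
  unfolding reassoc_def
  by (intro borel_measurable_continuous_onI continuous_on_Pair continuous_on_fst continuous_on_snd continuous_on_id)

lemma lborel_reassoc:
  "distr lborel borel reassoc = (lborel :: ('a::euclidean_space \<times> 'b::euclidean_space \<times> 'c::euclidean_space) measure)"
proof (rule measure_eqI)
  fix A :: "('a \<times> 'b \<times> 'c) set" assume "A \<in> sets (distr lborel borel reassoc)"
  then have A: "A \<in> sets borel" by simp
  define F where "F = (indicator A :: 'a \<times> 'b \<times> 'c \<Rightarrow> ennreal)"
  have F: "F \<in> borel_measurable borel" unfolding F_def using A by simp
  then have [measurable]: "F \<in> borel_measurable (borel \<Otimes>\<^sub>M (borel \<Otimes>\<^sub>M borel))" by (simp add: borel_prod)
  have e: "emeasure (distr lborel borel reassoc) A = (\<integral>\<^sup>+p. F (reassoc p) \<partial>lborel)"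
  proof -
    have "emeasure (distr lborel borel reassoc) A = (\<integral>\<^sup>+q. F q \<partial>distr lborel borel reassoc)"
      unfolding F_def using A by simp
    also have "\<dots> = (\<integral>\<^sup>+p. F (reassoc p) \<partial>lborel)"
      by (rule nn_integral_distr) (use F in simp_all)
    finally show ?thesis .
  qed
  also have "\<dots> = (\<integral>\<^sup>+p. F (reassoc p) \<partial>(lborel \<Otimes>\<^sub>M lborel))" by (simp add: lborel_prod)
  also have "\<dots> = (\<integral>\<^sup>+z. \<integral>\<^sup>+v. F (fst z, snd z, v) \<partial>lborel \<partial>lborel)"
  proof -
    have "(\<lambda>p. F (reassoc p)) \<in> borel_measurable borel"
      by (rule measurable_compose[OF reassoc_borel F])
    then have "(\<lambda>p. F (reassoc p)) \<in> borel_measurable (lborel \<Otimes>\<^sub>M lborel)" by (simp add: lborel_prod)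
    from lborel.nn_integral_fst[OF this] show ?thesis by (simp add: reassoc_def)
  qed
  also have "\<dots> = (\<integral>\<^sup>+z. \<integral>\<^sup>+v. F (fst z, snd z, v) \<partial>lborel \<partial>(lborel \<Otimes>\<^sub>M lborel))" by (simp add: lborel_prod)
  also have "\<dots> = (\<integral>\<^sup>+t. \<integral>\<^sup>+x. \<integral>\<^sup>+v. F (t, x, v) \<partial>lborel \<partial>lborel \<partial>lborel)"
  proof -
    have "(\<lambda>z. \<integral>\<^sup>+v. F (fst z, snd z, v) \<partial>lborel) \<in> borel_measurable (lborel \<Otimes>\<^sub>M lborel)" by measurable
    from lborel.nn_integral_fst[OF this] show ?thesis by simp
  qed
  also have "\<dots> = (\<integral>\<^sup>+t. \<integral>\<^sup>+y. F (t, y) \<partial>lborel \<partial>lborel)"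
  proof (rule nn_integral_cong)
    fix t
    have "(\<lambda>y. F (t, y)) \<in> borel_measurable (lborel \<Otimes>\<^sub>M lborel)" by measurable
    from lborel.nn_integral_fst[OF this]
    show "(\<integral>\<^sup>+x. \<integral>\<^sup>+v. F (t, x, v) \<partial>lborel \<partial>lborel) = (\<integral>\<^sup>+y. F (t, y) \<partial>lborel)" by (simp add: lborel_prod)
  qed
  also have "\<dots> = (\<integral>\<^sup>+q. F q \<partial>(lborel \<Otimes>\<^sub>M lborel))"
  proof -
    have "F \<in> borel_measurable (lborel \<Otimes>\<^sub>M lborel)" using F by (simp add: lborel_prod)
    from lborel.nn_integral_fst[OF this] show ?thesis .
  qed
  also have "\<dots> = emeasure lborel A" unfolding F_def using A by (simp add: lborel_prod)
  finally show "emeasure (distr lborel borel reassoc) A = emeasure lborel A" .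
qed simp

lemma integral_reassoc:
  fixes F :: "'a::euclidean_space \<times> 'b::euclidean_space \<times> 'c::euclidean_space \<Rightarrow> 'd::euclidean_space"
  assumes F: "F \<in> borel_measurable borel"
  shows "(\<integral>p. F (reassoc p) \<partial>lborel) = (\<integral>q. F q \<partial>lborel)"
    and "integrable lborel (\<lambda>p. F (reassoc p)) \<longleftrightarrow> integrable lborel F"
proof -
  have r: "reassoc \<in> lborel \<rightarrow>\<^sub>M (borel :: ('a \<times> 'b \<times> 'c) measure)" using reassoc_borel by simp
  show "(\<integral>p. F (reassoc p) \<partial>lborel) = (\<integral>q. F q \<partial>lborel)"
    using integral_distr[OF r F] by (simp add: lborel_reassoc)
  show "integrable lborel (\<lambda>p. F (reassoc p)) \<longleftrightarrow> integrable lborel F"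
    using integrable_distr_eq[OF r F] by (simp add: lborel_reassoc)
qed

lemma square_integrable_reassoc:
  fixes F :: "'a::euclidean_space \<times> 'b::euclidean_space \<times> 'c::euclidean_space \<Rightarrow> 'd::euclidean_space"
  assumes F: "square_integrable F"
  shows "square_integrable (\<lambda>p. F (reassoc p))" "l2 (\<lambda>p. F (reassoc p)) = l2 F"
proof -
  note Fb = square_integrable_borel[OF F]
  have m: "(\<lambda>q. (norm (F q))\<^sup>2) \<in> borel_measurable borel"
    by (intro borel_measurable_power measurable_compose[OF Fb borel_measurable_norm])
  show "square_integrable (\<lambda>p. F (reassoc p))"
    unfolding square_integrable_def
    using measurable_compose[OF reassoc_borel Fb] integral_reassoc(2)[OF m] F by (simp add: square_integrable_def)
  show "l2 (\<lambda>p. F (reassoc p)) = l2 F"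
    unfolding l2_def using integral_reassoc(1)[OF m] by simp
qed

lemma AE_reassoc:
  assumes "AE q in lborel. Q (q :: 'a::euclidean_space \<times> 'b::euclidean_space \<times> 'c::euclidean_space)"
  shows "AE p in lborel. Q (reassoc p)"
proof -
  have r: "reassoc \<in> lborel \<rightarrow>\<^sub>M (borel :: ('a \<times> 'b \<times> 'c) measure)" using reassoc_borel by simp
  have "AE q in distr lborel borel reassoc. Q q" unfolding lborel_reassoc by (rule assms)
  then show ?thesis by (rule AE_distrD[OF r])
qed

lemma AE_snd:
  assumes "AE v in lborel. Q (v :: 'b::euclidean_space)"
  shows "AE p in (lborel :: ('a::euclidean_space \<times> 'b) measure). Q (snd p)"
proof -
  obtain N where N: "{v \<in> space lborel. \<not> Q v} \<subseteq> N" "emeasure lborel N = 0" "N \<in> sets lborel"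
    using AE_E[OF assms] by blast
  have "AE v in lborel. v \<notin> N" using N by (intro AE_not_in) (simp add: null_sets_def)
  then have "AE z in (lborel :: 'a measure). AE v in (lborel :: 'b measure). snd (z, v) \<notin> N" by simp
  moreover have "{p \<in> space (lborel \<Otimes>\<^sub>M lborel). snd p \<notin> N} \<in> sets (lborel \<Otimes>\<^sub>M lborel)"
  proof -
    have [measurable]: "N \<in> sets borel" using N(3) by simp
    show ?thesis by measurable
  qed
  ultimately have "AE p in (lborel :: 'a measure) \<Otimes>\<^sub>M (lborel :: 'b measure). snd p \<notin> N"
    by (intro lborel_pair.AE_pair_measure) auto
  then have "AE p in (lborel :: ('a \<times> 'b) measure). snd p \<notin> N" unfolding lborel_prod .
  then show ?thesis by eventually_elim (use N(1) in auto)
qed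

lemma phase_space_borel: "phase_space R \<in> sets borel"
proof -
  have "open (phase_space R)" unfolding phase_space_def by (intro open_Times open_UNIV open_ball)
  then show ?thesis by (rule borel_open)
qed

lemma mem_phase_space: "q \<in> phase_space R \<longleftrightarrow> norm (snd (snd q)) < R"
  by (cases q) (auto simp: phase_space_def)

text \<open>The derivative in the direction \<open>(a, y, u)\<close> splits into a derivative of \<open>\<phi>\<close> and one of \<open>w\<close>,
  which turns the distributional equation into the one of the locale \<open>kinetic\<close>.\<close>

lemma product_test_function:
  fixes \<phi> :: "real \<times> (real^'n) \<Rightarrow> real" and w :: "real^'m \<Rightarrow> real"
  assumes \<phi>: "smooth_in_ball \<rho> \<phi>" and w: "test_function (ball 0 R) w"
  defines "\<Phi> \<equiv> \<lambda>q. \<phi> (fst q, fst (snd q)) * w (snd (snd q))"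
  shows "test_function (phase_space R) \<Phi>"
    and "frechet_derivative \<Phi> (at q) (a, y, u) = frechet_derivative \<phi> (at (fst q, fst (snd q))) (a, y) * w (snd (snd q))
      + \<phi> (fst q, fst (snd q)) * frechet_derivative w (at (snd (snd q))) u"
proof -
  obtain \<rho>' where ws: "smooth_in_ball \<rho>' w" using test_function_smooth_in_ball[OF w] .
  let ?L = "\<lambda>q :: real \<times> (real^'n) \<times> (real^'m). (fst q, fst (snd q))"
  have bs: "bounded_linear (\<lambda>q :: real \<times> (real^'n) \<times> (real^'m). snd (snd q))"
    by (rule bounded_linear_compose[OF bounded_linear_snd bounded_linear_snd])
  have bL: "bounded_linear ?L"
    by (rule bounded_linear_Pair[OF bounded_linear_fst bounded_linear_compose[OF bounded_linear_fst bounded_linear_snd]])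
  have Ck: "Ck k \<Phi>" for k
    unfolding \<Phi>_def
    by (rule Ck_mult[OF Ck_compose_linear[OF smooth_in_ballD(1)[OF \<phi>] bL] Ck_compose_linear[OF smooth_in_ballD(1)[OF ws] bs]])
  let ?S = "closure {v. w v \<noteq> 0}"
  have S: "compact ?S" "?S \<subseteq> ball 0 R" using w by (auto simp: test_function_def Ck_c_def)
  define T where "T = {q. norm (?L q) \<le> \<rho>} \<inter> {q. snd (snd q) \<in> ?S}"
  have "closed T"
    unfolding T_def
  proof (intro closed_Int)
    show "closed {q. norm (?L q) \<le> \<rho>}"
      by (intro closed_Collect_le continuous_on_norm bounded_linear.continuous_on[OF bL] continuous_on_id continuous_on_const)
    have "closed ((\<lambda>q :: real \<times> (real^'n) \<times> (real^'m). snd (snd q)) -` ?S)"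
      by (rule closed_vimage[OF closed_closure]) (intro continuous_on_snd continuous_on_id)
    then show "closed {q :: real \<times> (real^'n) \<times> (real^'m). snd (snd q) \<in> ?S}" by (simp add: vimage_def)
  qed
  moreover have "{q. \<Phi> q \<noteq> 0} \<subseteq> T"
  proof
    fix q assume "q \<in> {q. \<Phi> q \<noteq> 0}"
    then have "\<phi> (?L q) \<noteq> 0" "w (snd (snd q)) \<noteq> 0" by (auto simp: \<Phi>_def)
    then show "q \<in> T"
      using smooth_in_ballD(2)[OF \<phi>, of "?L q"] closure_subset[of "{v. w v \<noteq> 0}"]
      by (force simp: T_def)
  qed
  ultimately have cl: "closure {q. \<Phi> q \<noteq> 0} \<subseteq> T" by (simp add: closure_minimal)
  have "bounded T"
    unfolding bounded_iff
  proof (intro exI ballI)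
    fix q assume q: "q \<in> T"
    have "norm q \<le> norm (fst q) + (norm (fst (snd q)) + norm (snd (snd q)))"
      using norm_Pair_le[of "fst q" "snd q"] norm_Pair_le[of "fst (snd q)" "snd (snd q)"] by simp
    moreover have "norm (fst q) \<le> norm (?L q)" "norm (fst (snd q)) \<le> norm (?L q)"
      using norm_fst_le[of "fst q" "fst (snd q)"] norm_snd_le[of "fst (snd q)" "fst q"] by simp_all
    moreover have "norm (?L q) \<le> \<rho>" "norm (snd (snd q)) \<le> R"
      using q S(2) by (auto simp: T_def subset_iff)
    ultimately show "norm q \<le> \<rho> + \<rho> + R" by linarith
  qed
  then have "compact (closure {q. \<Phi> q \<noteq> 0})"
    using bounded_subset[OF _ cl] by (simp add: compact_eq_bounded_closed)
  moreover have "T \<subseteq> phase_space R"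
    using S(2) by (auto simp: T_def mem_phase_space subset_iff)
  ultimately show "test_function (phase_space R) \<Phi>"
    using Ck subset_trans[OF cl] unfolding test_function_def Ck_c_def by simp
  have d1: "((\<lambda>q. \<phi> (?L q)) has_derivative (\<lambda>d. frechet_derivative \<phi> (at (?L q)) (?L d))) (at q)" for q
    by (rule has_derivative_compose[OF bounded_linear_imp_has_derivative[OF bL] smooth_in_ball_has_derivative[OF \<phi>]])
  have d2: "((\<lambda>q :: real \<times> (real^'n) \<times> (real^'m). w (snd (snd q))) has_derivative
      (\<lambda>d. frechet_derivative w (at (snd (snd q))) (snd (snd d)))) (at q)" for q
    by (rule has_derivative_compose[OF bounded_linear_imp_has_derivative[OF bs] smooth_in_ball_has_derivative[OF ws]])
  have "(\<Phi> has_derivative (\<lambda>d. \<phi> (?L q) * frechet_derivative w (at (snd (snd q))) (snd (snd d))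
      + frechet_derivative \<phi> (at (?L q)) (?L d) * w (snd (snd q)))) (at q)"
    unfolding \<Phi>_def by (rule has_derivative_mult[OF d1 d2])
  from frechet_derivative_at[OF this, symmetric]
  show "frechet_derivative \<Phi> (at q) (a, y, u) = frechet_derivative \<phi> (at (fst q, fst (snd q))) (a, y) * w (snd (snd q))
      + \<phi> (fst q, fst (snd q)) * frechet_derivative w (at (snd (snd q))) u"
    by (simp add: add.commute)
qed

section \<open>The velocity field as a field of directions in time and space\<close>

text \<open>With \<open>z = (t, x)\<close> the operator \<open>\<partial>\<^sub>t + b \<bullet> \<nabla>\<^sub>x\<close> is the derivative in this direction.\<close>

definition direction :: "real \<Rightarrow> (real^'m \<Rightarrow> real^'n) \<Rightarrow> real^'m \<Rightarrow> real \<times> (real^'n)" where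
  "direction R b v = (if norm v < R then (1, b v) else 0)"

definition direction_derivative :: "(real^'m \<Rightarrow> real^'m^'n) \<Rightarrow> real^'m \<Rightarrow> real^'m \<Rightarrow> real \<times> (real^'n)" where
  "direction_derivative Db j v = (0, \<chi> i. Db v $ i \<bullet> j)"

lemma direction_inner: "norm v < R \<Longrightarrow> direction R b v \<bullet> \<zeta> = fst \<zeta> + b v \<bullet> snd \<zeta>"
  by (simp add: direction_def inner_prod_def)

lemma direction_borel:
  fixes b :: "real^'m \<Rightarrow> real^'n"
  assumes b: "b \<in> borel_measurable borel"
  shows "direction R b \<in> borel_measurable borel"
  unfolding direction_def[abs_def]
proof (rule measurable_If)
  show "(\<lambda>v. (1 :: real, b v)) \<in> borel_measurable (borel :: (real^'m) measure)"
    by (rule borel_measurable_Pair[OF borel_measurable_const b])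
  show "{v \<in> space borel. norm v < R} \<in> sets (borel :: (real^'m) measure)"
    by (simp add: open_Collect_less continuous_on_norm_id)
qed simp

lemma bounded_representative:
  fixes b :: "real^'m \<Rightarrow> real^'n"
  assumes b: "Linf_on (ball 0 R) b"
  obtains b' where "borel_rep (ball 0 R) b b'" "\<And>v. norm (b' v) \<le> Linf_norm (ball 0 R) b"
proof -
  let ?M = "Linf_norm (ball 0 R) b" and ?X = "ball (0::real^'m) R"
  have M: "?M \<ge> 0" by (simp add: Linf_norm_def)
  obtain b0 where b0: "borel_rep ?X b b0"
    using borel_rep_exists[of b ?X] b by (auto simp: Linf_on_def)
  note r = borel_repD[OF b0]
  define b' where "b' v = (if norm (b0 v) \<le> ?M then b0 v else 0)" for v
  have "AE v in lborel. v \<in> ?X \<longrightarrow> norm (b v) \<le> ?M"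
    by (rule AE_lebesgue_imp_lborel) (use Linf_norm_AE[OF b] in \<open>simp add: AE_lebesgue_on_iff\<close>)
  with r(3) have "AE v in lborel. v \<in> ?X \<longrightarrow> b v = b' v"
    by eventually_elim (auto simp: b'_def)
  moreover have "b' \<in> borel_measurable borel"
  proof -
    have [measurable]: "b0 \<in> borel_measurable borel" by (rule r(1))
    show ?thesis unfolding b'_def[abs_def] by measurable
  qed
  ultimately have "borel_rep ?X b b'" using r(2) by (simp add: borel_rep_def b'_def)
  moreover have "norm (b' v) \<le> ?M" for v using M by (simp add: b'_def)
  ultimately show thesis by (rule that)
qed

text \<open>If the spatial part \<open>\<xi>\<close> of \<open>\<zeta>\<close> is comparable with \<open>\<zeta>\<close>, divide by \<open>|\<xi>|\<close> and use nondegeneracy; as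
  \<open>\<alpha> \<le> 1\<close>, the power of the ratio \<open>2 (1 + M)\<close> is at most the ratio. Otherwise the temporal part
  dominates, so that \<open>c v \<bullet> \<zeta>\<close> exceeds \<open>|\<zeta>| / 2\<close>: the set is empty unless \<open>\<delta> > |\<zeta>| / 2\<close>, and then its
  measure is trivially bounded.\<close>

lemma direction_nondegenerate:
  fixes b b' :: "real^'m \<Rightarrow> real^'n"
  assumes rep: "borel_rep (ball 0 R) b b'" and M: "\<And>v. norm (b' v) \<le> M" "M \<ge> 0"
    and nd: "nondegenerate R K \<alpha> b" and K: "K > 0" and \<alpha>: "0 < \<alpha>" "\<alpha> \<le> 1"
    and \<zeta>: "\<zeta> \<noteq> 0" and \<delta>: "\<delta> > 0"
  shows "measure lborel {v \<in> ball 0 R. \<bar>direction R b' v \<bullet> \<zeta>\<bar> \<le> \<delta>}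
    \<le> (2 * (1 + M) * K + 2 * measure lborel (ball (0::real^'m) R)) * (\<delta> / norm \<zeta>) powr \<alpha>"
proof -
  let ?X = "ball (0::real^'m) R" and ?\<tau> = "fst \<zeta>" and ?\<xi> = "snd \<zeta>" and ?x = "norm \<zeta>"
  let ?E = "{v \<in> ?X. \<bar>direction R b' v \<bullet> \<zeta>\<bar> \<le> \<delta>}"
  let ?q = "(\<delta> / ?x) powr \<alpha>" and ?V = "measure lborel ?X"
  have x: "?x > 0" using \<zeta> by simp
  have q0: "?q \<ge> 0" by simp
  have E: "?E = {v \<in> ?X. \<bar>?\<tau> + b' v \<bullet> ?\<xi>\<bar> \<le> \<delta>}"
    by (auto simp: direction_inner)
  have mdir: "(\<lambda>v. direction R b' v \<bullet> \<zeta>) \<in> borel_measurable borel"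
    by (intro borel_measurable_inner direction_borel borel_repD(1)[OF rep] borel_measurable_const)
  have Eb: "?E \<in> sets borel"
  proof -
    have [measurable]: "(\<lambda>v. direction R b' v \<bullet> \<zeta>) \<in> borel_measurable borel" by (rule mdir)
    have "{v \<in> space borel. \<bar>direction R b' v \<bullet> \<zeta>\<bar> \<le> \<delta>} \<in> sets borel" by measurable
    then have "?X \<inter> {v \<in> space borel. \<bar>direction R b' v \<bullet> \<zeta>\<bar> \<le> \<delta>} \<in> sets borel"
      by (intro sets.Int) auto
    moreover have "?X \<inter> {v \<in> space borel. \<bar>direction R b' v \<bullet> \<zeta>\<bar> \<le> \<delta>} = ?E" by auto
    ultimately show ?thesis by simp
  qed
  show ?thesis
  proof (cases "?x \<le> norm ?\<xi> * (2 * (1 + M))")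
    case True
    have \<xi>: "norm ?\<xi> > 0"
    proof (rule ccontr)
      assume "\<not> norm ?\<xi> > 0"
      then have "norm ?\<xi> = 0" by simp
      then show False using True x by simp
    qed
    define \<mu> where "\<mu> = ?\<tau> / norm ?\<xi>"
    define \<nu> where "\<nu> = (1 / norm ?\<xi>) *\<^sub>R ?\<xi>"
    define \<epsilon> where "\<epsilon> = \<delta> / norm ?\<xi>"
    have \<epsilon>: "\<epsilon> > 0" using \<delta> \<xi> by (simp add: \<epsilon>_def)
    have \<nu>: "\<nu> \<in> sphere 0 1" using \<xi> by (simp add: \<nu>_def)
    let ?E' = "{v \<in> ?X. \<bar>\<mu> + b v \<bullet> \<nu>\<bar> \<le> \<epsilon>}"
    have scale: "\<bar>\<mu> + y \<bullet> \<nu>\<bar> \<le> \<epsilon> \<longleftrightarrow> \<bar>?\<tau> + y \<bullet> ?\<xi>\<bar> \<le> \<delta>" for y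
    proof -
      have "\<mu> + y \<bullet> \<nu> = (?\<tau> + y \<bullet> ?\<xi>) / norm ?\<xi>" by (simp add: \<mu>_def \<nu>_def add_divide_distrib)
      then show ?thesis using \<xi> by (simp add: \<epsilon>_def divide_le_cancel)
    qed
    have "AE v in lborel. v \<in> ?E \<longleftrightarrow> v \<in> ?E'"
      using borel_repD(3)[OF rep] by eventually_elim (auto simp: scale direction_inner)
    then have ae: "AE v in lebesgue. v \<in> ?E \<longleftrightarrow> v \<in> ?E'" by (rule AE_completion)
    have EL: "?E \<in> sets lebesgue" using Eb by auto
    have E'L: "?E' \<in> sets lebesgue" by (rule completion.in_sets_AE[OF ae EL]) simp
    have "measure lborel ?E = measure lebesgue ?E" using Eb by simp
    also have "\<dots> = measure lebesgue ?E'" by (rule measure_eq_AE[OF ae EL E'L])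
    also have "\<dots> \<le> K * \<epsilon> powr \<alpha>" using nd \<nu> \<epsilon> unfolding nondegenerate_def by blast
    also have "\<epsilon> powr \<alpha> \<le> (2 * (1 + M) * (\<delta> / ?x)) powr \<alpha>"
    proof (rule powr_mono2)
      have "\<delta> * ?x \<le> \<delta> * (norm ?\<xi> * (2 * (1 + M)))" using True \<delta> by (intro mult_left_mono) auto
      then show "\<epsilon> \<le> 2 * (1 + M) * (\<delta> / ?x)" using x \<xi> by (simp add: \<epsilon>_def field_simps)
    qed (use \<alpha> \<epsilon> in auto)
    also have "(2 * (1 + M) * (\<delta> / ?x)) powr \<alpha> = (2 * (1 + M)) powr \<alpha> * ?q"
      using M(2) \<delta> x by (subst powr_mult) auto
    also have "(2 * (1 + M)) powr \<alpha> * ?q \<le> (2 * (1 + M)) * ?q"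
    proof (rule mult_right_mono[OF _ q0])
      have "(2 * (1 + M)) powr \<alpha> \<le> (2 * (1 + M)) powr 1" by (rule powr_mono) (use \<alpha> M(2) in auto)
      then show "(2 * (1 + M)) powr \<alpha> \<le> 2 * (1 + M)" using M(2) by simp
    qed
    finally have "measure lborel ?E \<le> K * ((2 * (1 + M)) * ?q)"
      using K by (meson mult_left_mono less_imp_le order_trans)
    also have "\<dots> \<le> (2 * (1 + M) * K + 2 * ?V) * ?q"
      using q0 by (simp add: algebra_simps)
    finally show ?thesis .
  next
    case False
    have far: "?x / 2 < \<bar>?\<tau> + b' v \<bullet> ?\<xi>\<bar>" for v
    proof -
      have "?x \<le> \<bar>?\<tau>\<bar> + norm ?\<xi>" using norm_Pair_le[of ?\<tau> ?\<xi>] by simp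
      moreover have "\<bar>b' v \<bullet> ?\<xi>\<bar> \<le> M * norm ?\<xi>"
        by (rule order_trans[OF Cauchy_Schwarz_ineq2 mult_right_mono[OF M(1) norm_ge_zero]])
      moreover have "2 * norm ?\<xi> + 2 * (M * norm ?\<xi>) < ?x" using False by (simp add: algebra_simps)
      ultimately show ?thesis by linarith
    qed
    show ?thesis
    proof (cases "\<delta> \<le> ?x / 2")
      case True
      then have "\<not> \<bar>?\<tau> + b' v \<bullet> ?\<xi>\<bar> \<le> \<delta>" for v using far[of v] by linarith
      then have "?E = {}" unfolding E by blast
      then have "measure lborel ?E = 0" by (simp only: measure_empty)
      then show ?thesis using q0 K M(2) by simp
    next
      case False
      have "measure lborel ?E \<le> ?V"
      proof (rule measure_mono_fmeasurable)
        show "?X \<in> fmeasurable lborel"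
          by (rule fmeasurableI[OF _ emeasure_lborel_ball_finite]) simp
      qed (use Eb in auto)
      also have "1 \<le> (2 * (\<delta> / ?x)) powr \<alpha>"
        using False x \<alpha> by (intro ge_one_powr_ge_zero) (auto simp: field_simps)
      then have "?V * 1 \<le> ?V * (2 * (\<delta> / ?x)) powr \<alpha>" by (intro mult_left_mono) auto
      also have "(2 * (\<delta> / ?x)) powr \<alpha> = 2 powr \<alpha> * ?q" using \<delta> x by (subst powr_mult) auto
      also have "?V * (2 powr \<alpha> * ?q) \<le> ?V * (2 * ?q)"
        using powr_mono[of \<alpha> 1 "2::real"] \<alpha> by (intro mult_left_mono mult_right_mono) auto
      also have "\<dots> \<le> (2 * (1 + M) * K + 2 * ?V) * ?q"
        using q0 K M(2) by (simp add: algebra_simps)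
      finally show ?thesis by simp
    qed
  qed
qed

lemma test_function_in_smaller_ball:
  fixes \<phi> :: "'a::euclidean_space \<Rightarrow> real"
  assumes \<phi>: "test_function (ball 0 R) \<phi>" and R: "R > 0"
  obtains r where "r < R" "smooth_in_ball r \<phi>"
proof -
  have "Ck_c 1 (ball 0 R) \<phi>" using \<phi> unfolding test_function_def by blast
  then obtain r where r: "r < R" "\<And>v. norm v > r \<Longrightarrow> \<phi> v = 0"
    using Ck_c_bounds[OF _ R] by metis
  have "smooth_in_ball r \<phi>"
    using \<phi> r(2) unfolding smooth_in_ball_def test_function_def Ck_c_def by simp
  with r(1) show thesis by (rule that)
qed

lemma vec_nth_borel: "(\<lambda>y :: real^'n. y $ i) \<in> borel_measurable borel"
  and matrix_nth_borel: "(\<lambda>y :: real^'m^'n. y $ i $ k) \<in> borel_measurable borel"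
  by (intro borel_measurable_continuous_onI continuous_intros)+

text \<open>The constant first component of the direction has derivative zero because the integral of
  a derivative of \<open>\<phi>\<close> vanishes.\<close>

lemma direction_weak_derivative:
  fixes b b' :: "real^'m \<Rightarrow> real^'n" and Db Db' :: "real^'m \<Rightarrow> real^'m^'n"
  assumes R: "R > 0" and rep: "borel_rep (ball 0 R) b b'" and M: "\<And>v. norm (b' v) \<le> M"
    and Drep: "borel_rep (ball 0 R) Db Db'" and Dsq: "square_integrable Db'"
    and H1: "H1_with_jacobian (ball 0 R) b Db"
    and j: "j \<in> Basis" and \<phi>: "test_function (ball 0 R) \<phi>"
  shows "(\<integral>y. (direction R b' y \<bullet> \<zeta>) * frechet_derivative \<phi> (at y) j \<partial>lborel)
    = - (\<integral>y. (direction_derivative Db' j y \<bullet> \<zeta>) * \<phi> y \<partial>lborel)"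
proof -
  let ?d = "\<lambda>y. frechet_derivative \<phi> (at y) j" and ?\<tau> = "fst \<zeta>" and ?\<xi> = "snd \<zeta>"
  obtain k where k: "j = axis k 1" using j by (auto simp: Basis_vec_def)
  obtain r where r: "r < R" "smooth_in_ball r \<phi>" using test_function_in_smaller_ball[OF \<phi> R] .
  note d = smooth_in_ball_derivative[OF r(2), of j]
  obtain C where C: "\<And>x. \<bar>\<phi> x\<bar> \<le> C" using smooth_in_ball_bounded[OF r(2)] by blast
  obtain C' where C': "C' \<ge> 0" "\<And>x. \<bar>?d x\<bar> \<le> C'" using smooth_in_ball_bounded[OF d] by blast
  note \<phi>b = smooth_in_ball_borel[OF r(2)] and db = smooth_in_ball_borel[OF d]
  have bi: "(\<lambda>y. b' y $ i) \<in> borel_measurable borel" for i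
    by (rule measurable_compose[OF borel_repD(1)[OF rep] vec_nth_borel])
  have Dbi: "(\<lambda>y. Db' y $ i $ k) \<in> borel_measurable borel" for i
    by (rule measurable_compose[OF borel_repD(1)[OF Drep] matrix_nth_borel])
  have ib: "integrable lborel (\<lambda>y. b' y $ i * ?d y)" for i
  proof (rule integrable_bounded_support)
    show "(\<lambda>y. b' y $ i * ?d y) \<in> borel_measurable borel" by (intro borel_measurable_times bi db)
    show "\<bar>b' y $ i * ?d y\<bar> \<le> M * C'" for y
    proof -
      have "\<bar>b' y $ i\<bar> \<le> M" using component_le_norm_cart[of "b' y" i] M[of y] by linarith
      then show ?thesis unfolding abs_mult by (rule mult_mono[OF _ C'(2)]) (use M[of y] norm_ge_zero[of "b' y"] in linarith, simp)
    qed
    show "b' y $ i * ?d y = 0" if "norm y > r" for y using smooth_in_ballD(2)[OF d that] by simp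
  qed
  have iD: "integrable lborel (\<lambda>y. Db' y $ i $ k * \<phi> y)" for i
  proof -
    have "norm (Db' y $ i $ k) \<le> norm (Db' y)" for y
    proof -
      have "norm (Db' y $ i $ k) \<le> norm (Db' y $ i)" by (rule Finite_Cartesian_Product.norm_nth_le)
      also have "\<dots> \<le> norm (Db' y)" by (rule Finite_Cartesian_Product.norm_nth_le)
      finally show ?thesis .
    qed
    from square_integrable_bound(1)[OF Dsq Dbi this]
    have "square_integrable (\<lambda>y. Db' y $ i $ k)" .
    from bounded_mult_square_integrable(1)[OF this \<phi>b C]
    have "integrable lborel (\<lambda>y. \<phi> y * Db' y $ i $ k)"
      by (rule compact_support_integrable[where \<rho>=r]) (simp add: smooth_in_ballD(2)[OF r(2)])
    then show ?thesis by (simp add: mult.commute)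
  qed
  have wk: "(\<integral>y. b' y $ i * ?d y \<partial>lborel) = - (\<integral>y. Db' y $ i $ k * \<phi> y \<partial>lborel)" for i
  proof -
    have 1: "borel_rep (ball 0 R) (\<lambda>y. b y $ i * ?d y) (\<lambda>y. b' y $ i * ?d y)"
      by (rule borel_rep_compose[where T="\<lambda>y x. x $ i * ?d y", OF rep]) (use ib[of i] in simp_all)
    have 2: "borel_rep (ball 0 R) (\<lambda>y. Db y $ i $ k * \<phi> y) (\<lambda>y. Db' y $ i $ k * \<phi> y)"
      by (rule borel_rep_compose[where T="\<lambda>y x. x $ i $ k * \<phi> y", OF Drep]) (use iD[of i] in simp_all)
    have "(LINT x|lebesgue_on (ball 0 R). b x $ i * frechet_derivative \<phi> (at x) (axis k 1))
        = - (LINT x|lebesgue_on (ball 0 R). Db x $ i $ k * \<phi> x)"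
      using H1 \<phi> unfolding H1_with_jacobian_def by blast
    then show ?thesis
      using lebesgue_on_integral_eq(1)[OF _ 1] lebesgue_on_integral_eq(1)[OF _ 2] by (simp add: k)
  qed
  have eq1: "(direction R b' y \<bullet> \<zeta>) * ?d y = ?\<tau> * ?d y + (\<Sum>i\<in>UNIV. ?\<xi> $ i * (b' y $ i * ?d y))" for y
  proof (cases "norm y < R")
    case True
    have "b' y \<bullet> ?\<xi> = (\<Sum>i\<in>UNIV. b' y $ i * ?\<xi> $ i)" by (simp add: inner_vec_def)
    then have "(direction R b' y \<bullet> \<zeta>) * ?d y = ?\<tau> * ?d y + (\<Sum>i\<in>UNIV. b' y $ i * ?\<xi> $ i) * ?d y"
      by (simp only: direction_inner[OF True] distrib_right)
    also have "(\<Sum>i\<in>UNIV. b' y $ i * ?\<xi> $ i) * ?d y = (\<Sum>i\<in>UNIV. ?\<xi> $ i * (b' y $ i * ?d y))"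
      unfolding sum_distrib_right by (simp only: mult_ac)
    finally show ?thesis .
  next
    case False
    then have "?d y = 0" using smooth_in_ballD(2)[OF d, of y] r(1) by simp
    then show ?thesis by simp
  qed
  have eq2: "(direction_derivative Db' j y \<bullet> \<zeta>) * \<phi> y = (\<Sum>i\<in>UNIV. ?\<xi> $ i * (Db' y $ i $ k * \<phi> y))" for y
  proof -
    have "Db' y $ i \<bullet> j = Db' y $ i $ k" for i by (simp add: k inner_axis)
    then have "direction_derivative Db' j y = (0, \<chi> i. Db' y $ i $ k)" by (simp add: direction_derivative_def)
    then show ?thesis by (simp add: inner_prod_def inner_vec_def sum_distrib_left mult_ac)
  qed
  have "(\<integral>y. (direction R b' y \<bullet> \<zeta>) * ?d y \<partial>lborel)
      = (\<integral>y. ?\<tau> * ?d y \<partial>lborel) + (\<integral>y. (\<Sum>i\<in>UNIV. ?\<xi> $ i * (b' y $ i * ?d y)) \<partial>lborel)"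
    unfolding eq1
    by (intro Bochner_Integration.integral_add Bochner_Integration.integrable_sum integrable_mult_right ib
        smooth_in_ball_integrable[OF d])
  also have "(\<integral>y. ?\<tau> * ?d y \<partial>lborel) = 0"
    using integral_derivative_eq_0[OF r(2), of j] by simp
  also have "(\<integral>y. (\<Sum>i\<in>UNIV. ?\<xi> $ i * (b' y $ i * ?d y)) \<partial>lborel) = (\<Sum>i\<in>UNIV. ?\<xi> $ i * (\<integral>y. b' y $ i * ?d y \<partial>lborel))"
    using ib by (subst Bochner_Integration.integral_sum) auto
  also have "\<dots> = - (\<Sum>i\<in>UNIV. ?\<xi> $ i * (\<integral>y. Db' y $ i $ k * \<phi> y \<partial>lborel))"
    by (simp add: wk sum_negf)
  also have "(\<Sum>i\<in>UNIV. ?\<xi> $ i * (\<integral>y. Db' y $ i $ k * \<phi> y \<partial>lborel)) = (\<integral>y. (\<Sum>i\<in>UNIV. ?\<xi> $ i * (Db' y $ i $ k * \<phi> y)) \<partial>lborel)"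
    using iD by (subst Bochner_Integration.integral_sum) auto
  finally show ?thesis unfolding eq2 by simp
qed

lemma direction_derivative_l2:
  fixes Db' :: "real^'m \<Rightarrow> real^'m^'n"
  assumes Dsq: "square_integrable Db'" and j: "j \<in> Basis"
  shows "square_integrable (direction_derivative Db' j)" "l2 (direction_derivative Db' j) \<le> l2 Db'"
proof -
  note Db = square_integrable_borel[OF Dsq]
  have "(\<lambda>A :: real^'m^'n. (0::real, \<chi> i. A $ i \<bullet> j)) \<in> borel_measurable borel"
    by (intro borel_measurable_continuous_onI continuous_intros)
  from measurable_compose[OF Db this]
  have m: "direction_derivative Db' j \<in> borel_measurable borel"
    by (simp add: direction_derivative_def[abs_def])
  have le: "norm (direction_derivative Db' j v) \<le> norm (Db' v)" for v
  proof -
    have "norm (direction_derivative Db' j v) = L2_set (\<lambda>i. norm (Db' v $ i \<bullet> j)) UNIV"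
      by (simp add: direction_derivative_def norm_Pair1 norm_vec_def)
    also have "\<dots> \<le> L2_set (\<lambda>i. norm (Db' v $ i)) UNIV"
      by (rule L2_set_mono) (use Cauchy_Schwarz_ineq2[of _ j] norm_Basis[OF j] in \<open>auto intro: order_trans\<close>)
    finally show ?thesis by (simp add: norm_vec_def)
  qed
  show "square_integrable (direction_derivative Db' j)" "l2 (direction_derivative Db' j) \<le> l2 Db'"
    using square_integrable_bound[OF Dsq m le] by blast+
qed

section \<open>The transport equation for Borel representatives\<close>

lemma reassoc_simps [simp]:
  "fst (reassoc p) = fst (fst p)" "fst (snd (reassoc p)) = snd (fst p)" "snd (snd (reassoc p)) = snd p"
  by (simp_all add: reassoc_def)

lemma transport_representatives:
  fixes b b' :: "real^'m \<Rightarrow> real^'n" and h g0 h' g0' :: "real \<times> (real^'n) \<times> (real^'m) \<Rightarrow> real"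
    and g1 g1' :: "real \<times> (real^'n) \<times> (real^'m) \<Rightarrow> real^'m"
  assumes te: "transport_equation R b h g1 g0"
    and rb: "borel_rep (ball 0 R) b b'" and M: "\<And>v. norm (b' v) \<le> M"
    and rh: "borel_rep (phase_space R) h h'" and r1: "borel_rep (phase_space R) g1 g1'"
    and r0: "borel_rep (phase_space R) g0 g0'"
    and sq1: "square_integrable g1'"
    and \<phi>: "smooth_in_ball \<rho> \<phi>" and w: "test_function (ball 0 R) w"
  shows "(\<integral>p. h' (reassoc p) * (frechet_derivative \<phi> (at (fst p)) (direction R b' (snd p)) * w (snd p)) \<partial>lborel)
    = (\<Sum>j\<in>Basis. \<integral>p. (g1' (reassoc p) \<bullet> j) * (\<phi> (fst p) * frechet_derivative w (at (snd p)) j) \<partial>lborel)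
      - (\<integral>p. g0' (reassoc p) * (\<phi> (fst p) * w (snd p)) \<partial>lborel)"
proof -
  let ?X = "phase_space R :: (real \<times> (real^'n) \<times> (real^'m)) set"
  let ?L = "\<lambda>q :: real \<times> (real^'n) \<times> (real^'m). (fst q, fst (snd q))"
  let ?v = "\<lambda>q :: real \<times> (real^'n) \<times> (real^'m). snd (snd q)"
  let ?\<Phi> = "\<lambda>q. \<phi> (?L q) * w (?v q)"
  let ?\<Phi>' = "\<lambda>q. frechet_derivative ?\<Phi> (at q)"
  obtain \<rho>' where ws: "smooth_in_ball \<rho>' w" using test_function_smooth_in_ball[OF w] .
  have Lb: "?L \<in> borel_measurable borel" and vb: "?v \<in> borel_measurable borel"
    by (intro borel_measurable_continuous_onI continuous_on_Pair continuous_on_fst continuous_on_snd continuous_on_id)+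
  note hb = borel_repD(1)[OF rh] and g1b = borel_repD(1)[OF r1] and g0b = borel_repD(1)[OF r0]
  have \<phi>b: "(\<lambda>q. \<phi> (?L q)) \<in> borel_measurable borel" by (rule measurable_compose[OF Lb smooth_in_ball_borel[OF \<phi>]])
  have wb: "(\<lambda>q. w (?v q)) \<in> borel_measurable borel" by (rule measurable_compose[OF vb smooth_in_ball_borel[OF ws]])
  have cb: "(\<lambda>q. direction R b' (?v q)) \<in> borel_measurable borel"
    by (rule measurable_compose[OF vb direction_borel[OF borel_repD(1)[OF rb]]])
  let ?F1 = "\<lambda>q. h' q * (frechet_derivative \<phi> (at (?L q)) (direction R b' (?v q)) * w (?v q))"
  let ?F2 = "\<lambda>q. \<phi> (?L q) * frechet_derivative w (at (?v q)) (g1' q)"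
  let ?F3 = "\<lambda>q. g0' q * (\<phi> (?L q) * w (?v q))"
  have m1: "?F1 \<in> borel_measurable borel"
    by (intro borel_measurable_times hb wb smooth_derivative_borel[OF \<phi> Lb cb])
  have m2: "?F2 \<in> borel_measurable borel"
    by (intro borel_measurable_times \<phi>b smooth_derivative_borel[OF ws vb g1b])
  have m3: "?F3 \<in> borel_measurable borel"
    by (intro borel_measurable_times g0b \<phi>b wb)
  note pt = product_test_function[OF \<phi> w]
  have D0: "frechet_derivative w (at v) 0 = 0" for v
    by (rule linear_0[OF bounded_linear.linear[OF has_derivative_bounded_linear[OF smooth_in_ball_has_derivative[OF ws]]]])
  have E0: "frechet_derivative \<phi> (at z) 0 = 0" for z
    by (rule linear_0[OF bounded_linear.linear[OF has_derivative_bounded_linear[OF smooth_in_ball_has_derivative[OF \<phi>]]]])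
  have E0': "frechet_derivative \<phi> (at z) (0, 0) = 0" for z
    using E0[of z] by (simp add: zero_prod_def)
  have ab: "AE q in lborel. ?v q \<in> ball 0 R \<longrightarrow> b (?v q) = b' (?v q)"
    using AE_snd[OF AE_snd[OF borel_repD(3)[OF rb]]] .
  have R1: "borel_rep ?X (\<lambda>q. h q * ?\<Phi>' q (1, b (?v q), 0)) ?F1"
    unfolding borel_rep_def
  proof (intro conjI allI impI m1)
    show "?F1 q = 0" if "q \<notin> ?X" for q using borel_repD(2)[OF rh that] by simp
    show "AE q in lborel. q \<in> ?X \<longrightarrow> h q * ?\<Phi>' q (1, b (?v q), 0) = ?F1 q"
      using borel_repD(3)[OF rh] ab
    proof eventually_elim
      case (elim q)
      show ?case
      proof
        assume q: "q \<in> ?X"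
        then have v: "norm (?v q) < R" by (simp add: mem_phase_space)
        then have "b (?v q) = b' (?v q)" using elim(2) by simp
        then have "(1, b (?v q)) = direction R b' (?v q)" using v by (simp add: direction_def)
        then show "h q * ?\<Phi>' q (1, b (?v q), 0) = ?F1 q"
          using elim(1) q by (simp add: pt(2) D0)
      qed
    qed
  qed
  have R2: "borel_rep ?X (\<lambda>q. ?\<Phi>' q (0, 0, g1 q)) ?F2"
    unfolding borel_rep_def
  proof (intro conjI allI impI m2)
    show "?F2 q = 0" if "q \<notin> ?X" for q using borel_repD(2)[OF r1 that] by (simp add: D0)
    show "AE q in lborel. q \<in> ?X \<longrightarrow> ?\<Phi>' q (0, 0, g1 q) = ?F2 q"
      using borel_repD(3)[OF r1] by eventually_elim (simp add: pt(2) E0')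
  qed
  have R3: "borel_rep ?X (\<lambda>q. g0 q * ?\<Phi> q) ?F3"
    by (rule borel_rep_compose[where T="\<lambda>q y. y * ?\<Phi> q", OF r0]) (use m3 in simp_all)
  have "- (LINT q|lebesgue_on ?X. h q * ?\<Phi>' q (1, b (?v q), 0))
      = - (LINT q|lebesgue_on ?X. ?\<Phi>' q (0, 0, g1 q)) + (LINT q|lebesgue_on ?X. g0 q * ?\<Phi> q)"
    using te pt(1) unfolding transport_equation_def by blast
  then have main: "(\<integral>q. ?F1 q \<partial>lborel) = (\<integral>q. ?F2 q \<partial>lborel) - (\<integral>q. ?F3 q \<partial>lborel)"
    unfolding lebesgue_on_integral_eq(1)[OF phase_space_borel R1] lebesgue_on_integral_eq(1)[OF phase_space_borel R2]
      lebesgue_on_integral_eq(1)[OF phase_space_borel R3] by linarith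
  let ?G = "\<lambda>j q. (g1' q \<bullet> j) * (\<phi> (?L q) * frechet_derivative w (at (?v q)) j)"
  have iG: "integrable lborel (?G j)" if j: "j \<in> Basis" for j
  proof -
    obtain C1 where C1: "\<And>x. \<bar>\<phi> x\<bar> \<le> C1" using smooth_in_ball_bounded[OF \<phi>] by blast
    obtain C2 where C2: "\<And>x. \<bar>frechet_derivative w (at x) j\<bar> \<le> C2"
      using smooth_in_ball_bounded[OF smooth_in_ball_derivative[OF ws]] by blast
    have gm: "(\<lambda>q. g1' q \<bullet> j) \<in> borel_measurable borel"
      by (intro borel_measurable_inner g1b borel_measurable_const)
    have gs: "square_integrable (\<lambda>q. g1' q \<bullet> j)"
      by (rule square_integrable_bound(1)[OF sq1 gm]) (simp add: Basis_le_norm[OF j])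
    have mm: "(\<lambda>q. \<phi> (?L q) * frechet_derivative w (at (?v q)) j) \<in> borel_measurable borel"
      by (intro borel_measurable_times \<phi>b smooth_derivative_borel[OF ws vb] borel_measurable_const)
    have bb: "\<bar>\<phi> (?L q) * frechet_derivative w (at (?v q)) j\<bar> \<le> C1 * C2" for q
      unfolding abs_mult by (rule mult_mono[OF C1 C2 order_trans[OF abs_ge_zero C1[of 0]]]) simp
    have sqG: "square_integrable (\<lambda>q. (\<phi> (?L q) * frechet_derivative w (at (?v q)) j) * (g1' q \<bullet> j))"
      by (rule bounded_mult_square_integrable(1)[OF gs mm bb])
    have "integrable lborel (\<lambda>q. (\<phi> (?L q) * frechet_derivative w (at (?v q)) j) * (g1' q \<bullet> j))"
    proof (rule compact_support_integrable[OF sqG])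
      fix q :: "real \<times> (real^'n) \<times> (real^'m)" assume q: "norm q > \<rho> + \<rho>'"
      have "norm q \<le> norm (?L q) + norm (?v q)"
      proof -
        have "(norm q)\<^sup>2 = (norm (?L q))\<^sup>2 + (norm (?v q))\<^sup>2"
          by (cases q) (simp add: norm_Pair)
        also have "\<dots> \<le> (norm (?L q) + norm (?v q))\<^sup>2" by (simp add: power2_sum)
        finally show ?thesis by (rule power2_le_imp_le) simp
      qed
      then have "norm (?L q) > \<rho> \<or> norm (?v q) > \<rho>'" using q by linarith
      then have "\<phi> (?L q) = 0 \<or> frechet_derivative w (at (?v q)) j = 0"
        using smooth_in_ballD(2)[OF \<phi>, of "?L q"] smooth_in_ballD(2)[OF smooth_in_ball_derivative[OF ws], of "?v q" j] by blast
      then show "(\<phi> (?L q) * frechet_derivative w (at (?v q)) j) * (g1' q \<bullet> j) = 0" by auto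
    qed
    then show ?thesis by (simp add: mult.commute)
  qed
  have F2: "?F2 q = (\<Sum>j\<in>Basis. ?G j q)" for q
    by (subst smooth_derivative_sum[OF ws]) (simp add: sum_distrib_left mult_ac)
  have s: "(\<integral>q. ?F2 q \<partial>lborel) = (\<Sum>j\<in>Basis. \<integral>q. ?G j q \<partial>lborel)"
    unfolding F2 by (rule Bochner_Integration.integral_sum[OF iG])
  have t1: "(\<integral>p. ?F1 (reassoc p) \<partial>lborel) = (\<integral>q. ?F1 q \<partial>lborel)" by (rule integral_reassoc(1)[OF m1])
  have t3: "(\<integral>p. ?F3 (reassoc p) \<partial>lborel) = (\<integral>q. ?F3 q \<partial>lborel)" by (rule integral_reassoc(1)[OF m3])
  have t2: "(\<integral>p. ?G j (reassoc p) \<partial>lborel) = (\<integral>q. ?G j q \<partial>lborel)" if "j \<in> Basis" for j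
    by (rule integral_reassoc(1)) (use iG[OF that] in simp)
  have t2s: "(\<Sum>j\<in>Basis. \<integral>q. ?G j q \<partial>lborel) = (\<Sum>j\<in>Basis. \<integral>p. ?G j (reassoc p) \<partial>lborel)"
    by (rule sum.cong[OF refl]) (simp only: t2)
  show ?thesis
    using main unfolding s t2s t1[symmetric] t3[symmetric] by simp
qed

text \<open>For almost every \<open>(t, x)\<close> the representative agrees with \<open>h\<close> for almost every \<open>v\<close>.\<close>

lemma velocity_average_rep:
  fixes h h' :: "real \<times> (real^'n) \<times> (real^'m) \<Rightarrow> real"
  assumes rh: "borel_rep (phase_space R) h h'"
    and \<psi>: "\<psi> \<in> borel_measurable borel"
  shows "borel_rep UNIV (velocity_average R h \<psi>) (\<lambda>z. \<integral>v. h' (reassoc (z, v)) * \<psi> v \<partial>lborel)"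
proof -
  have hb: "(\<lambda>p :: (real \<times> (real^'n)) \<times> (real^'m). h' (reassoc p)) \<in> borel_measurable borel"
    by (rule measurable_compose[OF reassoc_borel borel_repD(1)[OF rh]])
  have m: "(\<lambda>z. \<integral>v. h' (reassoc (z, v)) * \<psi> v \<partial>lborel) \<in> borel_measurable (borel :: (real \<times> (real^'n)) measure)"
  proof -
    have [measurable]: "(\<lambda>p :: (real \<times> (real^'n)) \<times> (real^'m). h' (reassoc p)) \<in> borel_measurable (borel \<Otimes>\<^sub>M borel)"
      using hb by (simp add: borel_prod)
    have [measurable]: "\<psi> \<in> borel_measurable borel" by (rule \<psi>)
    show ?thesis by measurable
  qed
  have "AE p in (lborel :: ((real \<times> (real^'n)) \<times> (real^'m)) measure).
      reassoc p \<in> phase_space R \<longrightarrow> h (reassoc p) = h' (reassoc p)"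
    by (rule AE_reassoc[OF borel_repD(3)[OF rh]])
  then have "AE p in (lborel :: (real \<times> (real^'n)) measure) \<Otimes>\<^sub>M (lborel :: (real^'m) measure).
      reassoc p \<in> phase_space R \<longrightarrow> h (reassoc p) = h' (reassoc p)"
    unfolding lborel_prod .
  then have "AE z in (lborel :: (real \<times> (real^'n)) measure). AE v in (lborel :: (real^'m) measure).
      reassoc (z, v) \<in> phase_space R \<longrightarrow> h (reassoc (z, v)) = h' (reassoc (z, v))"
    by (rule lborel_pair.AE_pair)
  then have "AE z in (lborel :: (real \<times> (real^'n)) measure).
      velocity_average R h \<psi> z = (\<integral>v. h' (reassoc (z, v)) * \<psi> v \<partial>lborel)"
  proof eventually_elim
    case (elim z)
    have m1: "(\<lambda>v. h' (reassoc (z, v))) \<in> borel_measurable (borel :: (real^'m) measure)"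
      by (rule measurable_compose[OF _ hb]) (intro borel_measurable_Pair borel_measurable_const measurable_ident_sets refl | simp)+
    have "borel_rep (ball 0 R) (\<lambda>v. h (reassoc (z, v)) * \<psi> v) (\<lambda>v. h' (reassoc (z, v)) * \<psi> v)"
      unfolding borel_rep_def
    proof (intro conjI allI impI)
      show "(\<lambda>v. h' (reassoc (z, v)) * \<psi> v) \<in> borel_measurable borel"
        by (intro borel_measurable_times m1 \<psi>)
      show "h' (reassoc (z, v)) * \<psi> v = 0" if "v \<notin> ball 0 R" for v
        using borel_repD(2)[OF rh, of "reassoc (z, v)"] that by (simp add: mem_phase_space)
      show "AE v in lborel. v \<in> ball 0 R \<longrightarrow> h (reassoc (z, v)) * \<psi> v = h' (reassoc (z, v)) * \<psi> v"
        using elim by eventually_elim (simp add: mem_phase_space)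
    qed
    from lebesgue_on_integral_eq(1)[OF _ this]
    have "(LINT v|lebesgue_on (ball 0 R). h (reassoc (z, v)) * \<psi> v) = (\<integral>v. h' (reassoc (z, v)) * \<psi> v \<partial>lborel)"
      by simp
    then show ?case by (simp add: velocity_average_def reassoc_def case_prod_unfold)
  qed
  with m show ?thesis by (simp add: borel_rep_def)
qed

lemma sum_components_l2:
  fixes g :: "'a::euclidean_space \<Rightarrow> 'b::euclidean_space"
  assumes g: "square_integrable g"
  shows "\<And>j. j \<in> Basis \<Longrightarrow> square_integrable (\<lambda>x. g x \<bullet> j)"
    and "(\<Sum>j\<in>Basis. (l2 (\<lambda>x. g x \<bullet> j))\<^sup>2) = (l2 g)\<^sup>2"
proof -
  show sq: "square_integrable (\<lambda>x. g x \<bullet> j)" if j: "j \<in> Basis" for j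
  proof (rule square_integrable_bound(1)[OF g])
    show "(\<lambda>x. g x \<bullet> j) \<in> borel_measurable borel"
      by (intro borel_measurable_inner square_integrable_borel[OF g] borel_measurable_const)
  qed (simp add: Basis_le_norm[OF j])
  have "(\<Sum>j\<in>Basis. (l2 (\<lambda>x. g x \<bullet> j))\<^sup>2) = (\<Sum>j\<in>Basis. \<integral>x. (norm (g x \<bullet> j))\<^sup>2 \<partial>lborel)"
    by (simp only: l2_square)
  also have "\<dots> = (\<integral>x. (\<Sum>j\<in>Basis. (norm (g x \<bullet> j))\<^sup>2) \<partial>lborel)"
    by (rule Bochner_Integration.integral_sum[symmetric]) (use sq in \<open>simp add: square_integrable_def\<close>)
  also have "(\<lambda>x. \<Sum>j\<in>Basis. (norm (g x \<bullet> j))\<^sup>2) = (\<lambda>x. (norm (g x))\<^sup>2)"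
  proof
    fix x
    have "(\<Sum>j\<in>Basis. (norm (g x \<bullet> j))\<^sup>2) = (\<Sum>j\<in>Basis. (g x \<bullet> j) * (g x \<bullet> j))"
      by (simp add: power2_eq_square)
    also have "\<dots> = (norm (g x))\<^sup>2"
      unfolding power2_norm_eq_inner by (rule euclidean_inner[symmetric])
    finally show "(\<Sum>j\<in>Basis. (norm (g x \<bullet> j))\<^sup>2) = (norm (g x))\<^sup>2" .
  qed
  finally show "(\<Sum>j\<in>Basis. (l2 (\<lambda>x. g x \<bullet> j))\<^sup>2) = (l2 g)\<^sup>2" by (simp only: l2_square)
qed

section \<open>Regularity of velocity averages\<close>

text \<open>The constant produced by the estimate; \<open>V\<close> is the volume of the velocity ball and \<open>m\<close> its dimension.\<close>

definition averaging_constant :: "real \<Rightarrow> real \<Rightarrow> real \<Rightarrow> real \<Rightarrow> real \<Rightarrow> real \<Rightarrow> real \<Rightarrow> real" where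
  "averaging_constant A L m V K M N =
    A * (sqrt (2 * (1 + M) * K + 2 * V) + sqrt V + N) * sqrt (6 * m * (2 + 2 * (L * (1 + M))\<^sup>2))"

lemma averaging_estimate:
  fixes \<psi> :: "real^'m \<Rightarrow> real" and b :: "real^'m \<Rightarrow> real^'n" and Db :: "real^'m \<Rightarrow> real^'m^'n"
    and h g0 :: "real \<times> (real^'n) \<times> (real^'m) \<Rightarrow> real" and g1 :: "real \<times> (real^'n) \<times> (real^'m) \<Rightarrow> real^'m"
  assumes A: "A \<ge> 1" "\<And>x. \<bar>profile x\<bar> \<le> A"
      "\<And>x y. \<bar>profile x - profile y\<bar> \<le> A * \<bar>x - y\<bar>"
    and L: "L \<ge> 0" "\<And>n x y. \<bar>plateau n (x::real \<times> (real^'n)) - plateau n y\<bar> \<le> L * norm (x - y)"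
    and R: "R > 0" and K: "K > 0" and \<alpha>: "0 < \<alpha>" "\<alpha> \<le> 1"
    and \<psi>: "Ck_c 1 (ball 0 R) \<psi>"
    and h: "L2_on (phase_space R) h" and g0: "L2_on (phase_space R) g0" and g1: "L2_on (phase_space R) g1"
    and b: "Linf_on (ball 0 R) b" and H1: "H1_with_jacobian (ball 0 R) b Db"
    and te: "transport_equation R b h g1 g0" and nd: "nondegenerate R K \<alpha> b"
  defines "B \<equiv> averaging_constant A L (real CARD('m)) (measure lborel (ball (0::real^'m) R)) K
      (Linf_norm (ball 0 R) b) (L2_norm (ball 0 R) Db) * W1inf_norm (ball 0 R) \<psi> *
      (L2_norm (phase_space R) h + L2_norm (phase_space R) g1 + L2_norm (phase_space R) g0)"
  shows "Hs (\<alpha> / (4 + \<alpha>)) (velocity_average R h \<psi>)" "Hs_norm (\<alpha> / (4 + \<alpha>)) (velocity_average R h \<psi>) \<le> B"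
proof -
  let ?M = "Linf_norm (ball 0 R) b" and ?N = "L2_norm (ball 0 R) Db" and ?P = "W1inf_norm (ball 0 R) \<psi>"
  let ?V = "measure lborel (ball (0::real^'m) R)"
  let ?Q = "2 * (1 + ?M) * K + 2 * ?V"
  have M0: "?M \<ge> 0" by (simp add: Linf_norm_def)
  have Q0: "?Q \<ge> 0" using M0 K by (intro add_nonneg_nonneg mult_nonneg_nonneg) auto
  obtain b' where b': "borel_rep (ball 0 R) b b'" "\<And>v. norm (b' v) \<le> ?M"
    using bounded_representative[OF b] by blast
  have DL2: "L2_on (ball 0 R) Db" using H1 by (simp add: H1_with_jacobian_def)
  obtain Db' where Db': "borel_rep (ball 0 R) Db Db'" "square_integrable Db'" "?N = l2 Db'"
    using L2_on_rep_obtain[OF DL2] by auto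
  obtain h' where h': "borel_rep (phase_space R) h h'" "square_integrable h'" "L2_norm (phase_space R) h = l2 h'"
    using L2_on_rep_obtain[OF h phase_space_borel] by blast
  obtain g0' where g0': "borel_rep (phase_space R) g0 g0'" "square_integrable g0'" "L2_norm (phase_space R) g0 = l2 g0'"
    using L2_on_rep_obtain[OF g0 phase_space_borel] by blast
  obtain g1' where g1': "borel_rep (phase_space R) g1 g1'" "square_integrable g1'" "L2_norm (phase_space R) g1 = l2 g1'"
    using L2_on_rep_obtain[OF g1 phase_space_borel] by blast
  obtain r where r: "0 \<le> r" "r < R" "\<And>v. norm v > r \<Longrightarrow> \<psi> v = 0" "0 \<le> ?P" "\<And>v. \<bar>\<psi> v\<bar> \<le> ?P"
    "\<And>v w. \<bar>\<psi> v - \<psi> w\<bar> \<le> ?P * norm (v - w)" "integrable lborel \<psi>"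
    using Ck_c_bounds[OF \<psi> R] by metis
  let ?c = "direction R b'" and ?dc = "direction_derivative Db'"
  let ?h = "\<lambda>p :: (real \<times> (real^'n)) \<times> (real^'m). h' (reassoc p)"
    and ?gz = "\<lambda>p :: (real \<times> (real^'n)) \<times> (real^'m). g0' (reassoc p)"
    and ?gv = "\<lambda>j (p :: (real \<times> (real^'n)) \<times> (real^'m)). g1' (reassoc p) \<bullet> j"
  note hr = square_integrable_reassoc[OF h'(2)] and g0r = square_integrable_reassoc[OF g0'(2)]
    and g1r = square_integrable_reassoc[OF g1'(2)]
  note comp = sum_components_l2[OF g1r(1)]
  interpret k: kinetic R r "1 + ?M" ?P A ?N ?Q L \<alpha> ?c ?dc ?h ?gz ?gv \<psi>
  proof
    show "0 \<le> r" "r < R" "0 \<le> ?P" by (rule r)+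
    show "0 \<le> 1 + ?M" using M0 by simp
    show "0 \<le> ?N" by (simp add: Db'(3) l2_nonneg)
    show "0 \<le> ?Q" by (rule Q0)
    show "0 < \<alpha>" "\<alpha> \<le> 1" "0 \<le> L" by (rule \<alpha> L)+
    show "\<bar>plateau n x - plateau n y\<bar> \<le> L * norm (x - y)" for n and x y :: "real \<times> (real^'n)" by (rule L(2))
    show "1 \<le> A" by (rule A(1))
    show "\<bar>profile x\<bar> \<le> A" for x by (rule A(2))
    show "\<bar>profile x - profile y\<bar> \<le> A * \<bar>x - y\<bar>" for x y by (rule A(3))
    show "?c \<in> borel_measurable borel" by (rule direction_borel[OF borel_repD(1)[OF b'(1)]])
    show "norm (?c v) \<le> 1 + ?M" for v
      using norm_Pair_le[of "1::real" "b' v"] b'(2)[of v] M0 by (simp add: direction_def)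
    show "?c v = 0" if "R \<le> norm v" for v using that by (simp add: direction_def)
    show "(\<integral>y. (?c y \<bullet> \<zeta>) * frechet_derivative \<phi> (at y) j \<partial>lborel) = - (\<integral>y. (?dc j y \<bullet> \<zeta>) * \<phi> y \<partial>lborel)"
      if "j \<in> Basis" "test_function (ball 0 R) \<phi>" for j \<phi> \<zeta>
      by (rule direction_weak_derivative[OF R b' Db'(1,2) H1 that])
    show "square_integrable (?dc j)" "l2 (?dc j) \<le> ?N" if "j \<in> Basis" for j
      unfolding Db'(3) by (rule direction_derivative_l2[OF Db'(2) that])+
    show "?dc j v = 0" if "j \<in> Basis" "R \<le> norm v" for j v
    proof -
      have z: "Db' v = 0" by (rule borel_repD(2)[OF Db'(1)]) (use that in simp)
      show ?thesis unfolding direction_derivative_def z by (simp add: zero_prod_def vec_eq_iff)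
    qed
    show "square_integrable ?h" "square_integrable ?gz" by (rule hr g0r)+
    show "square_integrable (?gv j)" if "j \<in> Basis" for j by (rule comp(1)[OF that])
    show "?h (z, v) = 0" if "R \<le> norm v" for z v
      by (rule borel_repD(2)[OF h'(1)]) (use that in \<open>simp add: mem_phase_space\<close>)
    show "?gz (z, v) = 0" if "R \<le> norm v" for z v
      by (rule borel_repD(2)[OF g0'(1)]) (use that in \<open>simp add: mem_phase_space\<close>)
    show "?gv j (z, v) = 0" if "j \<in> Basis" "R \<le> norm v" for j z v
    proof -
      have "g1' (reassoc (z, v)) = 0" by (rule borel_repD(2)[OF g1'(1)]) (use that in \<open>simp add: mem_phase_space\<close>)
      then show ?thesis by simp
    qed
    show "(\<integral>p. ?h p * (frechet_derivative \<phi> (at (fst p)) (?c (snd p)) * w (snd p)) \<partial>lborel)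
      = (\<Sum>j\<in>Basis. \<integral>p. ?gv j p * (\<phi> (fst p) * frechet_derivative w (at (snd p)) j) \<partial>lborel)
        - (\<integral>p. ?gz p * (\<phi> (fst p) * w (snd p)) \<partial>lborel)"
      if "smooth_in_ball \<rho> \<phi>" "test_function (ball 0 R) w" for \<rho> \<phi> w
      by (rule transport_representatives[OF te b' h'(1) g1'(1) g0'(1) g1'(2) that])
    show "measure lborel {v \<in> ball 0 R. \<bar>?c v \<bullet> \<zeta>\<bar> \<le> \<delta>} \<le> ?Q * (\<delta> / norm \<zeta>) powr \<alpha>"
      if "\<zeta> \<noteq> 0" "\<delta> > 0" for \<zeta> \<delta>
      by (rule direction_nondegenerate[OF b' M0 nd K \<alpha> that])
    show "integrable lborel \<psi>" by (rule r(7))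
    show "\<psi> v = 0" if "r < norm v" for v by (rule r(3)[OF that])
    show "\<bar>\<psi> v\<bar> \<le> ?P" for v by (rule r(5))
    show "\<bar>\<psi> v - \<psi> w\<bar> \<le> ?P * norm (v - w)" for v w by (rule r(6))
  qed
  let ?H = "l2 h'" and ?Z = "l2 g0'" and ?Y = "l2 g1'"
  let ?W = "6 * real CARD('m) * (2 + 2 * (L * (1 + ?M))\<^sup>2)"
  have W0: "?W \<ge> 0" by simp
  have nn: "?H \<ge> 0" "?Z \<ge> 0" "?Y \<ge> 0" by (rule l2_nonneg)+
  have Bdef: "B = ?P * A * (sqrt ?Q + sqrt ?V + ?N) * sqrt ?W * (?H + ?Y + ?Z)"
    unfolding B_def averaging_constant_def h'(3) g0'(3) g1'(3) by (simp only: mult_ac)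
  have B0: "B \<ge> 0"
    unfolding Bdef using r(4) A(1) Q0 nn by (intro mult_nonneg_nonneg add_nonneg_nonneg) (auto simp: Db'(3) l2_nonneg)
  have rep: "borel_rep UNIV (velocity_average R h \<psi>) k.avg"
    using velocity_average_rep[OF h'(1) k.\<psi>_borel] by (simp add: k.avg_def[abs_def])
  have C2: "k.C2 * (?H\<^sup>2 + ?Z\<^sup>2 + ?Y\<^sup>2) \<le> B\<^sup>2"
  proof -
    have "k.C2 = (?P * A * (sqrt ?Q + sqrt ?V + ?N))\<^sup>2 * ?W"
      unfolding k.C2_def k.C1_def k.M_def by (simp add: mult_ac)
    also have "\<dots> = (?P * A * (sqrt ?Q + sqrt ?V + ?N) * sqrt ?W)\<^sup>2"
      unfolding power_mult_distrib[of _ "sqrt ?W"] real_sqrt_pow2[OF W0] ..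
    finally have e: "k.C2 = (?P * A * (sqrt ?Q + sqrt ?V + ?N) * sqrt ?W)\<^sup>2" .
    have p: "0 \<le> ?H * ?Z" "0 \<le> ?H * ?Y" "0 \<le> ?Z * ?Y" using nn by auto
    have "?H\<^sup>2 + ?Z\<^sup>2 + ?Y\<^sup>2 \<le> (?H + ?Y + ?Z)\<^sup>2"
      using p by (simp add: power2_eq_square algebra_simps)
    then have "k.C2 * (?H\<^sup>2 + ?Z\<^sup>2 + ?Y\<^sup>2) \<le> k.C2 * (?H + ?Y + ?Z)\<^sup>2"
      by (rule mult_left_mono) (unfold e, rule zero_le_power2)
    also have "\<dots> = B\<^sup>2" unfolding e Bdef by (simp only: power_mult_distrib)
    finally show ?thesis .
  qed
  have bound: "(\<integral>\<^sup>+\<xi>. ennreal ((1 + (norm \<xi>)\<^sup>2) powr (\<alpha> / (4 + \<alpha>)) * (norm (F \<xi>))\<^sup>2) \<partial>lborel) \<le> ennreal (B\<^sup>2)"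
    if "square_integrable F"
      "(\<lambda>n. \<integral>\<^sup>+\<xi>. ennreal ((norm (F \<xi> - nft (cutoff n (\<lambda>x. complex_of_real (k.avg x))) \<xi>))\<^sup>2) \<partial>lborel) \<longlonglongrightarrow> 0"
    for F
  proof -
    have "(\<integral>\<^sup>+\<xi>. ennreal ((1 + (norm \<xi>)\<^sup>2) powr (\<alpha> / (4 + \<alpha>)) * (norm (F \<xi>))\<^sup>2) \<partial>lborel)
        \<le> ennreal (k.C2 * (?H\<^sup>2 + ?Z\<^sup>2 + ?Y\<^sup>2))"
      using k.average_regularity[OF that] unfolding k.\<sigma>_def comp(2) hr(2) g0r(2) g1r(2) .
    also have "\<dots> \<le> ennreal (B\<^sup>2)" by (rule ennreal_leI[OF C2])
    finally show ?thesis .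
  qed
  show "Hs (\<alpha> / (4 + \<alpha>)) (velocity_average R h \<psi>)" "Hs_norm (\<alpha> / (4 + \<alpha>)) (velocity_average R h \<psi>) \<le> B"
    by (rule Hs_from_transform_bound[OF rep k.avg_square_integrable B0 bound], assumption+)+
qed

theorem lemma2p1:
  shows "\<exists>C :: real \<Rightarrow> real \<Rightarrow> real \<Rightarrow> real \<Rightarrow> real.
    (\<forall>K R M N. C K R M N > 0) \<and>
    (\<forall>R K \<alpha> (\<psi> :: real^'m \<Rightarrow> real) (b :: real^'m \<Rightarrow> real^'n) (Db :: real^'m \<Rightarrow> real^'m^'n)
        (h :: real \<times> (real^'n) \<times> (real^'m) \<Rightarrow> real)
        (g1 :: real \<times> (real^'n) \<times> (real^'m) \<Rightarrow> real^'m)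
        (g0 :: real \<times> (real^'n) \<times> (real^'m) \<Rightarrow> real).
      R > 0 \<and> K > 0 \<and> 0 < \<alpha> \<and> \<alpha> \<le> 1 \<and>
      Ck_c 1 (ball 0 R) \<psi> \<and>
      L2_on (phase_space R) h \<and> L2_on (phase_space R) g0 \<and> L2_on (phase_space R) g1 \<and>
      Linf_on (ball 0 R) b \<and> H1_with_jacobian (ball 0 R) b Db \<and>
      transport_equation R b h g1 g0 \<and>
      nondegenerate R K \<alpha> b
      \<longrightarrow>
      Hs (\<alpha> / (4 + \<alpha>)) (velocity_average R h \<psi>) \<and>
      Hs_norm (\<alpha> / (4 + \<alpha>)) (velocity_average R h \<psi>)
        \<le> C K R (Linf_norm (ball 0 R) b) (L2_norm (ball 0 R) Db) *
          W1inf_norm (ball 0 R) \<psi> *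
          (L2_norm (phase_space R) h + L2_norm (phase_space R) g1 + L2_norm (phase_space R) g0))"
proof -
  obtain A where A: "A \<ge> 1" "\<And>x. \<bar>profile x\<bar> \<le> A" "\<And>x y. \<bar>profile x - profile y\<bar> \<le> A * \<bar>x - y\<bar>"
    using profile_bounds by metis
  obtain L where L: "L \<ge> 0" "\<And>n x y. \<bar>plateau n (x::real \<times> (real^'n)) - plateau n y\<bar> \<le> L * norm (x - y)"
    using plateau_Lipschitz by metis
  define c where "c K R M N = averaging_constant A L (real CARD('m)) (measure lborel (ball (0::real^'m) R)) K M N"
    for K R M N
  \<comment> \<open>The constant is to be positive also for arguments that do not occur, such as negative \<open>K\<close>.\<close>
  define C where "C K R M N = \<bar>c K R M N\<bar> + 1" for K R M N
  show ?thesis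
  proof (intro exI[of _ C] conjI allI impI)
    show "C K R M N > 0" for K R M N by (simp add: C_def)
    fix R K \<alpha> :: real and \<psi> :: "real^'m \<Rightarrow> real" and b :: "real^'m \<Rightarrow> real^'n" and Db :: "real^'m \<Rightarrow> real^'m^'n"
      and h g0 :: "real \<times> (real^'n) \<times> (real^'m) \<Rightarrow> real" and g1 :: "real \<times> (real^'n) \<times> (real^'m) \<Rightarrow> real^'m"
    assume asm: "R > 0 \<and> K > 0 \<and> 0 < \<alpha> \<and> \<alpha> \<le> 1 \<and>
      Ck_c 1 (ball 0 R) \<psi> \<and>
      L2_on (phase_space R) h \<and> L2_on (phase_space R) g0 \<and> L2_on (phase_space R) g1 \<and>
      Linf_on (ball 0 R) b \<and> H1_with_jacobian (ball 0 R) b Db \<and>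
      transport_equation R b h g1 g0 \<and>
      nondegenerate R K \<alpha> b"
    let ?M = "Linf_norm (ball 0 R) b" and ?N = "L2_norm (ball 0 R) Db" and ?P = "W1inf_norm (ball 0 R) \<psi>"
    let ?T = "L2_norm (phase_space R) h + L2_norm (phase_space R) g1 + L2_norm (phase_space R) g0"
    from asm have a: "R > 0" "K > 0" "0 < \<alpha>" "\<alpha> \<le> 1" "Ck_c 1 (ball 0 R) \<psi>" "L2_on (phase_space R) h"
      "L2_on (phase_space R) g0" "L2_on (phase_space R) g1" "Linf_on (ball 0 R) b" "H1_with_jacobian (ball 0 R) b Db"
      "transport_equation R b h g1 g0" "nondegenerate R K \<alpha> b" by blast+
    have est: "Hs (\<alpha> / (4 + \<alpha>)) (velocity_average R h \<psi>)"
      "Hs_norm (\<alpha> / (4 + \<alpha>)) (velocity_average R h \<psi>) \<le> c K R ?M ?N * ?P * ?T"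
      unfolding c_def by (rule averaging_estimate[OF A L a])+
    show "Hs (\<alpha> / (4 + \<alpha>)) (velocity_average R h \<psi>)" by (rule est(1))
    have "?P \<ge> 0" by (simp add: W1inf_norm_def Linf_norm_def)
    moreover have "?T \<ge> 0" by (simp add: L2_norm_def)
    moreover have "c K R ?M ?N \<le> C K R ?M ?N" by (simp add: C_def)
    ultimately have "c K R ?M ?N * ?P * ?T \<le> C K R ?M ?N * ?P * ?T"
      by (intro mult_right_mono)
    with est(2) show "Hs_norm (\<alpha> / (4 + \<alpha>)) (velocity_average R h \<psi>) \<le> C K R ?M ?N * ?P * ?T"
      by linarith
  qed
qed

end
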